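(* Assume the setting in the context, suppose Condition (C1) and Condition (C2) hold, and suppose the null hypothesis $\mathcal{H}_{\theta(P)}$ holds. Let $V_n(Z_\pi)=n^{1/2}\,\mathrm{vec}\{\hat\Theta(Z_\pi)\hat C(Z_\pi)\}$. Then, unconditionally, $V_n(Z)$ converges in distribution to a multivariate normal random vector with mean zero and covariance $$(C^{\mathtt T}\otimes I_{d\times d})\,\Gamma\,(C^{\mathtt T}\otimes I_{d\times d})^{\mathtt T},$$ where $\Gamma$ is the $kd\times kd$ block-diagonal matrix with $p_i^{-1}\Sigma_i$ in its $i$th $d\times d$ diagonal block ($i=1,\dots,k$). The permutation distribution of $V_n$, $R_{V_n}(t,\hat P)=\frac{1}{n!}\sum_{\pi\in\mathcal P_n}1\{V_n(Z_\pi)\le t\}$ (componentwise inequality), instead converges weakly in probability to the law of a multivariate normal distribution with mean zero and covariance $$(\bar C^{\mathtt T}\otimes I_{d\times d})\,\bar\Gamma\,(\bar C^{\mathtt T}\otimes I_{d\times d})^{\mathtt T},$$ where $\bar\Gamma$ is the $kd\times kd$ block-diagonal matrix with $p_i^{-1}\bar\Sigma$ in its $i$th diagonal block ($i=1,\dots,k$).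
   Context: Let $k\ge2$ and let $P_1,\dots,P_k$ be distributions on $\mathbb{R}^{d_P}$. For $i=1,\dots,k$, $X_{i1},\dots,X_{in_i}$ are i.i.d. from $P_i$, and the $k$ samples are jointly independent; $n=\sum_i n_i$. $X_i$ is the $n_i\times d_P$ matrix with $j$th row $X_{ij}$, and $Z$ is the $n\times d_P$ matrix stacking $X_1,\dots,X_k$; $\mathcal I_i$ denotes the set of row indices of $Z$ coming from sample $i$ (so $\mathcal I_1=\{1,\dots,n_1\}$, $\mathcal I_2=\{n_1+1,\dots,n_1+n_2\}$, etc.). Condition (C1): as $n\to\infty$, $n_i/n\to p_i$ with $0<p_i<1$ and $n_i/n-p_i=O(n^{-1/2})$ for each $i$. $\mathcal P_n$ is the set of all $n!$ permutations $\pi$ of $\{1,\dots,n\}$; $Z_\pi$ is $Z$ with rows permuted so that its $j$th row is the $\pi(j)$th row of $Z$; $Z_{\pi i}$ is the $n_i\times d_P$ matrix of rows of $Z_\pi$ with indices in $\mathcal I_i$. $\hat P$ denotes the collection of empirical distributions of $Z_1=X_1,\dots,Z_k=X_k$. $\Pi$ denotes a random permutation uniform on $\mathcal P_n$, independent of $Z$. The mixture $\bar P=\sum_{i=1}^k p_iP_i$. Let $\theta=(\theta_1,\dots,\theta_d)^{\mathtt T}$ be a $d$-dimensional functional of distributions. The null $\mathcal H_{\theta(P)}$ is: $\theta_\ell(P_1)=\dots=\theta_\ell(P_k)$ for all $\ell=1,\dots,d$. Condition (C2): there are estimators $\hat\theta_\ell(\cdot)$ (functions of data matrices with $d_P$ columns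 and any number of rows) such that for each $i$ and $\ell$, $n_i^{1/2}\{\hat\theta_\ell(X_i)-\theta_\ell(P_i)\}=n_i^{-1/2}\sum_{j=1}^{n_i}f_{P_i,\ell}(X_{ij})+o_{P_i}(1)$ with $E f_{P_i,\ell}(X_{i1})=0$, $E f_{P_i,\ell}(X_{i1})^2<\infty$; and if $Y$ is an $n\times d_P$ matrix with i.i.d. rows $Y_1,\dots,Y_n\sim\bar P$, then $n^{1/2}\{\hat\theta_\ell(Y)-\theta_\ell(\bar P)\}=n^{-1/2}\sum_{j=1}^n f_{\bar P,\ell}(Y_j)+o_{\bar P}(1)$ with $Ef_{\bar P,\ell}(Y_1)=0$, $Ef_{\bar P,\ell}(Y_1)^2<\infty$. $\Sigma_i$ is the covariance matrix of $(f_{P_i,1}(X_{i1}),\dots,f_{P_i,d}(X_{i1}))^{\mathtt T}$ and $\bar\Sigma$ that of $(f_{\bar P,1}(Y_1),\dots,f_{\bar P,d}(Y_1))^{\mathtt T}$. $\hat\Theta(Z_\pi)$ is the $d\times k$ matrix with $(\ell,i)$ entry $\hat\theta_\ell(Z_{\pi i})$. A contrast matrix is a $k\times m$ matrix each of whose columns sums to zero and none of whose columns is the zero vector. $\hat C(\cdot)$ is a statistic taking values in $k\times m$ contrast matrices such that $\hat C(Z)\to C$ and $\hat C(Z_\Pi)\to\bar C$ in probability, where $C,\bar C$ are contrast matrices. $\mathrm{vec}$ is columnwise vectorization, $\otimes$ the Kronecker product. Weak convergence in probability of $R_{V_n}$ to a law $Q$ means $\int f\,dR_{V_n}\to\int f\,dQ$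 in probability for every bounded continuous $f$. *)

theory Defs
  imports "HOL-Probability.Probability" "HOL-Library.Landau_Symbols"
    "HOL-Combinatorics.Permutations"
begin

text \<open>A k x m contrast matrix: every column sums to zero and no column is zero.
  Matrices are rendered as real^'cols^'rows, entry (r,c) is A$r$c.\<close>
definition contrast_matrix :: "real^'m^'k \<Rightarrow> bool" where
  "contrast_matrix C \<longleftrightarrow> (\<forall>j. (\<Sum>i\<in>UNIV. C$i$j) = 0) \<and> (\<forall>j. \<exists>i. C$i$j \<noteq> 0)"

text \<open>Columnwise vectorisation: index (j,l) = entry in row l, column j; with the
  lexicographic order of the index pair this is the column-major stacking.\<close>
definition vecc :: "real^'m^'d \<Rightarrow> real^('m \<times> 'd)" where
  "vecc X = (\<chi> jl. X$snd jl$fst jl)"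

definition kron :: "real^'c1^'r1 \<Rightarrow> real^'c2^'r2 \<Rightarrow> real^('c1 \<times> 'c2)^('r1 \<times> 'r2)" where
  "kron A B = (\<chi> r c. A$fst r$fst c * B$snd r$snd c)"

definition blockdiag :: "('k::finite \<Rightarrow> real^'d^'d) \<Rightarrow> real^('k \<times> 'd)^('k \<times> 'd)" where
  "blockdiag G = (\<chi> r c. if fst r = fst c then G (fst r) $ snd r $ snd c else 0)"

definition covmat :: "'a measure \<Rightarrow> ('d \<Rightarrow> 'a \<Rightarrow> real) \<Rightarrow> real^'d^'d" where
  "covmat M g = (\<chi> l l'. \<integral>x. (g l x - (\<integral>y. g l y \<partial>M)) * (g l' x - (\<integral>y. g l' y \<partial>M)) \<partial>M)"

text \<open>Multivariate normal N(0,S) on real^'n: law of A g with g a vector of i.i.d.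
  standard normals and A A^T = S (for positive semidefinite S the law does not depend
  on the choice of A).\<close>
definition mvnormal :: "real^'n^'n \<Rightarrow> (real^'n) measure" where
  "mvnormal S = (let A = (SOME A :: real^'n^'n. A ** transpose A = S) in
     distr (PiM UNIV (\<lambda>_::'n. density lborel std_normal_density)) borel
           (\<lambda>g. A *v (\<chi> i. g i)))"

definition weak_conv :: "(nat \<Rightarrow> (real^'n) measure) \<Rightarrow> (real^'n) measure \<Rightarrow> bool" where
  "weak_conv L Q \<longleftrightarrow> (\<forall>f :: real^'n \<Rightarrow> real. continuous_on UNIV f \<and> bounded (range f) \<longrightarrow>
      (\<lambda>n. \<integral>x. f x \<partial>L n) \<longlonglongrightarrow> (\<integral>x. f x \<partial>Q))"

definition conv_in_prob :: "(nat \<Rightarrow> 'a measure) \<Rightarrow> (nat \<Rightarrow> 'a \<Rightarrow> 'b::metric_space) \<Rightarrow> 'b \<Rightarrow> bool" where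
  "conv_in_prob M X c \<longleftrightarrow> (\<forall>e>0. (\<lambda>n. measure (M n) {x \<in> space (M n). dist (X n x) c > e}) \<longlonglongrightarrow> 0)"

definition mixture :: "('k::finite \<Rightarrow> real) \<Rightarrow> ('k \<Rightarrow> 'a::topological_space measure) \<Rightarrow> 'a measure" where
  "mixture p P = measure_of UNIV (sets borel) (\<lambda>A. \<Sum>i\<in>UNIV. ennreal (p i) * emeasure (P i) A)"

definition iid :: "nat \<Rightarrow> 'a measure \<Rightarrow> (nat \<Rightarrow> 'a) measure" where
  "iid n P = PiM {..<n} (\<lambda>_. P)"

text \<open>N n i = n_i (for total sample size n). Rows of sample i occupy the contiguous
  block of indices starting at the sum of the sizes of the earlier samples.\<close>
definition blk_start :: "(nat \<Rightarrow> 'k::{finite,linorder} \<Rightarrow> nat) \<Rightarrow> nat \<Rightarrow> 'k \<Rightarrow> nat" where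
  "blk_start N n i = (\<Sum>i'\<in>{i'. i' < i}. N n i')"

definition blk :: "(nat \<Rightarrow> 'k::{finite,linorder} \<Rightarrow> nat) \<Rightarrow> nat \<Rightarrow> 'k \<Rightarrow> nat set" where
  "blk N n i = {blk_start N n i ..< blk_start N n i + N n i}"

definition grp :: "(nat \<Rightarrow> 'k::{finite,linorder} \<Rightarrow> nat) \<Rightarrow> nat \<Rightarrow> nat \<Rightarrow> 'k" where
  "grp N n j = (THE i. j \<in> blk N n i)"

definition data_law :: "(nat \<Rightarrow> 'k::{finite,linorder} \<Rightarrow> nat) \<Rightarrow> ('k \<Rightarrow> 'a measure) \<Rightarrow> nat \<Rightarrow> (nat \<Rightarrow> 'a) measure" where
  "data_law N P n = PiM {..<n} (\<lambda>j. P (grp N n j))"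

definition permZ :: "nat \<Rightarrow> (nat \<Rightarrow> 'a) \<Rightarrow> (nat \<Rightarrow> nat) \<Rightarrow> 'a list" where
  "permZ n z \<pi> = map (\<lambda>j. z (\<pi> j)) [0..<n]"

definition permZi :: "(nat \<Rightarrow> 'k::{finite,linorder} \<Rightarrow> nat) \<Rightarrow> nat \<Rightarrow> (nat \<Rightarrow> 'a) \<Rightarrow> (nat \<Rightarrow> nat) \<Rightarrow> 'k \<Rightarrow> 'a list" where
  "permZi N n z \<pi> i = map (\<lambda>j. z (\<pi> j)) [blk_start N n i ..< blk_start N n i + N n i]"

definition Thetahat where
  "Thetahat th N n z \<pi> = (\<chi> l i. th l (permZi N n z \<pi> i))"

definition Vn where
  "Vn th Ch N n z \<pi> = sqrt (real n) *\<^sub>R vecc (Thetahat th N n z \<pi> ** Ch (permZ n z \<pi>))"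

definition unif_perm :: "nat \<Rightarrow> (nat \<Rightarrow> nat) pmf" where
  "unif_perm n = pmf_of_set {\<pi>. \<pi> permutes {..<n}}"

text \<open>Permutation distribution of V_n given the data z: the law of V_n(Z_Pi) given Z = z,
  i.e. the distribution with CDF R_{V_n}(t) = (1/n!) sum_pi 1{V_n(Z_pi) \<le> t}.\<close>
definition perm_dist where
  "perm_dist th Ch N n z = measure_pmf (map_pmf (\<lambda>\<pi>. Vn th Ch N n z \<pi>) (unif_perm n))"

definition weak_conv_in_prob :: "(nat \<Rightarrow> 'a measure) \<Rightarrow> (nat \<Rightarrow> 'a \<Rightarrow> (real^'n) measure) \<Rightarrow> (real^'n) measure \<Rightarrow> bool" where
  "weak_conv_in_prob M R Q \<longleftrightarrow> (\<forall>f :: real^'n \<Rightarrow> real. continuous_on UNIV f \<and> bounded (range f) \<longrightarrow>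
      conv_in_prob M (\<lambda>n z. \<integral>x. f x \<partial>R n z) (\<integral>x. f x \<partial>Q))"

end

theory Submission
  imports Defs
begin

text \<open>The columns of a contrast matrix sum to zero, so the common centring value cancels and \<open>V\<^sub>n\<close> is, up to a
  vanishing remainder, the linear statistic built from the normalised block sums of the influence functions. For the
  identity permutation the blocks are independent i.i.d. samples and the central limit theorem applies.

  For a random permutation the expansion holds for i.i.d. samples of the mixture. It transfers to permuted blocks by
  contiguity: a permuted block carries hypergeometric labels, and on sample sizes satisfying (C1) their probability is
  at most a constant times the multinomial one, outside an event of probability \<open>O(1/n)\<close>. The linear permutation
  statistic is then compared with the one of an i.i.d. sample from the mixture, by a coupling in which only
  \<open>O(\<surd>n)\<close> labels differ. Given two independent permutations \<open>\<Pi>, \<Pi>'\<close>, the joint characteristic function of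
  the two linear statistics tends to a product of Gaussian ones, since the cross covariance of the coefficients
  is negligible for most pairs. Hence \<open>E f(V\<^sub>n(Z\<^sub>\<Pi>)) f(V\<^sub>n(Z\<^sub>\<Pi>\<^sub>'))\<close> tends to the square of the limit of
  \<open>E f(V\<^sub>n(Z\<^sub>\<Pi>))\<close>, and Chebyshev's inequality gives weak convergence in probability (Hoeffding's method).\<close>

section \<open>Gaussian smoothing and characteristic functions\<close>

text \<open>The estimators are arbitrary functions of a sample, known only through an expansion that
  holds in probability for i.i.d. rows. The resulting bound has a constant factor \<open>K\<close>:
  it carries negligible events across, but not limit laws, which is why the linear part needs a
  comparison of its own, the coupling. There the scores are centred under the mixture and not under
  the single \<open>P i\<close>; the drift disappears because the coefficients of the statistic sum
  to zero over all rows. The rate in (C1) is used in the change of measure: the logarithm of the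
  label ratio contains the chi-square sum of \<open>n * (N n i / n - p i)\<^sup>2 / p i\<close>,
  which stays bounded for deviations of order \<open>1 / sqrt n\<close>. The condition
  \<open>p i < 1\<close> leaves a positive fraction of rows of every label outside the block, so
  that the half logarithms in Stirling's formula are bounded too.\<close>

definition gauss_density :: "'a::euclidean_space \<Rightarrow> real" where
  "gauss_density x = (\<Prod>b\<in>Basis. std_normal_density (x \<bullet> b))"

lemma gauss_density_eq:
  "gauss_density (x::'a::euclidean_space) = (1 / sqrt (2 * pi)) ^ DIM('a) * exp (- (norm x)\<^sup>2 / 2)"
proof -
  have "gauss_density x = (\<Prod>b\<in>(Basis::'a set). 1 / sqrt (2 * pi)) * (\<Prod>b\<in>Basis. exp (- (x \<bullet> b)\<^sup>2 / 2))"
    unfolding gauss_density_def std_normal_density_def prod.distrib ..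
  also have "(\<Prod>b\<in>Basis. exp (- (x \<bullet> b)\<^sup>2 / 2)) = exp (\<Sum>b\<in>Basis. - (x \<bullet> b)\<^sup>2 / 2)"
    by (simp add: exp_sum)
  also have "(\<Sum>b\<in>Basis. - (x \<bullet> b)\<^sup>2 / 2) = - (norm x)\<^sup>2 / 2"
    unfolding norm_eq_sqrt_inner euclidean_inner[of x x]
    by (simp add: sum_negf sum_divide_distrib power2_eq_square sum_nonneg flip: sum_negf)
  finally show ?thesis by simp
qed

lemma gauss_density_measurable [measurable]: "gauss_density \<in> borel_measurable borel"
  unfolding gauss_density_eq[abs_def] by measurable

lemma gauss_density_nonneg [simp]: "0 \<le> gauss_density x"
  unfolding gauss_density_def by (intro prod_nonneg) (simp add: normal_density_nonneg)

lemma gauss_density_le: "gauss_density (x::'a::euclidean_space) \<le> (1 / sqrt (2 * pi)) ^ DIM('a)"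
  unfolding gauss_density_eq by (simp add: mult_left_le)

lemma nn_integral_gauss_density:
  "(\<integral>\<^sup>+x. ennreal (gauss_density (x::'a::euclidean_space)) \<partial>lborel) = 1"
proof -
  interpret product_sigma_finite "\<lambda>_::'a. lborel :: real measure" ..
  have "(\<integral>\<^sup>+x. ennreal (gauss_density (x::'a)) \<partial>lborel) =
     (\<integral>\<^sup>+f. (\<Prod>b\<in>Basis. ennreal (std_normal_density (f b))) \<partial>(\<Pi>\<^sub>M b\<in>(Basis::'a set). lborel))"
    unfolding lborel_eq[where 'a='a]
    by (subst nn_integral_distr)
      (auto simp: gauss_density_def normal_density_nonneg prod_ennreal intro!: nn_integral_cong prod.cong)
  also have "\<dots> = (\<Prod>b\<in>(Basis::'a set). \<integral>\<^sup>+x. ennreal (std_normal_density x) \<partial>lborel)"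
    by (rule product_nn_integral_prod) auto
  also have "(\<integral>\<^sup>+x. ennreal (std_normal_density x) \<partial>lborel) = 1"
    using prob_space.emeasure_space_1[OF prob_space_normal_density[of 1 0]]
    by (simp add: emeasure_density)
  finally show ?thesis by simp
qed

lemma integrable_gauss_density [simp]: "integrable lborel (gauss_density :: 'a::euclidean_space \<Rightarrow> real)"
  by (rule integrableI_nonneg) (auto simp: nn_integral_gauss_density)

lemma integral_gauss_density: "(\<integral>x. gauss_density (x::'a::euclidean_space) \<partial>lborel) = 1"
  using nn_integral_gauss_density[where 'a='a]
  by (subst integral_eq_nn_integral) auto

text \<open>Density and exponential both factor over the coordinates, so the integral is a product
  of values of the characteristic function of the one-dimensional standard normal law.\<close>

lemma gauss_fourier:
  "(\<integral>x. gauss_density (x::'a::euclidean_space) *\<^sub>R iexp (t \<bullet> x) \<partial>lborel) = exp (- (norm t)\<^sup>2 / 2)"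
proof -
  interpret product_sigma_finite "\<lambda>_::'a. lborel :: real measure" ..
  have one: "(\<integral>x. std_normal_density x *\<^sub>R iexp (s * x) \<partial>lborel) = complex_of_real (exp (- s\<^sup>2 / 2))" for s
  proof -
    have "char std_normal_distribution s = (\<integral>x. std_normal_density x *\<^sub>R iexp (s * x) \<partial>lborel)"
      unfolding char_def
      by (subst integral_density) (auto simp: normal_density_nonneg intro!: AE_I2)
    then show ?thesis by (simp add: char_std_normal_distribution)
  qed
  have int: "integrable lborel (\<lambda>x. std_normal_density x *\<^sub>R iexp (s * x))" for s
    by (rule Bochner_Integration.integrable_bound[where f=std_normal_density])
      (auto simp: integrable_normal_density)
  have "(\<integral>x. gauss_density x *\<^sub>R iexp (t \<bullet> x) \<partial>lborel) =
     (\<integral>f. (\<Prod>b\<in>Basis. std_normal_density (f b) *\<^sub>R iexp ((t \<bullet> b) * f b)) \<partial>(\<Pi>\<^sub>M b\<in>(Basis::'a set). lborel))"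
    unfolding lborel_eq[where 'a='a]
  proof (subst integral_distr)
    show "(\<integral>x. gauss_density (\<Sum>b\<in>Basis. x b *\<^sub>R b) *\<^sub>R iexp (t \<bullet> (\<Sum>b\<in>Basis. x b *\<^sub>R b)) \<partial>(\<Pi>\<^sub>M b\<in>(Basis::'a set). lborel))
       = (\<integral>f. (\<Prod>b\<in>Basis. std_normal_density (f b) *\<^sub>R iexp ((t \<bullet> b) * f b)) \<partial>(\<Pi>\<^sub>M b\<in>(Basis::'a set). lborel))"
      by (intro Bochner_Integration.integral_cong refl)
        (simp add: gauss_density_def inner_sum_right scaleR_conv_of_real prod.distrib exp_sum sum_distrib_left mult_ac)
  qed auto
  also have "\<dots> = (\<Prod>b\<in>(Basis::'a set). \<integral>x. std_normal_density x *\<^sub>R iexp ((t \<bullet> b) * x) \<partial>lborel)"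
    by (rule product_integral_prod) (simp, rule int)
  also have "\<dots> = complex_of_real (\<Prod>b\<in>(Basis::'a set). exp (- (t \<bullet> b)\<^sup>2 / 2))"
    unfolding one by simp
  also have "(\<Prod>b\<in>(Basis::'a set). exp (- (t \<bullet> b)\<^sup>2 / 2)) = exp (\<Sum>b\<in>Basis. - (t \<bullet> b)\<^sup>2 / 2)"
    by (simp add: exp_sum)
  also have "(\<Sum>b\<in>Basis. - (t \<bullet> b)\<^sup>2 / 2) = - (norm t)\<^sup>2 / 2"
    unfolding norm_eq_sqrt_inner euclidean_inner[of t t]
    by (simp add: sum_divide_distrib power2_eq_square sum_nonneg flip: sum_negf)
  finally show ?thesis by simp
qed

definition mchar :: "'a::euclidean_space measure \<Rightarrow> 'a \<Rightarrow> complex" where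
  "mchar M t = (\<integral>x. iexp (t \<bullet> x) \<partial>M)"

text \<open>The Gaussian is its own Fourier transform up to a constant. Writing the kernel as such a
  transform and exchanging the integrals expresses the smoothed law through \<open>mchar M\<close>
  alone. This plays the role of an inversion formula, valid for every law because the factor
  \<open>gauss_density w\<close> makes the frequency integral converge.\<close>

lemma gauss_kernel_expectation:
  fixes M :: "'a::euclidean_space measure"
  assumes "prob_space M" and [measurable_cong]: "sets M = sets borel" and s: "s > 0"
  shows "complex_of_real (\<integral>x. gauss_density ((y - x) /\<^sub>R s) \<partial>M) =
    (1 / sqrt (2 * pi)) ^ DIM('a) * (\<integral>w. gauss_density w *\<^sub>R (iexp (w \<bullet> (y /\<^sub>R s)) * mchar M (- w /\<^sub>R s)) \<partial>lborel)"
proof -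
  interpret prob_space M by fact
  interpret pair_sigma_finite lborel M ..
  let ?c = "complex_of_real ((1 / sqrt (2 * pi)) ^ DIM('a))"
  have int: "integrable (lborel \<Otimes>\<^sub>M M) (\<lambda>(w, x). gauss_density w *\<^sub>R iexp (w \<bullet> ((y - x) /\<^sub>R s)))"
  proof (rule Fubini_integrable)
    show "AE w in lborel. integrable M (\<lambda>x. case (w, x) of (w, x) \<Rightarrow> gauss_density w *\<^sub>R iexp (w \<bullet> ((y - x) /\<^sub>R s)))"
    proof (intro AE_I2)
      fix w :: 'a
      show "integrable M (\<lambda>x. case (w, x) of (w, x) \<Rightarrow> gauss_density w *\<^sub>R iexp (w \<bullet> ((y - x) /\<^sub>R s)))"
        by (simp, rule integrable_const_bound[where B="gauss_density w"]) auto
    qed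
  qed (auto simp: case_prod_beta prob_space)
  have "complex_of_real (\<integral>x. gauss_density ((y - x) /\<^sub>R s) \<partial>M) =
     (\<integral>x. complex_of_real (gauss_density ((y - x) /\<^sub>R s)) \<partial>M)" by simp
  also have "\<dots> = (\<integral>x. ?c * (\<integral>w. gauss_density w *\<^sub>R iexp (w \<bullet> ((y - x) /\<^sub>R s)) \<partial>lborel) \<partial>M)"
    unfolding gauss_density_eq[of "(y - _) /\<^sub>R s"] by (subst inner_commute, subst gauss_fourier) simp
  also have "\<dots> = ?c * (\<integral>x. (\<integral>w. gauss_density w *\<^sub>R iexp (w \<bullet> ((y - x) /\<^sub>R s)) \<partial>lborel) \<partial>M)" by simp
  also have "\<dots> = ?c * (\<integral>w. (\<integral>x. gauss_density w *\<^sub>R iexp (w \<bullet> ((y - x) /\<^sub>R s)) \<partial>M) \<partial>lborel)"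
    using Fubini_integral[OF int] by simp
  also have "(\<lambda>w. \<integral>x. gauss_density w *\<^sub>R iexp (w \<bullet> ((y - x) /\<^sub>R s)) \<partial>M) =
     (\<lambda>w. gauss_density w *\<^sub>R (iexp (w \<bullet> (y /\<^sub>R s)) * mchar M (- w /\<^sub>R s)))"
  proof
    fix w :: 'a
    have "(\<integral>x. gauss_density w *\<^sub>R iexp (w \<bullet> ((y - x) /\<^sub>R s)) \<partial>M) =
      (\<integral>x. gauss_density w *\<^sub>R (iexp (w \<bullet> (y /\<^sub>R s)) * iexp ((- w /\<^sub>R s) \<bullet> x)) \<partial>M)"
      by (intro Bochner_Integration.integral_cong refl)
        (simp add: exp_add[symmetric] inner_diff_right algebra_simps scaleR_diff_right)
    then show "(\<integral>x. gauss_density w *\<^sub>R iexp (w \<bullet> ((y - x) /\<^sub>R s)) \<partial>M) =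
      gauss_density w *\<^sub>R (iexp (w \<bullet> (y /\<^sub>R s)) * mchar M (- w /\<^sub>R s))" by (simp add: mchar_def)
  qed
  finally show ?thesis by simp
qed

text \<open>The substitution \<open>y = x + s *\<^sub>R g\<close> moves \<open>x\<close> from the
  test function into the kernel, where \<open>gauss_kernel_expectation\<close> can act on
  it.\<close>

lemma gauss_smoothing_affine:
  fixes h :: "'a::euclidean_space \<Rightarrow> real"
  assumes [measurable]: "h \<in> borel_measurable borel" and s: "s > 0"
  shows "(\<integral>g. h (x + s *\<^sub>R g) * gauss_density g \<partial>lborel) = (\<integral>y. h y * gauss_density ((y - x) /\<^sub>R s) \<partial>lborel) / s ^ DIM('a)"
proof -
  have "(\<integral>y. h y * gauss_density ((y - x) /\<^sub>R s) \<partial>lborel) =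
    (\<integral>y. h y * gauss_density ((y - x) /\<^sub>R s) \<partial>density (distr lborel borel (\<lambda>g. x + s *\<^sub>R g)) (\<lambda>_. ennreal (\<bar>s\<bar>^DIM('a))))"
    using lborel_affine[of s x] s by simp
  also have "\<dots> = s ^ DIM('a) * (\<integral>g. h (x + s *\<^sub>R g) * gauss_density g \<partial>lborel)"
    using s by (simp add: integral_density integral_distr)
  finally show ?thesis using s by simp
qed

text \<open>Convergence passes through two dominated limits: in the frequency, where characteristic
  functions are bounded by 1 against the weight \<open>gauss_density\<close>, and in
  \<open>y\<close>, where a multiple of the absolute value of \<open>h\<close> dominates. The second
  one is the reason for asking that \<open>h\<close> be Lebesgue integrable.\<close>

lemma char_imp_smoothed_convergence:
  fixes M :: "nat \<Rightarrow> 'a::euclidean_space measure" and Q :: "'a measure" and h :: "'a \<Rightarrow> real"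
  assumes "\<And>n. prob_space (M n)" and sM: "\<And>n. sets (M n) = sets borel"
    and Q: "prob_space Q" and sQ: "sets Q = sets borel"
    and lim: "\<And>t. (\<lambda>n. mchar (M n) t) \<longlonglongrightarrow> mchar Q t"
    and h: "integrable lborel h" and s: "s > 0"
  shows "(\<lambda>n. \<integral>x. (\<integral>g. h (x + s *\<^sub>R g) * gauss_density g \<partial>lborel) \<partial>M n) \<longlonglongrightarrow>
      (\<integral>x. (\<integral>g. h (x + s *\<^sub>R g) * gauss_density g \<partial>lborel) \<partial>Q)"
proof -
  have hm [measurable]: "h \<in> borel_measurable borel" using h by auto
  let ?c = "(1 / sqrt (2 * pi)) ^ DIM('a)"
  \<comment> \<open>Up to the factor \<open>s ^ DIM('a)\<close> this is the density at
    \<open>y\<close> of the convolution of \<open>N\<close> with a centred Gaussian of scale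
    \<open>s\<close>.\<close>
  define K where "K N y = (\<integral>x. gauss_density ((y - x) /\<^sub>R s) \<partial>N)" for N :: "'a measure" and y
  have K_bound: "\<bar>K N y\<bar> \<le> ?c" if "prob_space N" "sets N = sets borel" for N y
  proof -
    interpret prob_space N by fact
    note [measurable_cong] = that(2)
    have "\<bar>K N y\<bar> \<le> (\<integral>x. ?c \<partial>N)"
      unfolding K_def real_norm_def[symmetric]
      by (rule order_trans[OF integral_norm_bound], rule integral_mono)
        (auto simp: gauss_density_le intro!: integrable_const_bound[where B="?c"])
    then show ?thesis by (simp add: prob_space)
  qed
  have smooth: "(\<integral>x. (\<integral>g. h (x + s *\<^sub>R g) * gauss_density g \<partial>lborel) \<partial>N) = (\<integral>y. h y * K N y \<partial>lborel) / s ^ DIM('a)"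
    if "prob_space N" "sets N = sets borel" for N
  proof -
    interpret prob_space N by fact
    note [measurable_cong] = that(2)
    interpret pair_sigma_finite lborel N ..
    have int: "integrable (lborel \<Otimes>\<^sub>M N) (\<lambda>(y, x). h y * gauss_density ((y - x) /\<^sub>R s))"
    proof (rule Fubini_integrable)
      show "(\<lambda>(y, x). h y * gauss_density ((y - x) /\<^sub>R s)) \<in> borel_measurable (lborel \<Otimes>\<^sub>M N)" by measurable
      show "integrable lborel (\<lambda>y. \<integral>x. norm (case (y, x) of (y, x) \<Rightarrow> h y * gauss_density ((y - x) /\<^sub>R s)) \<partial>N)"
      proof (rule Bochner_Integration.integrable_bound)
        show "integrable lborel (\<lambda>y. ?c * h y)" using h by simp
        show "AE y in lborel. norm (\<integral>x. norm (case (y, x) of (y, x) \<Rightarrow> h y * gauss_density ((y - x) /\<^sub>R s)) \<partial>N) \<le> norm (?c * h y)"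
        proof (intro AE_I2)
          fix y
          have "norm (\<integral>x. norm (case (y, x) of (y, x) \<Rightarrow> h y * gauss_density ((y - x) /\<^sub>R s)) \<partial>N) = \<bar>h y\<bar> * \<bar>K N y\<bar>"
            by (simp add: K_def abs_mult)
          also have "\<dots> \<le> \<bar>h y\<bar> * ?c" by (intro mult_left_mono K_bound that) auto
          finally show "norm (\<integral>x. norm (case (y, x) of (y, x) \<Rightarrow> h y * gauss_density ((y - x) /\<^sub>R s)) \<partial>N) \<le> norm (?c * h y)"
            by (simp add: abs_mult mult.commute)
        qed
      qed measurable
      show "AE y in lborel. integrable N (\<lambda>x. case (y, x) of (y, x) \<Rightarrow> h y * gauss_density ((y - x) /\<^sub>R s))"
        by (auto intro!: AE_I2 integrable_mult_right integrable_const_bound[where B="?c"] simp: gauss_density_le)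
    qed
    have "(\<integral>x. (\<integral>g. h (x + s *\<^sub>R g) * gauss_density g \<partial>lborel) \<partial>N) =
      (\<integral>x. (\<integral>y. h y * gauss_density ((y - x) /\<^sub>R s) \<partial>lborel) / s ^ DIM('a) \<partial>N)"
      using s by (simp add: gauss_smoothing_affine)
    also have "\<dots> = (\<integral>y. (\<integral>x. h y * gauss_density ((y - x) /\<^sub>R s) \<partial>N) \<partial>lborel) / s ^ DIM('a)"
      using Fubini_integral[OF int] by simp
    finally show ?thesis by (simp add: K_def)
  qed
  have K_lim: "(\<lambda>n. K (M n) y) \<longlonglongrightarrow> K Q y" for y
  proof -
    have mm: "mchar N \<in> borel_measurable borel" if N: "prob_space N" "sets N = sets borel" for N :: "'a measure"
    proof -
      interpret prob_space N by fact
      note [measurable_cong] = that(2)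
      show ?thesis unfolding mchar_def by measurable
    qed
    note [measurable] = mm[OF assms(1,2)] mm[OF Q sQ]
    have b: "cmod (mchar N t) \<le> 1" if N: "prob_space N" "sets N = sets borel" for N :: "'a measure" and t
    proof -
      interpret prob_space N by fact
      note [measurable_cong] = that(2)
      have "cmod (mchar N t) \<le> (\<integral>x. 1 \<partial>N)"
        unfolding mchar_def by (rule order_trans[OF integral_norm_bound]) simp
      then show ?thesis by (simp add: prob_space)
    qed
    have "(\<lambda>n. ?c * (\<integral>w. gauss_density w *\<^sub>R (iexp (w \<bullet> (y /\<^sub>R s)) * mchar (M n) (- w /\<^sub>R s)) \<partial>lborel))
      \<longlonglongrightarrow> ?c * (\<integral>w. gauss_density w *\<^sub>R (iexp (w \<bullet> (y /\<^sub>R s)) * mchar Q (- w /\<^sub>R s)) \<partial>lborel)"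
      by (intro tendsto_mult tendsto_const integral_dominated_convergence[where w=gauss_density])
       (auto intro!: AE_I2 tendsto_scaleR tendsto_mult tendsto_const lim simp: norm_mult mult_left_le b[OF assms(1,2)])
    then have "(\<lambda>n. complex_of_real (K (M n) y)) \<longlonglongrightarrow> complex_of_real (K Q y)"
      unfolding K_def by (simp only: gauss_kernel_expectation[OF assms(1,2) s] gauss_kernel_expectation[OF Q sQ s])
    then show ?thesis by (simp only: tendsto_of_real_iff)
  qed
  have [measurable]: "K N \<in> borel_measurable borel" if "prob_space N" "sets N = sets borel" for N
  proof -
    interpret prob_space N by fact
    note [measurable_cong] = that(2)
    show ?thesis unfolding K_def[abs_def] by measurable
  qed
  have "(\<lambda>n. \<integral>y. h y * K (M n) y \<partial>lborel) \<longlonglongrightarrow> (\<integral>y. h y * K Q y \<partial>lborel)"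
  proof (rule integral_dominated_convergence[where w="\<lambda>y. ?c * \<bar>h y\<bar>"])
    show "AE y in lborel. norm (h y * K (M n) y) \<le> ?c * \<bar>h y\<bar>" for n
      by (auto intro!: AE_I2 mult_left_mono K_bound assms simp: abs_mult mult.commute[of ?c])
  qed (use h assms in \<open>auto intro!: AE_I2 tendsto_mult tendsto_const K_lim\<close>)
  then show ?thesis
    unfolding smooth[OF assms(1,2)] smooth[OF Q sQ] by (intro tendsto_divide tendsto_const) (use s in auto)
qed


lemma gauss_smoothing_close:
  fixes h :: "'a::euclidean_space \<Rightarrow> real"
  assumes uc: "uniformly_continuous_on UNIV h" and B: "\<And>x. \<bar>h x\<bar> \<le> B" and e: "e > 0"
  obtains s where "s > 0" "\<And>x. \<bar>(\<integral>g. h (x + s *\<^sub>R g) * gauss_density g \<partial>lborel) - h x\<bar> \<le> e"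
proof -
  have [measurable]: "h \<in> borel_measurable borel"
    using uc by (intro borel_measurable_continuous_onI uniformly_continuous_imp_continuous)
  have B0: "B \<ge> 0" using B[of 0] by linarith
  obtain d where d: "d > 0" "\<And>x y. dist x y < d \<Longrightarrow> \<bar>h x - h y\<bar> < e / 2"
    using uc e unfolding uniformly_continuous_on_def dist_real_def
    by (metis UNIV_I abs_minus_commute dist_commute half_gt_zero)
  have "(\<lambda>n. \<integral>g. gauss_density (g::'a) * indicator {g. norm g \<ge> real n} g \<partial>lborel) \<longlonglongrightarrow> (\<integral>g. 0 \<partial>(lborel :: 'a measure))"
  proof (rule integral_dominated_convergence[where w=gauss_density])
    show "AE g in lborel. (\<lambda>n. gauss_density (g::'a) * indicator {g. norm g \<ge> real n} g) \<longlonglongrightarrow> 0"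
    proof (intro AE_I2)
      fix g :: 'a
      obtain N :: nat where "norm g < real N" using reals_Archimedean2 by blast
      then have "\<forall>\<^sub>F n in sequentially. gauss_density g * indicator {g. norm g \<ge> real n} g = 0"
        by (intro eventually_sequentiallyI[of N]) (auto simp: indicator_def)
      then show "(\<lambda>n. gauss_density g * indicator {g. norm g \<ge> real n} g) \<longlonglongrightarrow> 0"
        by (rule tendsto_eventually)
    qed
  qed (auto simp: indicator_def)
  \<comment> \<open>This tail contributes at most half of \<open>e\<close>: its weight is
    \<open>2 * B\<close>, and \<open>B + 1\<close> in the denominator avoids a division by
    zero.\<close>
  then have "\<forall>\<^sub>F n in sequentially. \<bar>\<integral>g. gauss_density (g::'a) * indicator {g. norm g \<ge> real n} g \<partial>lborel\<bar> < e / (4 * (B + 1))"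
    using e B0 by (auto simp: tendsto_iff dist_real_def elim!: allE[of _ "e / (4 * (B + 1))"])
  then obtain n where n: "n > 0" "\<bar>\<integral>g. gauss_density (g::'a) * indicator {g. norm g \<ge> real n} g \<partial>lborel\<bar> < e / (4 * (B + 1))"
    unfolding eventually_sequentially by (metis le_SucI less_Suc_eq_0_disj order_refl zero_less_Suc)
  \<comment> \<open>Then \<open>norm g < n\<close> makes the shift \<open>s *\<^sub>R g\<close>
    shorter than the modulus of continuity \<open>d\<close>.\<close>
  define s where "s = d / real n"
  have s: "s > 0" using d n by (simp add: s_def)
  have "\<bar>(\<integral>g. h (x + s *\<^sub>R g) * gauss_density g \<partial>lborel) - h x\<bar> \<le> e" for x
  proof -
    have i1: "integrable lborel (\<lambda>g. h (x + s *\<^sub>R g) * gauss_density g)"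
      by (rule Bochner_Integration.integrable_bound[where f="\<lambda>g. B * gauss_density g"])
        (auto intro!: AE_I2 mult_right_mono B simp: abs_mult B0)
    have "(\<integral>g. h (x + s *\<^sub>R g) * gauss_density g \<partial>lborel) - h x =
       (\<integral>g. h (x + s *\<^sub>R g) * gauss_density g - h x * gauss_density g \<partial>lborel)"
      using i1 by (simp add: integral_gauss_density)
    also have "\<bar>\<dots>\<bar> \<le> (\<integral>g. (e / 2) * gauss_density (g::'a) + (2 * B) * (gauss_density g * indicator {g. norm g \<ge> real n} g) \<partial>lborel)"
      unfolding real_norm_def[symmetric]
    proof (rule order_trans[OF integral_norm_bound], rule integral_mono)
      show "integrable lborel (\<lambda>g::'a. e / 2 * gauss_density g + 2 * B * (gauss_density g * indicator {g. norm g \<ge> real n} g))"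
        by (intro Bochner_Integration.integrable_add integrable_mult_right integrable_gauss_density integrable_real_mult_indicator) auto
      fix g :: 'a
      have "\<bar>h (x + s *\<^sub>R g) - h x\<bar> \<le> e / 2 + 2 * B * indicator {g. norm g \<ge> real n} g"
      proof (cases "norm g \<ge> real n")
        case True
        then show ?thesis using B[of "x + s *\<^sub>R g"] B[of x] e by (auto simp: indicator_def)
      next
        case False
        have "norm (s *\<^sub>R g) < d" using False d n by (auto simp: s_def field_simps)
        then have "\<bar>h (x + s *\<^sub>R g) - h x\<bar> < e / 2" by (intro d) (simp add: dist_norm)
        then show ?thesis using False by (auto simp: indicator_def)
      qed
      from mult_right_mono[OF this gauss_density_nonneg[of g]]
      have "\<bar>h (x + s *\<^sub>R g) - h x\<bar> * gauss_density g \<le> e / 2 * gauss_density g + 2 * B * (gauss_density g * indicator {g. norm g \<ge> real n} g)"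
        by (simp add: algebra_simps)
      moreover have "norm (h (x + s *\<^sub>R g) * gauss_density g - h x * gauss_density g) = \<bar>h (x + s *\<^sub>R g) - h x\<bar> * gauss_density g"
        by (simp add: left_diff_distrib[symmetric] abs_mult)
      ultimately show "norm (h (x + s *\<^sub>R g) * gauss_density g - h x * gauss_density g) \<le> e / 2 * gauss_density g + 2 * B * (gauss_density g * indicator {g. norm g \<ge> real n} g)"
        by simp
    qed (use i1 in auto)
    also have "\<dots> = e / 2 + 2 * B * (\<integral>g. gauss_density (g::'a) * indicator {g. norm g \<ge> real n} g \<partial>lborel)"
      by (subst Bochner_Integration.integral_add) (auto simp: integral_gauss_density intro!: integrable_real_mult_indicator)
    also have "\<dots> \<le> e / 2 + 2 * B * (e / (4 * (B + 1)))"
      using n(2) B0 by (intro add_left_mono mult_left_mono) auto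
    also have "\<dots> \<le> e"
    proof -
      have "B * e / (B + 1) \<le> e" using B0 e by (simp add: field_simps)
      then show ?thesis using B0 by (simp add: field_simps)
    qed
    finally show ?thesis .
  qed
  with s that show ?thesis by blast
qed

text \<open>Smoothing moves the integral of \<open>h\<close> by at most \<open>e / 4\<close> under
  every probability measure, hence uniformly along the sequence; what remains is the convergence of
  the smoothed integrals.\<close>

lemma char_imp_convergence_compact_support:
  fixes M :: "nat \<Rightarrow> 'a::euclidean_space measure" and Q :: "'a measure" and h :: "'a \<Rightarrow> real"
  assumes M: "\<And>n. prob_space (M n)" and sM: "\<And>n. sets (M n) = sets borel"
    and Q: "prob_space Q" and sQ: "sets Q = sets borel"
    and lim: "\<And>t. (\<lambda>n. mchar (M n) t) \<longlonglongrightarrow> mchar Q t"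
    and uc: "uniformly_continuous_on UNIV h" and B: "\<And>x. \<bar>h x\<bar> \<le> B" and h: "integrable lborel h"
  shows "(\<lambda>n. \<integral>x. h x \<partial>M n) \<longlonglongrightarrow> (\<integral>x. h x \<partial>Q)"
proof (rule LIMSEQ_I)
  fix e :: real assume e: "e > 0"
  have hm [measurable]: "h \<in> borel_measurable borel" using h by auto
  obtain s where s: "s > 0" "\<And>x. \<bar>(\<integral>g. h (x + s *\<^sub>R g) * gauss_density g \<partial>lborel) - h x\<bar> \<le> e / 4"
    using gauss_smoothing_close[OF uc B, of "e / 4"] e by auto
  define hs where "hs x = (\<integral>g. h (x + s *\<^sub>R g) * gauss_density g \<partial>lborel)" for x
  have hsm [measurable]: "hs \<in> borel_measurable borel" unfolding hs_def by measurable
  have close: "\<bar>(\<integral>x. hs x \<partial>N) - (\<integral>x. h x \<partial>N)\<bar> \<le> e / 4" if "prob_space N" "sets N = sets borel" for N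
  proof -
    interpret prob_space N by fact
    note [measurable_cong] = that(2)
    have s2: "\<bar>hs x - h x\<bar> \<le> e / 4" for x using s(2)[of x] by (simp only: hs_def)
    have hsB: "\<bar>hs x\<bar> \<le> B + e / 4" for x using s(2)[of x] B[of x] unfolding hs_def abs_le_iff by linarith
    have "integrable N h" by (rule integrable_const_bound[where B=B]) (auto simp: B)
    moreover have "integrable N hs" by (rule integrable_const_bound[where B="B + e / 4"]) (auto simp: hsB)
    ultimately
    have "(\<integral>x. hs x \<partial>N) - (\<integral>x. h x \<partial>N) = (\<integral>x. hs x - h x \<partial>N)" by simp
    also have "\<bar>\<dots>\<bar> \<le> (\<integral>x. e / 4 \<partial>N)"
      unfolding real_norm_def[symmetric]
      by (rule order_trans[OF integral_norm_bound], rule integral_mono)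
        (use s2 \<open>integrable N h\<close> \<open>integrable N hs\<close> in auto)
    finally show ?thesis by (simp add: prob_space)
  qed
  have "(\<lambda>n. \<integral>x. hs x \<partial>M n) \<longlonglongrightarrow> (\<integral>x. hs x \<partial>Q)"
    unfolding hs_def by (rule char_imp_smoothed_convergence[OF M sM Q sQ lim h s(1)])
  from LIMSEQ_D[OF this, of "e / 4"] obtain n0 where n0: "\<And>n. n \<ge> n0 \<Longrightarrow> \<bar>(\<integral>x. hs x \<partial>M n) - (\<integral>x. hs x \<partial>Q)\<bar> < e / 4"
    using e by auto
  show "\<exists>n0. \<forall>n\<ge>n0. norm ((\<integral>x. h x \<partial>M n) - (\<integral>x. h x \<partial>Q)) < e"
  proof (intro exI[of _ n0] allI impI)
    fix n assume "n0 \<le> n"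
    from n0[OF this] close[OF M[of n] sM] close[OF Q sQ] e
    show "norm ((\<integral>x. h x \<partial>M n) - (\<integral>x. h x \<partial>Q)) < e" unfolding real_norm_def by linarith
  qed
qed

text \<open>Only test functions of compact support are needed: a nonnegative test function is the increasing
  limit of its products with cut-offs, which gives a lower bound for the limit inferior, and the upper bound
  comes from the same argument for the reflected function.\<close>

lemma convergence_from_compact_support:
  fixes X :: "nat \<Rightarrow> 'b \<Rightarrow> 'a::euclidean_space" and Q :: "'a measure" and f :: "'a \<Rightarrow> real"
  assumes M: "\<And>n. prob_space (M n)" and X: "\<And>n. X n \<in> borel_measurable (M n)"
    and Q: "prob_space Q" and sQ: "sets Q = sets borel"
    and lim: "\<And>h :: 'a \<Rightarrow> real. \<lbrakk>uniformly_continuous_on UNIV h; bounded (range h); integrable lborel h\<rbrakk>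
       \<Longrightarrow> (\<lambda>n. \<integral>x. h (X n x) \<partial>M n) \<longlonglongrightarrow> (\<integral>x. h x \<partial>Q)"
    and f: "continuous_on UNIV f" and bf: "bounded (range f)"
  shows "(\<lambda>n. \<integral>x. f (X n x) \<partial>M n) \<longlonglongrightarrow> (\<integral>x. f x \<partial>Q)"
proof -
  obtain B where B: "\<And>x. \<bar>f x\<bar> \<le> B" using bf by (auto simp: bounded_iff)
  have lower: "\<forall>\<^sub>F n in sequentially. (\<integral>x. g (X n x) \<partial>M n) > (\<integral>x. g x \<partial>Q) - e"
    if g: "continuous_on UNIV g" "\<And>x. 0 \<le> g x" "\<And>x. g x \<le> D" and e: "e > 0" for g :: "'a \<Rightarrow> real" and D e
  proof -
    have [measurable]: "g \<in> borel_measurable borel" using g by (intro borel_measurable_continuous_onI)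
    interpret Q: prob_space Q by fact
    note [measurable_cong] = sQ
    \<comment> \<open>Equal to 1 on the ball of radius \<open>k - 1\<close> and to 0 outside the
      ball of radius \<open>k\<close>.\<close>
    define ch :: "nat \<Rightarrow> 'a \<Rightarrow> real" where "ch k x = max 0 (min 1 (real k - norm x))" for k x
    have ch: "0 \<le> ch k x" "ch k x \<le> 1" for k x by (auto simp: ch_def)
    have chm [measurable]: "ch k \<in> borel_measurable borel" for k unfolding ch_def by measurable
    have lek: "g x * ch k x \<le> g x" "0 \<le> g x * ch k x" for k x
      using g(2)[of x] ch[of k x] by (auto simp: mult_left_le)
    have "(\<lambda>k. \<integral>x. g x * ch k x \<partial>Q) \<longlonglongrightarrow> (\<integral>x. g x \<partial>Q)"
    proof (rule integral_dominated_convergence[where w="\<lambda>_. D"])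
      show "AE x in Q. (\<lambda>k. g x * ch k x) \<longlonglongrightarrow> g x"
      proof (intro AE_I2)
        fix x :: 'a
        obtain N :: nat where "norm x + 1 < real N" using reals_Archimedean2 by blast
        then have "\<forall>\<^sub>F k in sequentially. g x * ch k x = g x"
          by (intro eventually_sequentiallyI[of N]) (auto simp: ch_def)
        then show "(\<lambda>k. g x * ch k x) \<longlonglongrightarrow> g x" by (rule tendsto_eventually)
      qed
      show "AE x in Q. norm (g x * ch k x) \<le> D" for k
        using order_trans[OF lek(1) g(3)] lek(2) by (intro AE_I2) simp
    qed auto
    from order_tendstoD(1)[OF this, of "(\<integral>x. g x \<partial>Q) - e / 2"] e
    obtain k where k: "(\<integral>x. g x * ch k x \<partial>Q) > (\<integral>x. g x \<partial>Q) - e / 2"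
      by (auto simp: eventually_sequentially)
    have supp: "g x * ch k x = 0" if "x \<notin> cball 0 (real k)" for x using that by (simp add: ch_def)
    have cont: "continuous_on UNIV (\<lambda>x. g x * ch k x)"
      unfolding ch_def by (intro continuous_intros g)
    have "(\<lambda>n. \<integral>x. g (X n x) * ch k (X n x) \<partial>M n) \<longlonglongrightarrow> (\<integral>x. g x * ch k x \<partial>Q)"
    proof (rule lim)
      show "bounded (range (\<lambda>x. g x * ch k x))"
        using order_trans[OF lek(1) g(3)] lek(2) by (intro boundedI[where B=D]) auto
      have "integrable lborel (\<lambda>x. indicator (cball 0 (real k)) x *\<^sub>R (g x * ch k x))"
        using borel_integrable_compact[OF compact_cball continuous_on_subset[OF cont subset_UNIV]]
        by (simp add: set_integrable_def)
      also have "(\<lambda>x. indicator (cball 0 (real k)) x *\<^sub>R (g x * ch k x)) = (\<lambda>x. g x * ch k x)"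
        using supp by (intro ext) (metis indicator_simps mult_1 mult_zero_left real_scaleR_def)
      finally show "integrable lborel (\<lambda>x. g x * ch k x)" .
      show "uniformly_continuous_on UNIV (\<lambda>x. g x * ch k x)"
        unfolding uniformly_continuous_on_def
      proof (intro allI impI)
        fix e :: real assume "e > 0"
        have "uniformly_continuous_on (cball 0 (real k + 1)) (\<lambda>x. g x * ch k x)"
          by (intro compact_uniformly_continuous continuous_on_subset[OF cont] compact_cball subset_UNIV)
        with \<open>e > 0\<close> obtain d where d: "d > 0" "\<And>x y. \<lbrakk>x \<in> cball 0 (real k + 1); y \<in> cball 0 (real k + 1); dist y x < d\<rbrakk>
           \<Longrightarrow> dist (g y * ch k y) (g x * ch k x) < e"
          unfolding uniformly_continuous_on_def by meson
        show "\<exists>d>0. \<forall>x\<in>UNIV. \<forall>x'\<in>UNIV. dist x' x < d \<longrightarrow> dist (g x' * ch k x') (g x * ch k x) < e"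
        proof (intro exI[of _ "min d 1"] conjI ballI impI)
          fix x y :: 'a assume xy: "dist y x < min d 1"
          show "dist (g y * ch k y) (g x * ch k x) < e"
          proof (cases "x \<in> cball 0 (real k + 1) \<and> y \<in> cball 0 (real k + 1)")
            case True then show ?thesis using d xy by auto
          next
            \<comment> \<open>One point lies outside the larger ball and the two are closer than 1,
              so both lie outside \<open>cball 0 (real k)\<close>, where the product
              vanishes.\<close>
            case False
            have "norm x \<le> norm y + dist y x" "norm y \<le> norm x + dist y x"
              by (metis dist_norm norm_minus_commute norm_triangle_sub) (metis dist_norm norm_triangle_sub)
            then have "x \<notin> cball 0 (real k)" "y \<notin> cball 0 (real k)" using False xy by auto
            then have "g x * ch k x = 0" "g y * ch k y = 0" using supp by blast+
            then show ?thesis using \<open>e > 0\<close> by (simp only: dist_self)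
          qed
        qed (use d in auto)
      qed
    qed
    from LIMSEQ_D[OF this, of "e / 2"] e obtain n0 where
      n0: "\<And>n. n \<ge> n0 \<Longrightarrow> \<bar>(\<integral>x. g (X n x) * ch k (X n x) \<partial>M n) - (\<integral>x. g x * ch k x \<partial>Q)\<bar> < e / 2" by auto
    show ?thesis
    proof (rule eventually_sequentiallyI[of n0])
      fix n assume n: "n0 \<le> n"
      interpret prob_space "M n" by (rule M)
      note [measurable] = X[of n]
      have "(\<integral>x. g (X n x) * ch k (X n x) \<partial>M n) \<le> (\<integral>x. g (X n x) \<partial>M n)"
        using order_trans[OF lek(1) g(3)] lek g
        by (intro integral_mono) (auto intro!: integrable_const_bound[where B=D])
      then show "(\<integral>x. g (X n x) \<partial>M n) > (\<integral>x. g x \<partial>Q) - e" using k n0[OF n] by linarith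
    qed
  qed
  have fm [measurable]: "f \<in> borel_measurable borel" using f by (intro borel_measurable_continuous_onI)
  have int: "integrable (M n) (\<lambda>x. f (X n x))" for n
  proof -
    interpret prob_space "M n" by (rule M)
    note [measurable] = X[of n]
    show ?thesis by (rule integrable_const_bound[where B=B]) (auto simp: B)
  qed
  have intQ: "integrable Q f"
  proof -
    interpret prob_space Q by (rule Q)
    note [measurable_cong] = sQ
    show ?thesis by (rule integrable_const_bound[where B=B]) (auto simp: B)
  qed
  have p1: "measure (M n) (space (M n)) = 1" "measure Q (space Q) = 1" for n
    using M Q by (auto simp: prob_space.prob_space)
  show ?thesis
  proof (rule LIMSEQ_I)
    fix e :: real assume e: "e > 0"
    have B': "0 \<le> B + f x" "0 \<le> B - f x" "B + f x \<le> 2 * B" "B - f x \<le> 2 * B" for x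
      using B[of x] by (auto simp: abs_le_iff)
    \<comment> \<open>The lower bound is applied to \<open>B + f\<close> and to
      \<open>B - f\<close>. All measures have total mass 1, so the constant \<open>B\<close> drops
      out and two one-sided bounds give convergence; this is what excludes a loss of mass at
      infinity.\<close>
    have "\<forall>\<^sub>F n in sequentially. (\<integral>x. B + f (X n x) \<partial>M n) > (\<integral>x. B + f x \<partial>Q) - e \<and>
        (\<integral>x. B - f (X n x) \<partial>M n) > (\<integral>x. B - f x \<partial>Q) - e"
      by (intro eventually_conj lower[of "\<lambda>x. B + f x" "2 * B" e] lower[of "\<lambda>x. B - f x" "2 * B" e] B' e
          continuous_intros f)
    then have "\<forall>\<^sub>F n in sequentially. \<bar>(\<integral>x. f (X n x) \<partial>M n) - (\<integral>x. f x \<partial>Q)\<bar> < e"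
    proof (rule eventually_mono)
      fix n assume *: "(\<integral>x. B + f (X n x) \<partial>M n) > (\<integral>x. B + f x \<partial>Q) - e \<and>
        (\<integral>x. B - f (X n x) \<partial>M n) > (\<integral>x. B - f x \<partial>Q) - e"
      interpret prob_space "M n" by (rule M)
      interpret Q: prob_space Q by (rule Q)
      have "(\<integral>x. B + f (X n x) \<partial>M n) = B + (\<integral>x. f (X n x) \<partial>M n)"
        "(\<integral>x. B - f (X n x) \<partial>M n) = B - (\<integral>x. f (X n x) \<partial>M n)"
        "(\<integral>x. B + f x \<partial>Q) = B + (\<integral>x. f x \<partial>Q)" "(\<integral>x. B - f x \<partial>Q) = B - (\<integral>x. f x \<partial>Q)"
        using int intQ by (simp_all add: p1)
      with * show "\<bar>(\<integral>x. f (X n x) \<partial>M n) - (\<integral>x. f x \<partial>Q)\<bar> < e" by linarith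
    qed
    then show "\<exists>n0. \<forall>n\<ge>n0. norm ((\<integral>x. f (X n x) \<partial>M n) - (\<integral>x. f x \<partial>Q)) < e"
      by (simp add: eventually_sequentially)
  qed
qed

text \<open>Slutsky's lemma and Levy's continuity theorem in one statement: characteristic functions
  are required for the tractable \<open>Y n\<close> only, and the uniform continuity of the
  restricted test functions \<open>h\<close> absorbs the difference
  \<open>X n - Y n\<close>.\<close>

lemma slutsky_levy:
  fixes X Y :: "nat \<Rightarrow> 'b \<Rightarrow> 'a::euclidean_space" and Q :: "'a measure" and f :: "'a \<Rightarrow> real"
  assumes M: "\<And>n. prob_space (M n)" and X: "\<And>n. X n \<in> borel_measurable (M n)" and Y: "\<And>n. Y n \<in> borel_measurable (M n)"
    and Q: "prob_space Q" and sQ: "sets Q = sets borel"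
    and close: "\<And>e. e > 0 \<Longrightarrow> (\<lambda>n. measure (M n) {x \<in> space (M n). norm (X n x - Y n x) > e}) \<longlonglongrightarrow> 0"
    and lim: "\<And>t. (\<lambda>n. \<integral>x. iexp (t \<bullet> Y n x) \<partial>M n) \<longlonglongrightarrow> mchar Q t"
    and f: "continuous_on UNIV f" and bf: "bounded (range f)"
  shows "(\<lambda>n. \<integral>x. f (X n x) \<partial>M n) \<longlonglongrightarrow> (\<integral>x. f x \<partial>Q)"
proof (rule convergence_from_compact_support[OF M X Q sQ _ f bf])
  fix h :: "'a \<Rightarrow> real"
  assume uc: "uniformly_continuous_on UNIV h" and bh: "bounded (range h)" and h: "integrable lborel h"
  obtain B where B: "\<And>x. \<bar>h x\<bar> \<le> B" using bh by (auto simp: bounded_iff)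
  have B0: "B \<ge> 0" using B[of 0] by linarith
  have [measurable]: "h \<in> borel_measurable borel" using h by auto
  have "(\<lambda>n. \<integral>y. h y \<partial>distr (M n) borel (Y n)) \<longlonglongrightarrow> (\<integral>x. h x \<partial>Q)"
  proof (rule char_imp_convergence_compact_support[OF _ _ Q sQ _ uc B h])
    show "prob_space (distr (M n) borel (Y n))" for n
      by (rule prob_space.prob_space_distr[OF M Y])
    show "(\<lambda>n. mchar (distr (M n) borel (Y n)) t) \<longlonglongrightarrow> mchar Q t" for t
      using lim[of t] unfolding mchar_def[of "distr _ _ _"] by (subst integral_distr[OF Y]) auto
  qed simp
  then have limY: "(\<lambda>n. \<integral>x. h (Y n x) \<partial>M n) \<longlonglongrightarrow> (\<integral>x. h x \<partial>Q)"
    by (subst (asm) integral_distr[OF Y]) auto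
  have "(\<lambda>n. (\<integral>x. h (X n x) \<partial>M n) - (\<integral>x. h (Y n x) \<partial>M n)) \<longlonglongrightarrow> 0"
  proof (rule LIMSEQ_I)
    fix e :: real assume e: "e > 0"
    obtain d where d: "d > 0" "\<And>x y. dist x y < d \<Longrightarrow> \<bar>h x - h y\<bar> < e / 2"
      using uc e unfolding uniformly_continuous_on_def dist_real_def
      by (metis UNIV_I abs_minus_commute dist_commute half_gt_zero)
    have "(\<lambda>n. e / 2 + 2 * B * measure (M n) {x \<in> space (M n). norm (X n x - Y n x) > d / 2}) \<longlonglongrightarrow> e / 2 + 2 * B * 0"
      using d by (intro tendsto_intros close) auto
    then have "\<forall>\<^sub>F n in sequentially. e / 2 + 2 * B * measure (M n) {x \<in> space (M n). norm (X n x - Y n x) > d / 2} < e"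
      by (rule order_tendstoD) (use e in auto)
    then have "\<forall>\<^sub>F n in sequentially. norm ((\<integral>x. h (X n x) \<partial>M n) - (\<integral>x. h (Y n x) \<partial>M n) - 0) < e"
    proof (rule eventually_mono)
      fix n
      assume *: "e / 2 + 2 * B * measure (M n) {x \<in> space (M n). norm (X n x - Y n x) > d / 2} < e"
      interpret prob_space "M n" by (rule M)
      note [measurable] = X[of n] Y[of n]
      let ?A = "{x \<in> space (M n). norm (X n x - Y n x) > d / 2}"
      have i: "integrable (M n) (\<lambda>x. h (X n x))" "integrable (M n) (\<lambda>x. h (Y n x))"
        by (auto intro!: integrable_const_bound[where B=B] simp: B)
      have "norm ((\<integral>x. h (X n x) \<partial>M n) - (\<integral>x. h (Y n x) \<partial>M n)) = norm (\<integral>x. h (X n x) - h (Y n x) \<partial>M n)"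
        using i by simp
      also have "\<dots> \<le> (\<integral>x. e / 2 + 2 * B * indicator ?A x \<partial>M n)"
      proof (rule order_trans[OF integral_norm_bound], rule integral_mono)
        fix x assume x: "x \<in> space (M n)"
        show "norm (h (X n x) - h (Y n x)) \<le> e / 2 + 2 * B * indicator ?A x"
        proof (cases "x \<in> ?A")
          case True
          then show ?thesis using B[of "X n x"] B[of "Y n x"] e by (auto simp: indicator_def abs_le_iff)
        next
          case False
          then have "\<bar>h (X n x) - h (Y n x)\<bar> < e / 2" using x d by (intro d) (auto simp: dist_norm)
          then show ?thesis using False by auto
        qed
      qed (use i in \<open>auto intro!: integrable_real_indicator simp: less_top[symmetric]\<close>)
      also have "\<dots> = e / 2 + 2 * B * measure (M n) ?A"
        by (subst Bochner_Integration.integral_add) (auto intro!: integrable_real_indicator simp: prob_space less_top[symmetric])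
      finally show "norm ((\<integral>x. h (X n x) \<partial>M n) - (\<integral>x. h (Y n x) \<partial>M n) - 0) < e" using * by simp
    qed
    then show "\<exists>n0. \<forall>n\<ge>n0. norm ((\<integral>x. h (X n x) \<partial>M n) - (\<integral>x. h (Y n x) \<partial>M n) - 0) < e"
      by (simp add: eventually_sequentially)
  qed
  from tendsto_add[OF this limY] show "(\<lambda>n. \<integral>x. h (X n x) \<partial>M n) \<longlonglongrightarrow> (\<integral>x. h x \<partial>Q)" by simp
qed

section \<open>The multivariate normal law\<close>

lemma sum_insert_quadratic:
  fixes S :: "'i \<Rightarrow> 'i \<Rightarrow> real"
  assumes "finite I" "a \<notin> I" "\<And>i. i \<in> I \<Longrightarrow> S i a = S a i"
  shows "(\<Sum>i\<in>insert a I. \<Sum>j\<in>insert a I. x i * S i j * x j) =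
    (x a)\<^sup>2 * S a a + 2 * x a * (\<Sum>i\<in>I. x i * S a i) + (\<Sum>i\<in>I. \<Sum>j\<in>I. x i * S i j * x j)"
proof -
  have "(\<Sum>i\<in>I. x i * S i a * x a) = x a * (\<Sum>i\<in>I. x i * S a i)"
    unfolding sum_distrib_left by (intro sum.cong) (auto simp: assms(3))
  moreover have "(\<Sum>j\<in>I. x a * S a j * x j) = x a * (\<Sum>i\<in>I. x i * S a i)"
    unfolding sum_distrib_left by (intro sum.cong) auto
  ultimately show ?thesis
    using assms(1,2) by (simp add: sum.distrib power2_eq_square algebra_simps)
qed

text \<open>Cholesky factorisation; the induction step passes to the Schur complement of the pivot.\<close>

lemma psd_factorisation:
  fixes S :: "'i \<Rightarrow> 'i \<Rightarrow> real"
  assumes "finite I" "\<And>i j. i \<in> I \<Longrightarrow> j \<in> I \<Longrightarrow> S i j = S j i"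
    "\<And>x. 0 \<le> (\<Sum>i\<in>I. \<Sum>j\<in>I. x i * S i j * x j)"
  shows "\<exists>A :: 'i \<Rightarrow> 'i \<Rightarrow> real. \<forall>i\<in>I. \<forall>j\<in>I. (\<Sum>k\<in>I. A i k * A j k) = S i j"
  using assms
proof (induction I arbitrary: S rule: finite_induct)
  case empty
  then show ?case by simp
next
  case (insert a I)
  note sym = insert.prems(1) and psd = insert.prems(2)
  have expand: "(\<Sum>i\<in>insert a I. \<Sum>j\<in>insert a I. x i * S i j * x j) =
    (x a)\<^sup>2 * S a a + 2 * x a * (\<Sum>i\<in>I. x i * S a i) + (\<Sum>i\<in>I. \<Sum>j\<in>I. x i * S i j * x j)" for x
    by (rule sum_insert_quadratic) (use insert.hyps sym in auto)
  have neq: "i \<noteq> a" if "i \<in> I" for i using that insert.hyps by auto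
  have upd: "(\<Sum>i\<in>I. (x(a := c)) i * S a i) = (\<Sum>i\<in>I. x i * S a i)"
    "(\<Sum>i\<in>I. \<Sum>j\<in>I. (x(a := c)) i * S i j * (x(a := c)) j) = (\<Sum>i\<in>I. \<Sum>j\<in>I. x i * S i j * x j)" for x c
    by (intro sum.cong refl; simp add: neq)+
  have psd_t: "0 \<le> t\<^sup>2 * S a a + 2 * t * (\<Sum>i\<in>I. x i * S a i) + (\<Sum>i\<in>I. \<Sum>j\<in>I. x i * S i j * x j)" for t x
    using psd[of "x(a := t)"] unfolding expand upd by simp
  have Saa: "0 \<le> S a a" using psd_t[of 1 "\<lambda>_. 0"] by simp
  show ?case
  proof (cases "S a a = 0")
    case True
    \<comment> \<open>A zero pivot forces its whole row to vanish: otherwise the form would be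
      affine and nonconstant in \<open>t\<close> along this direction and would become
      negative.\<close>
    have S0: "S a i = 0" if i: "i \<in> I" for i
    proof (rule ccontr)
      assume ne: "S a i \<noteq> 0"
      have "0 \<le> 2 * t * S a i + S i i" for t
      proof -
        have d: "(\<Sum>k\<in>I. (if k = i then 1 else 0) * S a k) = S a i"
          "(\<Sum>k\<in>I. \<Sum>j\<in>I. (if k = i then 1 else 0) * S k j * (if j = i then 1 else 0)) = S i i"
          using i insert.hyps(1) by (simp_all add: mult_delta_left mult_delta_right sum.delta)
        show ?thesis using psd_t[of t "\<lambda>k. if k = i then 1 else 0"] unfolding d True by simp
      qed
      from this[of "- (S i i + 1) / (2 * S a i)"] show False using ne by (simp add: field_simps)
    qed
    have "\<exists>A. \<forall>i\<in>I. \<forall>j\<in>I. (\<Sum>k\<in>I. A i k * A j k) = S i j"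
      using psd_t[of 0] by (intro insert.IH) (auto intro: sym)
    then obtain A where A: "\<And>i j. i \<in> I \<Longrightarrow> j \<in> I \<Longrightarrow> (\<Sum>k\<in>I. A i k * A j k) = S i j" by blast
    define A' where "A' i k = (if i = a \<or> k = a then 0 else A i k)" for i k
    have "(\<Sum>k\<in>I. A' i k * A' j k) = (if i = a \<or> j = a then 0 else S i j)" if "i \<in> insert a I" "j \<in> insert a I" for i j
    proof (cases "i = a \<or> j = a")
      case False
      then have "(\<Sum>k\<in>I. A' i k * A' j k) = (\<Sum>k\<in>I. A i k * A j k)"
        by (intro sum.cong) (auto simp: A'_def neq)
      with False that A[of i j] show ?thesis by auto
    qed (auto simp: A'_def)
    moreover have "(if i = a \<or> j = a then 0 else S i j) = S i j" if "i \<in> insert a I" "j \<in> insert a I" for i j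
      using that S0 sym[of i a] True by auto
    ultimately show ?thesis
      using insert.hyps by (intro exI[of _ A']) (simp add: A'_def)
  next
    case False
    with Saa have pos: "S a a > 0" by simp
    define S' where "S' i j = S i j - S a i * S a j / S a a" for i j
    have "\<exists>A. \<forall>i\<in>I. \<forall>j\<in>I. (\<Sum>k\<in>I. A i k * A j k) = S' i j"
    proof (rule insert.IH)
      show "S' i j = S' j i" if "i \<in> I" "j \<in> I" for i j
        using sym[of i j] that by (simp add: S'_def mult.commute)
      fix x :: "'i \<Rightarrow> real"
      define m where "m = (\<Sum>i\<in>I. x i * S a i)"
      have "(\<Sum>i\<in>I. \<Sum>j\<in>I. x i * S' i j * x j) = (\<Sum>i\<in>I. \<Sum>j\<in>I. x i * S i j * x j - (x i * S a i) * (x j * S a j) / S a a)"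
        by (intro sum.cong refl) (simp add: S'_def algebra_simps)
      also have "\<dots> = (\<Sum>i\<in>I. \<Sum>j\<in>I. x i * S i j * x j) - (m * m) / S a a"
        unfolding m_def sum_product sum_subtractf sum_divide_distrib ..
      \<comment> \<open>The value \<open>t = - m / S a a\<close> minimises the quadratic in
        \<open>t\<close>, so the form of the Schur complement is itself a value of the form of
        \<open>S\<close>.\<close>
      also have "\<dots> = (- m / S a a)\<^sup>2 * S a a + 2 * (- m / S a a) * m + (\<Sum>i\<in>I. \<Sum>j\<in>I. x i * S i j * x j)"
        using pos by (simp add: power2_eq_square field_simps)
      finally show "0 \<le> (\<Sum>i\<in>I. \<Sum>j\<in>I. x i * S' i j * x j)"
        using psd_t[of "- m / S a a" x] unfolding m_def by simp
    qed
    then obtain A where A: "\<And>i j. i \<in> I \<Longrightarrow> j \<in> I \<Longrightarrow> (\<Sum>k\<in>I. A i k * A j k) = S' i j" by blast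
    define A' where "A' i k = (if k = a then S a i / sqrt (S a a) else if i = a then 0 else A i k)" for i k
    have "(\<Sum>k\<in>I. A' i k * A' j k) = (if i = a \<or> j = a then 0 else S' i j)" if "i \<in> insert a I" "j \<in> insert a I" for i j
    proof (cases "i = a \<or> j = a")
      case True
      then show ?thesis by (auto simp: A'_def neq intro!: sum.neutral)
    next
      case False
      then have "(\<Sum>k\<in>I. A' i k * A' j k) = (\<Sum>k\<in>I. A i k * A j k)"
        by (intro sum.cong) (auto simp: A'_def neq)
      with False that A[of i j] show ?thesis by auto
    qed
    moreover have "A' i a * A' j a = S a i * S a j / S a a" for i j
      using pos by (simp add: A'_def)
    moreover have "S a i * S a j / S a a + (if i = a \<or> j = a then 0 else S' i j) = S i j"
      if "i \<in> insert a I" "j \<in> insert a I" for i j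
      using that pos sym[of i a] by (auto simp: S'_def)
    ultimately show ?thesis
      using insert.hyps by (intro exI[of _ A']) simp
  qed
qed

lemma psd_matrix_factorisation:
  fixes S :: "real^'n^'n"
  assumes sym: "transpose S = S" and psd: "\<And>x. 0 \<le> x \<bullet> (S *v x)"
  shows "\<exists>A :: real^'n^'n. A ** transpose A = S"
proof -
  have "S $ i $ j = S $ j $ i" for i j
    using arg_cong[OF sym, of "\<lambda>T. T $ i $ j"] by (simp add: transpose_def)
  moreover have "0 \<le> (\<Sum>i\<in>UNIV. \<Sum>j\<in>UNIV. x i * S $ i $ j * x j)" for x
    using psd[of "\<chi> i. x i"]
    by (simp add: inner_vec_def matrix_vector_mult_def sum_distrib_left mult.assoc)
  ultimately obtain A :: "'n \<Rightarrow> 'n \<Rightarrow> real" where A: "\<And>i j. (\<Sum>k\<in>UNIV. A i k * A j k) = S $ i $ j"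
    using psd_factorisation[of UNIV "\<lambda>i j. S $ i $ j"] by auto
  show ?thesis
    by (rule exI[of _ "\<chi> i k. A i k"]) (simp add: vec_eq_iff matrix_matrix_mult_def transpose_def A)
qed

text \<open>\<open>mvnormal\<close> picks an arbitrary factor \<open>A\<close> of \<open>S\<close>.
  The factorisation above shows that one exists, and the characteristic function depends on
  \<open>A\<close> only through \<open>A ** transpose A\<close>.\<close>

lemma mvnormal_char:
  fixes S :: "real^'n^'n"
  assumes sym: "transpose S = S" and psd: "\<And>x. 0 \<le> x \<bullet> (S *v x)"
  shows prob_space_mvnormal: "prob_space (mvnormal S)" and sets_mvnormal: "sets (mvnormal S) = sets borel"
    and mchar_mvnormal: "mchar (mvnormal S) t = exp (- (t \<bullet> (S *v t)) / 2)"
proof -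
  define A where "A = (SOME A :: real^'n^'n. A ** transpose A = S)"
  have A: "A ** transpose A = S"
    unfolding A_def by (rule someI_ex[OF psd_matrix_factorisation[OF sym psd]])
  let ?N = "\<lambda>_::'n. density lborel std_normal_density"
  have mv: "mvnormal S = distr (PiM UNIV ?N) borel (\<lambda>g. A *v (\<chi> i. g i))"
    by (simp add: mvnormal_def A_def Let_def)
  have [measurable]: "(\<lambda>g. A *v (\<chi> i. g i)) \<in> borel_measurable (PiM UNIV ?N)"
  proof (subst borel_measurable_euclidean_space, intro ballI)
    fix b :: "real^'n" assume "b \<in> Basis"
    then show "(\<lambda>g. (A *v (\<chi> i. g i)) \<bullet> b) \<in> borel_measurable (PiM UNIV ?N)"
      by (auto simp: Basis_vec_def inner_axis matrix_vector_mult_def)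
  qed
  interpret product_prob_space ?N
    by (intro product_prob_spaceI prob_space_normal_density) simp
  show "prob_space (mvnormal S)" unfolding mv
    by (intro prob_space.prob_space_distr prob_space_PiM prob_space_normal_density) simp_all
  show "sets (mvnormal S) = sets borel" by (simp add: mv)
  have "mchar (mvnormal S) t = (\<integral>g. iexp (t \<bullet> (A *v (\<chi> i. g i))) \<partial>PiM UNIV ?N)"
    unfolding mv mchar_def by (subst integral_distr) auto
  also have "\<dots> = (\<integral>g. (\<Prod>i\<in>UNIV. iexp ((t v* A) $ i * g i)) \<partial>PiM UNIV ?N)"
    by (simp only: dot_lmul_matrix[symmetric]) (simp add: inner_vec_def exp_sum sum_distrib_left)
  also have "\<dots> = (\<Prod>i\<in>UNIV. char std_normal_distribution ((t v* A) $ i))"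
    unfolding char_def
    by (rule product_integral_prod) (auto intro!: finite_measure.integrable_const_bound[OF prob_space.axioms(1)[OF prob_space_normal_density], where B=1])
  also have "\<dots> = complex_of_real (exp (\<Sum>i\<in>UNIV. - ((t v* A) $ i)\<^sup>2 / 2))"
    by (simp add: char_std_normal_distribution exp_sum)
  also have "(\<Sum>i\<in>UNIV. - ((t v* A) $ i)\<^sup>2 / 2) = - ((t v* A) \<bullet> (t v* A)) / 2"
    by (simp add: inner_vec_def sum_divide_distrib power2_eq_square flip: sum_negf)
  also have "(t v* A) \<bullet> (t v* A) = t \<bullet> (S *v t)"
  proof -
    have "(t v* A) \<bullet> (t v* A) = t \<bullet> (A *v (t v* A))" by (rule dot_lmul_matrix)
    then show ?thesis by (simp only: transpose_matrix_vector[symmetric] matrix_vector_mul_assoc A)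
  qed
  finally show "mchar (mvnormal S) t = exp (- (t \<bullet> (S *v t)) / 2)" .
qed

section \<open>A central limit theorem with uniform weights\<close>

text \<open>The upper bound goes through \<open>exp (- y) \<le> 1 / (1 + y)\<close>. With
  \<open>y\<close> half a variance of order \<open>1 / n\<close>, the square is negligible even
  after summation over \<open>n\<close> rows.\<close>

lemma exp_minus_second_order:
  fixes y :: real
  assumes "y \<ge> 0"
  shows "\<bar>(1 - y) - exp (- y)\<bar> \<le> y\<^sup>2"
proof -
  have "1 - y \<le> exp (- y)" using exp_ge_add_one_self[of "- y"] by simp
  moreover have "exp (- y) \<le> 1 - y + y\<^sup>2"
  proof -
    have "exp (- y) \<le> 1 / (1 + y)"
      using exp_ge_add_one_self[of y] assms by (simp add: exp_minus inverse_eq_divide frac_le)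
    also have "\<dots> \<le> 1 - y + y\<^sup>2"
    proof -
      have "1 \<le> (1 - y + y\<^sup>2) * (1 + y)"
        using assms by (simp add: power2_eq_square algebra_simps)
      then show ?thesis using assms by (simp add: divide_le_eq)
    qed
    finally show ?thesis .
  qed
  ultimately show ?thesis by simp
qed

text \<open>The error of the Gaussian approximation of one factor, divided by
  \<open>s\<^sup>2\<close>: the first summand is a Lindeberg term from the Taylor expansion of the
  exponential, the second the cost of replacing \<open>1 - v / 2\<close> by
  \<open>exp (- v / 2)\<close>. Of the coefficients only their bound \<open>s\<close> enters, which
  makes the estimate uniform in them.\<close>

definition char_remainder :: "'a measure \<Rightarrow> ('d::finite \<Rightarrow> 'a \<Rightarrow> real) \<Rightarrow> real \<Rightarrow> real" where
  "char_remainder Q h s = (\<integral>x. min (6 * (\<Sum>l\<in>UNIV. \<bar>h l x\<bar>)\<^sup>2) (s * (\<Sum>l\<in>UNIV. \<bar>h l x\<bar>) ^ 3) \<partial>Q) / 6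
      + s\<^sup>2 * (\<integral>x. (\<Sum>l\<in>UNIV. \<bar>h l x\<bar>)\<^sup>2 \<partial>Q)\<^sup>2 / 4"

locale centred_scores = prob_space Q for Q :: "'a measure" +
  fixes h :: "'d::finite \<Rightarrow> 'a \<Rightarrow> real"
  assumes score_measurable [measurable]: "\<And>l. h l \<in> borel_measurable Q"
    and score_square: "\<And>l. integrable Q (\<lambda>x. (h l x)\<^sup>2)"
    and score_mean: "\<And>l. (\<integral>x. h l x \<partial>Q) = 0"
begin

lemma score_integrable: "integrable Q (h l)"
  by (rule square_integrable_imp_integrable[OF _ score_square]) simp

lemma score_product_integrable: "integrable Q (\<lambda>x. h l x * h l' x)"
proof (rule Bochner_Integration.integrable_bound)
  show "integrable Q (\<lambda>x. (h l x)\<^sup>2 + (h l' x)\<^sup>2)"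
    by (intro Bochner_Integration.integrable_add score_square)
  show "AE x in Q. norm (h l x * h l' x) \<le> norm ((h l x)\<^sup>2 + (h l' x)\<^sup>2)"
  proof (intro AE_I2)
    fix x
    have "2 * \<bar>h l x\<bar> * \<bar>h l' x\<bar> \<le> (h l x)\<^sup>2 + (h l' x)\<^sup>2"
      using sum_squares_bound[of "\<bar>h l x\<bar>" "\<bar>h l' x\<bar>"] by simp
    moreover have "0 \<le> \<bar>h l x\<bar> * \<bar>h l' x\<bar>" by simp
    ultimately show "norm (h l x * h l' x) \<le> norm ((h l x)\<^sup>2 + (h l' x)\<^sup>2)"
      unfolding real_norm_def abs_mult by linarith
  qed
qed simp

definition score_sum :: "'a \<Rightarrow> real" where "score_sum x = (\<Sum>l\<in>UNIV. \<bar>h l x\<bar>)"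

lemma score_sum_measurable [measurable]: "score_sum \<in> borel_measurable Q"
  unfolding score_sum_def by measurable

lemma score_sum_nonneg [simp]: "0 \<le> score_sum x" by (simp add: score_sum_def sum_nonneg)

lemma score_sum_square_integrable: "integrable Q (\<lambda>x. (score_sum x)\<^sup>2)"
proof -
  have "integrable Q (\<lambda>x. \<Sum>l\<in>UNIV. \<Sum>l'\<in>UNIV. \<bar>h l x * h l' x\<bar>)"
    by (intro Bochner_Integration.integrable_sum integrable_abs score_product_integrable)
  also have "(\<lambda>x. \<Sum>l\<in>UNIV. \<Sum>l'\<in>UNIV. \<bar>h l x * h l' x\<bar>) = (\<lambda>x. (score_sum x)\<^sup>2)"
    by (simp add: score_sum_def power2_eq_square sum_product abs_mult)
  finally show ?thesis .
qed

text \<open>The minimum never exceeds \<open>6 * (score_sum x)\<^sup>2\<close>, so dominated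
  convergence works with second moments alone.\<close>

lemma char_remainder_tendsto:
  assumes "s \<longlonglongrightarrow> 0" "\<And>n. 0 \<le> s n"
  shows "(\<lambda>n. char_remainder Q h (s n)) \<longlonglongrightarrow> 0"
proof -
  have "(\<lambda>n. \<integral>x. min (6 * (score_sum x)\<^sup>2) (s n * (score_sum x) ^ 3) \<partial>Q) \<longlonglongrightarrow> (\<integral>x. 0 \<partial>Q)"
  proof (rule integral_dominated_convergence[where w="\<lambda>x. 6 * (score_sum x)\<^sup>2"])
    show "AE x in Q. (\<lambda>n. min (6 * (score_sum x)\<^sup>2) (s n * (score_sum x) ^ 3)) \<longlonglongrightarrow> 0"
    proof (intro AE_I2)
      fix x
      have "(\<lambda>n. min (6 * (score_sum x)\<^sup>2) (s n * (score_sum x) ^ 3)) \<longlonglongrightarrow> min (6 * (score_sum x)\<^sup>2) (0 * (score_sum x) ^ 3)"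
        by (intro tendsto_intros assms)
      then show "(\<lambda>n. min (6 * (score_sum x)\<^sup>2) (s n * (score_sum x) ^ 3)) \<longlonglongrightarrow> 0" by simp
    qed
    show "AE x in Q. norm (min (6 * (score_sum x)\<^sup>2) (s n * (score_sum x) ^ 3)) \<le> 6 * (score_sum x)\<^sup>2" for n
      using assms(2)[of n] by (intro AE_I2) auto
  qed (auto simp: score_sum_square_integrable)
  then have "(\<lambda>n. (\<integral>x. min (6 * (score_sum x)\<^sup>2) (s n * (score_sum x) ^ 3) \<partial>Q) / 6 + (s n)\<^sup>2 * (\<integral>x. (score_sum x)\<^sup>2 \<partial>Q)\<^sup>2 / 4)
     \<longlonglongrightarrow> 0 / 6 + 0\<^sup>2 * (\<integral>x. (score_sum x)\<^sup>2 \<partial>Q)\<^sup>2 / 4"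
    by (intro tendsto_intros assms) simp_all
  then show ?thesis by (simp add: char_remainder_def score_sum_def)
qed

lemma score_quadratic_nonneg: "0 \<le> (\<Sum>l\<in>UNIV. \<Sum>l'\<in>UNIV. u l * u l' * (\<integral>x. h l x * h l' x \<partial>Q))"
  and score_quadratic_eq: "(\<integral>x. (\<Sum>l\<in>UNIV. u l * h l x)\<^sup>2 \<partial>Q) = (\<Sum>l\<in>UNIV. \<Sum>l'\<in>UNIV. u l * u l' * (\<integral>x. h l x * h l' x \<partial>Q))"
proof -
  have "(\<integral>x. (\<Sum>l\<in>UNIV. u l * h l x)\<^sup>2 \<partial>Q) = (\<integral>x. (\<Sum>l\<in>UNIV. \<Sum>l'\<in>UNIV. u l * u l' * (h l x * h l' x)) \<partial>Q)"
    by (simp add: power2_eq_square sum_product mult_ac)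
  also have "\<dots> = (\<Sum>l\<in>UNIV. \<Sum>l'\<in>UNIV. u l * u l' * (\<integral>x. h l x * h l' x \<partial>Q))"
    by (subst Bochner_Integration.integral_sum; (intro Bochner_Integration.integrable_sum integrable_mult_right score_product_integrable)?)
      (subst Bochner_Integration.integral_sum; (intro integrable_mult_right score_product_integrable)?; simp)
  finally show eq: "(\<integral>x. (\<Sum>l\<in>UNIV. u l * h l x)\<^sup>2 \<partial>Q) = (\<Sum>l\<in>UNIV. \<Sum>l'\<in>UNIV. u l * u l' * (\<integral>x. h l x * h l' x \<partial>Q))" .
  show "0 \<le> (\<Sum>l\<in>UNIV. \<Sum>l'\<in>UNIV. u l * u l' * (\<integral>x. h l x * h l' x \<partial>Q))"
    unfolding eq[symmetric] by simp
qed

text \<open>A linear combination with coefficients at most \<open>s\<close> is dominated by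
  \<open>s * score_sum x\<close>, so the scalar Taylor bound holds with a right-hand side that does
  not involve \<open>u\<close>.\<close>

lemma score_char_approx:
  assumes u: "\<And>l. \<bar>u l\<bar> \<le> s"
  shows "cmod ((\<integral>x. iexp (\<Sum>l\<in>UNIV. u l * h l x) \<partial>Q) -
      exp (- (\<Sum>l\<in>UNIV. \<Sum>l'\<in>UNIV. u l * u l' * (\<integral>x. h l x * h l' x \<partial>Q)) / 2)) \<le> s\<^sup>2 * char_remainder Q h s"
proof -
  have s0: "0 \<le> s" using u abs_ge_zero order_trans by blast
  define X where "X x = (\<Sum>l\<in>UNIV. u l * h l x)" for x
  have [measurable]: "X \<in> borel_measurable Q" unfolding X_def by measurable
  have XH: "\<bar>X x\<bar> \<le> s * score_sum x" for x
    unfolding X_def score_sum_def sum_distrib_left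
    by (rule order_trans[OF sum_abs], rule sum_mono) (simp add: abs_mult u mult_right_mono)
  have X2: "(X x)\<^sup>2 \<le> s\<^sup>2 * (score_sum x)\<^sup>2" for x
    using power_mono[OF XH[of x] abs_ge_zero, of 2] by (simp add: power_mult_distrib)
  have X3: "\<bar>X x\<bar> ^ 3 \<le> s ^ 3 * (score_sum x) ^ 3" for x
    using power_mono[OF XH[of x] abs_ge_zero, of 3] by (simp add: power_mult_distrib)
  have iX2: "integrable Q (\<lambda>x. (X x)\<^sup>2)"
    by (rule Bochner_Integration.integrable_bound[where f="\<lambda>x. s\<^sup>2 * (score_sum x)\<^sup>2"]) (auto simp: score_sum_square_integrable X2)
  have iX: "integrable Q X" unfolding X_def by (intro Bochner_Integration.integrable_sum integrable_mult_right score_integrable)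
  have mX: "expectation X = 0" unfolding X_def
    by (subst Bochner_Integration.integral_sum) (auto simp: score_mean score_integrable)
  define v where "v = expectation (\<lambda>x. (X x)\<^sup>2)"
  have v0: "0 \<le> v" unfolding v_def by simp
  have vH: "v \<le> s\<^sup>2 * expectation (\<lambda>x. (score_sum x)\<^sup>2)"
    unfolding v_def by (subst integral_mult_right_zero[symmetric], intro integral_mono) (auto simp: iX2 score_sum_square_integrable X2)
  have "cmod (char (distr Q borel X) 1 - (1 - 1\<^sup>2 * v / 2)) \<le> 1\<^sup>2 / 6 * expectation (\<lambda>x. min (6 * (X x)\<^sup>2) (\<bar>1\<bar> * \<bar>X x\<bar> ^ 3))"
    by (rule char_approx3') (auto simp: iX iX2 mX v_def)
  also have "char (distr Q borel X) 1 = expectation (\<lambda>x. iexp (X x))"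
    unfolding char_def by (subst integral_distr) auto
  also have "1\<^sup>2 / 6 * expectation (\<lambda>x. min (6 * (X x)\<^sup>2) (\<bar>1\<bar> * \<bar>X x\<bar> ^ 3)) \<le> expectation (\<lambda>x. s\<^sup>2 * min (6 * (score_sum x)\<^sup>2) (s * (score_sum x) ^ 3)) / 6"
  proof -
    have i1: "integrable Q (\<lambda>x. min (6 * (X x)\<^sup>2) (\<bar>X x\<bar> ^ 3))"
      by (rule Bochner_Integration.integrable_bound[where f="\<lambda>x. 6 * (X x)\<^sup>2"]) (auto simp: iX2)
    have i2: "integrable Q (\<lambda>x. s\<^sup>2 * min (6 * (score_sum x)\<^sup>2) (s * (score_sum x) ^ 3))"
      by (intro integrable_mult_right Bochner_Integration.integrable_bound[where f="\<lambda>x. 6 * (score_sum x)\<^sup>2" and g="\<lambda>x. min (6 * (score_sum x)\<^sup>2) (s * (score_sum x) ^ 3)"])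
        (use s0 in \<open>auto simp: score_sum_square_integrable intro!: AE_I2\<close>)
    have "expectation (\<lambda>x. min (6 * (X x)\<^sup>2) (\<bar>X x\<bar> ^ 3)) \<le> expectation (\<lambda>x. s\<^sup>2 * min (6 * (score_sum x)\<^sup>2) (s * (score_sum x) ^ 3))"
    proof (rule integral_mono[OF i1 i2])
      fix x
      have "s\<^sup>2 * min (6 * (score_sum x)\<^sup>2) (s * (score_sum x) ^ 3) = min (6 * (s\<^sup>2 * (score_sum x)\<^sup>2)) (s ^ 3 * (score_sum x) ^ 3)"
        by (simp add: min_mult_distrib_left power2_eq_square power3_eq_cube mult_ac)
      then show "min (6 * (X x)\<^sup>2) (\<bar>X x\<bar> ^ 3) \<le> s\<^sup>2 * min (6 * (score_sum x)\<^sup>2) (s * (score_sum x) ^ 3)"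
        using X2[of x] X3[of x] by linarith
    qed
    then show ?thesis by simp
  qed
  finally have 1: "cmod (expectation (\<lambda>x. iexp (X x)) - (1 - v / 2)) \<le> s\<^sup>2 * expectation (\<lambda>x. min (6 * (score_sum x)\<^sup>2) (s * (score_sum x) ^ 3)) / 6"
    by simp
  have "cmod ((1 - v / 2) - complex_of_real (exp (- v / 2))) = \<bar>(1 - v / 2) - exp (- (v / 2))\<bar>"
    by (metis minus_divide_left norm_of_real of_real_1 of_real_diff of_real_divide of_real_numeral)
  also have "\<dots> \<le> (v / 2)\<^sup>2" by (rule exp_minus_second_order) (use v0 in simp)
  also have "\<dots> \<le> (s\<^sup>2 * expectation (\<lambda>x. (score_sum x)\<^sup>2) / 2)\<^sup>2"
    by (intro power_mono divide_right_mono vH) (use v0 in auto)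
  finally have 2: "cmod ((1 - v / 2) - complex_of_real (exp (- v / 2))) \<le> s\<^sup>2 * (s\<^sup>2 * (expectation (\<lambda>x. (score_sum x)\<^sup>2))\<^sup>2 / 4)"
    by (simp add: power2_eq_square mult_ac)
  have "cmod (expectation (\<lambda>x. iexp (X x)) - exp (- v / 2)) \<le> s\<^sup>2 * char_remainder Q h s"
    using norm_triangle_ineq[of "expectation (\<lambda>x. iexp (X x)) - (1 - v / 2)" "(1 - v / 2) - exp (- v / 2)"] 1 2
    by (simp add: char_remainder_def score_sum_def distrib_left)
  then show ?thesis unfolding v_def X_def score_quadratic_eq .
qed

end

text \<open>The threshold \<open>n0\<close> depends on neither the labels nor the weights, because
  later one limit has to hold simultaneously for all pairs of permutations. The difference of the
  products is at most the sum of the differences of the factors, and \<open>n\<close> errors of size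
  \<open>K\<^sup>2 / n\<close> times a remainder tending to 0 add up to something small.\<close>

lemma uniform_clt:
  fixes Q :: "'k::finite \<Rightarrow> 'a measure" and h :: "'k \<Rightarrow> 'd::finite \<Rightarrow> 'a \<Rightarrow> real"
  assumes Q: "\<And>k. centred_scores (Q k) (h k)" and e: "e > 0" and K: "K \<ge> 0"
  shows "\<exists>n0. \<forall>n\<ge>n0. \<forall>lab (u :: nat \<Rightarrow> 'd \<Rightarrow> real). (\<forall>j<n. \<forall>l. \<bar>u j l\<bar> \<le> K / sqrt (real n)) \<longrightarrow>
     cmod ((\<integral>z. iexp (\<Sum>j<n. \<Sum>l\<in>UNIV. u j l * h (lab j) l (z j)) \<partial>PiM {..<n} (\<lambda>j. Q (lab j)))
       - exp (- (\<Sum>j<n. \<Sum>l\<in>UNIV. \<Sum>l'\<in>UNIV. u j l * u j l' * (\<integral>x. h (lab j) l x * h (lab j) l' x \<partial>Q (lab j))) / 2)) \<le> e"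
proof -
  have "(\<lambda>n. K / sqrt (real n)) \<longlonglongrightarrow> 0"
    by (rule tendsto_divide_0[OF tendsto_const]) (intro filterlim_at_top_imp_at_infinity filterlim_compose[OF sqrt_at_top filterlim_real_sequentially])
  then have "(\<lambda>n. K\<^sup>2 * (\<Sum>k\<in>UNIV. \<bar>char_remainder (Q k) (h k) (K / sqrt (real n))\<bar>)) \<longlonglongrightarrow> K\<^sup>2 * (\<Sum>k\<in>(UNIV :: 'k set). \<bar>0\<bar>)"
    using K by (intro tendsto_intros centred_scores.char_remainder_tendsto[OF Q]) auto
  then have "\<forall>\<^sub>F n in sequentially. K\<^sup>2 * (\<Sum>k\<in>UNIV. \<bar>char_remainder (Q k) (h k) (K / sqrt (real n))\<bar>) < e"
    by (rule order_tendstoD) (use e in simp)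
  then obtain n0 where n0: "\<And>n. n \<ge> n0 \<Longrightarrow> K\<^sup>2 * (\<Sum>k\<in>UNIV. \<bar>char_remainder (Q k) (h k) (K / sqrt (real n))\<bar>) < e"
    by (auto simp: eventually_sequentially)
  show ?thesis
  proof (intro exI[of _ "max 1 n0"] allI impI)
    fix n lab and u :: "nat \<Rightarrow> 'd \<Rightarrow> real" assume n: "max 1 n0 \<le> n" and u: "\<forall>j<n. \<forall>l. \<bar>u j l\<bar> \<le> K / sqrt (real n)"
    let ?s = "K / sqrt (real n)"
    let ?v = "\<lambda>j. \<Sum>l\<in>UNIV. \<Sum>l'\<in>UNIV. u j l * u j l' * (\<integral>x. h (lab j) l x * h (lab j) l' x \<partial>Q (lab j))"
    interpret product_prob_space "\<lambda>j. Q (lab j)"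
      by (intro product_prob_spaceI centred_scores.axioms(1)[OF Q])
    have meas [measurable]: "h k l \<in> borel_measurable (Q k)" for k l by (rule centred_scores.score_measurable[OF Q])
    have "(\<integral>z. iexp (\<Sum>j<n. \<Sum>l\<in>UNIV. u j l * h (lab j) l (z j)) \<partial>PiM {..<n} (\<lambda>j. Q (lab j))) =
      (\<integral>z. (\<Prod>j<n. iexp (\<Sum>l\<in>UNIV. u j l * h (lab j) l (z j))) \<partial>PiM {..<n} (\<lambda>j. Q (lab j)))"
      by (simp add: exp_sum sum_distrib_left)
    also have "\<dots> = (\<Prod>j<n. \<integral>x. iexp (\<Sum>l\<in>UNIV. u j l * h (lab j) l x) \<partial>Q (lab j))"
      by (rule product_integral_prod) (auto intro!: finite_measure.integrable_const_bound[OF prob_space.axioms(1)[OF centred_scores.axioms(1)[OF Q]], where B=1])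
    finally have eq1: "(\<integral>z. iexp (\<Sum>j<n. \<Sum>l\<in>UNIV. u j l * h (lab j) l (z j)) \<partial>PiM {..<n} (\<lambda>j. Q (lab j))) =
      (\<Prod>j<n. \<integral>x. iexp (\<Sum>l\<in>UNIV. u j l * h (lab j) l x) \<partial>Q (lab j))" .
    have eq2: "complex_of_real (exp (- (\<Sum>j<n. ?v j) / 2)) = (\<Prod>j<n. complex_of_real (exp (- ?v j / 2)))"
      by (simp add: exp_sum[symmetric] sum_negf sum_divide_distrib flip: of_real_prod)
    have "cmod ((\<Prod>j<n. \<integral>x. iexp (\<Sum>l\<in>UNIV. u j l * h (lab j) l x) \<partial>Q (lab j)) - (\<Prod>j<n. complex_of_real (exp (- ?v j / 2))))
      \<le> (\<Sum>j<n. cmod ((\<integral>x. iexp (\<Sum>l\<in>UNIV. u j l * h (lab j) l x) \<partial>Q (lab j)) - complex_of_real (exp (- ?v j / 2))))"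
    proof (rule norm_prod_diff)
      fix j assume "j \<in> {..<n}"
      interpret q: centred_scores "Q (lab j)" "h (lab j)" by (rule Q)
      have "cmod (\<integral>x. iexp (\<Sum>l\<in>UNIV. u j l * h (lab j) l x) \<partial>Q (lab j)) \<le> (\<integral>x. 1 \<partial>Q (lab j))"
        by (rule order_trans[OF integral_norm_bound]) simp
      then show "cmod (\<integral>x. iexp (\<Sum>l\<in>UNIV. u j l * h (lab j) l x) \<partial>Q (lab j)) \<le> 1" 
        by (simp add: prob_space.prob_space[OF centred_scores.axioms(1)[OF Q]])
      show "cmod (complex_of_real (exp (- ?v j / 2))) \<le> 1"
        unfolding norm_of_real using q.score_quadratic_nonneg[of "u j"] by simp
    qed
    also have "\<dots> \<le> (\<Sum>j<n. ?s\<^sup>2 * (\<Sum>k\<in>UNIV. \<bar>char_remainder (Q k) (h k) ?s\<bar>))"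
    proof (rule sum_mono)
      fix j assume j: "j \<in> {..<n}"
      have "cmod ((\<integral>x. iexp (\<Sum>l\<in>UNIV. u j l * h (lab j) l x) \<partial>Q (lab j)) - complex_of_real (exp (- ?v j / 2)))
        \<le> ?s\<^sup>2 * char_remainder (Q (lab j)) (h (lab j)) ?s"
        using u j by (intro centred_scores.score_char_approx[OF Q]) auto
      also have "\<dots> \<le> ?s\<^sup>2 * \<bar>char_remainder (Q (lab j)) (h (lab j)) ?s\<bar>" by (intro mult_left_mono) auto
      also have "\<dots> \<le> ?s\<^sup>2 * (\<Sum>k\<in>UNIV. \<bar>char_remainder (Q k) (h k) ?s\<bar>)"
        by (intro mult_left_mono member_le_sum[of "lab j" UNIV "\<lambda>k. \<bar>char_remainder (Q k) (h k) ?s\<bar>"]) auto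
      finally show "cmod ((\<integral>x. iexp (\<Sum>l\<in>UNIV. u j l * h (lab j) l x) \<partial>Q (lab j)) - complex_of_real (exp (- ?v j / 2))) \<le> \<dots>" .
    qed
    also have "\<dots> = K\<^sup>2 * (\<Sum>k\<in>UNIV. \<bar>char_remainder (Q k) (h k) ?s\<bar>)"
      using n by (simp add: power_divide)
    also have "\<dots> \<le> e" using n0[of n] n by simp
    finally show "cmod ((\<integral>z. iexp (\<Sum>j<n. \<Sum>l\<in>UNIV. u j l * h (lab j) l (z j)) \<partial>PiM {..<n} (\<lambda>j. Q (lab j)))
       - exp (- (\<Sum>j<n. ?v j) / 2)) \<le> e" unfolding eq1 eq2 .
  qed
qed

section \<open>Random permutations\<close>

lemma sum_permutations_compose:
  assumes "\<tau> permutes S"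
  shows "(\<Sum>\<pi> | \<pi> permutes S. F (\<pi> \<circ> \<tau>)) = (\<Sum>\<pi> | \<pi> permutes S. F \<pi>)"
proof (rule sum.reindex_bij_witness[where i="\<lambda>\<pi>. \<pi> \<circ> inv \<tau>" and j="\<lambda>\<pi>. \<pi> \<circ> \<tau>"])
  fix \<pi> assume "\<pi> \<in> {\<pi>. \<pi> permutes S}"
  then show "\<pi> \<circ> \<tau> \<circ> inv \<tau> = \<pi>" "\<pi> \<circ> inv \<tau> \<circ> \<tau> = \<pi>" "\<pi> \<circ> \<tau> \<in> {\<pi>. \<pi> permutes S}"
    "\<pi> \<circ> inv \<tau> \<in> {\<pi>. \<pi> permutes S}"
    using assms permutes_inv[OF assms] by (auto simp: comp_assoc permutes_inv_o permutes_compose)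
qed simp

lemma sum_permutations_compose_left:
  assumes "\<tau> permutes S"
  shows "(\<Sum>\<pi> | \<pi> permutes S. F (\<tau> \<circ> \<pi>)) = (\<Sum>\<pi> | \<pi> permutes S. F \<pi>)"
proof (rule sum.reindex_bij_witness[where i="\<lambda>\<pi>. inv \<tau> \<circ> \<pi>" and j="\<lambda>\<pi>. \<tau> \<circ> \<pi>"])
  fix \<pi> assume "\<pi> \<in> {\<pi>. \<pi> permutes S}"
  then show "inv \<tau> \<circ> (\<tau> \<circ> \<pi>) = \<pi>" "\<tau> \<circ> (inv \<tau> \<circ> \<pi>) = \<pi>" "\<tau> \<circ> \<pi> \<in> {\<pi>. \<pi> permutes S}"
    "inv \<tau> \<circ> \<pi> \<in> {\<pi>. \<pi> permutes S}"
    using assms permutes_inv[OF assms] by (auto simp: comp_assoc[symmetric] permutes_inv_o permutes_compose)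
qed simp

text \<open>By symmetry the products \<open>x (\<pi> j) * x (\<pi> k)\<close> have one total
  \<open>t\<close> on the diagonal and one off it, and since \<open>x\<close> sums to zero the
  latter is \<open>- t / (n - 1)\<close>. The resulting multiple of the squared sum of
  \<open>y\<close> is not positive and is dropped.\<close>

lemma perm_second_moment:
  fixes x y :: "'a \<Rightarrow> real"
  assumes fin: "finite S" and card: "card S \<ge> 2" and x0: "(\<Sum>j\<in>S. x j) = 0"
  shows "(\<Sum>\<pi> | \<pi> permutes S. (\<Sum>j\<in>S. x (\<pi> j) * y j)\<^sup>2) \<le>
    fact (card S) * ((\<Sum>j\<in>S. (x j)\<^sup>2) * (\<Sum>j\<in>S. (y j)\<^sup>2)) / (real (card S) - 1)"
proof -
  let ?P = "{\<pi>. \<pi> permutes S}"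
  let ?n = "real (card S)"
  define T where "T j k = (\<Sum>\<pi>\<in>?P. x (\<pi> j) * x (\<pi> k))" for j k
  have n2: "?n \<ge> 2" using card by simp
  have sumP: "(\<Sum>j\<in>S. g (\<pi> j)) = (\<Sum>j\<in>S. g j)" if "\<pi> \<in> ?P" for \<pi> and g :: "'a \<Rightarrow> real"
    using sum.permute[of \<pi> S g] that by (simp add: comp_def)
  have T_diag: "T j j = fact (card S) * (\<Sum>j\<in>S. (x j)\<^sup>2) / ?n" if j: "j \<in> S" for j
  proof -
    have eq: "T k k = T j j" if k: "k \<in> S" for k
      using sum_permutations_compose[OF permutes_swap_id[OF j k], of "\<lambda>\<pi>. x (\<pi> k) * x (\<pi> k)"]
      by (simp add: T_def)
    have "?n * T j j = (\<Sum>k\<in>S. T k k)" using eq by simp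
    also have "\<dots> = (\<Sum>\<pi>\<in>?P. \<Sum>k\<in>S. (x (\<pi> k))\<^sup>2)"
      unfolding T_def by (subst sum.swap) (simp add: power2_eq_square)
    also have "\<dots> = (\<Sum>\<pi>\<in>?P. \<Sum>k\<in>S. (x k)\<^sup>2)" by (intro sum.cong refl sumP)
    also have "\<dots> = fact (card S) * (\<Sum>j\<in>S. (x j)\<^sup>2)" using fin by (simp add: card_permutations)
    finally show ?thesis using n2 by (simp add: field_simps)
  qed
  have T_off: "T j k = - T j j / (?n - 1)" if jk: "j \<in> S" "k \<in> S" "j \<noteq> k" for j k
  proof -
    have eq: "T j k' = T j k" if k': "k' \<in> S - {j}" for k'
    proof -
      have "k' \<in> S" "k' \<noteq> j" using k' by auto
      then show ?thesis
        using sum_permutations_compose[OF permutes_swap_id[OF \<open>k \<in> S\<close> \<open>k' \<in> S\<close>], of "\<lambda>\<pi>. x (\<pi> j) * x (\<pi> k')"] jk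
        by (simp add: T_def transpose_apply_other)
    qed
    have "T j j + (?n - 1) * T j k = T j j + (\<Sum>k'\<in>S - {j}. T j k')"
      using sum.cong[OF refl eq, of "S - {j}"] fin jk n2 by (simp add: of_nat_diff)
    also have "\<dots> = (\<Sum>k'\<in>S. T j k')" by (rule sum.remove[OF fin \<open>j \<in> S\<close>, of "T j", symmetric])
    also have "\<dots> = (\<Sum>\<pi>\<in>?P. x (\<pi> j) * (\<Sum>k\<in>S. x (\<pi> k)))"
      unfolding T_def by (subst sum.swap) (simp add: sum_distrib_left)
    also have "\<dots> = 0" using sumP[of _ x] x0 by simp
    finally show ?thesis using n2 by (simp add: field_simps)
  qed
  define t where "t = fact (card S) * (\<Sum>j\<in>S. (x j)\<^sup>2) / ?n"
  have t0: "0 \<le> t" by (simp add: t_def sum_nonneg)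
  have "(\<Sum>\<pi>\<in>?P. (\<Sum>j\<in>S. x (\<pi> j) * y j)\<^sup>2) = (\<Sum>\<pi>\<in>?P. \<Sum>j\<in>S. \<Sum>k\<in>S. y j * y k * (x (\<pi> j) * x (\<pi> k)))"
    by (simp add: power2_eq_square sum_product mult_ac)
  also have "\<dots> = (\<Sum>j\<in>S. \<Sum>k\<in>S. y j * y k * T j k)"
    unfolding T_def by (subst sum.swap, rule sum.cong[OF refl], subst sum.swap) (simp add: sum_distrib_left)
  also have "\<dots> = (\<Sum>j\<in>S. \<Sum>k\<in>S. - (t / (?n - 1)) * (y j * y k) + (if j = k then (t + t / (?n - 1)) * (y j * y k) else 0))"
    using T_off T_diag by (intro sum.cong refl) (auto simp: t_def algebra_simps)
  also have "\<dots> = - (t / (?n - 1)) * (\<Sum>j\<in>S. y j)\<^sup>2 + (t + t / (?n - 1)) * (\<Sum>j\<in>S. (y j)\<^sup>2)"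
  proof -
    have "(\<Sum>j\<in>S. \<Sum>k\<in>S. if j = k then (t + t / (?n - 1)) * (y j * y k) else 0) = (t + t / (?n - 1)) * (\<Sum>j\<in>S. (y j)\<^sup>2)"
      using fin by (simp add: power2_eq_square sum_distrib_left)
    moreover have "(\<Sum>j\<in>S. \<Sum>k\<in>S. - (t / (?n - 1)) * (y j * y k)) = - (t / (?n - 1)) * (\<Sum>j\<in>S. y j)\<^sup>2"
      by (simp only: power2_eq_square sum_product) (simp only: sum_distrib_left)
    ultimately show ?thesis unfolding sum.distrib by simp
  qed
  also have "\<dots> \<le> (t + t / (?n - 1)) * (\<Sum>j\<in>S. (y j)\<^sup>2)"
    using t0 n2 by simp
  also have "t + t / (?n - 1) = fact (card S) * (\<Sum>j\<in>S. (x j)\<^sup>2) / (?n - 1)"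
    using n2 by (simp add: t_def field_simps)
  finally show ?thesis by (simp add: mult_ac)
qed

text \<open>For each label as many elements as both functions allow are matched, and the rest is
  joined by any bijection. Only unmatched elements can disagree, and their number is the surplus of
  \<open>f\<close> over \<open>g\<close>, label by label, which is what truncated subtraction
  counts.\<close>

lemma exists_permutation_few_mismatches:
  fixes f g :: "'a \<Rightarrow> 'k::finite"
  assumes fin: "finite S"
  obtains \<tau> where "\<tau> permutes S"
    "card {j \<in> S. g (\<tau> j) \<noteq> f j} \<le> (\<Sum>i\<in>UNIV. card {j \<in> S. f j = i} - card {j \<in> S. g j = i})"
proof -
  let ?m = "\<lambda>i. min (card {j \<in> S. f j = i}) (card {j \<in> S. g j = i})"
  have "\<exists>A. A \<subseteq> {j \<in> S. f j = i} \<and> card A = ?m i" for i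
    by (rule obtain_subset_with_card_n[of "?m i" "{j \<in> S. f j = i}"]) auto
  then obtain A where A: "\<And>i. A i \<subseteq> {j \<in> S. f j = i}" "\<And>i. card (A i) = ?m i" by metis
  have "\<exists>A. A \<subseteq> {j \<in> S. g j = i} \<and> card A = ?m i" for i
    by (rule obtain_subset_with_card_n[of "?m i" "{j \<in> S. g j = i}"]) auto
  then obtain B where B: "\<And>i. B i \<subseteq> {j \<in> S. g j = i}" "\<And>i. card (B i) = ?m i" by metis
  have finA: "finite (A i)" "finite (B i)" for i
    using A(1)[of i] B(1)[of i] fin by (auto intro: finite_subset)
  have "\<exists>h. bij_betw h (A i) (B i)" for i
    using finA A(2) B(2) by (intro finite_same_card_bij) auto
  then obtain h where h: "\<And>i. bij_betw (h i) (A i) (B i)" by metis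
  define A' B' where "A' = (\<Union>i. A i)" and "B' = (\<Union>i. B i)"
  have sub: "A' \<subseteq> S" "B' \<subseteq> S" using A B unfolding A'_def B'_def by blast+
  have bij: "bij_betw (\<lambda>j. h (f j) j) A' B'"
  proof (rule bij_betw_imageI)
    show "inj_on (\<lambda>j. h (f j) j) A'"
    proof (rule inj_onI)
      fix j k assume jk: "j \<in> A'" "k \<in> A'" "h (f j) j = h (f k) k"
      have mem: "j \<in> A (f j)" "k \<in> A (f k)" using jk A(1) unfolding A'_def by fastforce+
      then have "h (f j) j \<in> B (f j)" "h (f k) k \<in> B (f k)" using h bij_betwE by metis+
      then have "g (h (f j) j) = f j" "g (h (f k) k) = f k" using B(1) by blast+
      then have "f j = f k" using jk by simp
      then show "j = k" using jk mem h[of "f j"] by (auto simp: bij_betw_def dest: inj_onD)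
    qed
    show "(\<lambda>j. h (f j) j) ` A' = B'"
    proof (intro equalityI subsetI)
      fix y assume "y \<in> (\<lambda>j. h (f j) j) ` A'"
      then obtain j where j: "j \<in> A'" "y = h (f j) j" by blast
      have "j \<in> A (f j)" using j A(1) unfolding A'_def by fastforce
      then show "y \<in> B'" using h[of "f j"] j unfolding B'_def bij_betw_def by blast
    next
      fix y assume "y \<in> B'"
      then obtain i where "y \<in> B i" unfolding B'_def by blast
      then obtain j where j: "j \<in> A i" "y = h i j" using h[of i] unfolding bij_betw_def by blast
      then have "f j = i" using A(1) by blast
      then show "y \<in> (\<lambda>j. h (f j) j) ` A'" using j unfolding A'_def by blast
    qed
  qed
  have "card (S - A') = card (S - B')"
    using bij_betw_same_card[OF bij] sub fin by (simp add: card_Diff_subset finite_subset)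
  then obtain h' where h': "bij_betw h' (S - A') (S - B')"
    using fin finite_same_card_bij by (metis finite_Diff)
  define \<tau> where "\<tau> x = (if x \<in> A' then h (f x) x else if x \<in> S then h' x else x)" for x
  have "bij_betw \<tau> A' B'" using bij by (rule bij_betw_cong[THEN iffD1, rotated]) (simp add: \<tau>_def)
  moreover have "bij_betw \<tau> (S - A') (S - B')" using h' by (rule bij_betw_cong[THEN iffD1, rotated]) (simp add: \<tau>_def)
  ultimately have "bij_betw \<tau> (A' \<union> (S - A')) (B' \<union> (S - B'))" by (rule bij_betw_combine) auto
  moreover have "A' \<union> (S - A') = S" "B' \<union> (S - B') = S" using sub by auto
  ultimately have "\<tau> permutes S" by (intro bij_imp_permutes) (auto simp: \<tau>_def sub(1)[THEN subsetD])
  moreover have "card {j \<in> S. g (\<tau> j) \<noteq> f j} \<le> (\<Sum>i\<in>UNIV. card {j \<in> S. f j = i} - card {j \<in> S. g j = i})"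
  proof -
    have "g (\<tau> j) = f j" if "j \<in> A'" for j
    proof -
      have "j \<in> A (f j)" using that A(1) unfolding A'_def by fastforce
      then have "h (f j) j \<in> B (f j)" using h bij_betwE by metis
      then show ?thesis using B(1) that by (auto simp: \<tau>_def)
    qed
    then have "{j \<in> S. g (\<tau> j) \<noteq> f j} \<subseteq> (\<Union>i. {j \<in> S. f j = i} - A i)" unfolding A'_def by blast
    then have "card {j \<in> S. g (\<tau> j) \<noteq> f j} \<le> card (\<Union>i. {j \<in> S. f j = i} - A i)"
      using fin by (intro card_mono finite_UN_I) auto
    also have "\<dots> \<le> (\<Sum>i\<in>UNIV. card ({j \<in> S. f j = i} - A i))" by (rule card_UN_le) simp
    also have "\<dots> = (\<Sum>i\<in>UNIV. card {j \<in> S. f j = i} - ?m i)"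
      using A finA by (simp add: card_Diff_subset)
    also have "\<dots> = (\<Sum>i\<in>UNIV. card {j \<in> S. f j = i} - card {j \<in> S. g j = i})"
      by (intro sum.cong refl) auto
    finally show ?thesis .
  qed
  ultimately show ?thesis using that by blast
qed

section \<open>Counting permutations by the labels they induce\<close>

definition labelings :: "'a set \<Rightarrow> ('k \<Rightarrow> nat) \<Rightarrow> ('a \<Rightarrow> 'k) set" where
  "labelings A b = {q \<in> A \<rightarrow>\<^sub>E UNIV. \<forall>i. card {j \<in> A. q j = i} = b i}"

lemma finite_labelings: "finite A \<Longrightarrow> finite (labelings A (b :: 'k::finite \<Rightarrow> nat))"
  unfolding labelings_def by (rule finite_subset[of _ "A \<rightarrow>\<^sub>E UNIV"]) (auto intro: finite_PiE)

text \<open>The multinomial coefficient, stated as a product to stay within the naturals. A new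
  element with label \<open>i\<close> lowers \<open>b i\<close> by one, which contributes the factor
  \<open>b i\<close>, and these factors add up to the new cardinality.\<close>

lemma card_labelings:
  fixes b :: "'k::finite \<Rightarrow> nat"
  assumes "finite A" "(\<Sum>i\<in>UNIV. b i) = card A"
  shows "card (labelings A b) * (\<Prod>i\<in>UNIV. fact (b i)) = (fact (card A) :: nat)"
  using assms
proof (induction A arbitrary: b rule: finite_induct)
  case empty
  then have "b i = 0" for i by simp
  then show ?case by (simp add: labelings_def)
next
  case (insert x A)
  let ?b = "\<lambda>i. b(i := b i - 1)"
  have cnt: "card {j \<in> insert x A. q j = i} = card {j \<in> A. q j = i} + (if q x = i then 1 else 0)" for q :: "'a \<Rightarrow> 'k" and i
  proof -
    have "{j \<in> insert x A. q j = i} = (if q x = i then insert x {j \<in> A. q j = i} else {j \<in> A. q j = i})" by auto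
    then show ?thesis using insert.hyps by simp
  qed
  have split: "labelings (insert x A) b = (\<Union>i\<in>{i. b i > 0}. (\<lambda>q. q(x := i)) ` labelings A (?b i))"
  proof (intro equalityI subsetI)
    fix q assume l: "q \<in> labelings (insert x A) b"
    then have c: "card {j \<in> A. q j = i} + (if q x = i then 1 else 0) = b i" for i
      unfolding labelings_def cnt by auto
    have "restrict q A \<in> labelings A (?b (q x))"
    proof -
      have "card {j \<in> A. restrict q A j = i} = ?b (q x) i" for i
      proof -
        have "{j \<in> A. restrict q A j = i} = {j \<in> A. q j = i}" by auto
        then show ?thesis using c[of i] by (auto split: if_splits)
      qed
      then show ?thesis by (auto simp: labelings_def)
    qed
    moreover have "q = (restrict q A)(x := q x)"
      using l by (intro ext) (auto simp: labelings_def PiE_def extensional_def restrict_def)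
    moreover have "b (q x) > 0" using c[of "q x"] by simp
    ultimately show "q \<in> (\<Union>i\<in>{i. b i > 0}. (\<lambda>q. q(x := i)) ` labelings A (?b i))" by blast
  next
    fix q assume "q \<in> (\<Union>i\<in>{i. b i > 0}. (\<lambda>q. q(x := i)) ` labelings A (?b i))"
    then obtain i q' where i: "b i > 0" "q' \<in> labelings A (?b i)" "q = q'(x := i)" by blast
    have "card {j \<in> A. q j = k} = ?b i k" for k
    proof -
      have "{j \<in> A. q j = k} = {j \<in> A. q' j = k}" using i insert.hyps by auto
      then show ?thesis using i by (simp add: labelings_def)
    qed
    then have "card {j \<in> insert x A. q j = k} = b k" for k unfolding cnt using i by auto
    moreover have "q \<in> insert x A \<rightarrow>\<^sub>E UNIV" using i by (auto simp: labelings_def PiE_def extensional_def)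
    ultimately show "q \<in> labelings (insert x A) b" unfolding labelings_def by blast
  qed
  have inj: "inj_on (\<lambda>q. q(x := i)) (labelings A b')" for i and b' :: "'k \<Rightarrow> nat"
  proof (rule inj_onI)
    fix q q' assume l: "q \<in> labelings A b'" "q' \<in> labelings A b'" "q(x := i) = q'(x := i)"
    show "q = q'"
    proof
      fix y show "q y = q' y"
      proof (cases "y = x")
        case True
        then show ?thesis using l(1,2) insert.hyps by (simp add: labelings_def PiE_def extensional_def)
      next
        case False
        then show ?thesis using fun_cong[OF l(3), of y] by simp
      qed
    qed
  qed
  have disj: "(\<lambda>q. q(x := i)) ` X \<inter> (\<lambda>q. q(x := k)) ` Y = {}" if "i \<noteq> k" for i k :: 'k and X Y
  proof -
    have False if "q(x := i) = q'(x := k)" for q q' :: "'a \<Rightarrow> 'k"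
      using fun_cong[OF that, of x] \<open>i \<noteq> k\<close> by simp
    then show ?thesis by blast
  qed
  have "card (labelings (insert x A) b) = (\<Sum>i | b i > 0. card ((\<lambda>q. q(x := i)) ` labelings A (?b i)))"
    unfolding split
    by (rule card_UN_disjoint) (use disj in \<open>simp_all add: finite_labelings insert.hyps\<close>)
  also have "\<dots> = (\<Sum>i | b i > 0. card (labelings A (?b i)))" by (simp only: card_image[OF inj])
  finally have "card (labelings (insert x A) b) = (\<Sum>i | b i > 0. card (labelings A (?b i)))" .
  then have "card (labelings (insert x A) b) * (\<Prod>i\<in>UNIV. fact (b i)) =
    (\<Sum>i | b i > 0. card (labelings A (?b i)) * (\<Prod>i\<in>UNIV. fact (b i)))" by (simp add: sum_distrib_right)
  also have "\<dots> = (\<Sum>i | b i > 0. b i * fact (card A))"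
  proof (intro sum.cong refl)
    fix i assume "i \<in> {i. b i > 0}"
    then have i: "b i > 0" by simp
    have "(\<Sum>k\<in>UNIV. ?b i k) = card A"
      using insert.prems insert.hyps i by (subst (asm) sum.remove[of _ i]) (auto simp: sum.remove[of _ i])
    from insert.IH[OF this] have IH: "card (labelings A (?b i)) * (\<Prod>k\<in>UNIV. fact (?b i k)) = (fact (card A) :: nat)" .
    have "(\<Prod>k\<in>UNIV. fact (b k) :: nat) = b i * (\<Prod>k\<in>UNIV. fact (?b i k))"
      using i fact_reduce[of "b i", where 'a=nat] by (simp add: prod.remove[of UNIV i] mult.assoc)
    then show "card (labelings A (?b i)) * (\<Prod>i\<in>UNIV. fact (b i)) = b i * fact (card A)"
      using IH by (metis mult.left_commute)
  qed
  also have "\<dots> = (\<Sum>i\<in>UNIV. b i) * fact (card A)"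
    unfolding sum_distrib_right by (intro sum.mono_neutral_left) auto
  finally show ?case using insert by simp
qed

text \<open>Composing with a suitable permutation carries the labels of \<open>g\<close> to any
  labeling with the same counts, so all those labelings are induced by equally many permutations,
  namely \<open>c0\<close>. This reduces the claim to counting labelings that agree with
  \<open>q\<close> on \<open>B\<close>, and these are the labelings of \<open>S - B\<close> by the
  remaining counts.\<close>

lemma card_permutations_with_labels:
  fixes g q :: "'a \<Rightarrow> 'k::finite"
  assumes fin: "finite S" and B: "B \<subseteq> S"
    and le: "\<And>i. card {j \<in> B. q j = i} \<le> card {j \<in> S. g j = i}"
  shows "card {\<pi>. \<pi> permutes S \<and> (\<forall>j\<in>B. g (\<pi> j) = q j)} *
      (\<Prod>i\<in>UNIV. fact (card {j \<in> S. g j = i} - card {j \<in> B. q j = i})) =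
    fact (card S - card B) * (\<Prod>i\<in>UNIV. fact (card {j \<in> S. g j = i}) :: nat)"
proof -
  define N where "N i = card {j \<in> S. g j = i}" for i
  define lab where "lab \<pi> = restrict (g \<circ> \<pi>) S" for \<pi>
  let ?P = "{\<pi>. \<pi> permutes S}"
  have finP: "finite ?P" by (rule finite_permutations[OF fin])
  have sumcard: "(\<Sum>i\<in>UNIV. card {j \<in> A. f j = i}) = card A" if "finite A" for A and f :: "'a \<Rightarrow> 'k"
    using sum.group[of A UNIV f "\<lambda>_. 1::nat"] that by simp
  have lab_in: "lab \<pi> \<in> labelings S N" if "\<pi> permutes S" for \<pi>
  proof -
    have "card {j \<in> S. lab \<pi> j = i} = N i" for i
    proof -
      have "bij_betw \<pi> {j \<in> S. lab \<pi> j = i} {j \<in> S. g j = i}"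
        by (rule bij_betw_byWitness[where f'="inv \<pi>"])
          (auto simp: lab_def permutes_in_image[OF that] permutes_inverses[OF that] permutes_in_image[OF permutes_inv[OF that]])
      then show ?thesis unfolding N_def by (rule bij_betw_same_card)
    qed
    then show ?thesis by (auto simp: labelings_def lab_def)
  qed
  have fibre: "card {\<pi> \<in> ?P. lab \<pi> = m} = card {\<pi> \<in> ?P. lab \<pi> = restrict g S}" if m: "m \<in> labelings S N" for m
  proof -
    obtain \<tau> where t: "\<tau> permutes S" "card {j \<in> S. g (\<tau> j) \<noteq> m j} \<le> (\<Sum>i\<in>UNIV. card {j \<in> S. m j = i} - card {j \<in> S. g j = i})"
      using exists_permutation_few_mismatches[OF fin, of g m] by blast
    \<comment> \<open>Equal label counts make the bound on the number of mismatches zero.\<close>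
    have "{j \<in> S. g (\<tau> j) \<noteq> m j} = {}" using t(2) m fin by (simp add: labelings_def N_def)
    then have gm: "g (\<tau> j) = m j" if "j \<in> S" for j using that by blast
    have restr: "(lab (\<pi> \<circ> \<tau>) = m) = (lab \<pi> = restrict g S)" if p: "\<pi> permutes S" for \<pi>
    proof -
      have ext: "m x = undefined" if "x \<notin> S" for x using m that by (auto simp: labelings_def PiE_def extensional_def)
      have "(lab (\<pi> \<circ> \<tau>) = m) = (\<forall>j\<in>S. g (\<pi> (\<tau> j)) = g (\<tau> j))"
        using gm ext by (auto simp: lab_def fun_eq_iff restrict_def)
      also have "\<dots> = (\<forall>j\<in>\<tau> ` S. g (\<pi> j) = g j)" by blast
      also have "\<dots> = (\<forall>j\<in>S. g (\<pi> j) = g j)" by (simp only: permutes_image[OF t(1)])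
      also have "\<dots> = (lab \<pi> = restrict g S)" by (auto simp: lab_def fun_eq_iff restrict_def)
      finally show ?thesis .
    qed
    have "card {\<pi> \<in> ?P. lab \<pi> = m} = (\<Sum>\<pi>\<in>?P. if lab \<pi> = m then 1 else 0)"
      using sum.inter_filter[OF finP, of "\<lambda>_. 1::nat" "\<lambda>\<pi>. lab \<pi> = m"] by simp
    also have "\<dots> = (\<Sum>\<pi>\<in>?P. if lab (\<pi> \<circ> \<tau>) = m then 1 else 0)"
      using sum_permutations_compose[OF t(1), of "\<lambda>\<pi>. if lab \<pi> = m then 1 else (0::nat)"] by simp
    also have "\<dots> = (\<Sum>\<pi>\<in>?P. if lab \<pi> = restrict g S then 1 else 0)" by (intro sum.cong) (auto simp: restr)
    also have "\<dots> = card {\<pi> \<in> ?P. lab \<pi> = restrict g S}" 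
      using sum.inter_filter[OF finP, of "\<lambda>_. 1::nat" "\<lambda>\<pi>. lab \<pi> = restrict g S"] by simp
    finally show ?thesis .
  qed
  define c0 where "c0 = card {\<pi> \<in> ?P. lab \<pi> = restrict g S}"
  have count: "card {\<pi> \<in> ?P. lab \<pi> \<in> L} = card L * c0" if L: "L \<subseteq> labelings S N" for L
  proof -
    have finL: "finite L" using L finite_labelings[OF fin] finite_subset by blast
    have "card {\<pi> \<in> ?P. lab \<pi> \<in> L} = card (\<Union>m\<in>L. {\<pi> \<in> ?P. lab \<pi> = m})" by (rule arg_cong[where f=card]) auto
    also have "\<dots> = (\<Sum>m\<in>L. card {\<pi> \<in> ?P. lab \<pi> = m})"
      using finL finP by (intro card_UN_disjoint) auto
    also have "\<dots> = (\<Sum>m\<in>L. c0)" unfolding c0_def using L fibre by (intro sum.cong refl) blast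
    finally show ?thesis by simp
  qed
  have "card {\<pi> \<in> ?P. lab \<pi> \<in> labelings S N} = fact (card S)"
    using lab_in fin card_permutations[OF refl fin] by (simp add: conj_absorb cong: conj_cong)
  then have all: "card (labelings S N) * c0 = fact (card S)" using count[of "labelings S N"] by simp
  have SN: "card (labelings S N) * (\<Prod>i\<in>UNIV. fact (N i)) = (fact (card S) :: nat)"
    by (rule card_labelings[OF fin]) (simp add: N_def sumcard fin)
  then have "card (labelings S N) \<noteq> 0" by (metis fact_nonzero mult_is_0)
  \<comment> \<open>The common fibre size is the number of all permutations divided by the number of
    labelings.\<close>
  then have c0: "c0 = (\<Prod>i\<in>UNIV. fact (N i))" using all SN by (metis mult_left_cancel)
  define b where "b i = N i - card {j \<in> B. q j = i}" for i
  have finB: "finite B" using B fin finite_subset by blast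
  have "{\<pi>. \<pi> permutes S \<and> (\<forall>j\<in>B. g (\<pi> j) = q j)} = {\<pi> \<in> ?P. lab \<pi> \<in> {m \<in> labelings S N. \<forall>j\<in>B. m j = q j}}"
    using lab_in B by (auto simp: lab_def)
  then have "card {\<pi>. \<pi> permutes S \<and> (\<forall>j\<in>B. g (\<pi> j) = q j)} = card {m \<in> labelings S N. \<forall>j\<in>B. m j = q j} * c0"
    using count[of "{m \<in> labelings S N. \<forall>j\<in>B. m j = q j}"] by simp
  moreover have "card {m \<in> labelings S N. \<forall>j\<in>B. m j = q j} = card (labelings (S - B) b)"
  proof (rule bij_betw_same_card[where f="\<lambda>m. restrict m (S - B)"], rule bij_betw_byWitness[where f'="\<lambda>m x. if x \<in> B then q x else m x"])
    have part: "card {j \<in> S. m j = i} = card {j \<in> S - B. m j = i} + card {j \<in> B. m j = i}" for m :: "'a \<Rightarrow> 'k" and i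
    proof -
      have "{j \<in> S. m j = i} = {j \<in> S - B. m j = i} \<union> {j \<in> B. m j = i}" using B by auto
      then show ?thesis using fin finB by (simp add: card_Un_disjoint disjoint_iff)
    qed
    show "\<forall>m\<in>{m \<in> labelings S N. \<forall>j\<in>B. m j = q j}. (\<lambda>x. if x \<in> B then q x else restrict m (S - B) x) = m"
      by (auto simp: labelings_def fun_eq_iff PiE_def extensional_def restrict_def)
    show "\<forall>m\<in>labelings (S - B) b. restrict (\<lambda>x. if x \<in> B then q x else m x) (S - B) = m"
      by (auto simp: labelings_def fun_eq_iff PiE_def extensional_def restrict_def)
    show "(\<lambda>m. restrict m (S - B)) ` {m \<in> labelings S N. \<forall>j\<in>B. m j = q j} \<subseteq> labelings (S - B) b"
    proof (rule image_subsetI)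
      fix m assume m: "m \<in> {m \<in> labelings S N. \<forall>j\<in>B. m j = q j}"
      have "card {j \<in> S - B. restrict m (S - B) j = i} = b i" for i
      proof -
        have "{j \<in> S - B. restrict m (S - B) j = i} = {j \<in> S - B. m j = i}" "{j \<in> B. m j = i} = {j \<in> B. q j = i}"
          using m by auto
        moreover have "card {j \<in> S. m j = i} = N i" using m by (auto simp: labelings_def)
        ultimately show ?thesis using part[of m i] by (simp add: b_def)
      qed
      then show "restrict m (S - B) \<in> labelings (S - B) b" by (auto simp: labelings_def)
    qed
    show "(\<lambda>m x. if x \<in> B then q x else m x) ` labelings (S - B) b \<subseteq> {m \<in> labelings S N. \<forall>j\<in>B. m j = q j}"
    proof (rule image_subsetI)
      fix m assume m: "m \<in> labelings (S - B) b"
      let ?m = "\<lambda>x. if x \<in> B then q x else m x"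
      have "card {j \<in> S. ?m j = i} = N i" for i
      proof -
        have "{j \<in> S - B. ?m j = i} = {j \<in> S - B. m j = i}" "{j \<in> B. ?m j = i} = {j \<in> B. q j = i}" by auto
        moreover have "card {j \<in> S - B. m j = i} = b i" using m by (auto simp: labelings_def)
        ultimately show ?thesis using part[of ?m i] le[of i] by (simp add: b_def N_def)
      qed
      moreover have "?m \<in> S \<rightarrow>\<^sub>E UNIV" using m B by (auto simp: labelings_def PiE_def extensional_def)
      ultimately show "?m \<in> {m \<in> labelings S N. \<forall>j\<in>B. m j = q j}" by (auto simp: labelings_def)
    qed
  qed
  moreover have "card (labelings (S - B) b) * (\<Prod>i\<in>UNIV. fact (b i)) = (fact (card (S - B)) :: nat)"
  proof (rule card_labelings)
    have "(\<Sum>i\<in>UNIV. b i) = (\<Sum>i\<in>UNIV. N i) - (\<Sum>i\<in>UNIV. card {j \<in> B. q j = i})"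
      unfolding b_def by (rule sum_subtractf_nat) (simp add: N_def le)
    then show "(\<Sum>i\<in>UNIV. b i) = card (S - B)"
      using sumcard[OF fin, of g] sumcard[OF finB, of q] B finB by (simp add: N_def card_Diff_subset)
  qed (use fin in simp)
  ultimately show ?thesis
    using c0 B finB unfolding b_def N_def by (simp add: card_Diff_subset mult_ac)
qed

section \<open>Stirling bounds and the hypergeometric ratio\<close>

text \<open>With \<open>x = 1 / n\<close> this bound times \<open>1 / x + 1 / 2\<close> equals 1,
  which is exactly what makes the Stirling errors nonincreasing.\<close>

lemma ln_one_plus_lower:
  fixes x :: real
  assumes "0 \<le> x"
  shows "2 * x / (2 + x) \<le> ln (1 + x)"
proof -
  define f where "f x = ln (1 + x) - 2 * x / (2 + x)" for x :: real
  have "f 0 \<le> f x"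
  proof (rule DERIV_nonneg_imp_nondecreasing[OF assms])
    fix y :: real assume y: "0 \<le> y" "y \<le> x"
    have "(f has_real_derivative (1 / (1 + y) - (2 * (2 + y) - 2 * y) / (2 + y)\<^sup>2)) (at y)"
      unfolding f_def using y by (auto intro!: derivative_eq_intros simp: power2_eq_square)
    moreover have "0 \<le> 1 / (1 + y) - (2 * (2 + y) - 2 * y) / (2 + y)\<^sup>2"
    proof -
      have "4 * (1 + y) \<le> (2 + y)\<^sup>2" using y by (simp add: power2_eq_square algebra_simps)
      moreover have "0 < (2 + y)\<^sup>2" using y by (intro zero_less_power) simp
      ultimately
      have "4 / (2 + y)\<^sup>2 \<le> 1 / (1 + y)" using y by (simp add: pos_divide_le_eq pos_le_divide_eq)
      then show ?thesis by simp
    qed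
    ultimately show "\<exists>z. (f has_real_derivative z) (at y) \<and> 0 \<le> z" by blast
  qed
  then show ?thesis by (simp add: f_def)
qed

lemma ln_one_plus_upper:
  fixes x :: real
  assumes "0 \<le> x"
  shows "ln (1 + x) \<le> x - x\<^sup>2 / 2 + x ^ 3 / 3"
proof -
  define f where "f x = x - x\<^sup>2 / 2 + x ^ 3 / 3 - ln (1 + x)" for x :: real
  have "f 0 \<le> f x"
  proof (rule DERIV_nonneg_imp_nondecreasing[OF assms])
    fix y :: real assume y: "0 \<le> y" "y \<le> x"
    have "(f has_real_derivative (1 - y + y\<^sup>2 - 1 / (1 + y))) (at y)"
      unfolding f_def using y by (auto intro!: derivative_eq_intros simp: power2_eq_square)
    moreover have "0 \<le> 1 - y + y\<^sup>2 - 1 / (1 + y)"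
      using y by (simp add: field_simps power2_eq_square)
    ultimately show "\<exists>z. (f has_real_derivative z) (at y) \<and> 0 \<le> z" by blast
  qed
  then show ?thesis by (simp add: f_def)
qed

text \<open>The logarithm of the ratio of \<open>n!\<close> to Stirling's approximation without its
  constant factor. It tends to \<open>ln (2 * pi) / 2\<close>, a value enclosed by the bounds 1/2
  and 1 proved below.\<close>

definition stirling_error :: "nat \<Rightarrow> real" where
  "stirling_error n = ln (fact n) - ((real n + 1 / 2) * ln (real n) - real n)"

text \<open>The upper bound is a difference of consecutive terms so that the steps telescope:
  starting from the value 1 at \<open>n = 1\<close>, the error loses at most 1/2 in all.\<close>

lemma stirling_error_step:
  assumes "n \<ge> 1"
  shows "0 \<le> stirling_error n - stirling_error (Suc n)"
    "stirling_error n - stirling_error (Suc n) \<le> 1 / (2 * real n) - 1 / (2 * real (Suc n))"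
proof -
  define x where "x = 1 / real n"
  have x: "0 < x" "x \<le> 1" "real n = 1 / x" using assms by (auto simp: x_def)
  have "real (Suc n) = real n * (1 + x)" using assms by (simp add: x_def distrib_left)
  then have "ln (real (Suc n)) = ln (real n * (1 + x))" by (simp only:)
  also have "\<dots> = ln (real n) + ln (1 + x)" using assms x by (subst ln_mult) auto
  finally have l: "ln (real (Suc n)) = ln (real n) + ln (1 + x)" .
  have "ln (fact (Suc n) :: real) = ln (real (Suc n)) + ln (fact n)"
    by (simp add: ln_mult del: of_nat_Suc)
  then have eq: "stirling_error n - stirling_error (Suc n) = (1 / x + 1 / 2) * ln (1 + x) - 1"
    unfolding stirling_error_def l x(3)[symmetric] by (simp add: l algebra_simps)
  have "(1 / x + 1 / 2) * (2 * x / (2 + x)) \<le> (1 / x + 1 / 2) * ln (1 + x)"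
    using x by (intro mult_left_mono ln_one_plus_lower) auto
  moreover have "(1 / x + 1 / 2) * (2 * x / (2 + x)) = 1"
  proof -
    have "1 / x + 1 / 2 = (2 + x) / (2 * x)" using x by (simp add: field_simps)
    then show ?thesis using x by (simp only:) simp
  qed
  ultimately show "0 \<le> stirling_error n - stirling_error (Suc n)" unfolding eq by linarith
  have "(1 / x + 1 / 2) * ln (1 + x) \<le> (1 / x + 1 / 2) * (x - x\<^sup>2 / 2 + x ^ 3 / 3)"
    using x by (intro mult_left_mono ln_one_plus_upper) auto
  also have "\<dots> = 1 + x\<^sup>2 / 12 + x ^ 3 / 6" using x by (simp add: field_simps power2_eq_square power3_eq_cube)
  also have "\<dots> \<le> 1 + x\<^sup>2 / 4"
  proof -
    have "x ^ 3 \<le> x\<^sup>2" using x by (simp add: power_decreasing)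
    then show ?thesis by simp
  qed
  finally have "stirling_error n - stirling_error (Suc n) \<le> x\<^sup>2 / 4" unfolding eq by linarith
  also have "\<dots> \<le> 1 / (2 * real n) - 1 / (2 * real (Suc n))"
  proof -
    have m: "1 \<le> real n" using assms by simp
    have "1 / (2 * real n) - 1 / (2 * real (Suc n)) = 1 / (2 * (real n * (real n + 1)))" using m by (simp add: field_simps)
    moreover have "1 / (4 * (real n * real n)) \<le> 1 / (2 * (real n * (real n + 1)))"
    proof (rule divide_left_mono)
      show "2 * (real n * (real n + 1)) \<le> 4 * (real n * real n)"
        using mult_left_mono[OF m, of "real n"] by (simp add: distrib_left)
      show "0 < 4 * (real n * real n) * (2 * (real n * (real n + 1)))" using m by (intro mult_pos_pos) auto
    qed simp
    ultimately show ?thesis by (simp add: x_def power2_eq_square)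
  qed
  finally show "stirling_error n - stirling_error (Suc n) \<le> 1 / (2 * real n) - 1 / (2 * real (Suc n))" .
qed

lemma stirling_error_bounds:
  assumes "n \<ge> 1"
  shows "1 / 2 \<le> stirling_error n" "stirling_error n \<le> 1"
proof -
  have "stirling_error n \<le> 1 \<and> 1 / 2 + 1 / (2 * real n) \<le> stirling_error n"
    using assms
  proof (induction n rule: dec_induct)
    case base
    show ?case by (simp add: stirling_error_def)
  next
    case (step n)
    then show ?case using stirling_error_step[of n] by linarith
  qed
  moreover have "0 \<le> 1 / (2 * real n)" by simp
  ultimately show "1 / 2 \<le> stirling_error n" "stirling_error n \<le> 1" by linarith+
qed

text \<open>The ratio of the multivariate hypergeometric to the multinomial probability of a label pattern. The
  exponent is estimated by \<open>ln y \<le> y - 1\<close> twice: once for the cells that remain, where the terms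
  cancel, and once for the sample sizes, where they leave a chi-square statistic.\<close>

lemma hypergeometric_multinomial_ratio:
  fixes n b :: "'k::finite \<Rightarrow> nat" and p :: "'k \<Rightarrow> real" and c D :: real
  assumes p: "\<And>i. 0 < p i" "(\<Sum>i\<in>UNIV. p i) = 1"
    and n: "(\<Sum>i\<in>UNIV. n i) = N" and N: "N \<ge> 1" and M: "(\<Sum>i\<in>UNIV. b i) = M"
    and b: "\<And>i. b i \<le> n i" "\<And>i. c * real N \<le> real (b i)" and c: "0 < c"
    and D: "\<And>i. \<bar>real (n i) / real N - p i\<bar> \<le> D / sqrt (real N)"
  shows "fact M * (\<Prod>i\<in>UNIV. fact (n i)) / ((\<Prod>i\<in>UNIV. fact (b i)) * fact N) \<le>
    exp ((real CARD('k) + 1) / 2 + (\<Sum>i\<in>UNIV. D\<^sup>2 / p i) + real CARD('k) * \<bar>ln c\<bar> / 2) * (\<Prod>i\<in>UNIV. p i ^ (n i - b i))"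
proof -
  have bpos: "b i \<ge> 1" for i
  proof -
    have "0 < c * real N" using c N by simp
    then have "0 < real (b i)" using b(2)[of i] by linarith
    then show ?thesis by simp
  qed
  have npos: "n i \<ge> 1" for i using bpos[of i] b(1)[of i] by linarith
  have Mpos: "M \<ge> 1"
    using M bpos member_le_sum[of undefined UNIV b] by (metis UNIV_I bot_nat_0.extremum finite order_trans)
  have MN: "M \<le> N" unfolding n[symmetric] M[symmetric] by (intro sum_mono b)
  define s where "s = stirling_error"
  have lf: "ln (fact m :: real) = s m + (real m + 1 / 2) * ln (real m) - real m" for m
    by (simp add: s_def stirling_error_def)
  have rn: "(\<Sum>i\<in>UNIV. real (n i)) = real N" "(\<Sum>i\<in>UNIV. real (b i)) = real M"
    using n M by (simp_all flip: of_nat_sum)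
  define L where "L = ln (fact M) + (\<Sum>i\<in>UNIV. ln (fact (n i))) - (\<Sum>i\<in>UNIV. ln (fact (b i))) - ln (fact N :: real)
      - (\<Sum>i\<in>UNIV. real (n i - b i) * ln (p i))"
  \<comment> \<open>Stirling's formula is inserted in each factorial. The linear parts cancel
    because the totals agree, leaving bounded errors, half logarithms, and two sums of
    relative-entropy type, one for \<open>b\<close> and one for \<open>n\<close>.\<close>
  have "L = (s M - s N) + (\<Sum>i\<in>UNIV. s (n i) - s (b i)) + (ln M - ln N) / 2 + (\<Sum>i\<in>UNIV. (ln (n i) - ln (b i)) / 2)
     + (\<Sum>i\<in>UNIV. b i * (ln M + ln (p i) - ln (b i))) + (\<Sum>i\<in>UNIV. n i * (ln (n i) - ln N - ln (p i)))"
  proof -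
    have "(\<Sum>i\<in>UNIV. b i * (ln M + ln (p i) - ln (b i))) = M * ln M + (\<Sum>i\<in>UNIV. b i * ln (p i)) - (\<Sum>i\<in>UNIV. b i * ln (b i))"
      unfolding rn(2)[symmetric] sum_distrib_right by (simp add: algebra_simps sum.distrib sum_subtractf)
    moreover have "(\<Sum>i\<in>UNIV. n i * (ln (n i) - ln N - ln (p i))) = (\<Sum>i\<in>UNIV. n i * ln (n i)) - N * ln N - (\<Sum>i\<in>UNIV. n i * ln (p i))"
      unfolding rn(1)[symmetric] sum_distrib_right by (simp add: algebra_simps sum.distrib sum_subtractf)
    moreover have "(\<Sum>i\<in>UNIV. real (n i - b i) * ln (p i)) = (\<Sum>i\<in>UNIV. n i * ln (p i)) - (\<Sum>i\<in>UNIV. b i * ln (p i))"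
      using b(1) by (simp add: of_nat_diff algebra_simps sum_subtractf)
    moreover have "(\<Sum>i\<in>UNIV. ln (fact (n i))) = (\<Sum>i\<in>UNIV. s (n i)) + (\<Sum>i\<in>UNIV. n i * ln (n i)) + (\<Sum>i\<in>UNIV. ln (n i)) / 2 - N"
      unfolding lf rn(1)[symmetric] by (simp add: algebra_simps sum.distrib sum_subtractf sum_divide_distrib)
    moreover have "(\<Sum>i\<in>UNIV. ln (fact (b i))) = (\<Sum>i\<in>UNIV. s (b i)) + (\<Sum>i\<in>UNIV. b i * ln (b i)) + (\<Sum>i\<in>UNIV. ln (b i)) / 2 - M"
      unfolding lf rn(2)[symmetric] by (simp add: algebra_simps sum.distrib sum_subtractf sum_divide_distrib)
    ultimately show ?thesis unfolding L_def lf[of M] lf[of N]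
      by (simp add: algebra_simps sum_subtractf sum_divide_distrib[symmetric] diff_divide_distrib)
  qed
  moreover have "s M - s N \<le> 1 / 2"
    using stirling_error_bounds[OF Mpos] stirling_error_bounds[OF N] unfolding s_def by linarith
  moreover have "(\<Sum>i\<in>UNIV. s (n i) - s (b i)) \<le> real CARD('k) / 2"
  proof -
    have "s (n i) - s (b i) \<le> 1 / 2" for i
      using stirling_error_bounds[OF npos[of i]] stirling_error_bounds[OF bpos[of i]] unfolding s_def by linarith
    then show ?thesis using sum_bounded_above[of UNIV "\<lambda>i. s (n i) - s (b i)" "1 / 2"] by simp
  qed
  moreover have "(ln M - ln N) / 2 \<le> 0" using Mpos MN by simp
  \<comment> \<open>Here every remaining cell must be of order \<open>N\<close>: then
    \<open>n i / b i\<close> is at most \<open>1 / c\<close>.\<close>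
  moreover have "(\<Sum>i\<in>UNIV. (ln (n i) - ln (b i)) / 2) \<le> real CARD('k) * \<bar>ln c\<bar> / 2"
  proof -
    have "(ln (n i) - ln (b i)) / 2 \<le> \<bar>ln c\<bar> / 2" for i
    proof -
      have "n i \<le> N" unfolding n[symmetric] by (rule member_le_sum) auto
      then have "ln (n i) \<le> ln N" using npos[of i] by simp
      moreover have "ln c + ln N \<le> ln (b i)"
      proof -
        have "ln c + ln N = ln (c * N)" using c N by (simp add: ln_mult)
        moreover have "0 < c * N" using c N by simp
        ultimately show ?thesis using b(2)[of i] by simp
      qed
      ultimately show ?thesis using abs_ge_minus_self[of "ln c"] by simp
    qed
    then show ?thesis using sum_bounded_above[of UNIV "\<lambda>i. (ln (n i) - ln (b i)) / 2" "\<bar>ln c\<bar> / 2"] by simp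
  qed
  moreover have "(\<Sum>i\<in>UNIV. b i * (ln M + ln (p i) - ln (b i))) \<le> 0"
  proof -
    have "b i * (ln M + ln (p i) - ln (b i)) \<le> M * p i - b i" for i
    proof -
      have "ln M + ln (p i) - ln (b i) = ln (M * p i / b i)"
        using Mpos p(1)[of i] bpos[of i] by (simp add: ln_mult ln_div)
      also have "\<dots> \<le> M * p i / b i - 1" using Mpos p(1)[of i] bpos[of i] by (intro ln_le_minus_one) simp
      finally have "b i * (ln M + ln (p i) - ln (b i)) \<le> b i * (M * p i / b i - 1)" by (intro mult_left_mono) auto
      also have "\<dots> = M * p i - b i" using bpos[of i] by (simp add: field_simps)
      finally show ?thesis .
    qed
    then have "(\<Sum>i\<in>UNIV. b i * (ln M + ln (p i) - ln (b i))) \<le> (\<Sum>i\<in>UNIV. M * p i - b i)" by (intro sum_mono)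
    also have "\<dots> = 0" using rn p(2) by (simp add: sum_subtractf sum_distrib_left[symmetric])
    finally show ?thesis .
  qed
  moreover have "(\<Sum>i\<in>UNIV. n i * (ln (n i) - ln N - ln (p i))) \<le> (\<Sum>i\<in>UNIV. D\<^sup>2 / p i)"
  proof -
    have "n i * (ln (n i) - ln N - ln (p i)) \<le> D\<^sup>2 / p i + (n i - N * p i)" for i
    proof -
      define q where "q = n i / N"
      have q: "n i = N * q" "0 < q" using N npos[of i] by (simp_all add: q_def)
      have "ln (n i) - ln N - ln (p i) = ln (q / p i)"
        using N p(1)[of i] npos[of i] by (simp add: q_def ln_mult ln_div)
      also have "\<dots> \<le> q / p i - 1" using q p(1)[of i] by (intro ln_le_minus_one) simp
      finally have "n i * (ln (n i) - ln N - ln (p i)) \<le> n i * (q / p i - 1)" by (intro mult_left_mono) auto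
      \<comment> \<open>The product \<open>q * (q - p i)\<close> is the square of
        \<open>q - p i\<close> plus \<open>p i * (q - p i)\<close>; multiplied by
        \<open>N / p i\<close>, the latter sums to zero over the labels.\<close>
      also have "\<dots> = N * (q - p i)\<^sup>2 / p i + (n i - N * p i)"
        unfolding q(1) using p(1)[of i] by (simp add: field_simps power2_eq_square)
      also have "N * (q - p i)\<^sup>2 / p i \<le> D\<^sup>2 / p i"
      proof -
        have "\<bar>q - p i\<bar> ^ 2 \<le> (D / sqrt N) ^ 2" using D[of i] by (intro power_mono) (simp_all add: q_def)
        then have "N * (q - p i)\<^sup>2 \<le> D\<^sup>2" using N by (simp add: power_divide field_simps)
        then show ?thesis using p(1)[of i] by (simp add: divide_right_mono)
      qed
      finally show ?thesis by simp
    qed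
    then have "(\<Sum>i\<in>UNIV. n i * (ln (n i) - ln N - ln (p i))) \<le> (\<Sum>i\<in>UNIV. D\<^sup>2 / p i + (n i - N * p i))" by (intro sum_mono)
    also have "\<dots> = (\<Sum>i\<in>UNIV. D\<^sup>2 / p i)" using rn p(2) by (simp add: sum.distrib sum_subtractf sum_distrib_left[symmetric])
    finally show ?thesis .
  qed
  ultimately have L: "L \<le> (real CARD('k) + 1) / 2 + (\<Sum>i\<in>UNIV. D\<^sup>2 / p i) + real CARD('k) * \<bar>ln c\<bar> / 2"
    by (simp add: field_simps)
  have e1: "exp (\<Sum>i\<in>UNIV. ln (fact (m i) :: real)) = (\<Prod>i\<in>UNIV. fact (m i))" for m :: "'k \<Rightarrow> nat"
    by (simp add: exp_sum)
  have e2: "exp (\<Sum>i\<in>UNIV. real (n i - b i) * ln (p i)) = (\<Prod>i\<in>UNIV. p i ^ (n i - b i))"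
    using p(1) by (simp add: exp_sum exp_of_nat_mult)
  have "exp L = fact M * (\<Prod>i\<in>UNIV. fact (n i)) / ((\<Prod>i\<in>UNIV. fact (b i)) * fact N) / (\<Prod>i\<in>UNIV. p i ^ (n i - b i))"
    unfolding L_def exp_diff exp_add e1 e2 by simp
  then have "fact M * (\<Prod>i\<in>UNIV. fact (n i)) / ((\<Prod>i\<in>UNIV. fact (b i)) * fact N) = exp L * (\<Prod>i\<in>UNIV. p i ^ (n i - b i))"
    using p(1) by (simp add: prod_zero_iff less_imp_neq[symmetric])
  also have "\<dots> \<le> exp ((real CARD('k) + 1) / 2 + (\<Sum>i\<in>UNIV. D\<^sup>2 / p i) + real CARD('k) * \<bar>ln c\<bar> / 2) * (\<Prod>i\<in>UNIV. p i ^ (n i - b i))"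
    using L p(1) by (intro mult_right_mono prod_nonneg) (auto intro: less_imp_le)
  finally show ?thesis .
qed

section \<open>Label sequences and mixtures\<close>

text \<open>Coordinates chosen along an injection are again independent. Below, \<open>e\<close> is
  either a map between row positions or the map that picks from an array of values the one with the
  prescribed label.\<close>

lemma integral_PiM_reindex:
  fixes f :: "_ \<Rightarrow> 'b::{banach,second_countable_topology}"
  assumes M: "\<And>i. i \<in> K \<Longrightarrow> prob_space (M i)" and e: "inj_on e I" "e \<in> I \<rightarrow> K"
    and f: "f \<in> borel_measurable (PiM I (\<lambda>i. M (e i)))"
  shows "(\<integral>x. f (\<lambda>i\<in>I. x (e i)) \<partial>PiM K M) = (\<integral>x. f x \<partial>PiM I (\<lambda>i. M (e i)))"
proof -
  have [measurable]: "(\<lambda>x. \<lambda>i\<in>I. x (e i)) \<in> PiM K M \<rightarrow>\<^sub>M PiM I (\<lambda>i. M (e i))"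
    using e by (intro measurable_restrict measurable_component_singleton) auto
  have "(\<integral>x. f x \<partial>PiM I (\<lambda>i. M (e i))) = (\<integral>x. f x \<partial>distr (PiM K M) (PiM I (\<lambda>i. M (e i))) (\<lambda>x. \<lambda>i\<in>I. x (e i)))"
    by (simp only: distr_PiM_reindex[of K M, OF M e])
  also have "\<dots> = (\<integral>x. f (\<lambda>i\<in>I. x (e i)) \<partial>PiM K M)" by (rule integral_distr) (use f in simp_all)
  finally show ?thesis by simp
qed

lemma measure_PiM_reindex:
  assumes M: "\<And>i. i \<in> K \<Longrightarrow> prob_space (M i)" and e: "inj_on e I" "e \<in> I \<rightarrow> K"
    and A: "A \<in> sets (PiM I (\<lambda>i. M (e i)))"
  shows "measure (PiM K M) {x \<in> space (PiM K M). (\<lambda>i\<in>I. x (e i)) \<in> A} = measure (PiM I (\<lambda>i. M (e i))) A"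
proof -
  have [measurable]: "(\<lambda>x. \<lambda>i\<in>I. x (e i)) \<in> PiM K M \<rightarrow>\<^sub>M PiM I (\<lambda>i. M (e i))"
    using e by (intro measurable_restrict measurable_component_singleton) auto
  have "measure (PiM I (\<lambda>i. M (e i))) A = measure (distr (PiM K M) (PiM I (\<lambda>i. M (e i))) (\<lambda>x. \<lambda>i\<in>I. x (e i))) A"
    by (simp only: distr_PiM_reindex[of K M, OF M e])
  also have "\<dots> = measure (PiM K M) ((\<lambda>x. \<lambda>i\<in>I. x (e i)) -` A \<inter> space (PiM K M))"
    by (rule measure_distr) (use A in simp_all)
  also have "(\<lambda>x. \<lambda>i\<in>I. x (e i)) -` A \<inter> space (PiM K M) = {x \<in> space (PiM K M). (\<lambda>i\<in>I. x (e i)) \<in> A}" by auto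
  finally show ?thesis by simp
qed

lemma PiM_second_moment:
  fixes g :: "nat \<Rightarrow> 'a \<Rightarrow> real"
  assumes M: "\<And>j. prob_space (M j)" and fin: "finite I"
    and g [measurable]: "\<And>j. g j \<in> borel_measurable (M j)" and sq: "\<And>j. integrable (M j) (\<lambda>x. (g j x)\<^sup>2)"
    and mean: "\<And>j. (\<integral>x. g j x \<partial>M j) = 0"
  shows "integrable (PiM I M) (\<lambda>x. (\<Sum>j\<in>I. g j (x j))\<^sup>2)"
    and "(\<integral>x. (\<Sum>j\<in>I. g j (x j))\<^sup>2 \<partial>PiM I M) = (\<Sum>j\<in>I. \<integral>x. (g j x)\<^sup>2 \<partial>M j)"
proof -
  interpret product_prob_space M by (intro product_prob_spaceI M)
  have ig: "integrable (M j) (g j)" for j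
    by (rule finite_measure.square_integrable_imp_integrable[OF prob_space.axioms(1)[OF M] g sq])
  have pm: "measure (M j) (space (M j)) = 1" for j using M prob_space.prob_space by blast
  have pair: "integrable (PiM I M) (\<lambda>x. g a (x a) * g b (x b)) \<and>
     (\<integral>x. g a (x a) * g b (x b) \<partial>PiM I M) = (if a = b then \<integral>x. (g a x)\<^sup>2 \<partial>M a else 0)" if ab: "a \<in> I" "b \<in> I" for a b
  proof (cases "a = b")
    case True
    \<comment> \<open>Padding with factors 1 writes the two-coordinate product as a product over all
      of \<open>I\<close>, so that its integral factorises.\<close>
    define F where "F j x = (if j = a then (g a x)\<^sup>2 else 1)" for j x
    have iF: "integrable (M j) (F j)" for j unfolding F_def using sq
      by (cases "j = a") (auto intro!: finite_measure.integrable_const prob_space.axioms(1)[OF M])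
    have eq: "(\<Prod>j\<in>I. F j (x j)) = g a (x a) * g b (x b)" for x
      using ab fin True by (simp add: F_def prod.delta power2_eq_square)
    have "(\<Prod>j\<in>I. \<integral>x. F j x \<partial>M j) = (\<Prod>j\<in>I. if j = a then \<integral>x. (g a x)\<^sup>2 \<partial>M a else 1)"
      by (intro prod.cong refl) (simp add: F_def pm)
    then have "(\<Prod>j\<in>I. \<integral>x. F j x \<partial>M j) = (\<integral>x. (g a x)\<^sup>2 \<partial>M a)" using ab fin by (simp add: prod.delta)
    then show ?thesis
      using product_integral_prod[OF fin iF] product_integrable_prod[OF fin iF] True by (simp add: eq)
  next
    case False
    define F where "F j x = (if j \<in> {a, b} then g j x else 1)" for j x
    have iF: "integrable (M j) (F j)" for j unfolding F_def using ig
      by (cases "j \<in> {a, b}") (auto intro!: finite_measure.integrable_const prob_space.axioms(1)[OF M])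
    have eq: "(\<Prod>j\<in>I. F j (x j)) = g a (x a) * g b (x b)" for x
    proof -
      have "(\<Prod>j\<in>I. F j (x j)) = (\<Prod>j\<in>I \<inter> {a, b}. g j (x j))"
        unfolding F_def by (rule prod.inter_restrict[OF fin, symmetric])
      also have "I \<inter> {a, b} = {a, b}" using ab by auto
      finally show ?thesis using False by simp
    qed
    have "(\<integral>x. F a x \<partial>M a) = 0" by (simp add: F_def mean)
    then have "(\<Prod>j\<in>I. \<integral>x. F j x \<partial>M j) = 0" using ab fin by auto
    then show ?thesis
      using product_integral_prod[OF fin iF] product_integrable_prod[OF fin iF] False by (simp add: eq)
  qed
  have sq_eq: "(\<Sum>j\<in>I. g j (x j))\<^sup>2 = (\<Sum>a\<in>I. \<Sum>b\<in>I. g a (x a) * g b (x b))" for x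
    by (simp add: power2_eq_square sum_product)
  show "integrable (PiM I M) (\<lambda>x. (\<Sum>j\<in>I. g j (x j))\<^sup>2)"
    unfolding sq_eq using pair by (intro Bochner_Integration.integrable_sum) auto
  have "(\<integral>x. (\<Sum>j\<in>I. g j (x j))\<^sup>2 \<partial>PiM I M) = (\<Sum>a\<in>I. \<Sum>b\<in>I. \<integral>x. g a (x a) * g b (x b) \<partial>PiM I M)"
    unfolding sq_eq using pair
    by (simp add: Bochner_Integration.integral_sum)
  also have "\<dots> = (\<Sum>a\<in>I. \<Sum>b\<in>I. if a = b then \<integral>x. (g a x)\<^sup>2 \<partial>M a else 0)"
    using pair by (intro sum.cong refl) auto
  also have "\<dots> = (\<Sum>j\<in>I. \<integral>x. (g j x)\<^sup>2 \<partial>M j)" using fin by simp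
  finally show "(\<integral>x. (\<Sum>j\<in>I. g j (x j))\<^sup>2 \<partial>PiM I M) = (\<Sum>j\<in>I. \<integral>x. (g j x)\<^sup>2 \<partial>M j)" .
qed

locale prob_vector =
  fixes p :: "'k::finite \<Rightarrow> real"
  assumes p_pos: "\<And>i. 0 < p i" and p_sum: "(\<Sum>i\<in>UNIV. p i) = 1"
begin

definition label_weight :: "nat \<Rightarrow> (nat \<Rightarrow> 'k) \<Rightarrow> real" where
  "label_weight n L = (\<Prod>j<n. p (L j))"

abbreviation label_seqs :: "nat \<Rightarrow> (nat \<Rightarrow> 'k) set" where
  "label_seqs n \<equiv> {..<n} \<rightarrow>\<^sub>E UNIV"

lemma finite_label_seqs: "finite (label_seqs n)"
  by (intro finite_PiE) auto

lemma label_weight_nonneg [simp]: "0 \<le> label_weight n L"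
  unfolding label_weight_def by (intro prod_nonneg) (auto intro: less_imp_le p_pos)

lemma p_le_1: "p i \<le> 1"
  using member_le_sum[of i UNIV p] p_sum p_pos by (auto intro: less_imp_le)

lemma label_expectation_prod:
  "(\<Sum>L\<in>label_seqs n. label_weight n L * (\<Prod>j<n. h j (L j))) = (\<Prod>j<n. \<Sum>i\<in>UNIV. p i * (h j i :: real))"
  unfolding label_weight_def prod.distrib[symmetric]
  by (subst prod_sum_PiE) simp_all

lemma label_weight_sum: "(\<Sum>L\<in>label_seqs n. label_weight n L) = 1"
  using label_expectation_prod[where h="\<lambda>_ _. 1"] by (simp add: p_sum)

text \<open>Independence and centring remove the mixed terms, so only \<open>n\<close> diagonal
  terms of size at most 1 remain.\<close>

lemma label_second_moment:
  fixes y :: "'k \<Rightarrow> real"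
  assumes mean: "(\<Sum>i\<in>UNIV. p i * y i) = 0" and bound: "\<And>i. \<bar>y i\<bar> \<le> 1"
  shows "(\<Sum>L\<in>label_seqs n. label_weight n L * (\<Sum>j<n. y (L j))\<^sup>2) \<le> real n"
proof -
  have pair: "(\<Sum>L\<in>label_seqs n. label_weight n L * (y (L a) * y (L b))) \<le> (if a = b then 1 else 0)"
    if ab: "a < n" "b < n" for a b
  proof (cases "a = b")
    case True
    have "y i * y i \<le> 1" for i using bound[of i] by (metis abs_le_square_iff abs_one one_power2 power2_eq_square)
    then have "(\<Sum>L\<in>label_seqs n. label_weight n L * (y (L a) * y (L b))) \<le> (\<Sum>L\<in>label_seqs n. label_weight n L * 1)"
      unfolding True by (intro sum_mono mult_left_mono) auto
    then show ?thesis using True label_weight_sum by simp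
  next
    case False
    define h where "h j i = (if j \<in> {a, b} then y i else 1)" for j :: nat and i
    have h_eq: "(\<Prod>j<n. h j (L j)) = y (L a) * y (L b)" for L
    proof -
      have "(\<Prod>j<n. h j (L j)) = (\<Prod>j\<in>{..<n} \<inter> {a, b}. y (L j))"
        unfolding h_def by (rule prod.inter_restrict[symmetric]) simp
      also have "{..<n} \<inter> {a, b} = {a, b}" using ab by auto
      finally show ?thesis using False by simp
    qed
    have h_zero: "(\<Prod>j<n. \<Sum>i\<in>UNIV. p i * h j i) = 0"
    proof (rule prod_zero)
      show "\<exists>j\<in>{..<n}. (\<Sum>i\<in>UNIV. p i * h j i) = 0"
        using ab mean by (intro bexI[of _ a]) (simp_all add: h_def)
    qed simp
    have "(\<Sum>L\<in>label_seqs n. label_weight n L * (y (L a) * y (L b))) = 0"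
      unfolding h_eq[symmetric] label_expectation_prod h_zero ..
    then show ?thesis using False by simp
  qed
  have "(\<Sum>L\<in>label_seqs n. label_weight n L * (\<Sum>j<n. y (L j))\<^sup>2) =
     (\<Sum>L\<in>label_seqs n. \<Sum>a<n. \<Sum>b<n. label_weight n L * (y (L a) * y (L b)))"
    by (simp only: power2_eq_square sum_product) (simp only: sum_distrib_left)
  also have "\<dots> = (\<Sum>a<n. \<Sum>b<n. \<Sum>L\<in>label_seqs n. label_weight n L * (y (L a) * y (L b)))"
    by (subst sum.swap, rule sum.cong[OF refl], rule sum.swap)
  also have "\<dots> \<le> (\<Sum>a<n. \<Sum>b<n. if a = b then 1 else 0)" using pair by (intro sum_mono) auto
  also have "\<dots> = real n" by simp
  finally show ?thesis .
qed

end

section \<open>Mixtures and randomly labelled samples\<close>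

locale mixture_model = prob_vector p for p :: "'k::finite \<Rightarrow> real" +
  fixes P :: "'k \<Rightarrow> 'a::topological_space measure"
  assumes P_prob: "\<And>i. prob_space (P i)" and P_sets [measurable_cong]: "\<And>i. sets (P i) = sets borel"
begin

lemma P_space [simp]: "space (P i) = UNIV"
  using sets_eq_imp_space_eq[OF P_sets] by simp

lemma sets_mixture [simp, measurable_cong]: "sets (mixture p P) = sets borel"
  using sets.sigma_sets_eq[of borel] by (simp add: mixture_def)

lemma space_mixture [simp]: "space (mixture p P) = UNIV"
  by (simp add: mixture_def space_measure_of_conv)

lemma emeasure_mixture:
  assumes "A \<in> sets borel"
  shows "emeasure (mixture p P) A = (\<Sum>i\<in>UNIV. ennreal (p i) * emeasure (P i) A)"
  unfolding mixture_def
proof (rule emeasure_measure_of_sigma)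
  show "sigma_algebra UNIV (sets (borel :: 'a measure))"
    using sets.sigma_algebra_axioms[of "borel :: 'a measure"] by simp
  show "positive (sets borel) (\<lambda>A. \<Sum>i\<in>UNIV. ennreal (p i) * emeasure (P i) A)"
    by (simp add: positive_def)
  show "countably_additive (sets borel) (\<lambda>A. \<Sum>i\<in>UNIV. ennreal (p i) * emeasure (P i) A)"
  proof (rule countably_additiveI)
    fix A :: "nat \<Rightarrow> 'a set" assume A: "range A \<subseteq> sets borel" "disjoint_family A"
    have "(\<Sum>n. \<Sum>i\<in>UNIV. ennreal (p i) * emeasure (P i) (A n)) = (\<Sum>i\<in>UNIV. \<Sum>n. ennreal (p i) * emeasure (P i) (A n))"
      by (rule suminf_sum) simp
    also have "\<dots> = (\<Sum>i\<in>UNIV. ennreal (p i) * emeasure (P i) (\<Union>n. A n))"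
      using A by (intro sum.cong refl) (simp add: ennreal_suminf_cmult suminf_emeasure P_sets)
    finally show "(\<Sum>n. \<Sum>i\<in>UNIV. ennreal (p i) * emeasure (P i) (A n)) = (\<Sum>i\<in>UNIV. ennreal (p i) * emeasure (P i) (\<Union> (range A)))" .
  qed
qed (rule assms)

lemma prob_space_mixture: "prob_space (mixture p P)"
proof
  have "emeasure (mixture p P) UNIV = (\<Sum>i\<in>UNIV. ennreal (p i) * emeasure (P i) UNIV)"
    by (rule emeasure_mixture) simp
  also have "\<dots> = (\<Sum>i\<in>UNIV. ennreal (p i))"
    using prob_space.emeasure_space_1[OF P_prob] by simp
  also have "\<dots> = 1" using p_sum p_pos by (subst sum_ennreal) (auto intro: less_imp_le)
  finally show "emeasure (mixture p P) (space (mixture p P)) = 1" by simp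
qed

text \<open>The mixture dominates \<open>p i\<close> times \<open>P i\<close> as a measure. Since
  \<open>p i\<close> is positive, integrability under the mixture is inherited by each
  component.\<close>

lemma nn_integral_component_le_mixture:
  assumes [measurable]: "f \<in> borel_measurable borel"
  shows "ennreal (p i) * (\<integral>\<^sup>+x. f x \<partial>P i) \<le> (\<integral>\<^sup>+x. f x \<partial>mixture p P)"
proof -
  have "scale_measure (ennreal (p i)) (P i) \<le> mixture p P"
    unfolding le_measure[of "scale_measure (ennreal (p i)) (P i)" "mixture p P", simplified P_sets sets_mixture sets_scale_measure, OF refl]
  proof
    fix A :: "'a set" assume "A \<in> sets borel"
    then show "emeasure (scale_measure (ennreal (p i)) (P i)) A \<le> emeasure (mixture p P) A"
      using member_le_sum[of i UNIV "\<lambda>i. ennreal (p i) * emeasure (P i) A"] by (simp add: emeasure_mixture)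
  qed
  then have "(\<integral>\<^sup>+x. f x \<partial>scale_measure (ennreal (p i)) (P i)) \<le> (\<integral>\<^sup>+x. f x \<partial>mixture p P)"
    by (intro nn_integral_mono_measure) (simp_all add: P_sets)
  then show ?thesis by (simp add: nn_integral_scale_measure)
qed

lemma integrable_component:
  fixes f :: "'a \<Rightarrow> real"
  assumes f: "integrable (mixture p P) f"
  shows "integrable (P i) f"
proof (rule integrableI_bounded)
  have [measurable]: "f \<in> borel_measurable borel" using f by (auto simp: measurable_cong_sets[OF sets_mixture refl] dest: borel_measurable_integrable)
  show "f \<in> borel_measurable (P i)" by measurable
  have "ennreal (p i) * (\<integral>\<^sup>+x. norm (f x) \<partial>P i) \<le> (\<integral>\<^sup>+x. norm (f x) \<partial>mixture p P)"
    by (rule nn_integral_component_le_mixture) measurable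
  also have "\<dots> < \<infinity>" using f by (simp add: integrable_iff_bounded)
  finally show "(\<integral>\<^sup>+x. norm (f x) \<partial>P i) < \<infinity>"
    using p_pos[of i] by (auto simp: ennreal_mult_less_top)
qed

lemma sets_PiM_labels [simp]: "sets (PiM I (\<lambda>j. P (L j))) = sets (PiM I (\<lambda>_. borel))"
  by (intro sets_PiM_cong refl P_sets)

lemma sets_PiM_mixture [simp]: "sets (PiM I (\<lambda>j. mixture p P)) = sets (PiM I (\<lambda>_. borel))"
  by (intro sets_PiM_cong refl sets_mixture)

text \<open>An i.i.d. sample from the mixture arises by drawing i.i.d. labels and then, given the
  labels, independent rows. To realise this on a product space, \<open>U\<close> holds a value for
  every position and every label, and \<open>T\<close> selects along the label sequence. That
  \<open>T\<close> has the right law is checked on rectangles, where the sum over label sequences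
  becomes a product of mixture probabilities.\<close>

lemma iid_mixture_integral:
  fixes f :: "(nat \<Rightarrow> 'a) \<Rightarrow> 'b::{banach,second_countable_topology}"
  assumes f: "f \<in> borel_measurable (PiM {..<n} (\<lambda>_. borel))" and B: "\<And>x. norm (f x) \<le> B"
  shows "(\<integral>x. f x \<partial>iid n (mixture p P)) =
    (\<Sum>L\<in>label_seqs n. label_weight n L *\<^sub>R (\<integral>x. f x \<partial>PiM {..<n} (\<lambda>j. P (L j))))"
proof -
  let ?K = "{..<n} \<times> (UNIV :: 'k set)"
  define \<Lambda> where "\<Lambda> = point_measure (label_seqs n) (\<lambda>L. ennreal (label_weight n L))"
  define U where "U = PiM ?K (\<lambda>ji. P (snd ji))"
  define T where "T = (\<lambda>(L, u). \<lambda>j\<in>{..<n}. (u :: nat \<times> 'k \<Rightarrow> 'a) (j, L j))"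
  have \<Lambda>_prob: "prob_space \<Lambda>"
    unfolding \<Lambda>_def using label_weight_sum finite_label_seqs
    by (intro prob_spaceI) (simp add: space_point_measure emeasure_point_measure_finite sum_ennreal)
  have U_prob: "prob_space U" unfolding U_def by (intro prob_space_PiM P_prob)
  interpret \<Lambda>: prob_space \<Lambda> by (rule \<Lambda>_prob)
  interpret U: prob_space U by (rule U_prob)
  interpret LU: pair_prob_space \<Lambda> U ..
  have [measurable_cong]: "sets \<Lambda> = sets (count_space (label_seqs n))"
    by (simp add: \<Lambda>_def sets_point_measure)
  have T_L [measurable]: "(\<lambda>u. T (L, u)) \<in> U \<rightarrow>\<^sub>M PiM {..<n} (\<lambda>_. borel)" for L
    unfolding T_def U_def split
  proof (rule measurable_restrict)
    fix j assume "j \<in> {..<n}"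
    then have "(\<lambda>u. u (j, L j)) \<in> PiM ?K (\<lambda>ji. P (snd ji)) \<rightarrow>\<^sub>M P (snd (j, L j))"
      by (intro measurable_component_singleton) auto
    then show "(\<lambda>u. u (j, L j)) \<in> PiM ?K (\<lambda>ji. P (snd ji)) \<rightarrow>\<^sub>M borel"
      by (simp add: measurable_cong_sets[OF refl P_sets])
  qed
  have T: "T \<in> \<Lambda> \<Otimes>\<^sub>M U \<rightarrow>\<^sub>M PiM {..<n} (\<lambda>_. borel)"
  proof -
    have "T \<in> count_space (label_seqs n) \<Otimes>\<^sub>M U \<rightarrow>\<^sub>M PiM {..<n} (\<lambda>_. borel)"
      by (rule measurable_pair_measure_countable1) (auto intro: countable_finite finite_label_seqs T_L)
    then show ?thesis by (rule measurable_cong_sets[THEN equalityD1, THEN subsetD, rotated -1]) (auto intro!: sets_pair_measure_cong simp: \<Lambda>_def sets_point_measure)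
  qed
  have inj: "inj_on (\<lambda>j. (j, L j)) {..<n}" "(\<lambda>j. (j, L j)) \<in> {..<n} \<rightarrow> ?K" for L :: "nat \<Rightarrow> 'k"
    by (auto intro: inj_onI)
  have distr_L: "distr U (PiM {..<n} (\<lambda>j. P (L j))) (\<lambda>u. T (L, u)) = PiM {..<n} (\<lambda>j. P (L j))" for L
    using distr_PiM_reindex[OF _ inj, of "\<lambda>ji. P (snd ji)" L] P_prob by (simp add: U_def T_def)
  have "distr (\<Lambda> \<Otimes>\<^sub>M U) (PiM {..<n} (\<lambda>_. borel)) T = PiM {..<n} (\<lambda>_. mixture p P)"
  proof (rule product_sigma_finite.PiM_eqI)
    show "product_sigma_finite (\<lambda>_. mixture p P)"
      by (rule product_sigma_finite.intro) (intro prob_space_imp_sigma_finite prob_space_mixture)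
    fix A :: "nat \<Rightarrow> 'a set" assume "\<And>i. i \<in> {..<n} \<Longrightarrow> A i \<in> sets (mixture p P)"
    then have A: "A i \<in> sets borel" if "i < n" for i using that by simp
    then have PA: "Pi\<^sub>E {..<n} A \<in> sets (PiM {..<n} (\<lambda>_. borel))" by (intro sets_PiM_I_finite) auto
    have "emeasure (distr (\<Lambda> \<Otimes>\<^sub>M U) (PiM {..<n} (\<lambda>_. borel)) T) (Pi\<^sub>E {..<n} A) =
       emeasure (\<Lambda> \<Otimes>\<^sub>M U) (T -` Pi\<^sub>E {..<n} A \<inter> space (\<Lambda> \<Otimes>\<^sub>M U))"
      by (rule emeasure_distr[OF T PA])
    also have "\<dots> = (\<integral>\<^sup>+L. emeasure U (Pair L -` (T -` Pi\<^sub>E {..<n} A \<inter> space (\<Lambda> \<Otimes>\<^sub>M U))) \<partial>\<Lambda>)"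
      by (rule U.emeasure_pair_measure_alt[OF measurable_sets[OF T PA]])
    also have "\<dots> = (\<integral>\<^sup>+L. (\<Prod>j<n. emeasure (P (L j)) (A j)) \<partial>\<Lambda>)"
    proof (rule nn_integral_cong)
      fix L assume L: "L \<in> space \<Lambda>"
      interpret PL: product_prob_space "\<lambda>j. P (L j)" by (intro product_prob_spaceI P_prob)
      have "Pair L -` (T -` Pi\<^sub>E {..<n} A \<inter> space (\<Lambda> \<Otimes>\<^sub>M U)) = (\<lambda>u. T (L, u)) -` Pi\<^sub>E {..<n} A \<inter> space U"
        using L by (auto simp: space_pair_measure)
      also have "emeasure U \<dots> = emeasure (distr U (PiM {..<n} (\<lambda>j. P (L j))) (\<lambda>u. T (L, u))) (Pi\<^sub>E {..<n} A)"
        using T_L[of L] PA by (subst emeasure_distr) (simp_all add: measurable_cong_sets[OF refl sets_PiM_labels])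
      also have "\<dots> = (\<Prod>j<n. emeasure (P (L j)) (A j))"
        unfolding distr_L by (rule PL.emeasure_PiM) (use A P_sets in auto)
      finally show "emeasure U (Pair L -` (T -` Pi\<^sub>E {..<n} A \<inter> space (\<Lambda> \<Otimes>\<^sub>M U))) = (\<Prod>j<n. emeasure (P (L j)) (A j))" .
    qed
    also have "\<dots> = (\<Sum>L\<in>label_seqs n. ennreal (label_weight n L) * (\<Prod>j<n. emeasure (P (L j)) (A j)))"
      unfolding \<Lambda>_def by (rule nn_integral_point_measure_finite) (auto intro: finite_label_seqs)
    also have "\<dots> = (\<Sum>L\<in>label_seqs n. (\<Prod>j<n. ennreal (p (L j)) * emeasure (P (L j)) (A j)))"
      unfolding label_weight_def prod.distrib using p_pos
      by (subst prod_ennreal) (auto intro: less_imp_le)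
    also have "\<dots> = (\<Prod>j<n. \<Sum>i\<in>UNIV. ennreal (p i) * emeasure (P i) (A j))"
      by (subst prod_sum_PiE) simp_all
    also have "\<dots> = (\<Prod>j<n. emeasure (mixture p P) (A j))"
      using A by (intro prod.cong refl) (simp add: emeasure_mixture)
    finally show "emeasure (distr (\<Lambda> \<Otimes>\<^sub>M U) (PiM {..<n} (\<lambda>_. borel)) T) (Pi\<^sub>E {..<n} A) = (\<Prod>j<n. emeasure (mixture p P) (A j))" .
  qed simp_all
  then have "(\<integral>x. f x \<partial>iid n (mixture p P)) = (\<integral>x. f x \<partial>distr (\<Lambda> \<Otimes>\<^sub>M U) (PiM {..<n} (\<lambda>_. borel)) T)"
    by (simp add: iid_def)
  also have "\<dots> = (\<integral>x. f (T x) \<partial>(\<Lambda> \<Otimes>\<^sub>M U))" by (rule integral_distr[OF T f])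
  also have "\<dots> = (\<integral>L. (\<integral>u. f (T (L, u)) \<partial>U) \<partial>\<Lambda>)"
  proof (rule LU.integral_fst'[symmetric])
    show "integrable (\<Lambda> \<Otimes>\<^sub>M U) (\<lambda>x. f (T x))"
      using measurable_compose[OF T f] B by (intro LU.integrable_const_bound[where B=B]) auto
  qed
  also have "\<dots> = (\<Sum>L\<in>label_seqs n. label_weight n L *\<^sub>R (\<integral>u. f (T (L, u)) \<partial>U))"
    unfolding \<Lambda>_def by (rule lebesgue_integral_point_measure_finite) (auto intro: finite_label_seqs)
  also have "\<dots> = (\<Sum>L\<in>label_seqs n. label_weight n L *\<^sub>R (\<integral>x. f x \<partial>PiM {..<n} (\<lambda>j. P (L j))))"
  proof (intro sum.cong refl arg_cong2[where f=scaleR])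
    fix L :: "nat \<Rightarrow> 'k"
    have "(\<integral>x. f x \<partial>PiM {..<n} (\<lambda>j. P (L j))) = (\<integral>x. f x \<partial>distr U (PiM {..<n} (\<lambda>j. P (L j))) (\<lambda>u. T (L, u)))"
      by (simp only: distr_L)
    also have "\<dots> = (\<integral>u. f (T (L, u)) \<partial>U)"
      using T_L[of L] f by (subst integral_distr) (simp_all add: measurable_cong_sets[OF refl sets_PiM_labels] measurable_cong_sets[OF sets_PiM_labels refl])
    finally show "(\<integral>u. f (T (L, u)) \<partial>U) = (\<integral>x. f x \<partial>PiM {..<n} (\<lambda>j. P (L j)))" by simp
  qed
  finally show ?thesis .
qed

end

section \<open>Contiguity of permuted blocks\<close>

locale k_samples = mixture_model p P
  for p :: "'k::{finite,linorder} \<Rightarrow> real" and P :: "'k \<Rightarrow> 'a::topological_space measure" +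
  fixes N :: "nat \<Rightarrow> 'k \<Rightarrow> nat"
  assumes N_sum: "\<And>n. (\<Sum>i\<in>UNIV. N n i) = n"
    and N_lim: "\<And>i. (\<lambda>n. real (N n i) / real n) \<longlonglongrightarrow> p i"
    and p_lt1: "\<And>i. p i < 1"
    and N_rate: "\<And>i. (\<lambda>n. real (N n i) / real n - p i) \<in> O(\<lambda>n. 1 / sqrt (real n))"
begin

lemma N_le: "N n i \<le> n"
  using member_le_sum[of i UNIV "N n"] N_sum[of n] by simp

lemma blk_start_add_le: "i < i' \<Longrightarrow> blk_start N n i + N n i \<le> blk_start N n i'"
proof -
  assume "i < i'"
  have "blk_start N n i + N n i = (\<Sum>i'\<in>insert i {i'. i' < i}. N n i')"
    by (simp add: blk_start_def)
  also have "\<dots> \<le> blk_start N n i'"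
    unfolding blk_start_def using \<open>i < i'\<close> by (intro sum_mono2) auto
  finally show ?thesis .
qed

lemma blk_end_le: "blk_start N n i + N n i \<le> n"
proof -
  have "blk_start N n i + N n i = (\<Sum>i'\<in>insert i {i'. i' < i}. N n i')"
    by (simp add: blk_start_def)
  also have "\<dots> \<le> (\<Sum>i\<in>UNIV. N n i)" by (intro sum_mono2) auto
  finally show ?thesis by (simp add: N_sum)
qed

lemma blk_disjoint: "i \<noteq> i' \<Longrightarrow> blk N n i \<inter> blk N n i' = {}"
  using blk_start_add_le[of i i' n] blk_start_add_le[of i' i n]
  by (cases i i' rule: linorder_cases) (auto simp: blk_def)

lemma blk_subset: "blk N n i \<subseteq> {..<n}"
  using blk_end_le[of n i] by (auto simp: blk_def)

lemma blk_cover: "(\<Union>i. blk N n i) = {..<n}"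
proof (rule card_subset_eq)
  show "(\<Union>i. blk N n i) \<subseteq> {..<n}" using blk_subset by blast
  have "card (\<Union>i. blk N n i) = (\<Sum>i\<in>UNIV. card (blk N n i))"
    by (intro card_UN_disjoint) (auto simp: blk_disjoint, simp add: blk_def)
  then show "card (\<Union>i. blk N n i) = card {..<n}" by (simp add: blk_def N_sum)
qed simp

lemma card_blk: "card (blk N n i) = N n i"
  by (simp add: blk_def)

lemma grp_eq: "j \<in> blk N n i \<Longrightarrow> grp N n j = i"
  unfolding grp_def using blk_disjoint by blast

lemma grp_set: "{j \<in> {..<n}. grp N n j = i} = blk N n i"
proof (intro equalityI subsetI)
  fix j assume j: "j \<in> {j \<in> {..<n}. grp N n j = i}"
  then obtain i' where "j \<in> blk N n i'" using blk_cover[of n] by blast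
  with j grp_eq[OF this] show "j \<in> blk N n i" by simp
qed (use blk_subset grp_eq in blast)

lemma card_grp: "card {j \<in> {..<n}. grp N n j = i} = N n i"
  unfolding grp_set by (simp add: blk_def)

lemma sum_grp: "(\<Sum>j<n. h (grp N n j)) = (\<Sum>i\<in>UNIV. real (N n i) * (h i :: real))"
proof -
  have "(\<Sum>j<n. h (grp N n j)) = (\<Sum>i\<in>UNIV. \<Sum>j | j \<in> {..<n} \<and> grp N n j = i. h (grp N n j))"
    using sum.group[of "{..<n}" UNIV "grp N n" "\<lambda>j. h (grp N n j)"] by simp
  also have "\<dots> = (\<Sum>i\<in>UNIV. \<Sum>j | j \<in> {..<n} \<and> grp N n j = i. h i)"
    by (intro sum.cong refl) auto
  finally show ?thesis using card_grp by simp
qed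

lemma sets_data_law [simp, measurable_cong]: "sets (data_law N P n) = sets (PiM {..<n} (\<lambda>_. borel))"
  by (simp add: data_law_def)

lemma space_data_law: "space (data_law N P n) = {..<n} \<rightarrow>\<^sub>E UNIV"
  by (simp add: data_law_def space_PiM)

lemma prob_space_data_law: "prob_space (data_law N P n)"
  unfolding data_law_def by (intro prob_space_PiM P_prob)

lemma N_at_top: "filterlim (\<lambda>n. N n i) at_top sequentially"
proof -
  have "filterlim (\<lambda>n. real (N n i) / real n * real n) at_top sequentially"
    by (rule filterlim_tendsto_pos_mult_at_top[OF N_lim p_pos filterlim_real_sequentially])
  moreover have "(\<lambda>n. real (N n i) / real n * real n) = (\<lambda>n. real (N n i))"
  proof
    fix n show "real (N n i) / real n * real n = real (N n i)"
      using N_le[of 0 i] by (cases "n = 0") auto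
  qed
  ultimately show ?thesis by (simp add: filterlim_sequentially_iff_filterlim_real)
qed

lemma label_weight_group:
  assumes "q \<in> label_seqs m"
  shows "label_weight m q = (\<Prod>i\<in>UNIV. p i ^ card {j \<in> {..<m}. q j = i})"
proof -
  have "label_weight m q = (\<Prod>i\<in>UNIV. \<Prod>j | j \<in> {..<m} \<and> q j = i. p (q j))"
    unfolding label_weight_def using prod.group[of "{..<m}" UNIV q "\<lambda>j. p (q j)"] by simp
  also have "\<dots> = (\<Prod>i\<in>UNIV. \<Prod>j | j \<in> {..<m} \<and> q j = i. p i)"
    by (intro prod.cong refl) auto
  finally show ?thesis by simp
qed

lemma measure_iid_mixture:
  assumes A: "A \<in> sets (PiM {..<m} (\<lambda>_. borel))"
  shows "measure (iid m (mixture p P)) A = (\<Sum>q\<in>label_seqs m. label_weight m q * measure (PiM {..<m} (\<lambda>j. P (q j))) A)"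
proof -
  have sub: "A \<inter> space (PiM {..<m} M) = A" if "sets (PiM {..<m} M) = sets (PiM {..<m} (\<lambda>_. borel))" for M :: "nat \<Rightarrow> 'a measure"
    using sets.sets_into_space[of A "PiM {..<m} M"] A that by auto
  have "(\<integral>x. indicat_real A x \<partial>iid m (mixture p P)) =
    (\<Sum>q\<in>label_seqs m. label_weight m q *\<^sub>R (\<integral>x. indicat_real A x \<partial>PiM {..<m} (\<lambda>j. P (q j))))"
    using A by (intro iid_mixture_integral[where B=1]) auto
  then show ?thesis by (simp add: iid_def sub)
qed

text \<open>The left-hand side is a multivariate hypergeometric probability and
  \<open>label_weight\<close> its multinomial counterpart. The assumption \<open>good\<close> says
  that at least \<open>c * n\<close> rows of each label stay outside the block, as the ratio bound
  demands of its cells \<open>b i\<close>.\<close>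

lemma prefix_label_ratio:
  assumes n: "n \<ge> 1" and c: "c > 0" and D: "\<And>i. \<bar>real (N n i) / real n - p i\<bar> \<le> D / sqrt (real n)"
    and q: "q \<in> label_seqs (N n i0)"
    and good: "\<And>i. c * real n \<le> real (N n i) - real (card {j \<in> {..<N n i0}. q j = i})"
  shows "real (card {\<pi>. \<pi> permutes {..<n} \<and> (\<lambda>j\<in>{..<N n i0}. grp N n (\<pi> (blk_start N n i0 + j))) = q}) / fact n
    \<le> exp ((real CARD('k) + 1) / 2 + (\<Sum>i\<in>UNIV. D\<^sup>2 / p i) + real CARD('k) * \<bar>ln c\<bar> / 2) * label_weight (N n i0) q"
proof -
  let ?m = "N n i0" and ?s = "blk_start N n i0" and ?B = "blk N n i0"
  define a where "a i = card {j \<in> {..<?m}. q j = i}" for i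
  have le: "a i \<le> N n i" for i
  proof -
    have "0 < c * real n" using c n by simp
    then have "real (a i) < real (N n i)" using good[of i] unfolding a_def by linarith
    then show ?thesis by simp
  qed
  have aB: "card {j \<in> ?B. q (j - ?s) = i} = a i" for i
  proof -
    have "bij_betw (\<lambda>j. ?s + j) {j \<in> {..<?m}. q j = i} {j \<in> ?B. q (j - ?s) = i}"
      by (rule bij_betw_byWitness[where f'="\<lambda>j. j - ?s"]) (auto simp: blk_def)
    from bij_betw_same_card[OF this] show ?thesis by (simp add: a_def)
  qed
  have "{\<pi>. \<pi> permutes {..<n} \<and> (\<lambda>j\<in>{..<?m}. grp N n (\<pi> (?s + j))) = q} =
      {\<pi>. \<pi> permutes {..<n} \<and> (\<forall>j\<in>?B. grp N n (\<pi> j) = q (j - ?s))}"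
  proof (intro Collect_cong conj_cong refl)
    fix \<pi> :: "nat \<Rightarrow> nat"
    have "((\<lambda>j\<in>{..<?m}. grp N n (\<pi> (?s + j))) = q) = (\<forall>j<?m. grp N n (\<pi> (?s + j)) = q j)"
      using q by (auto simp: fun_eq_iff PiE_def extensional_def restrict_def)
    also have "\<dots> = (\<forall>j\<in>?B. grp N n (\<pi> j) = q (j - ?s))"
    proof (intro iffI ballI allI impI)
      fix j assume *: "\<forall>j<?m. grp N n (\<pi> (?s + j)) = q j" "j \<in> ?B"
      then have "j - ?s < ?m" "?s + (j - ?s) = j" by (auto simp: blk_def)
      then show "grp N n (\<pi> j) = q (j - ?s)" using *(1) by metis
    next
      fix j assume *: "\<forall>j\<in>?B. grp N n (\<pi> j) = q (j - ?s)" "j < ?m"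
      then have "?s + j \<in> ?B" by (auto simp: blk_def)
      with *(1) have "grp N n (\<pi> (?s + j)) = q (?s + j - ?s)" by blast
      then show "grp N n (\<pi> (?s + j)) = q j" by simp
    qed
    finally show "((\<lambda>j\<in>{..<?m}. grp N n (\<pi> (?s + j))) = q) = (\<forall>j\<in>?B. grp N n (\<pi> j) = q (j - ?s))" .
  qed
  then have "card {\<pi>. \<pi> permutes {..<n} \<and> (\<lambda>j\<in>{..<?m}. grp N n (\<pi> (?s + j))) = q} * (\<Prod>i\<in>UNIV. fact (N n i - a i)) =
    fact (n - ?m) * (\<Prod>i\<in>UNIV. fact (N n i) :: nat)"
    using card_permutations_with_labels[of "{..<n}" ?B "\<lambda>j. q (j - ?s)" "grp N n"] blk_subset le
    by (simp add: aB card_grp[simplified] card_blk)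
  from arg_cong[OF this, of real]
  have "real (card {\<pi>. \<pi> permutes {..<n} \<and> (\<lambda>j\<in>{..<?m}. grp N n (\<pi> (?s + j))) = q}) * (\<Prod>i\<in>UNIV. fact (N n i - a i)) =
    fact (n - ?m) * (\<Prod>i\<in>UNIV. fact (N n i))"
    by simp
  then have eq: "real (card {\<pi>. \<pi> permutes {..<n} \<and> (\<lambda>j\<in>{..<?m}. grp N n (\<pi> (?s + j))) = q}) / fact n =
    fact (n - ?m) * (\<Prod>i\<in>UNIV. fact (N n i)) / ((\<Prod>i\<in>UNIV. fact (N n i - a i)) * fact n)"
    by (simp add: field_simps)
  have "label_weight ?m q = (\<Prod>i\<in>UNIV. p i ^ (N n i - (N n i - a i)))"
    unfolding label_weight_group[OF q] using le by (simp add: a_def)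
  moreover have "fact (n - ?m) * (\<Prod>i\<in>UNIV. fact (N n i)) / ((\<Prod>i\<in>UNIV. fact (N n i - a i)) * fact n) \<le>
    exp ((real CARD('k) + 1) / 2 + (\<Sum>i\<in>UNIV. D\<^sup>2 / p i) + real CARD('k) * \<bar>ln c\<bar> / 2) * (\<Prod>i\<in>UNIV. p i ^ (N n i - (N n i - a i)))"
  proof (rule hypergeometric_multinomial_ratio)
    have "(\<Sum>i\<in>UNIV. N n i - a i) = (\<Sum>i\<in>UNIV. N n i) - (\<Sum>i\<in>UNIV. a i)" by (rule sum_subtractf_nat) (rule le)
    also have "(\<Sum>i\<in>UNIV. a i) = ?m"
      unfolding a_def using sum.group[of "{..<?m}" UNIV q "\<lambda>_. 1::nat"] by simp
    finally show "(\<Sum>i\<in>UNIV. N n i - a i) = n - ?m" by (simp add: N_sum)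
    show "c * real n \<le> real (N n i - a i)" for i using good[of i] le[of i] by (simp add: a_def of_nat_diff)
  qed (use p_pos p_sum N_sum n c D in auto)
  ultimately show ?thesis unfolding eq by simp
qed

text \<open>The number of rows with label \<open>i\<close> in the block is a linear permutation
  statistic with mean \<open>N n i * N n i0 / n\<close> and variance at most \<open>2 * n\<close>.
  By \<open>gap\<close> the mean leaves \<open>2 * c * n\<close> rows outside, so a deficit is a
  deviation by at least \<open>c * n\<close>, and Chebyshev's inequality applies.\<close>

lemma prefix_deficit_rare:
  assumes n: "n \<ge> 2" and c: "c > 0" and gap: "2 * c \<le> (real (N n i) / real n) * (1 - real (N n i0) / real n)"
  shows "real (card {\<pi>. \<pi> permutes {..<n} \<and>
     real (N n i) - real (card {j \<in> {..<N n i0}. grp N n (\<pi> (blk_start N n i0 + j)) = i}) < c * real n}) / fact n \<le> 2 / (c\<^sup>2 * real n)"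
proof -
  let ?m = "N n i0" and ?s = "blk_start N n i0" and ?B = "blk N n i0" and ?P = "{\<pi>. \<pi> permutes {..<n}}"
  define x where "x j = (if grp N n j = i then 1 else 0) - real (N n i) / real n" for j
  define y where "y j = (if j \<in> ?B then 1 else 0 :: real)" for j
  define bad where "bad = {\<pi> \<in> ?P. real (N n i) - real (card {j \<in> {..<?m}. grp N n (\<pi> (?s + j)) = i}) < c * real n}"
  have finP: "finite ?P" by (rule finite_permutations) simp
  have ind: "(\<Sum>j<n. if grp N n j = i then 1 else 0 :: real) = real (N n i)"
    using sum.inter_filter[of "{..<n}" "\<lambda>_. 1::real" "\<lambda>j. grp N n j = i"] card_grp[of n i] by simp
  have X: "(\<Sum>j<n. x (\<pi> j) * y j) = real (card {j \<in> {..<?m}. grp N n (\<pi> (?s + j)) = i}) - real (N n i) / real n * real ?m" for \<pi>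
  proof -
    have "(\<Sum>j<n. x (\<pi> j) * y j) = (\<Sum>j\<in>{..<n}. if j \<in> ?B then x (\<pi> j) else 0)"
      by (intro sum.cong) (auto simp: y_def)
    also have "\<dots> = (\<Sum>j\<in>{..<n} \<inter> ?B. x (\<pi> j))" by (rule sum.inter_restrict[symmetric]) simp
    also have "{..<n} \<inter> ?B = ?B" using blk_subset by blast
    also have "(\<Sum>j\<in>?B. x (\<pi> j)) = (\<Sum>j<?m. x (\<pi> (?s + j)))"
      by (rule sum.reindex_bij_witness[where i="\<lambda>j. ?s + j" and j="\<lambda>j. j - ?s"]) (auto simp: blk_def)
    also have "\<dots> = (\<Sum>j<?m. if grp N n (\<pi> (?s + j)) = i then 1 else 0) - real (N n i) / real n * real ?m"
      by (simp add: x_def sum_subtractf)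
    finally show ?thesis
      using sum.inter_filter[of "{..<?m}" "\<lambda>_. 1::real" "\<lambda>j. grp N n (\<pi> (?s + j)) = i"] by simp
  qed
  have x1: "\<bar>x j\<bar> \<le> 1" for j
  proof -
    have "0 \<le> real (N n i) / real n" "real (N n i) / real n \<le> 1"
      using N_le[of n i] n by (simp_all add: divide_le_eq)
    then show ?thesis by (auto simp: x_def abs_le_iff intro: order_trans[of _ 0])
  qed
  have "(\<Sum>j<n. (x j)\<^sup>2) \<le> real n" "(\<Sum>j<n. (y j)\<^sup>2) \<le> real n"
    using sum_bounded_above[of "{..<n}" "\<lambda>j. (x j)\<^sup>2" 1] sum_bounded_above[of "{..<n}" "\<lambda>j. (y j)\<^sup>2" 1] x1
    by (auto simp: y_def abs_square_le_1)
  then have xy: "(\<Sum>j<n. (x j)\<^sup>2) * (\<Sum>j<n. (y j)\<^sup>2) \<le> real n * real n"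
    by (intro mult_mono) (auto intro: sum_nonneg)
  have "(c * real n)\<^sup>2 * real (card bad) = (\<Sum>\<pi>\<in>bad. (c * real n)\<^sup>2)" by simp
  also have "\<dots> \<le> (\<Sum>\<pi>\<in>bad. (\<Sum>j<n. x (\<pi> j) * y j)\<^sup>2)"
  proof (intro sum_mono power_mono)
    fix \<pi> assume "\<pi> \<in> bad"
    then have "real (N n i) - c * real n < real (card {j \<in> {..<?m}. grp N n (\<pi> (?s + j)) = i})" by (simp add: bad_def)
    moreover have "2 * c * real n \<le> real (N n i) - real (N n i) / real n * real ?m"
    proof -
      have "real (N n i) / real n * (1 - real ?m / real n) * real n = real (N n i) * (1 - real ?m / real n)"
        using n by simp
      then show ?thesis using mult_right_mono[OF gap, of "real n"] n by (simp add: right_diff_distrib)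
    qed
    ultimately show "c * real n \<le> (\<Sum>j<n. x (\<pi> j) * y j)" unfolding X by linarith
  qed (use c in simp)
  also have "\<dots> \<le> (\<Sum>\<pi>\<in>?P. (\<Sum>j<n. x (\<pi> j) * y j)\<^sup>2)"
    by (rule sum_mono2[OF finP]) (auto simp: bad_def)
  also have "\<dots> \<le> fact n * ((\<Sum>j<n. (x j)\<^sup>2) * (\<Sum>j<n. (y j)\<^sup>2)) / (real n - 1)"
    using perm_second_moment[of "{..<n}" x y] n ind by (simp add: x_def sum_subtractf)
  also have "\<dots> \<le> fact n * (real n * real n) / (real n - 1)"
    using xy n by (intro divide_right_mono mult_left_mono) auto
  also have "\<dots> \<le> fact n * (2 * real n)"
  proof -
    have "real n / (real n - 1) \<le> 2" using n by (simp add: divide_le_eq)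
    then have "fact n * real n * (real n / (real n - 1)) \<le> fact n * real n * 2" by (intro mult_left_mono) auto
    then show ?thesis by (simp add: mult_ac)
  qed
  finally have "(c * real n)\<^sup>2 * real (card bad) \<le> fact n * (2 * real n)" .
  then have "real (card bad) / fact n \<le> 2 / (c\<^sup>2 * real n)"
    using n c by (simp add: field_simps power2_eq_square)
  then show ?thesis by (simp add: bad_def)
qed

text \<open>Contiguity: conditionally on the labels the permuted block and the i.i.d. sample from the mixture
  have the same law, so only the label sequences have to be compared.\<close>

lemma permuted_block_contiguity:
  "\<exists>K c. 0 \<le> K \<and> (\<forall>\<^sub>F n in sequentially. \<forall>A\<in>sets (PiM {..<N n i0} (\<lambda>_. borel)).
     (\<Sum>\<pi> | \<pi> permutes {..<n}. measure (data_law N P n)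
        {z \<in> space (data_law N P n). (\<lambda>j\<in>{..<N n i0}. z (\<pi> (blk_start N n i0 + j))) \<in> A}) / fact n
     \<le> c / real n + K * measure (iid (N n i0) (mixture p P)) A)"
proof -
  have "\<exists>D. \<forall>i. \<forall>\<^sub>F n in sequentially. \<bar>real (N n i) / real n - p i\<bar> \<le> D / sqrt (real n)"
  proof -
    have "\<exists>D. \<forall>\<^sub>F n in sequentially. \<bar>real (N n i) / real n - p i\<bar> \<le> D / sqrt (real n)" for i
    proof -
      obtain C where "\<forall>\<^sub>F n in sequentially. norm (real (N n i) / real n - p i) \<le> C * norm (1 / sqrt (real n))"
        using landau_o.bigE[OF N_rate[of i]] by blast
      then have "\<forall>\<^sub>F n in sequentially. \<bar>real (N n i) / real n - p i\<bar> \<le> C / sqrt (real n)"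
        by (rule eventually_mono) simp
      then show ?thesis by blast
    qed
    then obtain D where D: "\<And>i. \<forall>\<^sub>F n in sequentially. \<bar>real (N n i) / real n - p i\<bar> \<le> D i / sqrt (real n)" by metis
    have "\<forall>\<^sub>F n in sequentially. \<bar>real (N n i) / real n - p i\<bar> \<le> Max (range D) / sqrt (real n)" for i
      using D[of i] by (rule eventually_mono) (erule order_trans, intro divide_right_mono Max_ge, auto)
    then show ?thesis by blast
  qed
  then obtain D where D: "\<And>i. \<forall>\<^sub>F n in sequentially. \<bar>real (N n i) / real n - p i\<bar> \<le> D / sqrt (real n)" by blast
  \<comment> \<open>The expected fraction of rows that have label \<open>i\<close> and lie outside
    the block tends to \<open>p i * (1 - p i0)\<close>, which is at least \<open>4 * c\<close>, so
    that it eventually exceeds \<open>2 * c\<close>.\<close>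
  define c where "c = (1 - p i0) * Min (range p) / 4"
  have Minp: "0 < Min (range p)" "Min (range p) \<le> p i" for i using p_pos by (auto simp: Min_gr_iff)
  have c: "c > 0" using p_lt1[of i0] Minp by (simp add: c_def)
  have gap: "\<forall>\<^sub>F n in sequentially. 2 * c \<le> (real (N n i) / real n) * (1 - real (N n i0) / real n)" for i
  proof -
    have "(\<lambda>n. (real (N n i) / real n) * (1 - real (N n i0) / real n)) \<longlonglongrightarrow> p i * (1 - p i0)"
      by (intro tendsto_intros N_lim)
    moreover have "2 * c < p i * (1 - p i0)"
    proof -
      have "Min (range p) * (1 - p i0) \<le> p i * (1 - p i0)"
        using p_lt1[of i0] Minp by (intro mult_right_mono) auto
      moreover have "2 * c < Min (range p) * (1 - p i0)"
      proof -
        have "Min (range p) * (1 - p i0) = 4 * c" unfolding c_def by simp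
        then show ?thesis using c by linarith
      qed
      ultimately show ?thesis by linarith
    qed
    ultimately have "\<forall>\<^sub>F n in sequentially. 2 * c < (real (N n i) / real n) * (1 - real (N n i0) / real n)"
      by (rule order_tendstoD)
    then show ?thesis by (rule eventually_mono) simp
  qed
  define K where "K = exp ((real CARD('k) + 1) / 2 + (\<Sum>i\<in>UNIV. D\<^sup>2 / p i) + real CARD('k) * \<bar>ln c\<bar> / 2)"
  have "\<forall>\<^sub>F n in sequentially. (\<forall>i. \<bar>real (N n i) / real n - p i\<bar> \<le> D / sqrt (real n)) \<and>
     (\<forall>i. 2 * c \<le> (real (N n i) / real n) * (1 - real (N n i0) / real n)) \<and> n \<ge> 2"
    by (intro eventually_conj eventually_all_finite D gap eventually_ge_at_top)
  then have "\<forall>\<^sub>F n in sequentially. \<forall>A\<in>sets (PiM {..<N n i0} (\<lambda>_. borel)).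
     (\<Sum>\<pi> | \<pi> permutes {..<n}. measure (data_law N P n)
        {z \<in> space (data_law N P n). (\<lambda>j\<in>{..<N n i0}. z (\<pi> (blk_start N n i0 + j))) \<in> A}) / fact n
     \<le> (real CARD('k) * (2 / c\<^sup>2)) / real n + K * measure (iid (N n i0) (mixture p P)) A"
  proof (rule eventually_mono, intro ballI)
    fix n and A :: "(nat \<Rightarrow> 'a) set"
    let ?m = "N n i0" and ?s = "blk_start N n i0" and ?P = "{\<pi>. \<pi> permutes {..<n}}"
    assume n: "(\<forall>i. \<bar>real (N n i) / real n - p i\<bar> \<le> D / sqrt (real n)) \<and>
     (\<forall>i. 2 * c \<le> (real (N n i) / real n) * (1 - real (N n i0) / real n)) \<and> n \<ge> 2"
      and A: "A \<in> sets (PiM {..<?m} (\<lambda>_. borel))"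
    define lab where "lab \<pi> = (\<lambda>j\<in>{..<?m}. grp N n (\<pi> (?s + j)))" for \<pi>
    define \<mu> where "\<mu> q = measure (PiM {..<?m} (\<lambda>j. P (q j))) A" for q
    have \<mu>: "0 \<le> \<mu> q" "\<mu> q \<le> 1" for q
      unfolding \<mu>_def by (auto intro!: prob_space.prob_le_1 prob_space_PiM P_prob)
    have finP: "finite ?P" by (rule finite_permutations) simp
    have lab_in: "lab \<pi> \<in> label_seqs ?m" for \<pi> by (auto simp: lab_def)
    have law: "measure (data_law N P n) {z \<in> space (data_law N P n). (\<lambda>j\<in>{..<?m}. z (\<pi> (?s + j))) \<in> A} = \<mu> (lab \<pi>)"
      if p: "\<pi> permutes {..<n}" for \<pi>
    proof -
      have "measure (data_law N P n) {z \<in> space (data_law N P n). (\<lambda>j\<in>{..<?m}. z (\<pi> (?s + j))) \<in> A} =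
        measure (PiM {..<?m} (\<lambda>j. P (grp N n (\<pi> (?s + j))))) A"
        unfolding data_law_def
      proof (rule measure_PiM_reindex)
        show "inj_on (\<lambda>j. \<pi> (?s + j)) {..<?m}" 
          by (rule inj_onI) (use permutes_inj[OF p] in \<open>simp add: inj_eq\<close>)
        have "?s + j < n" if "j < ?m" for j using blk_end_le[of n i0] that by linarith
        then show "(\<lambda>j. \<pi> (?s + j)) \<in> {..<?m} \<rightarrow> {..<n}" using permutes_in_image[OF p] by auto
      qed (use P_prob A in auto)
      also have "PiM {..<?m} (\<lambda>j. P (grp N n (\<pi> (?s + j)))) = PiM {..<?m} (\<lambda>j. P (lab \<pi> j))"
        by (intro PiM_cong) (auto simp: lab_def)
      finally show ?thesis unfolding \<mu>_def .
    qed
    \<comment> \<open>The patterns to which the ratio bound applies. The others are charged with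
      their probability, which is of order \<open>1 / n\<close>.\<close>
    define Good where "Good = {q \<in> label_seqs ?m. \<forall>i. c * real n \<le> real (N n i) - real (card {j \<in> {..<?m}. q j = i})}"
    have "(\<Sum>\<pi>\<in>?P. measure (data_law N P n) {z \<in> space (data_law N P n). (\<lambda>j\<in>{..<?m}. z (\<pi> (?s + j))) \<in> A})
       = (\<Sum>\<pi>\<in>?P. \<mu> (lab \<pi>))" by (intro sum.cong refl) (simp add: law)
    also have "\<dots> = (\<Sum>\<pi>\<in>{\<pi> \<in> ?P. lab \<pi> \<notin> Good}. \<mu> (lab \<pi>)) + (\<Sum>\<pi>\<in>{\<pi> \<in> ?P. lab \<pi> \<in> Good}. \<mu> (lab \<pi>))"
    proof -
      have "(\<Sum>\<pi>\<in>?P. \<mu> (lab \<pi>)) = (\<Sum>\<pi>\<in>{\<pi> \<in> ?P. lab \<pi> \<notin> Good} \<union> {\<pi> \<in> ?P. lab \<pi> \<in> Good}. \<mu> (lab \<pi>))"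
        by (rule arg_cong[where f="sum _"]) auto
      also have "\<dots> = (\<Sum>\<pi>\<in>{\<pi> \<in> ?P. lab \<pi> \<notin> Good}. \<mu> (lab \<pi>)) + (\<Sum>\<pi>\<in>{\<pi> \<in> ?P. lab \<pi> \<in> Good}. \<mu> (lab \<pi>))"
        by (rule sum.union_disjoint) (use finP in auto)
      finally show ?thesis .
    qed
    also have "(\<Sum>\<pi>\<in>{\<pi> \<in> ?P. lab \<pi> \<notin> Good}. \<mu> (lab \<pi>)) \<le> fact n * (real CARD('k) * (2 / (c\<^sup>2 * real n)))"
    proof -
      let ?bad = "\<lambda>i. {\<pi>. \<pi> permutes {..<n} \<and> real (N n i) - real (card {j \<in> {..<?m}. grp N n (\<pi> (?s + j)) = i}) < c * real n}"
      have cnt: "{j \<in> {..<?m}. lab \<pi> j = i} = {j \<in> {..<?m}. grp N n (\<pi> (?s + j)) = i}" for \<pi> i by (auto simp: lab_def)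
      have "(\<Sum>\<pi>\<in>{\<pi> \<in> ?P. lab \<pi> \<notin> Good}. \<mu> (lab \<pi>)) \<le> (\<Sum>\<pi>\<in>{\<pi> \<in> ?P. lab \<pi> \<notin> Good}. 1)" by (intro sum_mono \<mu>)
      also have "\<dots> = real (card {\<pi> \<in> ?P. lab \<pi> \<notin> Good})" by simp
      also have "\<dots> \<le> real (card (\<Union>i. ?bad i))"
      proof (intro of_nat_mono card_mono)
        show "finite (\<Union>i. ?bad i)" using finP by (auto intro: finite_subset)
        show "{\<pi> \<in> ?P. lab \<pi> \<notin> Good} \<subseteq> (\<Union>i. ?bad i)"
          using lab_in by (auto simp: Good_def cnt[simplified] not_le)
      qed
      also have "\<dots> \<le> (\<Sum>i\<in>UNIV. real (card (?bad i)))"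
        unfolding of_nat_sum[symmetric] by (intro of_nat_mono card_UN_le) simp
      also have "\<dots> \<le> (\<Sum>i\<in>(UNIV :: 'k set). fact n * (2 / (c\<^sup>2 * real n)))"
      proof (rule sum_mono)
        fix i :: 'k
        have "real (card (?bad i)) / fact n \<le> 2 / (c\<^sup>2 * real n)"
          using n by (intro prefix_deficit_rare c) auto
        then show "real (card (?bad i)) \<le> fact n * (2 / (c\<^sup>2 * real n))"
          by (simp add: pos_divide_le_eq mult.commute)
      qed
      also have "\<dots> = fact n * (real CARD('k) * (2 / (c\<^sup>2 * real n)))" by simp
      finally show ?thesis .
    qed
    also have "(\<Sum>\<pi>\<in>{\<pi> \<in> ?P. lab \<pi> \<in> Good}. \<mu> (lab \<pi>)) \<le> fact n * (K * measure (iid ?m (mixture p P)) A)"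
    proof -
      have finG: "finite Good" unfolding Good_def using finite_label_seqs by simp
      have "(\<Sum>\<pi>\<in>{\<pi> \<in> ?P. lab \<pi> \<in> Good}. \<mu> (lab \<pi>)) = (\<Sum>q\<in>Good. \<Sum>\<pi> | \<pi> \<in> {\<pi> \<in> ?P. lab \<pi> \<in> Good} \<and> lab \<pi> = q. \<mu> (lab \<pi>))"
        using finP finG by (intro sum.group[symmetric]) auto
      also have "\<dots> = (\<Sum>q\<in>Good. real (card {\<pi>. \<pi> permutes {..<n} \<and> lab \<pi> = q}) * \<mu> q)"
      proof (intro sum.cong refl)
        fix q assume q: "q \<in> Good"
        have "(\<Sum>\<pi> | \<pi> \<in> {\<pi> \<in> ?P. lab \<pi> \<in> Good} \<and> lab \<pi> = q. \<mu> (lab \<pi>)) = (\<Sum>\<pi> | \<pi> permutes {..<n} \<and> lab \<pi> = q. \<mu> q)"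
          using q by (intro sum.cong) auto
        then show "(\<Sum>\<pi> | \<pi> \<in> {\<pi> \<in> ?P. lab \<pi> \<in> Good} \<and> lab \<pi> = q. \<mu> (lab \<pi>)) = real (card {\<pi>. \<pi> permutes {..<n} \<and> lab \<pi> = q}) * \<mu> q"
          by simp
      qed
      also have "\<dots> \<le> (\<Sum>q\<in>Good. fact n * (K * label_weight ?m q) * \<mu> q)"
      proof (intro sum_mono mult_right_mono \<mu>)
        fix q assume q: "q \<in> Good"
        have "real (card {\<pi>. \<pi> permutes {..<n} \<and> lab \<pi> = q}) / fact n \<le> K * label_weight ?m q"
          unfolding K_def lab_def using n q by (intro prefix_label_ratio c) (auto simp: Good_def)
        then show "real (card {\<pi>. \<pi> permutes {..<n} \<and> lab \<pi> = q}) \<le> fact n * (K * label_weight ?m q)"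
          by (simp add: pos_divide_le_eq mult.commute)
      qed
      also have "\<dots> \<le> (\<Sum>q\<in>label_seqs ?m. fact n * (K * label_weight ?m q) * \<mu> q)"
        using \<mu> by (intro sum_mono2 finite_label_seqs) (auto simp: Good_def K_def)
      also have "\<dots> = fact n * (K * measure (iid ?m (mixture p P)) A)"
        unfolding measure_iid_mixture[OF A] \<mu>_def by (simp add: sum_distrib_left mult_ac)
      finally show ?thesis .
    qed
    finally have "(\<Sum>\<pi>\<in>?P. measure (data_law N P n) {z \<in> space (data_law N P n). (\<lambda>j\<in>{..<?m}. z (\<pi> (?s + j))) \<in> A})
      \<le> fact n * (real CARD('k) * (2 / (c\<^sup>2 * real n)) + K * measure (iid ?m (mixture p P)) A)"
      by (simp add: distrib_left)
    then show "(\<Sum>\<pi>\<in>?P. measure (data_law N P n) {z \<in> space (data_law N P n). (\<lambda>j\<in>{..<?m}. z (\<pi> (?s + j))) \<in> A}) / fact n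
     \<le> (real CARD('k) * (2 / c\<^sup>2)) / real n + K * measure (iid ?m (mixture p P)) A"
      by (simp add: pos_divide_le_eq mult.commute)
  qed
  moreover have "0 \<le> K" by (simp add: K_def)
  ultimately show ?thesis by blast
qed

end

section \<open>Coupling with a sample from the mixture\<close>

context k_samples
begin

text \<open>The inequality between arithmetic and geometric means, scaled by the square root of
  \<open>n\<close>, reduces the first absolute moment to the second moment of a centred sum.\<close>

lemma label_count_deviation:
  "(\<Sum>L\<in>label_seqs n. label_weight n L * \<bar>real (card {j \<in> {..<n}. L j = i}) - real n * p i\<bar>) \<le> sqrt (real n)"
proof (cases "n = 0")
  case True
  then show ?thesis by (simp add: label_weight_def)
next
  case False
  let ?s = "sqrt (real n)"
  have s: "?s > 0" using False by simp
  define y where "y k = (if k = i then 1 else 0) - p i" for k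
  have y: "(\<Sum>j<n. y (L j)) = real (card {j \<in> {..<n}. L j = i}) - real n * p i" for L
    using sum.inter_filter[of "{..<n}" "\<lambda>_. 1::real" "\<lambda>j. L j = i"] by (simp add: y_def sum_subtractf)
  have y1: "\<bar>y k\<bar> \<le> 1" for k using p_pos[of i] p_le_1[of i] by (auto simp: y_def)
  have y0: "(\<Sum>k\<in>UNIV. p k * y k) = 0"
    by (simp add: y_def right_diff_distrib sum_subtractf mult_delta_right sum_distrib_right[symmetric] p_sum)
  have amgm: "\<bar>x\<bar> \<le> (?s + x\<^sup>2 / ?s) / 2" for x
  proof -
    have "2 * \<bar>x\<bar> * ?s \<le> ?s\<^sup>2 + x\<^sup>2" using sum_squares_bound[of "\<bar>x\<bar>" ?s] by simp
    then show ?thesis using s by (simp add: field_simps power2_eq_square)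
  qed
  have "(\<Sum>L\<in>label_seqs n. label_weight n L * \<bar>\<Sum>j<n. y (L j)\<bar>) \<le>
     (\<Sum>L\<in>label_seqs n. label_weight n L * ((?s + (\<Sum>j<n. y (L j))\<^sup>2 / ?s) / 2))"
    by (intro sum_mono mult_left_mono amgm) simp
  also have "\<dots> = (?s * (\<Sum>L\<in>label_seqs n. label_weight n L) + (\<Sum>L\<in>label_seqs n. label_weight n L * (\<Sum>j<n. y (L j))\<^sup>2) / ?s) / 2"
    by (simp add: sum_distrib_left sum_divide_distrib sum.distrib[symmetric] add_divide_distrib distrib_left mult_ac)
  also have "\<dots> \<le> (?s * 1 + real n / ?s) / 2"
    using label_second_moment[OF y0 y1, of n] s
    by (intro divide_right_mono add_mono) (auto simp: label_weight_sum divide_right_mono)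
  also have "\<dots> = ?s" using s by (simp add: real_div_sqrt)
  finally show ?thesis unfolding y .
qed

text \<open>The coupling: i.i.d. labels are corrected in the few positions where their counts miss the sample sizes;
  a value is drawn for every position and every label, so that both samples share the values where the labels agree.\<close>

lemma data_law_relabel:
  fixes F :: "(nat \<Rightarrow> 'a) \<Rightarrow> 'b::{banach,second_countable_topology}"
  assumes \<tau>: "\<tau> permutes {..<n}" and F: "F \<in> borel_measurable (PiM {..<n} (\<lambda>_. borel))"
    and inv: "\<And>z. z \<in> {..<n} \<rightarrow>\<^sub>E UNIV \<Longrightarrow> F (\<lambda>j\<in>{..<n}. z (\<tau> j)) = F z"
  shows "(\<integral>z. F z \<partial>data_law N P n) = (\<integral>z. F z \<partial>PiM {..<n} (\<lambda>j. P (grp N n (\<tau> j))))"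
proof -
  have "(\<integral>z. F z \<partial>data_law N P n) = (\<integral>z. F (\<lambda>j\<in>{..<n}. z (\<tau> j)) \<partial>data_law N P n)"
    using inv by (intro Bochner_Integration.integral_cong) (auto simp: space_data_law)
  also have "\<dots> = (\<integral>z. F z \<partial>PiM {..<n} (\<lambda>j. P (grp N n (\<tau> j))))"
    unfolding data_law_def
  proof (rule integral_PiM_reindex)
    show "inj_on \<tau> {..<n}" by (rule inj_on_subset[OF permutes_inj[OF \<tau>]]) simp
    show "\<tau> \<in> {..<n} \<rightarrow> {..<n}" using permutes_in_image[OF \<tau>] by auto
    show "F \<in> borel_measurable (PiM {..<n} (\<lambda>i. P (grp N n (\<tau> i))))"
      using F by (simp add: measurable_cong_sets[OF sets_PiM_labels refl])
  qed (rule P_prob)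
  finally show ?thesis .
qed

lemma coupling_bound:
  fixes F :: "(nat \<Rightarrow> 'a) \<Rightarrow> complex" and g :: "'d::finite \<Rightarrow> 'a \<Rightarrow> real"
  assumes F: "F \<in> borel_measurable (PiM {..<n} (\<lambda>_. borel))" and bound: "\<And>z. cmod (F z) \<le> 1"
    and g: "\<And>l. g l \<in> borel_measurable borel" and sq: "\<And>l. integrable (mixture p P) (\<lambda>x. (g l x)\<^sup>2)"
    and lip: "\<And>z z'. cmod (F z - F z') \<le> e + A * (\<Sum>j<n. \<Sum>l\<in>UNIV. (g l (z j) - g l (z' j))\<^sup>2)" and A: "A \<ge> 0"
  shows "cmod ((\<integral>z. F z \<partial>PiM {..<n} (\<lambda>j. P (q j))) - (\<integral>z. F z \<partial>PiM {..<n} (\<lambda>j. P (q' j)))) \<le>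
    e + A * (real (card {j \<in> {..<n}. q j \<noteq> q' j}) * (4 * (\<Sum>i\<in>UNIV. \<Sum>l\<in>UNIV. \<integral>x. (g l x)\<^sup>2 \<partial>P i)))"
proof -
  let ?K = "{..<n} \<times> (UNIV :: 'k set)"
  define G where "G = (\<Sum>i\<in>UNIV. \<Sum>l\<in>UNIV. \<integral>x. (g l x)\<^sup>2 \<partial>P i)"
  define U where "U = PiM ?K (\<lambda>ji. P (snd ji))"
  define R where "R q u = (\<lambda>j\<in>{..<n}. (u :: nat \<times> 'k \<Rightarrow> 'a) (j, q j))" for q u
  interpret U: prob_space U unfolding U_def by (intro prob_space_PiM P_prob)
  note [measurable] = g
  have comp: "(\<lambda>u. u (j, i)) \<in> U \<rightarrow>\<^sub>M borel" if "j < n" for j i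
  proof -
    have "(\<lambda>u. u (j, i)) \<in> U \<rightarrow>\<^sub>M P (snd (j, i))"
      unfolding U_def using that by (intro measurable_component_singleton) auto
    then show ?thesis by (simp add: measurable_cong_sets[OF refl P_sets])
  qed
  have R: "R q \<in> U \<rightarrow>\<^sub>M PiM {..<n} (\<lambda>_. borel)" for q
    unfolding R_def by (intro measurable_restrict comp) simp
  have law: "(\<integral>z. F z \<partial>PiM {..<n} (\<lambda>j. P (q j))) = (\<integral>u. F (R q u) \<partial>U)" for q
    unfolding R_def U_def
    using integral_PiM_reindex[of ?K "\<lambda>ji. P (snd ji)" "\<lambda>j. (j, q j)" "{..<n}" F] P_prob F
    by (simp add: measurable_cong_sets[OF sets_PiM_labels refl] inj_on_def)
  have FR: "(\<lambda>u. F (R q u)) \<in> borel_measurable U" for q by (rule measurable_compose[OF R F])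
  have iF: "integrable U (\<lambda>u. F (R q u))" for q
    using FR bound by (intro U.integrable_const_bound[where B=1]) auto
  have gi: "integrable U (\<lambda>u. (g l (u (j, i)))\<^sup>2)" "(\<integral>u. (g l (u (j, i)))\<^sup>2 \<partial>U) = (\<integral>x. (g l x)\<^sup>2 \<partial>P i)" if j: "j < n" for l j i
  proof -
    have d: "distr U (P i) (\<lambda>u. u (j, i)) = P i"
      using distr_PiM_component[of ?K "\<lambda>ji. P (snd ji)" "(j, i)"] P_prob j by (simp add: U_def)
    have m: "(\<lambda>u. u (j, i)) \<in> U \<rightarrow>\<^sub>M P i" using comp[OF j] by (simp add: measurable_cong_sets[OF refl P_sets])
    have gm: "(\<lambda>x. (g l x)\<^sup>2) \<in> borel_measurable (P i)"
      using g[of l] by (intro borel_measurable_power) (simp add: measurable_cong_sets[OF P_sets refl])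
    show "integrable U (\<lambda>u. (g l (u (j, i)))\<^sup>2)"
      using integrable_distr_eq[OF m gm] integrable_component[OF sq[of l], of i] by (simp add: d)
    show "(\<integral>u. (g l (u (j, i)))\<^sup>2 \<partial>U) = (\<integral>x. (g l x)\<^sup>2 \<partial>P i)"
      using integral_distr[OF m gm] by (simp add: d)
  qed
  have Gi: "(\<Sum>l\<in>UNIV. \<integral>x. (g l x)\<^sup>2 \<partial>P i) \<le> G" for i
    unfolding G_def by (rule member_le_sum[of i UNIV "\<lambda>i. \<Sum>l\<in>UNIV. \<integral>x. (g l x)\<^sup>2 \<partial>P i"]) (auto intro: sum_nonneg)
  \<comment> \<open>Only positions with different labels contribute, and there
    \<open>(a - b)\<^sup>2 \<le> 2 * a\<^sup>2 + 2 * b\<^sup>2\<close>, where both second moments,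
    summed over the coordinates, are at most \<open>G\<close>; this is the factor 4.\<close>
  define B where "B u = (\<Sum>j\<in>{j \<in> {..<n}. q j \<noteq> q' j}. \<Sum>l\<in>UNIV. 2 * (g l (u (j, q j)))\<^sup>2 + 2 * (g l (u (j, q' j)))\<^sup>2)" for u
  have iB: "integrable U B"
    unfolding B_def using gi by (intro Bochner_Integration.integrable_sum Bochner_Integration.integrable_add integrable_mult_right) auto
  have EB: "(\<integral>u. B u \<partial>U) \<le> real (card {j \<in> {..<n}. q j \<noteq> q' j}) * (4 * G)"
  proof -
    have "(\<integral>u. B u \<partial>U) = (\<Sum>j\<in>{j \<in> {..<n}. q j \<noteq> q' j}. \<Sum>l\<in>UNIV. 2 * (\<integral>x. (g l x)\<^sup>2 \<partial>P (q j)) + 2 * (\<integral>x. (g l x)\<^sup>2 \<partial>P (q' j)))"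
      unfolding B_def using gi by (simp add: Bochner_Integration.integral_sum)
    also have "\<dots> \<le> (\<Sum>j\<in>{j \<in> {..<n}. q j \<noteq> q' j}. 4 * G)"
    proof (rule sum_mono)
      fix j
      have "(\<Sum>l\<in>UNIV. 2 * (\<integral>x. (g l x)\<^sup>2 \<partial>P (q j)) + 2 * (\<integral>x. (g l x)\<^sup>2 \<partial>P (q' j))) =
        2 * (\<Sum>l\<in>UNIV. \<integral>x. (g l x)\<^sup>2 \<partial>P (q j)) + 2 * (\<Sum>l\<in>UNIV. \<integral>x. (g l x)\<^sup>2 \<partial>P (q' j))"
        by (simp add: sum.distrib sum_distrib_left)
      then show "(\<Sum>l\<in>UNIV. 2 * (\<integral>x. (g l x)\<^sup>2 \<partial>P (q j)) + 2 * (\<integral>x. (g l x)\<^sup>2 \<partial>P (q' j))) \<le> 4 * G"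
        using Gi[of "q j"] Gi[of "q' j"] by linarith
    qed
    finally show ?thesis by simp
  qed
  have pw: "cmod (F (R q u) - F (R q' u)) \<le> e + A * B u" for u
  proof -
    have "(\<Sum>j<n. \<Sum>l\<in>UNIV. (g l (R q u j) - g l (R q' u j))\<^sup>2) \<le> B u"
    proof -
      have "(\<Sum>j<n. \<Sum>l\<in>UNIV. (g l (R q u j) - g l (R q' u j))\<^sup>2) =
        (\<Sum>j\<in>{j \<in> {..<n}. q j \<noteq> q' j}. \<Sum>l\<in>UNIV. (g l (R q u j) - g l (R q' u j))\<^sup>2)"
        by (intro sum.mono_neutral_right) (auto simp: R_def)
      also have "\<dots> \<le> B u" unfolding B_def
      proof (intro sum_mono)
        fix j l assume "j \<in> {j \<in> {..<n}. q j \<noteq> q' j}"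
        then have "R q u j = u (j, q j)" "R q' u j = u (j, q' j)" by (auto simp: R_def)
        moreover have "(a - b)\<^sup>2 \<le> 2 * a\<^sup>2 + 2 * b\<^sup>2" for a b :: real
          using zero_le_power2[of "a + b"] by (simp add: power2_eq_square algebra_simps)
        ultimately show "(g l (R q u j) - g l (R q' u j))\<^sup>2 \<le> 2 * (g l (u (j, q j)))\<^sup>2 + 2 * (g l (u (j, q' j)))\<^sup>2" by simp
      qed
      finally show ?thesis .
    qed
    then show ?thesis using lip[of "R q u" "R q' u"] mult_left_mono[OF _ A] by fastforce
  qed
  have "cmod ((\<integral>u. F (R q u) \<partial>U) - (\<integral>u. F (R q' u) \<partial>U)) = cmod (\<integral>u. F (R q u) - F (R q' u) \<partial>U)"
    using iF by simp
  also have "\<dots> \<le> (\<integral>u. cmod (F (R q u) - F (R q' u)) \<partial>U)" by (rule integral_norm_bound)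
  also have "\<dots> \<le> (\<integral>u. e + A * B u \<partial>U)"
    by (intro integral_mono pw) (use iF iB in auto)
  also have "\<dots> = e + A * (\<integral>u. B u \<partial>U)" using iB by (simp add: U.prob_space)
  also have "\<dots> \<le> e + A * (real (card {j \<in> {..<n}. q j \<noteq> q' j}) * (4 * G))"
    using EB A by (intro add_left_mono mult_left_mono)
  finally show ?thesis unfolding law G_def .
qed

text \<open>The mixture integral is an average over label sequences. For each of them invariance
  permits reordering the data so that only the excess counts are mismatched; their mean number is of
  smaller order than \<open>n\<close>, while a mismatch costs \<open>A / n\<close>. The free
  \<open>e\<close> in \<open>lip\<close> is there because a bound by absolute differences turns into
  one by squared differences only up to such a term.\<close>

lemma permutation_invariant_replacement:
  fixes H :: "nat \<Rightarrow> (nat \<Rightarrow> 'a) \<Rightarrow> complex" and g :: "'d::finite \<Rightarrow> 'a \<Rightarrow> real"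
  assumes H: "\<And>n. H n \<in> borel_measurable (PiM {..<n} (\<lambda>_. borel))" and bound: "\<And>n z. cmod (H n z) \<le> 1"
    and inv: "\<And>n \<tau> z. \<tau> permutes {..<n} \<Longrightarrow> H n (\<lambda>j\<in>{..<n}. z (\<tau> j)) = H n z"
    and g: "\<And>l. g l \<in> borel_measurable borel" and sq: "\<And>l. integrable (mixture p P) (\<lambda>x. (g l x)\<^sup>2)"
    and lip: "\<And>e. e > 0 \<Longrightarrow> \<exists>A\<ge>0. \<forall>\<^sub>F n in sequentially. \<forall>z z'.
        cmod (H n z - H n z') \<le> e + A / real n * (\<Sum>j<n. \<Sum>l\<in>UNIV. (g l (z j) - g l (z' j))\<^sup>2)"
  shows "(\<lambda>n. (\<integral>z. H n z \<partial>data_law N P n) - (\<integral>z. H n z \<partial>iid n (mixture p P))) \<longlonglongrightarrow> 0"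
proof (rule LIMSEQ_I)
  fix e :: real assume e: "e > 0"
  obtain A where A: "A \<ge> 0" and ev: "\<forall>\<^sub>F n in sequentially. \<forall>z z'.
     cmod (H n z - H n z') \<le> e / 2 + A / real n * (\<Sum>j<n. \<Sum>l\<in>UNIV. (g l (z j) - g l (z' j))\<^sup>2)"
    using lip[of "e / 2"] e by auto
  define G where "G = 4 * (\<Sum>i\<in>UNIV. \<Sum>l\<in>UNIV. \<integral>x. (g l x)\<^sup>2 \<partial>P i)"
  have G0: "G \<ge> 0" unfolding G_def by (intro mult_nonneg_nonneg sum_nonneg) auto
  have root: "(\<lambda>n. 1 / sqrt (real n)) \<longlonglongrightarrow> 0"
    by (rule tendsto_divide_0[OF tendsto_const]) (intro filterlim_at_top_imp_at_infinity filterlim_compose[OF sqrt_at_top filterlim_real_sequentially])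
  have "(\<lambda>n. e / 2 + A * G * (\<Sum>i\<in>(UNIV :: 'k set). 1 / sqrt (real n) + \<bar>p i - real (N n i) / real n\<bar>))
     \<longlonglongrightarrow> e / 2 + A * G * (\<Sum>i\<in>(UNIV :: 'k set). 0 + \<bar>p i - p i\<bar>)"
    by (intro tendsto_intros root N_lim)
  then have lim: "\<forall>\<^sub>F n in sequentially. e / 2 + A * G * (\<Sum>i\<in>(UNIV :: 'k set). 1 / sqrt (real n) + \<bar>p i - real (N n i) / real n\<bar>) < e"
    by (rule order_tendstoD) (use e in simp)
  have "\<forall>\<^sub>F n in sequentially. norm ((\<integral>z. H n z \<partial>data_law N P n) - (\<integral>z. H n z \<partial>iid n (mixture p P)) - 0) < e"
    using ev lim eventually_gt_at_top[of 0]
  proof eventually_elim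
    fix n assume lip_n: "\<forall>z z'. cmod (H n z - H n z') \<le> e / 2 + A / real n * (\<Sum>j<n. \<Sum>l\<in>UNIV. (g l (z j) - g l (z' j))\<^sup>2)"
      and lim_n: "e / 2 + A * G * (\<Sum>i\<in>(UNIV :: 'k set). 1 / sqrt (real n) + \<bar>p i - real (N n i) / real n\<bar>) < e" and n: "0 < n"
    let ?c = "\<lambda>L i. real (card {j \<in> {..<n}. L j = i})"
    let ?I = "\<lambda>L. \<integral>z. H n z \<partial>PiM {..<n} (\<lambda>j. P (L j))"
    have each: "cmod ((\<integral>z. H n z \<partial>data_law N P n) - ?I L) \<le> e / 2 + A / real n * ((\<Sum>i\<in>UNIV. \<bar>?c L i - real n * p i\<bar> + \<bar>real n * p i - real (N n i)\<bar>) * G)" for L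
    proof -
      obtain \<tau> where \<tau>: "\<tau> permutes {..<n}"
        "card {j \<in> {..<n}. grp N n (\<tau> j) \<noteq> L j} \<le> (\<Sum>i\<in>UNIV. card {j \<in> {..<n}. L j = i} - card {j \<in> {..<n}. grp N n j = i})"
        using exists_permutation_few_mismatches[of "{..<n}" "grp N n" L] by auto
      have "cmod ((\<integral>z. H n z \<partial>data_law N P n) - ?I L) \<le> e / 2 + A / real n * (real (card {j \<in> {..<n}. grp N n (\<tau> j) \<noteq> L j}) * G)"
        unfolding data_law_relabel[OF \<tau>(1) H inv[OF \<tau>(1)]] G_def
        by (rule coupling_bound[OF H bound g sq]) (use lip_n A in auto)
      also have "\<dots> \<le> e / 2 + A / real n * ((\<Sum>i\<in>UNIV. \<bar>?c L i - real n * p i\<bar> + \<bar>real n * p i - real (N n i)\<bar>) * G)"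
      proof (intro add_left_mono mult_left_mono mult_right_mono G0)
        have "real (card {j \<in> {..<n}. grp N n (\<tau> j) \<noteq> L j}) \<le> real (\<Sum>i\<in>UNIV. card {j \<in> {..<n}. L j = i} - card {j \<in> {..<n}. grp N n j = i})"
          using \<tau>(2) by (rule of_nat_mono)
        also have "\<dots> \<le> (\<Sum>i\<in>UNIV. \<bar>?c L i - real n * p i\<bar> + \<bar>real n * p i - real (N n i)\<bar>)"
          unfolding of_nat_sum card_grp by (intro sum_mono) linarith
        finally show "real (card {j \<in> {..<n}. grp N n (\<tau> j) \<noteq> L j}) \<le> \<dots>" .
      qed (use A in simp)
      finally show ?thesis .
    qed
    have "(\<integral>z. H n z \<partial>data_law N P n) - (\<integral>z. H n z \<partial>iid n (mixture p P)) =
      (\<Sum>L\<in>label_seqs n. label_weight n L *\<^sub>R ((\<integral>z. H n z \<partial>data_law N P n) - ?I L))"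
      unfolding iid_mixture_integral[OF H bound]
      by (simp add: scaleR_diff_right sum_subtractf scaleR_left.sum[symmetric] label_weight_sum)
    then have "cmod ((\<integral>z. H n z \<partial>data_law N P n) - (\<integral>z. H n z \<partial>iid n (mixture p P))) \<le>
      (\<Sum>L\<in>label_seqs n. cmod (label_weight n L *\<^sub>R ((\<integral>z. H n z \<partial>data_law N P n) - ?I L)))"
      by (simp add: norm_sum del: norm_scaleR)
    also have "\<dots> \<le> (\<Sum>L\<in>label_seqs n. label_weight n L * (e / 2 + A / real n * ((\<Sum>i\<in>UNIV. \<bar>?c L i - real n * p i\<bar> + \<bar>real n * p i - real (N n i)\<bar>) * G)))"
      unfolding norm_scaleR abs_of_nonneg[OF label_weight_nonneg] by (intro sum_mono mult_left_mono each) simp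
    also have "\<dots> = e / 2 * (\<Sum>L\<in>label_seqs n. label_weight n L) + A / real n * G *
       (\<Sum>i\<in>UNIV. (\<Sum>L\<in>label_seqs n. label_weight n L * \<bar>?c L i - real n * p i\<bar>) + \<bar>real n * p i - real (N n i)\<bar> * (\<Sum>L\<in>label_seqs n. label_weight n L))"
    proof -
      have "(\<Sum>L\<in>label_seqs n. label_weight n L * (\<Sum>i\<in>UNIV. \<bar>?c L i - real n * p i\<bar> + \<bar>real n * p i - real (N n i)\<bar>)) =
        (\<Sum>i\<in>UNIV. (\<Sum>L\<in>label_seqs n. label_weight n L * \<bar>?c L i - real n * p i\<bar>) + \<bar>real n * p i - real (N n i)\<bar> * (\<Sum>L\<in>label_seqs n. label_weight n L))"
        unfolding sum_distrib_left by (subst sum.swap) (simp add: distrib_left sum.distrib mult_ac)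
      moreover have "(\<Sum>L\<in>label_seqs n. label_weight n L * (e / 2 + A / real n * ((\<Sum>i\<in>UNIV. \<bar>?c L i - real n * p i\<bar> + \<bar>real n * p i - real (N n i)\<bar>) * G))) =
        e / 2 * (\<Sum>L\<in>label_seqs n. label_weight n L) + A / real n * G * (\<Sum>L\<in>label_seqs n. label_weight n L * (\<Sum>i\<in>UNIV. \<bar>?c L i - real n * p i\<bar> + \<bar>real n * p i - real (N n i)\<bar>))"
        by (simp add: sum_distrib_left[of _ _ "label_seqs n"] sum.distrib[symmetric] distrib_left mult_ac del: sum.distrib)
      ultimately show ?thesis by simp
    qed
    also have "\<dots> \<le> e / 2 * 1 + A / real n * G * (\<Sum>i\<in>(UNIV :: 'k set). sqrt (real n) + \<bar>real n * p i - real (N n i)\<bar> * 1)"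
      unfolding label_weight_sum using A G0
      by (intro add_left_mono mult_left_mono sum_mono add_right_mono label_count_deviation) auto
    also have "\<dots> = e / 2 + A * G * (\<Sum>i\<in>(UNIV :: 'k set). 1 / sqrt (real n) + \<bar>p i - real (N n i) / real n\<bar>)"
    proof -
      have "sqrt (real n) / real n = 1 / sqrt (real n)" 
        using nonzero_divide_mult_cancel_left[of "sqrt (real n)" "sqrt (real n)"] n by simp
      moreover have "\<bar>real n * p i - real (N n i)\<bar> / real n = \<bar>p i - real (N n i) / real n\<bar>" for i
      proof -
        have "\<bar>real n * p i - real (N n i)\<bar> / real n = \<bar>(real n * p i - real (N n i)) / real n\<bar>" by simp
        also have "(real n * p i - real (N n i)) / real n = p i - real (N n i) / real n"
          using n by (simp add: diff_divide_distrib)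
        finally show ?thesis .
      qed
      ultimately have "(\<Sum>i\<in>(UNIV :: 'k set). sqrt (real n) + \<bar>real n * p i - real (N n i)\<bar>) / real n =
         (\<Sum>i\<in>(UNIV :: 'k set). 1 / sqrt (real n) + \<bar>p i - real (N n i) / real n\<bar>)"
        by (simp add: sum_divide_distrib add_divide_distrib)
      moreover have "A / real n * G * X = A * G * (X / real n)" for X by simp
      ultimately show ?thesis by (simp only: mult_1_right)
    qed
    also note lim_n
    finally show "norm ((\<integral>z. H n z \<partial>data_law N P n) - (\<integral>z. H n z \<partial>iid n (mixture p P)) - 0) < e" by simp
  qed
  then show "\<exists>n0. \<forall>n\<ge>n0. norm ((\<integral>z. H n z \<partial>data_law N P n) - (\<integral>z. H n z \<partial>iid n (mixture p P)) - 0) < e"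
    by (simp add: eventually_sequentially)
qed

end

section \<open>Convergence in probability and boundedness in probability\<close>

text \<open>The relation usually written o_P(1).\<close>

definition vanishing :: "(nat \<Rightarrow> 'w measure) \<Rightarrow> (nat \<Rightarrow> 'w \<Rightarrow> real) \<Rightarrow> bool" where
  "vanishing M X \<longleftrightarrow> (\<forall>e>0. (\<lambda>n. measure (M n) {x \<in> space (M n). \<bar>X n x\<bar> > e}) \<longlonglongrightarrow> 0)"

text \<open>The relation usually written O_P(1).\<close>

definition stoch_bounded :: "(nat \<Rightarrow> 'w measure) \<Rightarrow> (nat \<Rightarrow> 'w \<Rightarrow> real) \<Rightarrow> bool" where
  "stoch_bounded M X \<longleftrightarrow> (\<forall>e>0. \<exists>B>0. \<forall>\<^sub>F n in sequentially. measure (M n) {x \<in> space (M n). \<bar>X n x\<bar> > B} < e)"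

lemma vanishing_alt:
  "vanishing M X \<longleftrightarrow> (\<forall>d>0. \<forall>e>0. \<forall>\<^sub>F n in sequentially. measure (M n) {x \<in> space (M n). \<bar>X n x\<bar> > d} < e)"
  unfolding vanishing_def tendsto_iff dist_real_def diff_0_right abs_of_nonneg[OF measure_nonneg] ..

lemma vanishingD:
  "vanishing M X \<Longrightarrow> d > 0 \<Longrightarrow> e > 0 \<Longrightarrow> \<forall>\<^sub>F n in sequentially. measure (M n) {x \<in> space (M n). \<bar>X n x\<bar> > d} < e"
  by (simp add: vanishing_alt)

lemma stoch_boundedD:
  "stoch_bounded M X \<Longrightarrow> e > 0 \<Longrightarrow> \<exists>B>0. \<forall>\<^sub>F n in sequentially. measure (M n) {x \<in> space (M n). \<bar>X n x\<bar> > B} < e"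
  by (simp add: stoch_bounded_def)

locale prob_seq =
  fixes M :: "nat \<Rightarrow> 'w measure"
  assumes prob_M: "\<And>n. prob_space (M n)"
begin

definition rv :: "(nat \<Rightarrow> 'w \<Rightarrow> real) \<Rightarrow> bool" where
  "rv X \<longleftrightarrow> (\<forall>n. X n \<in> borel_measurable (M n))"

lemma rvD [measurable_dest]: "rv X \<Longrightarrow> X n \<in> borel_measurable (M n)"
  by (simp add: rv_def)

text \<open>The set given by \<open>R\<close> may fail to be measurable: \<open>measure\<close> then
  assigns 0 to it, and monotonicity still holds.\<close>

lemma measure_union_bound:
  assumes "{x \<in> space (M n). P x} \<in> sets (M n)" "{x \<in> space (M n). Q x} \<in> sets (M n)"
    and "\<And>x. x \<in> space (M n) \<Longrightarrow> R x \<Longrightarrow> P x \<or> Q x"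
  shows "measure (M n) {x \<in> space (M n). R x} \<le> measure (M n) {x \<in> space (M n). P x} + measure (M n) {x \<in> space (M n). Q x}"
proof -
  interpret prob_space "M n" by (rule prob_M)
  have "measure (M n) {x \<in> space (M n). R x} \<le> measure (M n) ({x \<in> space (M n). P x} \<union> {x \<in> space (M n). Q x})"
    using assms by (intro finite_measure_mono) auto
  also have "\<dots> \<le> measure (M n) {x \<in> space (M n). P x} + measure (M n) {x \<in> space (M n). Q x}"
    using assms by (intro measure_Un_le)
  finally show ?thesis .
qed

lemma vanishing_add:
  assumes [measurable]: "rv X" "rv Y" and "vanishing M X" "vanishing M Y"
  shows "vanishing M (\<lambda>n x. X n x + Y n x)"
  unfolding vanishing_alt
proof (intro allI impI)
  fix d e :: real assume d: "d > 0" and e: "e > 0"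
  have "\<forall>\<^sub>F n in sequentially. measure (M n) {x \<in> space (M n). \<bar>X n x\<bar> > d / 2} < e / 2"
    "\<forall>\<^sub>F n in sequentially. measure (M n) {x \<in> space (M n). \<bar>Y n x\<bar> > d / 2} < e / 2"
    using vanishingD[OF assms(3), of "d / 2" "e / 2"] vanishingD[OF assms(4), of "d / 2" "e / 2"] d e by simp_all
  then show "\<forall>\<^sub>F n in sequentially. measure (M n) {x \<in> space (M n). \<bar>X n x + Y n x\<bar> > d} < e"
  proof eventually_elim
    case (elim n)
    have "measure (M n) {x \<in> space (M n). \<bar>X n x + Y n x\<bar> > d} \<le>
       measure (M n) {x \<in> space (M n). \<bar>X n x\<bar> > d / 2} + measure (M n) {x \<in> space (M n). \<bar>Y n x\<bar> > d / 2}"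
      by (rule measure_union_bound) (measurable, linarith)
    with elim show ?case by linarith
  qed
qed

lemma vanishing_mult:
  assumes [measurable]: "rv X" "rv Y" and X: "stoch_bounded M X" and Y: "vanishing M Y"
  shows "vanishing M (\<lambda>n x. X n x * Y n x)"
  unfolding vanishing_alt
proof (intro allI impI)
  fix d e :: real assume d: "d > 0" and e: "e > 0"
  obtain B where B: "B > 0" "\<forall>\<^sub>F n in sequentially. measure (M n) {x \<in> space (M n). \<bar>X n x\<bar> > B} < e / 2"
    using stoch_boundedD[OF X, of "e / 2"] e by auto
  have "\<forall>\<^sub>F n in sequentially. measure (M n) {x \<in> space (M n). \<bar>Y n x\<bar> > d / B} < e / 2"
    using vanishingD[OF Y, of "d / B" "e / 2"] d e B by simp
  with B(2) show "\<forall>\<^sub>F n in sequentially. measure (M n) {x \<in> space (M n). \<bar>X n x * Y n x\<bar> > d} < e"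
  proof eventually_elim
    case (elim n)
    have "measure (M n) {x \<in> space (M n). \<bar>X n x * Y n x\<bar> > d} \<le>
       measure (M n) {x \<in> space (M n). \<bar>X n x\<bar> > B} + measure (M n) {x \<in> space (M n). \<bar>Y n x\<bar> > d / B}"
    proof (rule measure_union_bound)
      fix x assume x: "\<bar>X n x * Y n x\<bar> > d"
      show "\<bar>X n x\<bar> > B \<or> \<bar>Y n x\<bar> > d / B"
      proof (rule ccontr)
        assume "\<not> ?thesis"
        then have "\<bar>X n x\<bar> * \<bar>Y n x\<bar> \<le> B * (d / B)" using B by (intro mult_mono) auto
        then show False using x B by (simp add: abs_mult)
      qed
    qed measurable
    with elim show ?case by linarith
  qed
qed

lemma vanishing_imp_bounded: "vanishing M X \<Longrightarrow> stoch_bounded M X"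
  unfolding stoch_bounded_def using vanishingD[of M X 1] zero_less_one by blast

lemma stoch_bounded_const:
  assumes "w \<longlonglongrightarrow> (c :: real)"
  shows "stoch_bounded M (\<lambda>n _. w n)"
  unfolding stoch_bounded_def
proof (intro allI impI)
  fix e :: real assume e: "e > 0"
  have "\<forall>\<^sub>F n in sequentially. \<bar>w n\<bar> < \<bar>c\<bar> + 1"
    by (rule order_tendstoD[OF tendsto_rabs[OF assms]]) simp
  then have "\<forall>\<^sub>F n in sequentially. measure (M n) {x \<in> space (M n). \<bar>w n\<bar> > \<bar>c\<bar> + 1} < e"
  proof eventually_elim
    case (elim n)
    then have "{x \<in> space (M n). \<bar>w n\<bar> > \<bar>c\<bar> + 1} = {}" by auto
    then show ?case using e by (simp only: measure_empty)
  qed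
  then show "\<exists>B>0. \<forall>\<^sub>F n in sequentially. measure (M n) {x \<in> space (M n). \<bar>w n\<bar> > B} < e"
    by (intro exI[of _ "\<bar>c\<bar> + 1"]) simp
qed

lemma rv_const [simp]: "rv (\<lambda>n _. w n)" by (simp add: rv_def)

lemma rv_add: "rv X \<Longrightarrow> rv Y \<Longrightarrow> rv (\<lambda>n x. X n x + Y n x)"
  by (auto simp: rv_def intro: borel_measurable_add)

lemma rv_mult: "rv X \<Longrightarrow> rv Y \<Longrightarrow> rv (\<lambda>n x. X n x * Y n x)"
  by (auto simp: rv_def intro: borel_measurable_times)

lemma rv_sum: "(\<And>i. i \<in> I \<Longrightarrow> rv (X i)) \<Longrightarrow> rv (\<lambda>n x. \<Sum>i\<in>I. X i n x)"
  unfolding rv_def by (intro allI borel_measurable_sum) blast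

lemma vanishing_const_mult:
  assumes "w \<longlonglongrightarrow> (c :: real)" "rv X" "vanishing M X"
  shows "vanishing M (\<lambda>n x. w n * X n x)"
  by (rule vanishing_mult[OF rv_const assms(2) stoch_bounded_const[OF assms(1)] assms(3)])

lemma vanishing_sum:
  assumes "finite I" "\<And>i. i \<in> I \<Longrightarrow> rv (X i)" "\<And>i. i \<in> I \<Longrightarrow> vanishing M (X i)"
  shows "vanishing M (\<lambda>n x. \<Sum>i\<in>I. X i n x)"
  using assms
proof (induction I rule: finite_induct)
  case empty
  then show ?case by (simp add: vanishing_def)
next
  case (insert i I)
  then show ?case by (simp add: vanishing_add rv_sum)
qed

lemma vanishing_mono:
  assumes "\<forall>\<^sub>F n in sequentially. \<forall>x\<in>space (M n). \<bar>Y n x\<bar> \<le> \<bar>X n x\<bar>" and [measurable]: "rv X" and "vanishing M X"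
  shows "vanishing M Y"
  unfolding vanishing_alt
proof (intro allI impI)
  fix d e :: real assume "d > 0" "e > 0"
  then have "\<forall>\<^sub>F n in sequentially. measure (M n) {x \<in> space (M n). \<bar>X n x\<bar> > d} < e"
    using assms(3) by (simp add: vanishing_alt)
  with assms(1) show "\<forall>\<^sub>F n in sequentially. measure (M n) {x \<in> space (M n). \<bar>Y n x\<bar> > d} < e"
  proof eventually_elim
    case (elim n)
    interpret prob_space "M n" by (rule prob_M)
    have "measure (M n) {x \<in> space (M n). \<bar>Y n x\<bar> > d} \<le> measure (M n) {x \<in> space (M n). \<bar>X n x\<bar> > d}"
      using elim(1) by (intro finite_measure_mono) (force, measurable)
    with elim show ?case by linarith
  qed
qed

text \<open>The product of \<open>T + R\<close> with \<open>W\<close> differs from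
  \<open>T * C\<close> by \<open>T * (W - C)\<close>, \<open>R * (W - C)\<close> and
  \<open>C * R\<close>, each of which is o_P(1) since \<open>T\<close> is O_P(1). The abstract form
  serves the identity and the random permutation alike.\<close>

lemma contrast_linearisation:
  fixes T R :: "nat \<Rightarrow> 'w \<Rightarrow> 'k::finite \<Rightarrow> 'd::finite \<Rightarrow> real" and W :: "nat \<Rightarrow> 'w \<Rightarrow> real^'m^'k" and C :: "real^'m^'k"
  assumes T: "\<And>i l. rv (\<lambda>n x. T n x i l)" "\<And>i l. stoch_bounded M (\<lambda>n x. T n x i l)"
    and R: "\<And>i l. rv (\<lambda>n x. R n x i l)" "\<And>i l. vanishing M (\<lambda>n x. R n x i l)"
    and W: "\<And>n. W n \<in> borel_measurable (M n)" "conv_in_prob M W C"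
    and w: "\<And>i. (\<lambda>n. w n i) \<longlonglongrightarrow> (\<omega> i :: real)"
    and V: "\<forall>\<^sub>F n in sequentially. \<forall>x\<in>space (M n). V n x = (\<chi> rl. \<Sum>i\<in>UNIV. w n i * (T n x i (snd rl) + R n x i (snd rl)) * W n x $ i $ fst rl)"
    and e: "e > 0"
  shows "(\<lambda>n. measure (M n) {x \<in> space (M n). norm (V n x - (\<chi> rl. \<Sum>i\<in>UNIV. w n i * T n x i (snd rl) * C $ i $ fst rl)) > e}) \<longlonglongrightarrow> 0"
proof -
  have comp: "\<bar>A $ i $ r - B $ i $ r\<bar> \<le> dist A B" for A B :: "real^'m^'k" and i r
    using component_le_norm_cart[of "(A - B) $ i" r] Finite_Cartesian_Product.norm_nth_le[of "A - B" i] by (simp add: dist_norm)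
  define Dv where "Dv i r n x = W n x $ i $ r - C $ i $ r" for i r n x
  have Wm [measurable]: "(\<lambda>x. W n x $ i $ r) \<in> borel_measurable (M n)" for n i r
  proof -
    have "(\<lambda>A :: real^'m^'k. A $ i $ r) \<in> borel_measurable borel"
      by (intro borel_measurable_continuous_onI continuous_intros)
    from measurable_compose[OF W(1) this] show ?thesis .
  qed
  have D_rv: "rv (Dv i r)" for i r unfolding Dv_def rv_def by measurable
  have D_van: "vanishing M (Dv i r)" for i r
  proof -
    have "rv (\<lambda>n x. dist (W n x) C)" unfolding rv_def using W(1) by (auto intro!: borel_measurable_dist)
    moreover have "vanishing M (\<lambda>n x. dist (W n x) C)" using W(2) by (simp add: vanishing_def conv_in_prob_def)
    ultimately show ?thesis
      by (rule vanishing_mono[rotated]) (auto simp: Dv_def comp)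
  qed
  define E where "E i r l n x = w n i * (T n x i l * Dv i r n x + (R n x i l * Dv i r n x + C $ i $ r * R n x i l))" for i r l n x
  have E: "rv (E i r l) \<and> vanishing M (E i r l)" for i r l
  proof -
    have a: "rv (\<lambda>n x. T n x i l * Dv i r n x)" "vanishing M (\<lambda>n x. T n x i l * Dv i r n x)"
      by (intro rv_mult T D_rv vanishing_mult D_van)+
    have b: "rv (\<lambda>n x. R n x i l * Dv i r n x)" "vanishing M (\<lambda>n x. R n x i l * Dv i r n x)"
      by (intro rv_mult R D_rv vanishing_mult D_van vanishing_imp_bounded)+
    have c: "rv (\<lambda>n x. C $ i $ r * R n x i l)" "vanishing M (\<lambda>n x. C $ i $ r * R n x i l)"
      by (rule rv_mult[OF rv_const R(1)], rule vanishing_const_mult[OF tendsto_const R])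
    have bc: "rv (\<lambda>n x. R n x i l * Dv i r n x + C $ i $ r * R n x i l)" "vanishing M (\<lambda>n x. R n x i l * Dv i r n x + C $ i $ r * R n x i l)"
      by (intro rv_add b c vanishing_add)+
    show ?thesis unfolding E_def
      by (intro conjI rv_mult rv_const rv_add a bc vanishing_const_mult[OF w] vanishing_add)
  qed
  define Z where "Z n x = (\<Sum>rl\<in>UNIV. \<bar>\<Sum>i\<in>UNIV. E i (fst rl) (snd rl) n x\<bar>)" for n x
  have abs_van: "vanishing M (\<lambda>n x. \<bar>X n x\<bar>)" "rv (\<lambda>n x. \<bar>X n x\<bar>)" if "vanishing M X" "rv X" for X
    using that by (auto simp: vanishing_def rv_def intro: borel_measurable_abs)
  have Z: "rv Z" "vanishing M Z"
    unfolding Z_def by (intro rv_sum vanishing_sum abs_van; use E in \<open>auto intro!: rv_sum vanishing_sum\<close>)+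
  have "vanishing M (\<lambda>n x. norm (V n x - (\<chi> rl. \<Sum>i\<in>UNIV. w n i * T n x i (snd rl) * C $ i $ fst rl)))"
  proof (rule vanishing_mono[OF _ Z])
    show "\<forall>\<^sub>F n in sequentially. \<forall>x\<in>space (M n). \<bar>norm (V n x - (\<chi> rl. \<Sum>i\<in>UNIV. w n i * T n x i (snd rl) * C $ i $ fst rl))\<bar> \<le> \<bar>Z n x\<bar>"
      using V
    proof eventually_elim
      case (elim n)
      show ?case
      proof
        fix x assume x: "x \<in> space (M n)"
        have "V n x - (\<chi> rl. \<Sum>i\<in>UNIV. w n i * T n x i (snd rl) * C $ i $ fst rl) = (\<chi> rl. \<Sum>i\<in>UNIV. E i (fst rl) (snd rl) n x)"
        proof -
          have "V n x = (\<chi> rl. \<Sum>i\<in>UNIV. w n i * (T n x i (snd rl) + R n x i (snd rl)) * W n x $ i $ fst rl)"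
            using elim x by blast
          then show ?thesis
            by (simp add: vec_eq_iff sum_subtractf[symmetric]) (simp add: E_def Dv_def algebra_simps)
        qed
        moreover have "norm (\<chi> rl. \<Sum>i\<in>UNIV. E i (fst rl) (snd rl) n x) \<le> Z n x"
          unfolding Z_def by (rule order_trans[OF norm_le_l1_cart]) simp
        ultimately show "\<bar>norm (V n x - (\<chi> rl. \<Sum>i\<in>UNIV. w n i * T n x i (snd rl) * C $ i $ fst rl))\<bar> \<le> \<bar>Z n x\<bar>" by simp
      qed
    qed
  qed
  then show ?thesis using e by (simp add: vanishing_def)
qed

end

section \<open>Product measures with a uniform choice from a finite set\<close>

lemma uniform_product_measurable:
  assumes A: "finite A" and F: "\<And>a. a \<in> A \<Longrightarrow> (\<lambda>z. F (z, a)) \<in> D \<rightarrow>\<^sub>M K"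
  shows "F \<in> D \<Otimes>\<^sub>M uniform_count_measure A \<rightarrow>\<^sub>M K"
proof -
  have "(\<lambda>(a, z). F (z, a)) \<in> count_space A \<Otimes>\<^sub>M D \<rightarrow>\<^sub>M K"
    by (rule measurable_pair_measure_countable1) (use A F in \<open>auto intro: countable_finite\<close>)
  from measurable_compose[OF measurable_pair_swap' this] have "F \<in> D \<Otimes>\<^sub>M count_space A \<rightarrow>\<^sub>M K"
    by (simp add: case_prod_beta)
  then show ?thesis
    by (simp add: measurable_cong_sets[OF sets_pair_measure_cong[OF refl sets_uniform_count_measure_count_space] refl])
qed

lemma prob_space_uniform_count:
  assumes "finite A" "A \<noteq> {}"
  shows "prob_space (uniform_count_measure A)"
  using assms by (intro prob_spaceI) (simp add: space_uniform_count_measure emeasure_uniform_count_measure)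

lemma uniform_product_integral:
  fixes F :: "'z \<times> 'a \<Rightarrow> 'b::{banach,second_countable_topology}"
  assumes D: "prob_space D" and A: "finite A" "A \<noteq> {}"
    and F: "\<And>a. a \<in> A \<Longrightarrow> (\<lambda>z. F (z, a)) \<in> borel_measurable D" and B: "\<And>x. norm (F x) \<le> B"
  shows "(\<integral>x. F x \<partial>(D \<Otimes>\<^sub>M uniform_count_measure A)) = (\<Sum>a\<in>A. \<integral>z. F (z, a) \<partial>D) /\<^sub>R real (card A)"
proof -
  interpret D: prob_space D by fact
  interpret U: prob_space "uniform_count_measure A" by (rule prob_space_uniform_count[OF A])
  interpret DU: pair_prob_space D "uniform_count_measure A" ..
  have i: "integrable (D \<Otimes>\<^sub>M uniform_count_measure A) F"
    using uniform_product_measurable[OF A(1) F] B by (intro DU.integrable_const_bound[where B=B]) auto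
  have "(\<integral>x. F x \<partial>(D \<Otimes>\<^sub>M uniform_count_measure A)) = (\<integral>a. (\<integral>z. F (z, a) \<partial>D) \<partial>uniform_count_measure A)"
    using DU.integral_snd[of "\<lambda>z a. F (z, a)"] i by simp
  also have "\<dots> = (\<Sum>a\<in>A. (1 / real (card A)) *\<^sub>R (\<integral>z. F (z, a) \<partial>D))"
    unfolding uniform_count_measure_def by (rule lebesgue_integral_point_measure_finite[OF A(1)]) simp
  finally show ?thesis by (simp add: scaleR_sum_right inverse_eq_divide)
qed

lemma uniform_product_measure:
  assumes D: "prob_space D" and A: "finite A" "A \<noteq> {}"
    and E: "\<And>a. a \<in> A \<Longrightarrow> {z \<in> space D. P z a} \<in> sets D"
  shows "{x \<in> space (D \<Otimes>\<^sub>M uniform_count_measure A). P (fst x) (snd x)} \<in> sets (D \<Otimes>\<^sub>M uniform_count_measure A)"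
    "measure (D \<Otimes>\<^sub>M uniform_count_measure A) {x \<in> space (D \<Otimes>\<^sub>M uniform_count_measure A). P (fst x) (snd x)} =
      (\<Sum>a\<in>A. measure D {z \<in> space D. P z a}) / real (card A)"
proof -
  interpret D: prob_space D by fact
  let ?E = "{x \<in> space (D \<Otimes>\<^sub>M uniform_count_measure A). P (fst x) (snd x)}"
  have "(\<lambda>x. P (fst x) (snd x)) \<in> D \<Otimes>\<^sub>M uniform_count_measure A \<rightarrow>\<^sub>M count_space UNIV"
    by (rule uniform_product_measurable[OF A(1)]) (use E in \<open>simp add: pred_def\<close>)
  then show m: "?E \<in> sets (D \<Otimes>\<^sub>M uniform_count_measure A)" by (simp add: pred_def)
  have eq: "indicat_real ?E (z, a) = indicat_real {z \<in> space D. P z a} z" if "a \<in> A" "z \<in> space D" for z a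
    using that by (auto simp: indicator_def space_pair_measure space_uniform_count_measure)
  have "measure (D \<Otimes>\<^sub>M uniform_count_measure A) ?E = (\<integral>x. indicat_real ?E x \<partial>(D \<Otimes>\<^sub>M uniform_count_measure A))"
    using m sets.sets_into_space[OF m] by (simp add: Int_absorb2)
  also have "\<dots> = (\<Sum>a\<in>A. \<integral>z. indicat_real ?E (z, a) \<partial>D) /\<^sub>R real (card A)"
  proof (rule uniform_product_integral[OF D A, where B=1])
    fix a assume a: "a \<in> A"
    show "(\<lambda>z. indicat_real ?E (z, a)) \<in> borel_measurable D"
      using E[OF a] by (subst measurable_cong[OF eq[OF a]]) auto
  qed simp
  also have "(\<Sum>a\<in>A. \<integral>z. indicat_real ?E (z, a) \<partial>D) = (\<Sum>a\<in>A. measure D {z \<in> space D. P z a})"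
  proof (rule sum.cong[OF refl])
    fix a assume a: "a \<in> A"
    have "(\<integral>z. indicat_real ?E (z, a) \<partial>D) = (\<integral>z. indicat_real {z \<in> space D. P z a} z \<partial>D)"
      by (intro Bochner_Integration.integral_cong refl eq a)
    then show "(\<integral>z. indicat_real ?E (z, a) \<partial>D) = measure D {z \<in> space D. P z a}"
      by (simp add: Int_absorb2)
  qed
  finally show "measure (D \<Otimes>\<^sub>M uniform_count_measure A) ?E = (\<Sum>a\<in>A. measure D {z \<in> space D. P z a}) / real (card A)"
    by (simp add: divide_inverse mult.commute)
qed

section \<open>The limiting covariance as a quadratic form\<close>

lemma sum_UNIV_prod: "(\<Sum>x\<in>UNIV. F x) = (\<Sum>r\<in>UNIV. \<Sum>l\<in>UNIV. F (r, l))"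
  unfolding sum.cartesian_product by simp

text \<open>The entry \<open>(i, l)\<close> of \<open>a v* kron (transpose C) (mat 1)\<close>: the
  weight that the direction \<open>a\<close> gives to coordinate \<open>l\<close> of sample
  \<open>i\<close>.\<close>

definition contrast_weight :: "real^'m^'k \<Rightarrow> real^('m \<times> 'd) \<Rightarrow> 'k \<Rightarrow> 'd::finite \<Rightarrow> real" where
  "contrast_weight C a i l = (\<Sum>r\<in>UNIV. a $ (r, l) * C $ i $ r)"

text \<open>Moving both Kronecker factors onto \<open>a\<close> leaves a block-diagonal form, in
  which different samples do not interact. In this shape the limiting covariance can be compared
  with variances of weighted sums of scores.\<close>

lemma kron_quadratic_form:
  fixes C :: "real^'m^'k" and G :: "'k \<Rightarrow> real^'d^'d" and a :: "real^('m \<times> 'd)"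
  defines "S \<equiv> kron (transpose C) (mat 1 :: real^'d^'d) ** blockdiag G ** transpose (kron (transpose C) (mat 1 :: real^'d^'d))"
  shows "a \<bullet> (S *v a) = (\<Sum>i\<in>UNIV. \<Sum>l\<in>UNIV. \<Sum>l'\<in>UNIV. contrast_weight C a i l * contrast_weight C a i l' * G i $ l $ l')"
    and "(\<And>i l l'. G i $ l $ l' = G i $ l' $ l) \<Longrightarrow> transpose S = S"
proof -
  let ?K = "kron (transpose C) (mat 1 :: real^'d^'d)"
  define v where "v = a v* ?K"
  have v: "v $ (i, l) = contrast_weight C a i l" for i l
  proof -
    have "v $ (i, l) = (\<Sum>r\<in>UNIV. \<Sum>l'\<in>UNIV. C $ i $ r * (if l' = l then 1 else 0) * a $ (r, l'))"
      by (simp add: v_def vector_matrix_mult_def kron_def transpose_def mat_def sum_UNIV_prod mult_ac)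
    then show ?thesis
      by (simp add: contrast_weight_def mult_delta_left mult_delta_right mult.commute if_distrib if_distribR cong: if_cong)
  qed
  have "a \<bullet> (S *v a) = a \<bullet> (?K *v (blockdiag G *v (transpose ?K *v a)))"
    by (simp only: S_def matrix_vector_mul_assoc matrix_mul_assoc)
  also have "\<dots> = v \<bullet> (blockdiag G *v v)"
    by (simp add: v_def dot_lmul_matrix[symmetric])
  also have "\<dots> = (\<Sum>i\<in>UNIV. \<Sum>l\<in>UNIV. v $ (i, l) * (\<Sum>i'\<in>UNIV. \<Sum>l'\<in>UNIV. (if i = i' then G i $ l $ l' else 0) * v $ (i', l')))"
    by (simp add: inner_vec_def matrix_vector_mult_def blockdiag_def sum_UNIV_prod cong: if_cong)
  also have "\<dots> = (\<Sum>i\<in>UNIV. \<Sum>l\<in>UNIV. v $ (i, l) * (\<Sum>l'\<in>UNIV. G i $ l $ l' * v $ (i, l')))"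
  proof (intro sum.cong refl arg_cong2[where f="(*)"])
    fix i l
    have "(\<Sum>i'\<in>UNIV. \<Sum>l'\<in>UNIV. (if i = i' then G i $ l $ l' else 0) * v $ (i', l')) =
      (\<Sum>i'\<in>UNIV. if i = i' then \<Sum>l'\<in>UNIV. G i $ l $ l' * v $ (i', l') else 0)"
      by (intro sum.cong refl) auto
    then show "(\<Sum>i'\<in>UNIV. \<Sum>l'\<in>UNIV. (if i = i' then G i $ l $ l' else 0) * v $ (i', l')) = (\<Sum>l'\<in>UNIV. G i $ l $ l' * v $ (i, l'))"
      by simp
  qed
  also have "\<dots> = (\<Sum>i\<in>UNIV. \<Sum>l\<in>UNIV. \<Sum>l'\<in>UNIV. contrast_weight C a i l * contrast_weight C a i l' * G i $ l $ l')"
    by (simp add: v sum_distrib_left mult_ac)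
  finally show "a \<bullet> (S *v a) = (\<Sum>i\<in>UNIV. \<Sum>l\<in>UNIV. \<Sum>l'\<in>UNIV. contrast_weight C a i l * contrast_weight C a i l' * G i $ l $ l')" .
  assume "\<And>i l l'. G i $ l $ l' = G i $ l' $ l"
  then have "transpose (blockdiag G) = blockdiag G"
    by (simp add: transpose_def blockdiag_def vec_eq_iff)
  then show "transpose S = S" by (simp add: S_def matrix_transpose_mul matrix_mul_assoc)
qed

section \<open>Linearised block statistics\<close>

text \<open>Summation over inverse permutations moves the permutation from one array to the
  other.\<close>

lemma perm_second_moment_right:
  fixes x y :: "'a \<Rightarrow> real"
  assumes "finite S" "card S \<ge> 2" "(\<Sum>j\<in>S. x j) = 0"
  shows "(\<Sum>\<pi> | \<pi> permutes S. (\<Sum>j\<in>S. x j * y (\<pi> j))\<^sup>2) \<le>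
    fact (card S) * ((\<Sum>j\<in>S. (x j)\<^sup>2) * (\<Sum>j\<in>S. (y j)\<^sup>2)) / (real (card S) - 1)"
proof -
  have "(\<Sum>\<pi> | \<pi> permutes S. (\<Sum>j\<in>S. x j * y (\<pi> j))\<^sup>2) = (\<Sum>\<pi> | \<pi> permutes S. (\<Sum>j\<in>S. x j * y (inv \<pi> j))\<^sup>2)"
    by (rule sum_permutations_inverse)
  also have "\<dots> = (\<Sum>\<pi> | \<pi> permutes S. (\<Sum>j\<in>S. x (\<pi> j) * y j)\<^sup>2)"
  proof (rule sum.cong[OF refl])
    fix \<pi> assume "\<pi> \<in> {\<pi>. \<pi> permutes S}"
    then have p: "\<pi> permutes S" by simp
    show "(\<Sum>j\<in>S. x j * y (inv \<pi> j))\<^sup>2 = (\<Sum>j\<in>S. x (\<pi> j) * y j)\<^sup>2"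
      using sum.permute[OF p, of "\<lambda>j. x j * y (inv \<pi> j)"] by (simp add: comp_def permutes_inverses[OF p])
  qed
  finally show ?thesis using perm_second_moment[OF assms, of y] by simp
qed

lemma iexp_lipschitz: "cmod (iexp x - iexp y) \<le> \<bar>x - y\<bar>"
proof -
  have "iexp x - iexp y = iexp y * (iexp (x - y) - 1)"
    by (simp add: exp_add[symmetric] right_diff_distrib of_real_diff)
  then have "cmod (iexp x - iexp y) = cmod (iexp (x - y) - 1)" by (simp add: norm_mult)
  also have "\<dots> \<le> \<bar>x - y\<bar>" using iexp_approx1[of "x - y" 0] by simp
  finally show ?thesis .
qed

lemma exp_minus_lipschitz:
  fixes x y :: real
  assumes "x \<ge> 0" "y \<ge> 0"
  shows "\<bar>exp (- x) - exp (- y)\<bar> \<le> \<bar>x - y\<bar>"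
proof -
  have *: "exp (- a) - exp (- b) \<le> b - a" if "0 \<le> a" "a \<le> b" for a b :: real
  proof -
    have "1 - (b - a) \<le> exp (- (b - a))" using exp_ge_add_one_self[of "- (b - a)"] by linarith
    then have "exp (- a) * (1 - exp (- (b - a))) \<le> 1 * (b - a)"
      using that by (intro mult_mono) auto
    then show ?thesis by (simp add: right_diff_distrib exp_add[symmetric])
  qed
  show ?thesis
  proof (cases "x \<le> y")
    case True
    then show ?thesis using *[of x y] assms by simp
  next
    case False
    then show ?thesis using *[of y x] assms by simp
  qed
qed

lemma abs_le_square_tradeoff:
  fixes x \<epsilon> :: real
  assumes "\<epsilon> > 0"
  shows "\<bar>x\<bar> \<le> \<epsilon> + x\<^sup>2 / \<epsilon>"
proof -
  have "2 * \<bar>x\<bar> * \<epsilon> \<le> \<epsilon>\<^sup>2 + x\<^sup>2" using sum_squares_bound[of "\<bar>x\<bar>" \<epsilon>] by simp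
  moreover have "0 \<le> \<bar>x\<bar> * \<epsilon>" using assms by simp
  ultimately have "\<bar>x\<bar> * \<epsilon> \<le> \<epsilon>\<^sup>2 + x\<^sup>2" by linarith
  then show ?thesis using assms by (simp add: field_simps power2_eq_square)
qed

text \<open>The first moment is reduced to the second by
  \<open>\<bar>x\<bar> \<le> \<epsilon> + x\<^sup>2 / \<epsilon>\<close>, and the factor 2 comes
  from \<open>1 / (n - 1) \<le> 2 / n\<close>. The first version serves the sensitivity of
  permutation averages to the data, the second the cross terms of two permutations.\<close>

lemma perm_average_abs:
  fixes x y :: "'a \<Rightarrow> real"
  assumes S: "finite S" "card S \<ge> 2" and x: "(\<Sum>j\<in>S. x j) = 0" "(\<Sum>j\<in>S. (x j)\<^sup>2) \<le> X" and \<epsilon>: "\<epsilon> > 0"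
  shows "(\<Sum>\<pi> | \<pi> permutes S. \<bar>\<Sum>j\<in>S. x j * y (\<pi> j)\<bar>) / fact (card S) \<le> \<epsilon> + 2 * X / \<epsilon> * (\<Sum>j\<in>S. (y j)\<^sup>2) / real (card S)"
    and "(\<Sum>\<pi> | \<pi> permutes S. \<bar>\<Sum>j\<in>S. x (\<pi> j) * y j\<bar>) / fact (card S) \<le> \<epsilon> + 2 * X / \<epsilon> * (\<Sum>j\<in>S. (y j)\<^sup>2) / real (card S)"
proof -
  let ?n = "real (card S)" and ?Y = "\<Sum>j\<in>S. (y j)\<^sup>2"
  have n: "?n \<ge> 2" using S by simp
  have Y0: "0 \<le> ?Y" by (intro sum_nonneg) simp
  have X0: "0 \<le> X" using x(2) sum_nonneg[of S "\<lambda>j. (x j)\<^sup>2"] by simp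
  have step: "(\<Sum>\<pi> | \<pi> permutes S. \<bar>F \<pi>\<bar>) / fact (card S) \<le> \<epsilon> + 2 * X / \<epsilon> * ?Y / ?n"
    if F: "(\<Sum>\<pi> | \<pi> permutes S. (F \<pi>)\<^sup>2) \<le> fact (card S) * ((\<Sum>j\<in>S. (x j)\<^sup>2) * ?Y) / (?n - 1)" for F :: "('a \<Rightarrow> 'a) \<Rightarrow> real"
  proof -
    have "(\<Sum>\<pi> | \<pi> permutes S. \<bar>F \<pi>\<bar>) \<le> (\<Sum>\<pi> | \<pi> permutes S. \<epsilon> + (F \<pi>)\<^sup>2 / \<epsilon>)"
      by (intro sum_mono abs_le_square_tradeoff \<epsilon>)
    also have "\<dots> = fact (card S) * \<epsilon> + (\<Sum>\<pi> | \<pi> permutes S. (F \<pi>)\<^sup>2) / \<epsilon>"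
      using S(1) by (simp add: sum.distrib card_permutations sum_divide_distrib)
    also have "\<dots> \<le> fact (card S) * \<epsilon> + (fact (card S) * (X * ?Y) / (?n / 2)) / \<epsilon>"
    proof (intro add_left_mono divide_right_mono order_trans[OF F] frac_le mult_left_mono mult_right_mono x(2) Y0)
    qed (use n \<epsilon> X0 Y0 in auto)
    also have "\<dots> = fact (card S) * (\<epsilon> + 2 * X / \<epsilon> * ?Y / ?n)" using n \<epsilon> by (simp add: field_simps)
    finally show ?thesis by (simp add: pos_divide_le_eq mult.commute)
  qed
  show "(\<Sum>\<pi> | \<pi> permutes S. \<bar>\<Sum>j\<in>S. x j * y (\<pi> j)\<bar>) / fact (card S) \<le> \<epsilon> + 2 * X / \<epsilon> * ?Y / ?n"
    by (rule step[OF perm_second_moment_right[OF S x(1)]])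
  show "(\<Sum>\<pi> | \<pi> permutes S. \<bar>\<Sum>j\<in>S. x (\<pi> j) * y j\<bar>) / fact (card S) \<le> \<epsilon> + 2 * X / \<epsilon> * ?Y / ?n"
    by (rule step[OF perm_second_moment[OF S x(1)]])
qed

context k_samples
begin

definition block_score :: "('k \<Rightarrow> 'd \<Rightarrow> 'a \<Rightarrow> real) \<Rightarrow> nat \<Rightarrow> (nat \<Rightarrow> 'a) \<Rightarrow> (nat \<Rightarrow> nat) \<Rightarrow> 'k \<Rightarrow> 'd \<Rightarrow> real" where
  "block_score h n z \<pi> i l = 1 / sqrt (real (N n i)) * (\<Sum>j<N n i. h i l (z (\<pi> (blk_start N n i + j))))"

text \<open>The linear part of \<open>Vn\<close>, with the random contrast matrix replaced by its
  limit. The scores may depend on the sample, so that the unpermuted case takes the family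
  \<open>f\<close> and the permuted case a constant family.\<close>

definition block_stat :: "('k \<Rightarrow> 'd::finite \<Rightarrow> 'a \<Rightarrow> real) \<Rightarrow> ((real, 'm::finite) vec, 'k) vec \<Rightarrow> nat \<Rightarrow> (nat \<Rightarrow> 'a) \<Rightarrow> (nat \<Rightarrow> nat) \<Rightarrow> real^('m \<times> 'd)" where
  "block_stat h C n z \<pi> = (\<chi> rl. \<Sum>i\<in>UNIV. sqrt (real n / real (N n i)) * block_score h n z \<pi> i (snd rl) * C $ i $ fst rl)"

text \<open>The weight of a single row in \<open>a \<bullet> block_stat\<close>; it is of order
  \<open>1 / sqrt n\<close> and constant on each block.\<close>

definition coef :: "((real, 'm::finite) vec, 'k) vec \<Rightarrow> real^('m \<times> 'd) \<Rightarrow> nat \<Rightarrow> 'k \<Rightarrow> 'd::finite \<Rightarrow> real" where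
  "coef C a n i l = sqrt (real n) / real (N n i) * contrast_weight C a i l"

lemma sqrt_quotient: "sqrt (real n / real m) * (1 / sqrt (real m)) = sqrt (real n) / real m"
  by (simp add: real_sqrt_divide)

text \<open>Regrouping by rows gives the shape shared by the central limit theorem and the
  permutation moments: weights attached to positions, scores to data.\<close>

lemma inner_block_stat:
  fixes C :: "((real, 'm::finite) vec, 'k) vec" and h :: "'k \<Rightarrow> 'd::finite \<Rightarrow> 'a \<Rightarrow> real"
  shows "a \<bullet> block_stat h C n z \<pi> = (\<Sum>j<n. \<Sum>l\<in>UNIV. coef C a n (grp N n j) l * h (grp N n j) l (z (\<pi> j)))"
proof -
  let ?s = "blk_start N n"
  have "a \<bullet> block_stat h C n z \<pi> = (\<Sum>r\<in>UNIV. \<Sum>l\<in>UNIV. \<Sum>i\<in>UNIV. a $ (r, l) * (sqrt (real n / real (N n i)) * block_score h n z \<pi> i l * C $ i $ r))"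
    by (simp add: inner_vec_def block_stat_def sum_UNIV_prod sum_distrib_left)
  also have "\<dots> = (\<Sum>i\<in>UNIV. \<Sum>l\<in>UNIV. \<Sum>r\<in>UNIV. a $ (r, l) * (sqrt (real n / real (N n i)) * block_score h n z \<pi> i l * C $ i $ r))"
  proof -
    have "(\<Sum>r\<in>UNIV. \<Sum>l\<in>UNIV. \<Sum>i\<in>UNIV. F r l i) = (\<Sum>i\<in>UNIV. \<Sum>l\<in>UNIV. \<Sum>r\<in>UNIV. F r l i)" for F :: "'m \<Rightarrow> 'd \<Rightarrow> 'k \<Rightarrow> real"
    proof -
      have "(\<Sum>r\<in>UNIV. \<Sum>l\<in>UNIV. \<Sum>i\<in>UNIV. F r l i) = (\<Sum>l\<in>UNIV. \<Sum>r\<in>UNIV. \<Sum>i\<in>UNIV. F r l i)" by (rule sum.swap)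
      also have "\<dots> = (\<Sum>l\<in>UNIV. \<Sum>i\<in>UNIV. \<Sum>r\<in>UNIV. F r l i)" by (rule sum.cong[OF refl], rule sum.swap)
      also have "\<dots> = (\<Sum>i\<in>UNIV. \<Sum>l\<in>UNIV. \<Sum>r\<in>UNIV. F r l i)" by (rule sum.swap)
      finally show ?thesis .
    qed
    then show ?thesis .
  qed
  also have "\<dots> = (\<Sum>i\<in>UNIV. \<Sum>l\<in>UNIV. coef C a n i l * (\<Sum>j<N n i. h i l (z (\<pi> (?s i + j)))))"
  proof (intro sum.cong refl)
    fix i l
    have "(\<Sum>r\<in>UNIV. a $ (r, l) * (sqrt (real n / real (N n i)) * block_score h n z \<pi> i l * C $ i $ r)) =
      (sqrt (real n / real (N n i)) * (1 / sqrt (real (N n i)))) * contrast_weight C a i l * (\<Sum>j<N n i. h i l (z (\<pi> (?s i + j))))"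
    proof -
      define X where "X = (\<Sum>j<N n i. h i l (z (\<pi> (?s i + j))))"
      have bs: "block_score h n z \<pi> i l = 1 / sqrt (real (N n i)) * X" by (simp add: block_score_def X_def)
      show ?thesis unfolding bs contrast_weight_def X_def[symmetric] sum_distrib_left sum_distrib_right
        by (intro sum.cong) (simp_all add: mult_ac)
    qed
    then show "(\<Sum>r\<in>UNIV. a $ (r, l) * (sqrt (real n / real (N n i)) * block_score h n z \<pi> i l * C $ i $ r)) =
      coef C a n i l * (\<Sum>j<N n i. h i l (z (\<pi> (?s i + j))))"
      unfolding sqrt_quotient by (simp add: coef_def)
  qed
  also have "\<dots> = (\<Sum>i\<in>UNIV. \<Sum>l\<in>UNIV. \<Sum>j\<in>blk N n i. coef C a n i l * h i l (z (\<pi> j)))"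
  proof (intro sum.cong refl)
    fix i l
    have "(\<Sum>j<N n i. h i l (z (\<pi> (?s i + j)))) = (\<Sum>j\<in>blk N n i. h i l (z (\<pi> j)))"
      by (rule sum.reindex_bij_witness[where i="\<lambda>j. j - ?s i" and j="\<lambda>j. ?s i + j"]) (auto simp: blk_def)
    then show "coef C a n i l * (\<Sum>j<N n i. h i l (z (\<pi> (?s i + j)))) = (\<Sum>j\<in>blk N n i. coef C a n i l * h i l (z (\<pi> j)))"
      by (simp add: sum_distrib_left)
  qed
  also have "\<dots> = (\<Sum>i\<in>UNIV. \<Sum>j\<in>blk N n i. \<Sum>l\<in>UNIV. coef C a n (grp N n j) l * h (grp N n j) l (z (\<pi> j)))"
    by (intro sum.cong refl, subst sum.swap) (intro sum.cong refl, simp add: grp_eq)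
  also have "\<dots> = (\<Sum>j<n. \<Sum>l\<in>UNIV. coef C a n (grp N n j) l * h (grp N n j) l (z (\<pi> j)))"
    using sum.group[OF finite_lessThan[of n] finite_class.finite_UNIV subset_UNIV, where g="grp N n"
      and h="\<lambda>j. \<Sum>l\<in>UNIV. coef C a n (grp N n j) l * h (grp N n j) l (z (\<pi> j))"]
    by (simp only: grp_set)
  finally show ?thesis .
qed

lemma inverse_fraction_lim: "(\<lambda>n. real n / real (N n i)) \<longlonglongrightarrow> 1 / p i"
proof -
  have "(\<lambda>n. inverse (real (N n i) / real n)) \<longlonglongrightarrow> inverse (p i)"
    by (intro tendsto_inverse N_lim) (use p_pos[of i] in simp)
  then show ?thesis by (simp add: inverse_eq_divide)
qed

lemma eventually_N_pos: "\<forall>\<^sub>F n in sequentially. \<forall>i. 0 < N n i"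
proof (rule eventually_all_finite)
  fix i
  have "\<forall>\<^sub>F n in sequentially. 1 \<le> N n i" using N_at_top[of i] by (simp add: filterlim_at_top)
  then show "\<forall>\<^sub>F n in sequentially. 0 < N n i" by (rule eventually_mono) simp
qed

lemma coef_bound:
  "\<exists>K\<ge>0. \<forall>\<^sub>F n in sequentially. \<forall>i l. \<bar>coef C a n i l\<bar> \<le> K / sqrt (real n)"
proof -
  \<comment> \<open>The summand 1 leaves room for \<open>n / N n i\<close>, which only tends to
    \<open>1 / p i\<close>; summing over all indices gives a bound common to them.\<close>
  define K where "K = (\<Sum>i\<in>UNIV. \<Sum>l\<in>UNIV. (1 / p i + 1) * \<bar>contrast_weight C a i l\<bar>)"
  have pos: "0 \<le> (1 / p i + 1) * \<bar>contrast_weight C a i l\<bar>" for i l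
    using p_pos[of i] by simp
  have K: "(1 / p i + 1) * \<bar>contrast_weight C a i l\<bar> \<le> K" for i l
  proof -
    have "(1 / p i + 1) * \<bar>contrast_weight C a i l\<bar> \<le> (\<Sum>l\<in>UNIV. (1 / p i + 1) * \<bar>contrast_weight C a i l\<bar>)"
      by (rule member_le_sum[of l UNIV "\<lambda>l. (1 / p i + 1) * \<bar>contrast_weight C a i l\<bar>"]) (use pos in auto)
    also have "\<dots> \<le> K" unfolding K_def
      by (rule member_le_sum[of i UNIV "\<lambda>i. \<Sum>l\<in>UNIV. (1 / p i + 1) * \<bar>contrast_weight C a i l\<bar>"]) (use pos in \<open>auto intro: sum_nonneg\<close>)
    finally show ?thesis .
  qed
  have "\<forall>\<^sub>F n in sequentially. \<forall>i. real n / real (N n i) < 1 / p i + 1"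
    by (intro eventually_all_finite order_tendstoD(2)[OF inverse_fraction_lim]) simp
  then have "\<forall>\<^sub>F n in sequentially. \<forall>i l. \<bar>coef C a n i l\<bar> \<le> K / sqrt (real n)"
    using eventually_gt_at_top[of 0]
  proof eventually_elim
    case (elim n)
    show ?case
    proof (intro allI)
      fix i l
      have "sqrt (real n) / real (N n i) = (real n / real (N n i)) / sqrt (real n)"
      proof -
        have "(real n / real (N n i)) / sqrt (real n) = (real n / sqrt (real n)) / real (N n i)" by simp
        also have "real n / sqrt (real n) = sqrt (real n)" by (rule real_div_sqrt) simp
        finally show ?thesis by simp
      qed
      then have "\<bar>coef C a n i l\<bar> = (real n / real (N n i)) * \<bar>contrast_weight C a i l\<bar> / sqrt (real n)"
        by (simp add: coef_def abs_mult)
      also have "\<dots> \<le> (1 / p i + 1) * \<bar>contrast_weight C a i l\<bar> / sqrt (real n)"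
        using elim(1) by (intro divide_right_mono mult_right_mono) (auto intro: less_imp_le)
      also have "\<dots> \<le> K / sqrt (real n)" using K by (intro divide_right_mono) auto
      finally show "\<bar>coef C a n i l\<bar> \<le> K / sqrt (real n)" .
    qed
  qed
  moreover have "K \<ge> 0" unfolding K_def using pos by (intro sum_nonneg) auto
  ultimately show ?thesis by blast
qed

text \<open>Squared weights of size \<open>n / (N n i)\<^sup>2\<close> occur \<open>N n i\<close>
  times in a block, hence \<open>n / N n i\<close> in total, with limit
  \<open>1 / p i\<close>.\<close>

lemma coef_quadratic_lim:
  fixes \<sigma> :: "'k \<Rightarrow> 'd::finite \<Rightarrow> 'd \<Rightarrow> real"
  shows "(\<lambda>n. \<Sum>j<n. \<Sum>l\<in>UNIV. \<Sum>l'\<in>UNIV. coef C a n (grp N n j) l * coef C a n (grp N n j) l' * \<sigma> (grp N n j) l l')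
    \<longlonglongrightarrow> (\<Sum>i\<in>UNIV. \<Sum>l\<in>UNIV. \<Sum>l'\<in>UNIV. contrast_weight C a i l * contrast_weight C a i l' * (1 / p i * \<sigma> i l l'))"
proof -
  have "(\<lambda>n. \<Sum>i\<in>UNIV. \<Sum>l\<in>UNIV. \<Sum>l'\<in>UNIV. contrast_weight C a i l * contrast_weight C a i l' * (real n / real (N n i) * \<sigma> i l l'))
    \<longlonglongrightarrow> (\<Sum>i\<in>UNIV. \<Sum>l\<in>UNIV. \<Sum>l'\<in>UNIV. contrast_weight C a i l * contrast_weight C a i l' * (1 / p i * \<sigma> i l l'))"
    by (intro tendsto_intros inverse_fraction_lim)
  then show ?thesis
  proof (rule Lim_transform_eventually)
    show "\<forall>\<^sub>F n in sequentially. (\<Sum>i\<in>UNIV. \<Sum>l\<in>UNIV. \<Sum>l'\<in>UNIV. contrast_weight C a i l * contrast_weight C a i l' * (real n / real (N n i) * \<sigma> i l l')) =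
      (\<Sum>j<n. \<Sum>l\<in>UNIV. \<Sum>l'\<in>UNIV. coef C a n (grp N n j) l * coef C a n (grp N n j) l' * \<sigma> (grp N n j) l l')"
      using eventually_N_pos
    proof eventually_elim
      case (elim n)
      have "(\<Sum>j<n. \<Sum>l\<in>UNIV. \<Sum>l'\<in>UNIV. coef C a n (grp N n j) l * coef C a n (grp N n j) l' * \<sigma> (grp N n j) l l') =
        (\<Sum>i\<in>UNIV. real (N n i) * (\<Sum>l\<in>UNIV. \<Sum>l'\<in>UNIV. coef C a n i l * coef C a n i l' * \<sigma> i l l'))"
        by (rule sum_grp)
      also have "\<dots> = (\<Sum>i\<in>UNIV. \<Sum>l\<in>UNIV. \<Sum>l'\<in>UNIV. contrast_weight C a i l * contrast_weight C a i l' * (real n / real (N n i) * \<sigma> i l l'))"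
        unfolding sum_distrib_left
      proof (intro sum.cong refl)
        fix i l l'
        have "real (N n i) * (coef C a n i l * coef C a n i l' * \<sigma> i l l') =
          (sqrt (real n) * sqrt (real n)) * real (N n i) / (real (N n i) * real (N n i)) * (contrast_weight C a i l * contrast_weight C a i l' * \<sigma> i l l')"
          by (simp add: coef_def)
        also have "(sqrt (real n) * sqrt (real n)) * real (N n i) / (real (N n i) * real (N n i)) = real n / real (N n i)"
          using elim by simp
        finally show "real (N n i) * (coef C a n i l * coef C a n i l' * \<sigma> i l l') =
          contrast_weight C a i l * contrast_weight C a i l' * (real n / real (N n i) * \<sigma> i l l')" by simp
      qed
      finally show ?case by simp
    qed
  qed
qed

text \<open>Summation over a block cancels its size in \<open>coef\<close>, so the total is a
  combination of column sums of \<open>C\<close>. This provides the centring required by the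
  permutation moments.\<close>

lemma coef_sum_zero:
  assumes "contrast_matrix C"
  shows "\<forall>\<^sub>F n in sequentially. \<forall>l. (\<Sum>j<n. coef C a n (grp N n j) l) = 0"
  using eventually_N_pos
proof eventually_elim
  case (elim n)
  show ?case
  proof
    fix l
    have "(\<Sum>j<n. coef C a n (grp N n j) l) = (\<Sum>i\<in>UNIV. real (N n i) * coef C a n i l)"
      by (rule sum_grp)
    also have "\<dots> = (\<Sum>i\<in>UNIV. sqrt (real n) * contrast_weight C a i l)"
      using elim by (intro sum.cong) (auto simp: coef_def)
    also have "\<dots> = sqrt (real n) * (\<Sum>r\<in>UNIV. a $ (r, l) * (\<Sum>i\<in>UNIV. C $ i $ r))"
      unfolding contrast_weight_def sum_distrib_left by (subst sum.swap) (rule refl)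
    also have "\<dots> = 0" using assms by (simp add: contrast_matrix_def)
    finally show "(\<Sum>j<n. coef C a n (grp N n j) l) = 0" .
  qed
qed

text \<open>\<open>uniform_clt\<close> compares with a Gaussian of the actual variance at stage
  \<open>n\<close>; the convergence of that variance is a separate, deterministic limit.\<close>

lemma sample_char_limit:
  fixes h :: "'k \<Rightarrow> 'd::finite \<Rightarrow> 'a \<Rightarrow> real"
  assumes h: "\<And>i. centred_scores (P i) (h i)"
  shows "(\<lambda>n. \<integral>z. iexp (a \<bullet> block_stat h C n z id) \<partial>data_law N P n) \<longlonglongrightarrow>
     complex_of_real (exp (- (\<Sum>i\<in>UNIV. \<Sum>l\<in>UNIV. \<Sum>l'\<in>UNIV. contrast_weight C a i l * contrast_weight C a i l' * (1 / p i * (\<integral>x. h i l x * h i l' x \<partial>P i))) / 2))"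
proof -
  obtain K where K: "K \<ge> 0" "\<forall>\<^sub>F n in sequentially. \<forall>i l. \<bar>coef C a n i l\<bar> \<le> K / sqrt (real n)"
    using coef_bound by blast
  define v where "v n = (\<Sum>j<n. \<Sum>l\<in>UNIV. \<Sum>l'\<in>UNIV. coef C a n (grp N n j) l * coef C a n (grp N n j) l' * (\<integral>x. h (grp N n j) l x * h (grp N n j) l' x \<partial>P (grp N n j)))" for n
  have "(\<lambda>n. (\<integral>z. iexp (a \<bullet> block_stat h C n z id) \<partial>data_law N P n) - complex_of_real (exp (- v n / 2))) \<longlonglongrightarrow> 0"
  proof (rule LIMSEQ_I)
    fix e :: real assume e: "e > 0"
    obtain n0 where n0: "\<And>n lab (u :: nat \<Rightarrow> 'd \<Rightarrow> real). n \<ge> n0 \<Longrightarrow> (\<forall>j<n. \<forall>l. \<bar>u j l\<bar> \<le> K / sqrt (real n)) \<Longrightarrow>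
     cmod ((\<integral>z. iexp (\<Sum>j<n. \<Sum>l\<in>UNIV. u j l * h (lab j) l (z j)) \<partial>PiM {..<n} (\<lambda>j. P (lab j)))
       - exp (- (\<Sum>j<n. \<Sum>l\<in>UNIV. \<Sum>l'\<in>UNIV. u j l * u j l' * (\<integral>x. h (lab j) l x * h (lab j) l' x \<partial>P (lab j))) / 2)) \<le> e / 2"
    proof -
      have "\<exists>n0. \<forall>n\<ge>n0. \<forall>lab (u :: nat \<Rightarrow> 'd \<Rightarrow> real). (\<forall>j<n. \<forall>l. \<bar>u j l\<bar> \<le> K / sqrt (real n)) \<longrightarrow>
        cmod ((\<integral>z. iexp (\<Sum>j<n. \<Sum>l\<in>UNIV. u j l * h (lab j) l (z j)) \<partial>PiM {..<n} (\<lambda>j. P (lab j)))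
          - exp (- (\<Sum>j<n. \<Sum>l\<in>UNIV. \<Sum>l'\<in>UNIV. u j l * u j l' * (\<integral>x. h (lab j) l x * h (lab j) l' x \<partial>P (lab j))) / 2)) \<le> e / 2"
        by (rule uniform_clt) (use h e K(1) in auto)
      then show ?thesis using that by blast
    qed
    obtain n1 where n1: "\<And>n i l. n \<ge> n1 \<Longrightarrow> \<bar>coef C a n i l\<bar> \<le> K / sqrt (real n)"
      using K(2) by (auto simp: eventually_sequentially)
    show "\<exists>n0. \<forall>n\<ge>n0. norm ((\<integral>z. iexp (a \<bullet> block_stat h C n z id) \<partial>data_law N P n) - complex_of_real (exp (- v n / 2)) - 0) < e"
    proof (intro exI[of _ "max n0 n1"] allI impI)
      fix n assume n: "max n0 n1 \<le> n"
      have "cmod ((\<integral>z. iexp (\<Sum>j<n. \<Sum>l\<in>UNIV. coef C a n (grp N n j) l * h (grp N n j) l (z j)) \<partial>PiM {..<n} (\<lambda>j. P (grp N n j)))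
       - exp (- v n / 2)) \<le> e / 2"
        unfolding v_def using n n1 by (intro n0) auto
      then show "norm ((\<integral>z. iexp (a \<bullet> block_stat h C n z id) \<partial>data_law N P n) - complex_of_real (exp (- v n / 2)) - 0) < e"
        using e by (simp only: inner_block_stat id_apply data_law_def diff_0_right)
    qed
  qed
  moreover have "(\<lambda>n. complex_of_real (exp (- v n / 2))) \<longlonglongrightarrow>
     complex_of_real (exp (- (\<Sum>i\<in>UNIV. \<Sum>l\<in>UNIV. \<Sum>l'\<in>UNIV. contrast_weight C a i l * contrast_weight C a i l' * (1 / p i * (\<integral>x. h i l x * h i l' x \<partial>P i))) / 2))"
    unfolding v_def by (intro tendsto_intros coef_quadratic_lim) simp
  ultimately show ?thesis using tendsto_add by fastforce
qed

end

section \<open>Two independent permutations\<close>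

context k_samples
begin

text \<open>The conditional characteristic function, given the data, of the linear statistic under a
  uniform permutation. Averaging over all permutations makes it invariant under reordering of the
  data.\<close>

definition perm_char :: "('d::finite \<Rightarrow> 'a \<Rightarrow> real) \<Rightarrow> ((real, 'm::finite) vec, 'k) vec \<Rightarrow> real^('m \<times> 'd) \<Rightarrow> nat \<Rightarrow> (nat \<Rightarrow> 'a) \<Rightarrow> complex" where
  "perm_char g C a n z = (\<Sum>\<pi> | \<pi> permutes {..<n}. iexp (a \<bullet> block_stat (\<lambda>_. g) C n z \<pi>)) / fact n"

lemma card_perms [simp]: "card {\<pi>. \<pi> permutes {..<n}} = fact n"
  by (simp add: card_permutations)

lemma norm_perm_average_le:
  assumes "\<And>\<pi>. \<pi> permutes {..<n} \<Longrightarrow> cmod (F \<pi>) \<le> B \<pi>"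
  shows "cmod ((\<Sum>\<pi> | \<pi> permutes {..<n}. F \<pi>) / fact n) \<le> (\<Sum>\<pi> | \<pi> permutes {..<n}. B \<pi>) / fact n"
  unfolding norm_divide norm_fact using assms by (intro divide_right_mono sum_norm_le) auto

lemma norm_perm_char: "cmod (perm_char g C a n z) \<le> 1"
proof -
  have "cmod (perm_char g C a n z) \<le> (\<Sum>\<pi> | \<pi> permutes {..<n}. 1) / fact n"
    unfolding perm_char_def by (rule norm_perm_average_le) simp
  then show ?thesis by simp
qed

lemma perm_char_measurable:
  assumes g: "\<And>l. g l \<in> borel_measurable borel"
  shows "perm_char g C a n \<in> borel_measurable (PiM {..<n} (\<lambda>_. borel))"
proof -
  have m: "(\<lambda>z. g l (z (\<pi> j))) \<in> borel_measurable (PiM {..<n} (\<lambda>_. borel))" if "\<pi> permutes {..<n}" "j < n" for \<pi> j l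
  proof -
    have "(\<lambda>z. z (\<pi> j)) \<in> PiM {..<n} (\<lambda>_. borel :: 'a measure) \<rightarrow>\<^sub>M borel"
      by (rule measurable_component_singleton) (use permutes_in_image[OF that(1)] that(2) in auto)
    from measurable_compose[OF this g] show ?thesis .
  qed
  have "(\<lambda>z. iexp (a \<bullet> block_stat (\<lambda>_. g) C n z \<pi>)) \<in> borel_measurable (PiM {..<n} (\<lambda>_. borel))" if "\<pi> permutes {..<n}" for \<pi>
  proof -
    have "(\<lambda>z. \<Sum>j<n. \<Sum>l\<in>UNIV. coef C a n (grp N n j) l * g l (z (\<pi> j))) \<in> borel_measurable (PiM {..<n} (\<lambda>_. borel))"
      by (intro borel_measurable_sum borel_measurable_times borel_measurable_const m that) auto
    then show ?thesis unfolding inner_block_stat by measurable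
  qed
  then show ?thesis unfolding perm_char_def[abs_def] by (intro borel_measurable_divide borel_measurable_sum) auto
qed

lemma perm_char_invariant:
  assumes \<tau>: "\<tau> permutes {..<n}"
  shows "perm_char g C a n (\<lambda>j\<in>{..<n}. z (\<tau> j)) = perm_char g C a n z"
proof -
  have "perm_char g C a n (\<lambda>j\<in>{..<n}. z (\<tau> j)) = (\<Sum>\<pi> | \<pi> permutes {..<n}. iexp (a \<bullet> block_stat (\<lambda>_. g) C n z (\<tau> \<circ> \<pi>))) / fact n"
    unfolding perm_char_def
  proof (intro arg_cong2[where f="(/)"] refl sum.cong)
    fix \<pi> assume "\<pi> \<in> {\<pi>. \<pi> permutes {..<n}}"
    then have "\<pi> j < n" if "j < n" for j using that permutes_in_image[of \<pi> "{..<n}" j] by auto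
    then have "a \<bullet> block_stat (\<lambda>_. g) C n (\<lambda>j\<in>{..<n}. z (\<tau> j)) \<pi> = a \<bullet> block_stat (\<lambda>_. g) C n z (\<tau> \<circ> \<pi>)"
      unfolding inner_block_stat by simp
    then show "iexp (a \<bullet> block_stat (\<lambda>_. g) C n (\<lambda>j\<in>{..<n}. z (\<tau> j)) \<pi>) = iexp (a \<bullet> block_stat (\<lambda>_. g) C n z (\<tau> \<circ> \<pi>))"
      by (simp only:)
  qed
  also have "\<dots> = perm_char g C a n z"
    unfolding perm_char_def
    using sum_permutations_compose_left[OF \<tau>, of "\<lambda>\<pi>. iexp (a \<bullet> block_stat (\<lambda>_. g) C n z \<pi>)"] by (simp only:)
  finally show ?thesis .
qed

lemma coef_square_sum:
  assumes "K \<ge> 0" "\<And>i l. \<bar>coef C a n i l\<bar> \<le> K / sqrt (real n)"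
  shows "(\<Sum>j<n. (coef C a n (grp N n j) l)\<^sup>2) \<le> K\<^sup>2"
proof -
  have "(coef C a n i l)\<^sup>2 \<le> K\<^sup>2 / real n" for i
    using power_mono[OF assms(2)[of i l] abs_ge_zero, of 2] by (simp add: power_divide)
  then have "(\<Sum>j<n. (coef C a n (grp N n j) l)\<^sup>2) \<le> (\<Sum>j<n. K\<^sup>2 / real n)" by (intro sum_mono)
  also have "\<dots> \<le> K\<^sup>2" by simp
  finally show ?thesis .
qed

text \<open>Averaged over permutations, a weighted sum of the differences is small in absolute mean:
  the weights sum to zero and have bounded square sum, so \<open>perm_average_abs\<close> leaves
  only the mean of the squared differences. The error is shared among the coordinates, whence
  \<open>\<epsilon>\<close>.\<close>

lemma perm_char_lipschitz:
  fixes g :: "'d::finite \<Rightarrow> 'a \<Rightarrow> real"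
  assumes C: "contrast_matrix C" and e: "e > 0"
  shows "\<exists>A\<ge>0. \<forall>\<^sub>F n in sequentially. \<forall>z z'. cmod (perm_char g C a n z - perm_char g C a n z') \<le>
      e + A / real n * (\<Sum>j<n. \<Sum>l\<in>UNIV. (g l (z j) - g l (z' j))\<^sup>2)"
proof -
  obtain K where K: "K \<ge> 0" "\<forall>\<^sub>F n in sequentially. \<forall>i l. \<bar>coef C a n i l\<bar> \<le> K / sqrt (real n)"
    using coef_bound by blast
  define \<epsilon> where "\<epsilon> = e / real CARD('d)"
  have \<epsilon>: "\<epsilon> > 0" using e by (simp add: \<epsilon>_def)
  have "\<forall>\<^sub>F n in sequentially. \<forall>z z'. cmod (perm_char g C a n z - perm_char g C a n z') \<le>
      e + (2 * K\<^sup>2 / \<epsilon>) / real n * (\<Sum>j<n. \<Sum>l\<in>UNIV. (g l (z j) - g l (z' j))\<^sup>2)"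
    using K(2) coef_sum_zero[OF C, of a] eventually_ge_at_top[of 2]
  proof eventually_elim
    case (elim n)
    show ?case
    proof (intro allI)
      fix z z' :: "nat \<Rightarrow> 'a"
      let ?\<Delta> = "\<lambda>l j. g l (z j) - g l (z' j)"
      let ?c = "\<lambda>l j. coef C a n (grp N n j) l"
      let ?P = "{\<pi>. \<pi> permutes {..<n}}"
      have "cmod (perm_char g C a n z - perm_char g C a n z') =
        cmod ((\<Sum>\<pi>\<in>?P. iexp (a \<bullet> block_stat (\<lambda>_. g) C n z \<pi>) - iexp (a \<bullet> block_stat (\<lambda>_. g) C n z' \<pi>)) / fact n)"
        by (simp only: perm_char_def sum_subtractf diff_divide_distrib)
      also have "\<dots> \<le> (\<Sum>\<pi>\<in>?P. \<Sum>l\<in>UNIV. \<bar>\<Sum>j<n. ?c l j * ?\<Delta> l (\<pi> j)\<bar>) / fact n"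
      proof (rule norm_perm_average_le)
        fix \<pi>
        have "cmod (iexp (a \<bullet> block_stat (\<lambda>_. g) C n z \<pi>) - iexp (a \<bullet> block_stat (\<lambda>_. g) C n z' \<pi>)) \<le>
          \<bar>a \<bullet> block_stat (\<lambda>_. g) C n z \<pi> - a \<bullet> block_stat (\<lambda>_. g) C n z' \<pi>\<bar>" by (rule iexp_lipschitz)
        also have "a \<bullet> block_stat (\<lambda>_. g) C n z \<pi> - a \<bullet> block_stat (\<lambda>_. g) C n z' \<pi> = (\<Sum>l\<in>UNIV. \<Sum>j<n. ?c l j * ?\<Delta> l (\<pi> j))"
          unfolding inner_block_stat sum_subtractf[symmetric] right_diff_distrib[symmetric] by (rule sum.swap)
        also have "\<bar>\<dots>\<bar> \<le> (\<Sum>l\<in>UNIV. \<bar>\<Sum>j<n. ?c l j * ?\<Delta> l (\<pi> j)\<bar>)" by (rule sum_abs)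
        finally show "cmod (iexp (a \<bullet> block_stat (\<lambda>_. g) C n z \<pi>) - iexp (a \<bullet> block_stat (\<lambda>_. g) C n z' \<pi>)) \<le> \<dots>" .
      qed
      also have "\<dots> = (\<Sum>l\<in>UNIV. (\<Sum>\<pi>\<in>?P. \<bar>\<Sum>j<n. ?c l j * ?\<Delta> l (\<pi> j)\<bar>) / fact n)"
        by (subst sum.swap) (simp add: sum_divide_distrib)
      also have "\<dots> \<le> (\<Sum>l\<in>UNIV. \<epsilon> + 2 * K\<^sup>2 / \<epsilon> * (\<Sum>j<n. (?\<Delta> l j)\<^sup>2) / real n)"
      proof (rule sum_mono)
        fix l
        have "(\<Sum>j<n. (?c l j)\<^sup>2) \<le> K\<^sup>2" using elim(1) by (intro coef_square_sum K(1)) blast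
        then show "(\<Sum>\<pi>\<in>?P. \<bar>\<Sum>j<n. ?c l j * ?\<Delta> l (\<pi> j)\<bar>) / fact n \<le> \<epsilon> + 2 * K\<^sup>2 / \<epsilon> * (\<Sum>j<n. (?\<Delta> l j)\<^sup>2) / real n"
          using perm_average_abs(1)[of "{..<n}" "?c l" "K\<^sup>2" \<epsilon> "?\<Delta> l"] elim \<epsilon> by simp
      qed
      also have "\<dots> = e + (2 * K\<^sup>2 / \<epsilon>) / real n * (\<Sum>l\<in>UNIV. \<Sum>j<n. (?\<Delta> l j)\<^sup>2)"
      proof -
        have "(\<Sum>l\<in>(UNIV :: 'd set). \<epsilon> + 2 * K\<^sup>2 / \<epsilon> * W l / real n) = e + (2 * K\<^sup>2 / \<epsilon>) / real n * (\<Sum>l\<in>UNIV. W l)" for W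
        proof -
          have "(\<Sum>l\<in>(UNIV :: 'd set). \<epsilon>) = e" by (simp add: \<epsilon>_def)
          moreover have "2 * K\<^sup>2 / \<epsilon> * W l / real n = (2 * K\<^sup>2 / \<epsilon>) / real n * W l" for l by simp
          ultimately show ?thesis unfolding sum.distrib sum_distrib_left by (simp only:)
        qed
        then show ?thesis .
      qed
      also have "(\<Sum>l\<in>UNIV. \<Sum>j<n. (?\<Delta> l j)\<^sup>2) = (\<Sum>j<n. \<Sum>l\<in>UNIV. (?\<Delta> l j)\<^sup>2)" by (rule sum.swap)
      finally show "cmod (perm_char g C a n z - perm_char g C a n z') \<le>
        e + (2 * K\<^sup>2 / \<epsilon>) / real n * (\<Sum>j<n. \<Sum>l\<in>UNIV. (?\<Delta> l j)\<^sup>2)" .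
    qed
  qed
  moreover have "0 \<le> 2 * K\<^sup>2 / \<epsilon>" using \<epsilon> by simp
  ultimately show ?thesis by blast
qed

text \<open>Passing to inverses puts the permutation on the weights. For a fixed permutation the
  exponent is then a sum of scores with deterministic weights, one for each row, as
  \<open>uniform_clt\<close> expects.\<close>

lemma perm_char_inverse:
  "perm_char g C a n z = (\<Sum>\<pi> | \<pi> permutes {..<n}. iexp (\<Sum>j<n. \<Sum>l\<in>UNIV. coef C a n (grp N n (\<pi> j)) l * g l (z j))) / fact n"
proof -
  have "(\<Sum>\<pi> | \<pi> permutes {..<n}. iexp (a \<bullet> block_stat (\<lambda>_. g) C n z \<pi>)) =
    (\<Sum>\<pi> | \<pi> permutes {..<n}. iexp (a \<bullet> block_stat (\<lambda>_. g) C n z (inv \<pi>)))"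
    by (rule sum_permutations_inverse)
  also have "\<dots> = (\<Sum>\<pi> | \<pi> permutes {..<n}. iexp (\<Sum>j<n. \<Sum>l\<in>UNIV. coef C a n (grp N n (\<pi> j)) l * g l (z j)))"
  proof (rule sum.cong[OF refl])
    fix \<pi> assume "\<pi> \<in> {\<pi>. \<pi> permutes {..<n}}"
    then have p: "\<pi> permutes {..<n}" by simp
    have "a \<bullet> block_stat (\<lambda>_. g) C n z (inv \<pi>) = (\<Sum>j<n. \<Sum>l\<in>UNIV. coef C a n (grp N n (\<pi> j)) l * g l (z j))"
      unfolding inner_block_stat
      using sum.permute[OF p, of "\<lambda>j. \<Sum>l\<in>UNIV. coef C a n (grp N n j) l * g l (z (inv \<pi> j))"]
      by (simp add: comp_def permutes_inverses[OF p])
    then show "iexp (a \<bullet> block_stat (\<lambda>_. g) C n z (inv \<pi>)) = iexp (\<Sum>j<n. \<Sum>l\<in>UNIV. coef C a n (grp N n (\<pi> j)) l * g l (z j))"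
      by (simp only:)
  qed
  finally show ?thesis by (simp only: perm_char_def)
qed

abbreviation limit_form :: "('d::finite \<Rightarrow> 'd \<Rightarrow> real) \<Rightarrow> ((real, 'm::finite) vec, 'k) vec \<Rightarrow> real^('m \<times> 'd) \<Rightarrow> real" where
  "limit_form \<sigma> C a \<equiv> (\<Sum>i\<in>UNIV. \<Sum>l\<in>UNIV. \<Sum>l'\<in>UNIV. contrast_weight C a i l * contrast_weight C a i l' * (1 / p i * \<sigma> l l'))"

text \<open>Two independent permutations decorrelate the coefficients, which is the point where the covariance of the
  two permuted statistics disappears.\<close>

lemma two_permutation_form:
  fixes \<sigma> :: "'d::finite \<Rightarrow> 'd \<Rightarrow> real" and C :: "((real, 'm::finite) vec, 'k) vec"
  defines "c \<equiv> \<lambda>a n j l. coef C a n (grp N n j) l"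
  assumes C: "contrast_matrix C" and sym: "\<And>l l'. \<sigma> l l' = \<sigma> l' l" and e: "e > 0"
  shows "\<forall>\<^sub>F n in sequentially. \<forall>\<pi>'. \<pi>' permutes {..<n} \<longrightarrow> (\<Sum>\<pi> | \<pi> permutes {..<n}.
     \<bar>(\<Sum>j<n. \<Sum>l\<in>UNIV. \<Sum>l'\<in>UNIV. (c a n (\<pi> j) l + c b n (\<pi>' j) l) * (c a n (\<pi> j) l' + c b n (\<pi>' j) l') * \<sigma> l l')
       - (limit_form \<sigma> C a + limit_form \<sigma> C b)\<bar>) / fact n \<le> e"
proof -
  obtain Ka where Ka: "Ka \<ge> 0" "\<forall>\<^sub>F n in sequentially. \<forall>i l. \<bar>coef C a n i l\<bar> \<le> Ka / sqrt (real n)"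
    using coef_bound by blast
  obtain Kb where Kb: "Kb \<ge> 0" "\<forall>\<^sub>F n in sequentially. \<forall>i l. \<bar>coef C b n i l\<bar> \<le> Kb / sqrt (real n)"
    using coef_bound by blast
  define s where "s = (\<Sum>l\<in>UNIV. \<Sum>l'\<in>UNIV. \<bar>\<sigma> l l'\<bar>)"
  have s0: "s \<ge> 0" unfolding s_def by (intro sum_nonneg) auto
  \<comment> \<open>The cross terms add up to at most \<open>2 * s * (2 * \<epsilon>)\<close>, hence
    to at most \<open>e / 2\<close>. The other half covers the two diagonal forms, and
    \<open>s + 1\<close> avoids a division by zero.\<close>
  define \<epsilon> where "\<epsilon> = e / (8 * (s + 1))"
  have \<epsilon>: "\<epsilon> > 0" using e s0 by (simp add: \<epsilon>_def)
  define Q where "Q d n = (\<Sum>j<n. \<Sum>l\<in>UNIV. \<Sum>l'\<in>UNIV. c d n j l * c d n j l' * \<sigma> l l')" for d n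
  have "\<forall>\<^sub>F n in sequentially. \<bar>Q d n - limit_form \<sigma> C d\<bar> < e / 4" for d
    using tendstoD[OF coef_quadratic_lim[of C d "\<lambda>_. \<sigma>"], of "e / 4"] e unfolding Q_def c_def dist_real_def by simp
  moreover have "(\<lambda>n. 2 * Ka\<^sup>2 / \<epsilon> * Kb\<^sup>2 / real n) \<longlonglongrightarrow> 0"
    by (rule tendsto_divide_0[OF tendsto_const]) (intro filterlim_at_top_imp_at_infinity filterlim_real_sequentially)
  then have "\<forall>\<^sub>F n in sequentially. 2 * Ka\<^sup>2 / \<epsilon> * Kb\<^sup>2 / real n < \<epsilon>"
    by (rule order_tendstoD) (rule \<epsilon>)
  ultimately have "\<forall>\<^sub>F n in sequentially. (\<bar>Q a n - limit_form \<sigma> C a\<bar> < e / 4 \<and> \<bar>Q b n - limit_form \<sigma> C b\<bar> < e / 4) \<and>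
     2 * Ka\<^sup>2 / \<epsilon> * Kb\<^sup>2 / real n < \<epsilon> \<and> n \<ge> 2"
    by (intro eventually_conj eventually_ge_at_top)
  then show ?thesis using Ka(2) Kb(2) coef_sum_zero[OF C, of a]
  proof eventually_elim
    case (elim n)
    show ?case
    proof (intro allI impI)
      fix \<pi>' assume p': "\<pi>' permutes {..<n}"
      let ?P = "{\<pi>. \<pi> permutes {..<n}}"
      define X where "X \<pi> l l' = (\<Sum>j<n. c a n (\<pi> j) l * c b n (\<pi>' j) l')" for \<pi> l l'
      have inv_sum: "(\<Sum>j<n. F (\<pi> j)) = (\<Sum>j<n. F j)" if "\<pi> permutes {..<n}" for F :: "nat \<Rightarrow> real" and \<pi>
        using sum.permute[OF that, of F] by (simp add: comp_def)
      \<comment> \<open>The diagonal parts do not depend on the permutations, which merely reorder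
        the rows; all dependence sits in the cross sums \<open>X\<close>.\<close>
      have expand: "(\<Sum>j<n. \<Sum>l\<in>UNIV. \<Sum>l'\<in>UNIV. (c a n (\<pi> j) l + c b n (\<pi>' j) l) * (c a n (\<pi> j) l' + c b n (\<pi>' j) l') * \<sigma> l l') =
        Q a n + Q b n + 2 * (\<Sum>l\<in>UNIV. \<Sum>l'\<in>UNIV. \<sigma> l l' * X \<pi> l l')" if p: "\<pi> permutes {..<n}" for \<pi>
      proof -
        let ?x = "\<lambda>j l. c a n (\<pi> j) l" and ?y = "\<lambda>j l. c b n (\<pi>' j) l"
        have "(\<Sum>j<n. \<Sum>l\<in>UNIV. \<Sum>l'\<in>UNIV. (?x j l + ?y j l) * (?x j l' + ?y j l') * \<sigma> l l') =
          (\<Sum>j<n. \<Sum>l\<in>UNIV. \<Sum>l'\<in>UNIV. ?x j l * ?x j l' * \<sigma> l l') + (\<Sum>j<n. \<Sum>l\<in>UNIV. \<Sum>l'\<in>UNIV. ?y j l * ?y j l' * \<sigma> l l') +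
          ((\<Sum>j<n. \<Sum>l\<in>UNIV. \<Sum>l'\<in>UNIV. ?x j l * ?y j l' * \<sigma> l l') + (\<Sum>j<n. \<Sum>l\<in>UNIV. \<Sum>l'\<in>UNIV. ?y j l * ?x j l' * \<sigma> l l'))"
          by (simp add: sum.distrib[symmetric] algebra_simps del: sum.distrib)
        moreover have "(\<Sum>j<n. \<Sum>l\<in>UNIV. \<Sum>l'\<in>UNIV. ?x j l * ?x j l' * \<sigma> l l') = Q a n"
          unfolding Q_def by (rule inv_sum[OF p])
        moreover have "(\<Sum>j<n. \<Sum>l\<in>UNIV. \<Sum>l'\<in>UNIV. ?y j l * ?y j l' * \<sigma> l l') = Q b n"
          unfolding Q_def by (rule inv_sum[OF p'])
        moreover have "(\<Sum>j<n. \<Sum>l\<in>UNIV. \<Sum>l'\<in>UNIV. ?y j l * ?x j l' * \<sigma> l l') = (\<Sum>j<n. \<Sum>l\<in>UNIV. \<Sum>l'\<in>UNIV. ?x j l * ?y j l' * \<sigma> l l')"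
        proof (rule sum.cong[OF refl])
          fix j
          have "(\<Sum>l\<in>UNIV. \<Sum>l'\<in>UNIV. ?y j l * ?x j l' * \<sigma> l l') = (\<Sum>l'\<in>UNIV. \<Sum>l\<in>UNIV. ?y j l * ?x j l' * \<sigma> l l')" by (rule sum.swap)
          also have "\<dots> = (\<Sum>l\<in>UNIV. \<Sum>l'\<in>UNIV. ?x j l * ?y j l' * \<sigma> l l')"
          proof (intro sum.cong refl)
            fix v w
            show "?y j w * ?x j v * \<sigma> w v = ?x j v * ?y j w * \<sigma> v w" using sym[of v w] by simp
          qed
          finally show "(\<Sum>l\<in>UNIV. \<Sum>l'\<in>UNIV. ?y j l * ?x j l' * \<sigma> l l') = \<dots>" .
        qed
        moreover have "(\<Sum>j<n. \<Sum>l\<in>UNIV. \<Sum>l'\<in>UNIV. ?x j l * ?y j l' * \<sigma> l l') = (\<Sum>l\<in>UNIV. \<Sum>l'\<in>UNIV. \<sigma> l l' * X \<pi> l l')"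
        proof -
          have "(\<Sum>j<n. \<Sum>l\<in>UNIV. \<Sum>l'\<in>UNIV. ?x j l * ?y j l' * \<sigma> l l') = (\<Sum>l\<in>UNIV. \<Sum>j<n. \<Sum>l'\<in>UNIV. ?x j l * ?y j l' * \<sigma> l l')" by (rule sum.swap)
          also have "\<dots> = (\<Sum>l\<in>UNIV. \<Sum>l'\<in>UNIV. \<Sum>j<n. ?x j l * ?y j l' * \<sigma> l l')" by (rule sum.cong[OF refl], rule sum.swap)
          also have "\<dots> = (\<Sum>l\<in>UNIV. \<Sum>l'\<in>UNIV. \<sigma> l l' * X \<pi> l l')"
            unfolding X_def sum_distrib_left by (intro sum.cong refl) (simp add: mult.commute)
          finally show ?thesis .
        qed
        ultimately show ?thesis by simp
      qed
      \<comment> \<open>With \<open>\<pi>'\<close> fixed, averaging over \<open>\<pi>\<close> alone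
        decorrelates the two sets of weights, so the bound is uniform in
        \<open>\<pi>'\<close>.\<close>
      have avgX: "(\<Sum>\<pi>\<in>?P. \<bar>X \<pi> l l'\<bar>) / fact n \<le> 2 * \<epsilon>" for l l'
      proof -
        have Ka': "(\<Sum>j<n. (c a n j l)\<^sup>2) \<le> Ka\<^sup>2" unfolding c_def using elim(2) by (intro coef_square_sum Ka(1)) blast
        have Kb': "(\<Sum>j<n. (c b n j l')\<^sup>2) \<le> Kb\<^sup>2" unfolding c_def using elim(3) by (intro coef_square_sum Kb(1)) blast
        have "(\<Sum>\<pi>\<in>?P. \<bar>X \<pi> l l'\<bar>) / fact n \<le> \<epsilon> + 2 * Ka\<^sup>2 / \<epsilon> * (\<Sum>j<n. (c b n (\<pi>' j) l')\<^sup>2) / real n"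
          using perm_average_abs(2)[of "{..<n}" "\<lambda>j. c a n j l" "Ka\<^sup>2" \<epsilon> "\<lambda>j. c b n (\<pi>' j) l'"] elim \<epsilon> Ka'
          by (simp add: X_def c_def)
        also have "(\<Sum>j<n. (c b n (\<pi>' j) l')\<^sup>2) = (\<Sum>j<n. (c b n j l')\<^sup>2)" by (rule inv_sum[OF p'])
        also have "\<epsilon> + 2 * Ka\<^sup>2 / \<epsilon> * (\<Sum>j<n. (c b n j l')\<^sup>2) / real n \<le> \<epsilon> + 2 * Ka\<^sup>2 / \<epsilon> * Kb\<^sup>2 / real n"
          using Kb' \<epsilon>
          by (intro add_left_mono divide_right_mono mult_left_mono) auto
        finally show ?thesis using elim by linarith
      qed
      have "(\<Sum>\<pi>\<in>?P. \<bar>(\<Sum>j<n. \<Sum>l\<in>UNIV. \<Sum>l'\<in>UNIV. (c a n (\<pi> j) l + c b n (\<pi>' j) l) * (c a n (\<pi> j) l' + c b n (\<pi>' j) l') * \<sigma> l l')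
         - (limit_form \<sigma> C a + limit_form \<sigma> C b)\<bar>) \<le> (\<Sum>\<pi>\<in>?P. e / 2 + 2 * (\<Sum>l\<in>UNIV. \<Sum>l'\<in>UNIV. \<bar>\<sigma> l l'\<bar> * \<bar>X \<pi> l l'\<bar>))"
      proof (rule sum_mono)
        fix \<pi> assume "\<pi> \<in> ?P"
        then have p: "\<pi> permutes {..<n}" by simp
        have "\<bar>\<Sum>l\<in>UNIV. \<Sum>l'\<in>UNIV. \<sigma> l l' * X \<pi> l l'\<bar> \<le> (\<Sum>l\<in>UNIV. \<Sum>l'\<in>UNIV. \<bar>\<sigma> l l'\<bar> * \<bar>X \<pi> l l'\<bar>)"
          unfolding abs_mult[symmetric] by (intro order_trans[OF sum_abs] sum_mono sum_abs)
        then show "\<bar>(\<Sum>j<n. \<Sum>l\<in>UNIV. \<Sum>l'\<in>UNIV. (c a n (\<pi> j) l + c b n (\<pi>' j) l) * (c a n (\<pi> j) l' + c b n (\<pi>' j) l') * \<sigma> l l')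
          - (limit_form \<sigma> C a + limit_form \<sigma> C b)\<bar> \<le> e / 2 + 2 * (\<Sum>l\<in>UNIV. \<Sum>l'\<in>UNIV. \<bar>\<sigma> l l'\<bar> * \<bar>X \<pi> l l'\<bar>)"
          unfolding expand[OF p] using elim by linarith
      qed
      also have "\<dots> = fact n * (e / 2) + 2 * (\<Sum>l\<in>UNIV. \<Sum>l'\<in>UNIV. \<bar>\<sigma> l l'\<bar> * (\<Sum>\<pi>\<in>?P. \<bar>X \<pi> l l'\<bar>))"
      proof -
        have "(\<Sum>\<pi>\<in>?P. \<Sum>l\<in>UNIV. \<Sum>l'\<in>UNIV. \<bar>\<sigma> l l'\<bar> * \<bar>X \<pi> l l'\<bar>) = (\<Sum>l\<in>UNIV. \<Sum>\<pi>\<in>?P. \<Sum>l'\<in>UNIV. \<bar>\<sigma> l l'\<bar> * \<bar>X \<pi> l l'\<bar>)" by (rule sum.swap)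
        also have "\<dots> = (\<Sum>l\<in>UNIV. \<Sum>l'\<in>UNIV. \<Sum>\<pi>\<in>?P. \<bar>\<sigma> l l'\<bar> * \<bar>X \<pi> l l'\<bar>)" by (rule sum.cong[OF refl], rule sum.swap)
        finally show ?thesis by (simp add: sum.distrib sum_distrib_left[symmetric])
      qed
      also have "\<dots> \<le> fact n * (e / 2) + 2 * (\<Sum>l\<in>UNIV. \<Sum>l'\<in>UNIV. \<bar>\<sigma> l l'\<bar> * (fact n * (2 * \<epsilon>)))"
      proof (intro add_left_mono mult_left_mono sum_mono)
        fix l l'
        show "(\<Sum>\<pi>\<in>?P. \<bar>X \<pi> l l'\<bar>) \<le> fact n * (2 * \<epsilon>)"
          using avgX[of l l'] by (simp add: pos_divide_le_eq mult.commute)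
      qed auto
      also have "\<dots> = fact n * (e / 2 + 4 * s * \<epsilon>)"
        by (simp add: s_def sum_distrib_right[symmetric] sum_distrib_left[symmetric] algebra_simps)
      also have "\<dots> \<le> fact n * e"
      proof (rule mult_left_mono)
        have "s * e / (8 * (s + 1)) \<le> e / 8" using s0 e by (simp add: field_simps)
        moreover have "4 * s * \<epsilon> = 4 * (s * e / (8 * (s + 1)))" unfolding \<epsilon>_def by simp
        ultimately show "e / 2 + 4 * s * \<epsilon> \<le> e" by linarith
      qed simp
      finally show "(\<Sum>\<pi>\<in>?P. \<bar>(\<Sum>j<n. \<Sum>l\<in>UNIV. \<Sum>l'\<in>UNIV. (c a n (\<pi> j) l + c b n (\<pi>' j) l) * (c a n (\<pi> j) l' + c b n (\<pi>' j) l') * \<sigma> l l')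
         - (limit_form \<sigma> C a + limit_form \<sigma> C b)\<bar>) / fact n \<le> e"
        by (simp add: pos_divide_le_eq mult.commute)
    qed
  qed
qed

text \<open>The product of two conditional characteristic functions is an average over pairs of
  permutations. After the passage to i.i.d. rows of the mixture each pair gives a weighted sum
  covered by \<open>uniform_clt\<close>, uniformly over pairs. By
  \<open>two_permutation_form\<close> its variance is on average close to the sum of the two limits,
  with no cross term left.\<close>

lemma permutation_char_limit:
  fixes g :: "'d::finite \<Rightarrow> 'a \<Rightarrow> real" and C :: "((real, 'm::finite) vec, 'k) vec"
  defines "\<sigma> \<equiv> \<lambda>l l'. \<integral>x. g l x * g l' x \<partial>mixture p P"
  assumes g: "\<And>l. g l \<in> borel_measurable borel" and sq: "\<And>l. integrable (mixture p P) (\<lambda>x. (g l x)\<^sup>2)"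
    and mean: "\<And>l. (\<integral>x. g l x \<partial>mixture p P) = 0" and C: "contrast_matrix C"
  shows "(\<lambda>n. \<integral>z. perm_char g C a n z * perm_char g C b n z \<partial>data_law N P n) \<longlonglongrightarrow>
    complex_of_real (exp (- (limit_form \<sigma> C a + limit_form \<sigma> C b) / 2))"
proof -
  interpret mix: prob_space "mixture p P" by (rule prob_space_mixture)
  have scores: "centred_scores (mixture p P) g"
    by (intro centred_scores.intro centred_scores_axioms.intro prob_space_mixture sq mean)
      (simp add: measurable_cong_sets[OF sets_mixture refl] g)
  define H where "H n z = perm_char g C a n z * perm_char g C b n z" for n z
  have Hm: "H n \<in> borel_measurable (PiM {..<n} (\<lambda>_. borel))" for n
    unfolding H_def[abs_def] by (intro borel_measurable_times perm_char_measurable g)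
  have Hb: "cmod (H n z) \<le> 1" for n z
    unfolding H_def norm_mult using mult_mono[OF norm_perm_char norm_perm_char] by fastforce
  have rep: "(\<lambda>n. (\<integral>z. H n z \<partial>data_law N P n) - (\<integral>z. H n z \<partial>iid n (mixture p P))) \<longlonglongrightarrow> 0"
  proof (rule permutation_invariant_replacement[OF Hm Hb _ g sq])
    show "H n (\<lambda>j\<in>{..<n}. z (\<tau> j)) = H n z" if "\<tau> permutes {..<n}" for n \<tau> z
      unfolding H_def perm_char_invariant[OF that] ..
    fix e :: real assume e: "e > 0"
    obtain A where A: "A \<ge> 0" "\<forall>\<^sub>F n in sequentially. \<forall>z z'. cmod (perm_char g C a n z - perm_char g C a n z') \<le>
      e / 2 + A / real n * (\<Sum>j<n. \<Sum>l\<in>UNIV. (g l (z j) - g l (z' j))\<^sup>2)"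
      using perm_char_lipschitz[OF C half_gt_zero[OF e], where a=a and g=g] by blast
    obtain B where B: "B \<ge> 0" "\<forall>\<^sub>F n in sequentially. \<forall>z z'. cmod (perm_char g C b n z - perm_char g C b n z') \<le>
      e / 2 + B / real n * (\<Sum>j<n. \<Sum>l\<in>UNIV. (g l (z j) - g l (z' j))\<^sup>2)"
      using perm_char_lipschitz[OF C half_gt_zero[OF e], where a=b and g=g] by blast
    have "\<forall>\<^sub>F n in sequentially. \<forall>z z'. cmod (H n z - H n z') \<le> e + (A + B) / real n * (\<Sum>j<n. \<Sum>l\<in>UNIV. (g l (z j) - g l (z' j))\<^sup>2)"
      using A(2) B(2)
    proof eventually_elim
      case (elim n)
      show ?case
      proof (intro allI)
        fix z z'
        let ?S = "\<Sum>j<n. \<Sum>l\<in>UNIV. (g l (z j) - g l (z' j))\<^sup>2"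
        have "H n z - H n z' = perm_char g C a n z * (perm_char g C b n z - perm_char g C b n z') + (perm_char g C a n z - perm_char g C a n z') * perm_char g C b n z'"
          by (simp add: H_def algebra_simps)
        then have "cmod (H n z - H n z') \<le> cmod (perm_char g C a n z) * cmod (perm_char g C b n z - perm_char g C b n z') + cmod (perm_char g C a n z - perm_char g C a n z') * cmod (perm_char g C b n z')"
          using norm_triangle_ineq norm_mult by metis
        also have "\<dots> \<le> 1 * cmod (perm_char g C b n z - perm_char g C b n z') + cmod (perm_char g C a n z - perm_char g C a n z') * 1"
          by (intro add_mono mult_right_mono mult_left_mono norm_perm_char) auto
        also have "\<dots> \<le> (e / 2 + B / real n * ?S) + (e / 2 + A / real n * ?S)"
          using elim(1)[rule_format, of z z'] elim(2)[rule_format, of z z'] unfolding mult_1_left mult_1_right by linarith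
        finally show "cmod (H n z - H n z') \<le> e + (A + B) / real n * ?S"
          by (simp add: add_divide_distrib distrib_right)
      qed
    qed
    with A(1) B(1) show "\<exists>A\<ge>0. \<forall>\<^sub>F n in sequentially. \<forall>z z'. cmod (H n z - H n z') \<le> e + A / real n * (\<Sum>j<n. \<Sum>l\<in>UNIV. (g l (z j) - g l (z' j))\<^sup>2)"
      by (intro exI[of _ "A + B"]) auto
  qed
  define lim where "lim = limit_form \<sigma> C a + limit_form \<sigma> C b"
  have "(\<lambda>n. (\<integral>z. H n z \<partial>iid n (mixture p P)) - complex_of_real (exp (- lim / 2))) \<longlonglongrightarrow> 0"
  proof (rule LIMSEQ_I)
    fix e :: real assume e: "e > 0"
    obtain Ka where Ka: "Ka \<ge> 0" "\<forall>\<^sub>F n in sequentially. \<forall>i l. \<bar>coef C a n i l\<bar> \<le> Ka / sqrt (real n)"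
      using coef_bound by blast
    obtain Kb where Kb: "Kb \<ge> 0" "\<forall>\<^sub>F n in sequentially. \<forall>i l. \<bar>coef C b n i l\<bar> \<le> Kb / sqrt (real n)"
      using coef_bound by blast
    let ?c = "\<lambda>a n j l. coef C a n (grp N n j) l"
    let ?u = "\<lambda>n \<pi> \<pi>' j l. ?c a n (\<pi> j) l + ?c b n (\<pi>' j) l"
    define V where "V n \<pi> \<pi>' = (\<Sum>j<n. \<Sum>l\<in>UNIV. \<Sum>l'\<in>UNIV. ?u n \<pi> \<pi>' j l * ?u n \<pi> \<pi>' j l' * \<sigma> l l')" for n \<pi> \<pi>'
    define I where "I n \<pi> \<pi>' = (\<integral>z. iexp (\<Sum>j<n. \<Sum>l\<in>UNIV. ?u n \<pi> \<pi>' j l * g l (z j)) \<partial>iid n (mixture p P))" for n \<pi> \<pi>'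
    \<comment> \<open>All rows now share one law, so the label type of \<open>uniform_clt\<close> is
      \<open>unit\<close>. The weights of the two permutations are added, which gives the bound
      \<open>Ka + Kb\<close>.\<close>
    have clt: "\<exists>n0. \<forall>n\<ge>n0. \<forall>(lab :: nat \<Rightarrow> unit) (u :: nat \<Rightarrow> 'd \<Rightarrow> real). (\<forall>j<n. \<forall>l. \<bar>u j l\<bar> \<le> (Ka + Kb) / sqrt (real n)) \<longrightarrow>
        cmod ((\<integral>z. iexp (\<Sum>j<n. \<Sum>l\<in>UNIV. u j l * g l (z j)) \<partial>PiM {..<n} (\<lambda>j. mixture p P))
          - exp (- (\<Sum>j<n. \<Sum>l\<in>UNIV. \<Sum>l'\<in>UNIV. u j l * u j l' * (\<integral>x. g l x * g l' x \<partial>mixture p P)) / 2)) \<le> e / 4"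
      by (rule uniform_clt[where Q="\<lambda>_. mixture p P" and h="\<lambda>_. g"]) (use scores e Ka Kb in auto)
    have \<sigma>_sym: "\<sigma> l l' = \<sigma> l' l" for l l' by (simp add: \<sigma>_def mult.commute)
    have lim0: "lim \<ge> 0"
    proof -
      have "0 \<le> limit_form \<sigma> C d" for d
      proof (rule sum_nonneg)
        fix i
        have "0 \<le> 1 / p i * (\<Sum>l\<in>UNIV. \<Sum>l'\<in>UNIV. contrast_weight C d i l * contrast_weight C d i l' * \<sigma> l l')"
          unfolding \<sigma>_def using p_pos[of i] by (intro mult_nonneg_nonneg centred_scores.score_quadratic_nonneg[OF scores]) simp
        then show "0 \<le> (\<Sum>l\<in>UNIV. \<Sum>l'\<in>UNIV. contrast_weight C d i l * contrast_weight C d i l' * (1 / p i * \<sigma> l l'))"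
          by (simp add: sum_distrib_left sum_divide_distrib)
      qed
      then show ?thesis by (simp add: lim_def)
    qed
    have V0: "V n \<pi> \<pi>' \<ge> 0" for n \<pi> \<pi>'
      unfolding V_def \<sigma>_def by (intro sum_nonneg centred_scores.score_quadratic_nonneg[OF scores])
    obtain n0 where n0: "\<And>n (lab :: nat \<Rightarrow> unit) (u :: nat \<Rightarrow> 'd \<Rightarrow> real). n \<ge> n0 \<Longrightarrow> (\<forall>j<n. \<forall>l. \<bar>u j l\<bar> \<le> (Ka + Kb) / sqrt (real n)) \<Longrightarrow>
        cmod ((\<integral>z. iexp (\<Sum>j<n. \<Sum>l\<in>UNIV. u j l * g l (z j)) \<partial>PiM {..<n} (\<lambda>j. mixture p P))
          - exp (- (\<Sum>j<n. \<Sum>l\<in>UNIV. \<Sum>l'\<in>UNIV. u j l * u j l' * (\<integral>x. g l x * g l' x \<partial>mixture p P)) / 2)) \<le> e / 4"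
      using clt by blast
    have "\<forall>\<^sub>F n in sequentially. norm ((\<integral>z. H n z \<partial>iid n (mixture p P)) - complex_of_real (exp (- lim / 2)) - 0) < e"
      using Ka(2) Kb(2) two_permutation_form[where a=a and b=b and \<sigma>=\<sigma>, OF C \<sigma>_sym half_gt_zero[OF e]] eventually_ge_at_top[of n0]
    proof eventually_elim
      case (elim n)
      let ?P = "{\<pi>. \<pi> permutes {..<n}}"
      have I: "cmod (I n \<pi> \<pi>' - exp (- V n \<pi> \<pi>' / 2)) \<le> e / 4" for \<pi> \<pi>'
        unfolding I_def V_def \<sigma>_def iid_def
      proof (rule n0[OF elim(4)])
        show "\<forall>j<n. \<forall>l. \<bar>?u n \<pi> \<pi>' j l\<bar> \<le> (Ka + Kb) / sqrt (real n)"
          using elim(1,2) by (auto simp: add_divide_distrib intro!: order_trans[OF abs_triangle_ineq] add_mono)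
      qed
      have "H n z = (\<Sum>\<pi>'\<in>?P. (\<Sum>\<pi>\<in>?P. iexp (\<Sum>j<n. \<Sum>l\<in>UNIV. ?u n \<pi> \<pi>' j l * g l (z j))) / fact n) / fact n" for z
      proof -
        have "H n z = (\<Sum>\<pi>\<in>?P. \<Sum>\<pi>'\<in>?P. iexp (\<Sum>j<n. \<Sum>l\<in>UNIV. ?c a n (\<pi> j) l * g l (z j)) * iexp (\<Sum>j<n. \<Sum>l\<in>UNIV. ?c b n (\<pi>' j) l * g l (z j))) / (fact n * fact n)"
          unfolding H_def perm_char_inverse times_divide_times_eq sum_product ..
        also have "\<dots> = (\<Sum>\<pi>'\<in>?P. \<Sum>\<pi>\<in>?P. iexp (\<Sum>j<n. \<Sum>l\<in>UNIV. ?u n \<pi> \<pi>' j l * g l (z j))) / (fact n * fact n)"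
          by (subst sum.swap) (simp add: exp_add[symmetric] distrib_left[symmetric] of_real_add[symmetric] sum.distrib[symmetric] distrib_right del: of_real_sum of_real_add sum.distrib)
        finally show ?thesis by (simp add: sum_divide_distrib)
      qed
      then have "(\<integral>z. H n z \<partial>iid n (mixture p P)) = (\<Sum>\<pi>'\<in>?P. (\<Sum>\<pi>\<in>?P. I n \<pi> \<pi>') / fact n) / fact n"
      proof -
        assume Heq: "\<And>z. H n z = (\<Sum>\<pi>'\<in>?P. (\<Sum>\<pi>\<in>?P. iexp (\<Sum>j<n. \<Sum>l\<in>UNIV. ?u n \<pi> \<pi>' j l * g l (z j))) / fact n) / fact n"
        interpret iidp: prob_space "iid n (mixture p P)" unfolding iid_def by (intro prob_space_PiM prob_space_mixture)
        have "integrable (iid n (mixture p P)) (\<lambda>z. iexp (\<Sum>j<n. \<Sum>l\<in>UNIV. ?u n \<pi> \<pi>' j l * g l (z j)))" for \<pi> \<pi>'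
        proof (rule iidp.integrable_const_bound[where B=1])
          have "(\<lambda>z. g l (z j)) \<in> borel_measurable (iid n (mixture p P))" if "j < n" for j l
            using that unfolding iid_def
            by (intro measurable_compose[OF measurable_component_singleton]) (auto simp: measurable_cong_sets[OF sets_mixture refl] g)
          then have "(\<lambda>z. \<Sum>j<n. \<Sum>l\<in>UNIV. ?u n \<pi> \<pi>' j l * g l (z j)) \<in> borel_measurable (iid n (mixture p P))"
            by (intro borel_measurable_sum borel_measurable_times borel_measurable_const) auto
          then show "(\<lambda>z. iexp (\<Sum>j<n. \<Sum>l\<in>UNIV. ?u n \<pi> \<pi>' j l * g l (z j))) \<in> borel_measurable (iid n (mixture p P))"
            by measurable
        qed simp
        then show ?thesis unfolding Heq I_def by (simp add: Bochner_Integration.integral_sum)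
      qed
      then have "(\<integral>z. H n z \<partial>iid n (mixture p P)) - exp (- lim / 2) = (\<Sum>\<pi>'\<in>?P. (\<Sum>\<pi>\<in>?P. I n \<pi> \<pi>' - exp (- lim / 2)) / fact n) / fact n"
        by (simp add: sum_subtractf diff_divide_distrib)
      then have "cmod ((\<integral>z. H n z \<partial>iid n (mixture p P)) - exp (- lim / 2)) = cmod ((\<Sum>\<pi>'\<in>?P. (\<Sum>\<pi>\<in>?P. I n \<pi> \<pi>' - exp (- lim / 2)) / fact n) / fact n)"
        by (simp only:)
      also have "\<dots> \<le> (\<Sum>\<pi>'\<in>?P. e / 2) / fact n"
      proof (rule norm_perm_average_le)
        fix \<pi>' assume p': "\<pi>' permutes {..<n}"
        have "cmod ((\<Sum>\<pi>\<in>?P. I n \<pi> \<pi>' - exp (- lim / 2)) / fact n) \<le> (\<Sum>\<pi>\<in>?P. e / 4 + \<bar>V n \<pi> \<pi>' - lim\<bar> / 2) / fact n"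
        proof (rule norm_perm_average_le)
          fix \<pi>
          have "cmod (I n \<pi> \<pi>' - exp (- lim / 2)) \<le> cmod (I n \<pi> \<pi>' - exp (- V n \<pi> \<pi>' / 2)) + cmod (complex_of_real (exp (- V n \<pi> \<pi>' / 2)) - exp (- lim / 2))"
            using norm_triangle_ineq[of "I n \<pi> \<pi>' - exp (- V n \<pi> \<pi>' / 2)" "exp (- V n \<pi> \<pi>' / 2) - exp (- lim / 2)"] by simp
          also have "cmod (complex_of_real (exp (- V n \<pi> \<pi>' / 2)) - exp (- lim / 2)) = \<bar>exp (- (V n \<pi> \<pi>' / 2)) - exp (- (lim / 2))\<bar>"
            by (metis minus_divide_left norm_of_real of_real_diff)
          also have "\<dots> \<le> \<bar>V n \<pi> \<pi>' / 2 - lim / 2\<bar>" using V0[of n \<pi> \<pi>'] lim0 by (intro exp_minus_lipschitz) auto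
          also have "\<dots> = \<bar>V n \<pi> \<pi>' - lim\<bar> / 2" by (auto simp: abs_if)
          finally show "cmod (I n \<pi> \<pi>' - exp (- lim / 2)) \<le> e / 4 + \<bar>V n \<pi> \<pi>' - lim\<bar> / 2" using I[of \<pi> \<pi>'] by linarith
        qed
        also have "\<dots> = e / 4 + (\<Sum>\<pi>\<in>?P. \<bar>V n \<pi> \<pi>' - lim\<bar>) / fact n / 2"
          by (simp add: sum.distrib add_divide_distrib sum_divide_distrib mult.commute)
        also have "(\<Sum>\<pi>\<in>?P. \<bar>V n \<pi> \<pi>' - lim\<bar>) / fact n \<le> e / 2"
          using elim(3) p' e unfolding V_def lim_def by simp
        finally show "cmod ((\<Sum>\<pi>\<in>?P. I n \<pi> \<pi>' - exp (- lim / 2)) / fact n) \<le> e / 2" by simp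
      qed
      also have "\<dots> < e" using e by simp
      finally show ?case by simp
    qed
    then show "\<exists>n0. \<forall>n\<ge>n0. norm ((\<integral>z. H n z \<partial>iid n (mixture p P)) - complex_of_real (exp (- lim / 2)) - 0) < e"
      by (simp add: eventually_sequentially)
  qed
  from tendsto_add[OF rep this] have "(\<lambda>n. (\<integral>z. H n z \<partial>data_law N P n) - complex_of_real (exp (- lim / 2))) \<longlonglongrightarrow> 0" by simp
  then show ?thesis unfolding H_def lim_def by (rule LIM_zero_cancel)
qed

end

section \<open>Limit laws of the contrast statistic\<close>

lemma borel_measurable_vecI:
  fixes F :: "'w \<Rightarrow> real^'n"
  assumes "\<And>i. (\<lambda>x. F x $ i) \<in> borel_measurable M"
  shows "F \<in> borel_measurable M"
  using assms by (subst borel_measurable_euclidean_space) (auto simp: Basis_vec_def inner_axis)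

lemma borel_measurable_matrix_nth:
  fixes F :: "'w \<Rightarrow> real^'m^'k"
  assumes "F \<in> borel_measurable M"
  shows "(\<lambda>x. F x $ i $ r) \<in> borel_measurable M"
  by (rule measurable_compose[OF assms]) (intro borel_measurable_continuous_onI continuous_intros)

lemma mchar_pair:
  fixes Q :: "'a::euclidean_space measure"
  assumes Q: "prob_space Q" and sQ [measurable_cong]: "sets Q = sets borel"
  shows "mchar (Q \<Otimes>\<^sub>M Q) (a, b) = mchar Q a * mchar Q b"
    and "\<And>f g :: 'a \<Rightarrow> real. f \<in> borel_measurable borel \<Longrightarrow> g \<in> borel_measurable borel \<Longrightarrow> (\<And>x. \<bar>f x\<bar> \<le> B) \<Longrightarrow> (\<And>x. \<bar>g x\<bar> \<le> B') \<Longrightarrow>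
      (\<integral>x. f (fst x) * g (snd x) \<partial>(Q \<Otimes>\<^sub>M Q)) = (\<integral>x. f x \<partial>Q) * (\<integral>x. g x \<partial>Q)"
proof -
  interpret prob_space Q by fact
  interpret QQ: pair_prob_space Q Q ..
  have "integrable (Q \<Otimes>\<^sub>M Q) (\<lambda>(x, y). iexp (a \<bullet> x) * iexp (b \<bullet> y))"
    by (rule QQ.integrable_const_bound[where B=1]) (auto simp: case_prod_beta norm_mult)
  from QQ.integral_fst'[OF this] have "(\<integral>x. (\<integral>y. iexp (a \<bullet> x) * iexp (b \<bullet> y) \<partial>Q) \<partial>Q) = (\<integral>x. iexp (a \<bullet> fst x) * iexp (b \<bullet> snd x) \<partial>(Q \<Otimes>\<^sub>M Q))"
    by (simp add: case_prod_unfold)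
  then show "mchar (Q \<Otimes>\<^sub>M Q) (a, b) = mchar Q a * mchar Q b"
    by (simp add: mchar_def inner_prod_def exp_add distrib_left)
  fix f g :: "'a \<Rightarrow> real"
  assume [measurable]: "f \<in> borel_measurable borel" "g \<in> borel_measurable borel" and B: "\<And>x. \<bar>f x\<bar> \<le> B" "\<And>x. \<bar>g x\<bar> \<le> B'"
  have "\<bar>f x * g y\<bar> \<le> B * B'" for x y
    unfolding abs_mult using B[of x] B(2)[of y] order_trans[OF abs_ge_zero B(1)[of x]] by (intro mult_mono) auto
  then have "integrable (Q \<Otimes>\<^sub>M Q) (\<lambda>(x, y). f x * g y)"
    by (intro QQ.integrable_const_bound[where B="B * B'"]) (auto simp: case_prod_beta)
  from QQ.integral_fst'[OF this] show "(\<integral>x. f (fst x) * g (snd x) \<partial>(Q \<Otimes>\<^sub>M Q)) = (\<integral>x. f x \<partial>Q) * (\<integral>x. g x \<partial>Q)"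
    by (simp add: case_prod_unfold)
qed

lemma Chebyshev_radius:
  fixes v d :: real
  assumes "0 \<le> v" "0 < d"
  obtains B where "0 < B" "v / B\<^sup>2 < d"
proof
  \<comment> \<open>Adding 1 keeps the radius positive when \<open>v = 0\<close>.\<close>
  have "(v + 1) / d > 0" using assms by simp
  then show "0 < sqrt ((v + 1) / d)" by simp
  show "v / (sqrt ((v + 1) / d))\<^sup>2 < d"
    using assms by (simp add: field_simps)
qed

context k_samples
begin

abbreviation Perms :: "nat \<Rightarrow> (nat \<Rightarrow> nat) set" where
  "Perms n \<equiv> {\<pi>. \<pi> permutes {..<n}}"

lemma finite_Perms: "finite (Perms n)" "Perms n \<noteq> {}"
  using finite_permutations[of "{..<n}"] permutes_id[of "{..<n}"] by (auto intro: exI[of _ id])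

text \<open>Shifted to start at 0 and restricted, a permuted block lives on the space of an i.i.d.
  sample of size \<open>N n i\<close>, so that events for the two can be compared.\<close>

definition block :: "nat \<Rightarrow> 'k \<Rightarrow> (nat \<Rightarrow> 'a) \<Rightarrow> (nat \<Rightarrow> nat) \<Rightarrow> (nat \<Rightarrow> 'a)" where
  "block n i z \<pi> = (\<lambda>j\<in>{..<N n i}. z (\<pi> (blk_start N n i + j)))"

lemma measurable_entry:
  assumes "\<pi> permutes {..<n}" "j < n"
  shows "(\<lambda>z. z (\<pi> j)) \<in> data_law N P n \<rightarrow>\<^sub>M borel"
proof -
  have "(\<lambda>z. z (\<pi> j)) \<in> PiM {..<n} (\<lambda>_. borel :: 'a measure) \<rightarrow>\<^sub>M borel"
    by (rule measurable_component_singleton) (use permutes_in_image[OF assms(1)] assms(2) in auto)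
  then show ?thesis by (simp add: measurable_cong_sets[OF sets_data_law refl])
qed

lemma measurable_block:
  assumes "\<pi> permutes {..<n}"
  shows "(\<lambda>z. block n i z \<pi>) \<in> data_law N P n \<rightarrow>\<^sub>M PiM {..<N n i} (\<lambda>_. borel)"
  unfolding block_def
proof (rule measurable_restrict)
  fix j assume "j \<in> {..<N n i}"
  then have "blk_start N n i + j < n" using blk_end_le[of n i] by auto
  then show "(\<lambda>z. z (\<pi> (blk_start N n i + j))) \<in> data_law N P n \<rightarrow>\<^sub>M borel"
    by (rule measurable_entry[OF assms])
qed

lemma block_identity_law:
  assumes A: "A \<in> sets (PiM {..<N n i} (\<lambda>_. borel))"
  shows "measure (data_law N P n) {z \<in> space (data_law N P n). block n i z id \<in> A} = measure (iid (N n i) (P i)) A"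
proof -
  have lt: "blk_start N n i + j < n" if "j < N n i" for j using blk_end_le[of n i] that by linarith
  have "measure (data_law N P n) {z \<in> space (data_law N P n). (\<lambda>j\<in>{..<N n i}. z (blk_start N n i + j)) \<in> A} =
    measure (PiM {..<N n i} (\<lambda>j. P (grp N n (blk_start N n i + j)))) A"
    unfolding data_law_def by (rule measure_PiM_reindex) (use lt P_prob A in \<open>auto intro: inj_onI\<close>)
  also have "PiM {..<N n i} (\<lambda>j. P (grp N n (blk_start N n i + j))) = PiM {..<N n i} (\<lambda>j. P i)"
    by (intro PiM_cong refl arg_cong[where f=P] grp_eq) (auto simp: blk_def)
  finally show ?thesis by (simp only: block_def id_apply iid_def)
qed

lemma block_score_block: "block_score h n z \<pi> i l = 1 / sqrt (real (N n i)) * (\<Sum>j<N n i. h i l (block n i z \<pi> j))"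
  by (simp add: block_score_def block_def)

lemma permZi_block: "permZi N n z \<pi> i = map (block n i z \<pi>) [0..<N n i]"
proof -
  have "[blk_start N n i ..< blk_start N n i + N n i] = map (\<lambda>j. blk_start N n i + j) [0..<N n i]"
    by (simp add: map_add_upt add.commute)
  then show ?thesis by (simp add: permZi_def block_def)
qed

lemma sum_score_measurable:
  fixes g :: "'a \<Rightarrow> real"
  assumes g: "g \<in> borel_measurable borel"
  shows "(\<lambda>x. c * (\<Sum>j<m. g (x j))) \<in> borel_measurable (PiM {..<m} (\<lambda>_. borel :: 'a measure))"
proof (intro borel_measurable_times borel_measurable_const borel_measurable_sum)
  fix j assume "j \<in> {..<m}"
  then have "(\<lambda>x. x j) \<in> PiM {..<m} (\<lambda>_. borel :: 'a measure) \<rightarrow>\<^sub>M borel"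
    by (rule measurable_component_singleton)
  from measurable_compose[OF this g] show "(\<lambda>x. g (x j)) \<in> borel_measurable (PiM {..<m} (\<lambda>_. borel :: 'a measure))" .
qed

lemma iid_score_tail:
  fixes Q :: "'a measure"
  assumes Q: "prob_space Q" "sets Q = sets borel" and g: "g \<in> borel_measurable borel"
    and sq: "integrable Q (\<lambda>x. (g x)\<^sup>2)" and mean: "(\<integral>x. g x \<partial>Q) = 0" and B: "B > 0"
  shows "measure (iid m Q) {x \<in> space (PiM {..<m} (\<lambda>_. borel)). \<bar>1 / sqrt (real m) * (\<Sum>j<m. g (x j))\<bar> > B} \<le> (\<integral>x. (g x)\<^sup>2 \<partial>Q) / B\<^sup>2"
proof -
  let ?X = "\<lambda>x. 1 / sqrt (real m) * (\<Sum>j<m. g (x j))"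
  have sets: "sets (iid m Q) = sets (PiM {..<m} (\<lambda>_. borel))" unfolding iid_def using Q(2) by (intro sets_PiM_cong) auto
  then have space: "space (iid m Q) = space (PiM {..<m} (\<lambda>_. borel))" by (rule sets_eq_imp_space_eq)
  interpret I: prob_space "iid m Q" unfolding iid_def by (intro prob_space_PiM Q)
  have gQ: "g \<in> borel_measurable Q" using g by (simp add: measurable_cong_sets[OF Q(2) refl])
  have X: "?X \<in> borel_measurable (iid m Q)"
    using sum_score_measurable[OF g] by (simp only: measurable_cong_sets[OF sets refl])
  note M = PiM_second_moment[where M="\<lambda>_. Q" and g="\<lambda>_. g" and I="{..<m}", OF Q(1) finite_lessThan gQ sq mean]
  have X2: "(?X x)\<^sup>2 = 1 / real m * (\<Sum>j<m. g (x j))\<^sup>2" for x by (simp add: power_mult_distrib power_divide)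
  have "measure (iid m Q) {x \<in> space (iid m Q). \<bar>?X x\<bar> > B} \<le> measure (iid m Q) {x \<in> space (iid m Q). \<bar>?X x\<bar> \<ge> B}"
  proof (rule I.finite_measure_mono)
    note [measurable] = X
    show "{x \<in> space (iid m Q). \<bar>?X x\<bar> \<ge> B} \<in> sets (iid m Q)" by measurable
  qed auto
  also have "\<dots> \<le> (\<integral>x. (?X x)\<^sup>2 \<partial>iid m Q) / B\<^sup>2"
    by (rule I.second_moment_method[OF X _ B]) (unfold X2, use M(1) in \<open>simp add: iid_def\<close>)
  also have "(\<integral>x. (?X x)\<^sup>2 \<partial>iid m Q) = 1 / real m * (real m * (\<integral>x. (g x)\<^sup>2 \<partial>Q))"
    unfolding X2 using M(2) by (simp add: iid_def)
  \<comment> \<open>Equality, except for \<open>m = 0\<close>, where division by zero makes the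
    left-hand side vanish.\<close>
  also have "\<dots> \<le> (\<integral>x. (g x)\<^sup>2 \<partial>Q)" by simp
  finally show ?thesis using B by (simp add: space divide_right_mono)
qed

end

section \<open>The contrast statistic and its linear expansion\<close>

locale estimator = k_samples p P N
  for p :: "'k::{finite,linorder} \<Rightarrow> real" and P :: "'k \<Rightarrow> 'a::topological_space measure" and N +
  fixes th :: "'d::finite \<Rightarrow> 'a list \<Rightarrow> real" and Ch :: "'a list \<Rightarrow> ((real, 'm::finite) vec, 'k) vec"
  assumes th_meas: "\<And>m l. (\<lambda>x. th l (map x [0..<m])) \<in> borel_measurable (PiM {..<m} (\<lambda>_. borel))"
    and Ch_meas: "\<And>m. (\<lambda>x. Ch (map x [0..<m])) \<in> borel_measurable (PiM {..<m} (\<lambda>_. borel))"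
    and Ch_contrast: "\<And>zs. contrast_matrix (Ch zs)"
begin

text \<open>The error term of the asymptotically linear expansion. The centring \<open>t\<close> is
  left free: it becomes the common value under the null for the original samples, and the value at
  the mixture for permuted blocks.\<close>

definition remainder :: "real \<Rightarrow> ('a \<Rightarrow> real) \<Rightarrow> 'd \<Rightarrow> nat \<Rightarrow> (nat \<Rightarrow> 'a) \<Rightarrow> real" where
  "remainder t g l m x = sqrt (real m) * (th l (map x [0..<m]) - t) - 1 / sqrt (real m) * (\<Sum>j<m. g (x j))"

lemma remainder_measurable:
  assumes g: "g \<in> borel_measurable borel"
  shows "remainder t g l m \<in> borel_measurable (PiM {..<m} (\<lambda>_. borel))"
  unfolding remainder_def[abs_def]
  by (intro borel_measurable_diff borel_measurable_times borel_measurable_const th_meas sum_score_measurable g)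

lemma Vn_component:
  "Vn th Ch N n z \<pi> $ rl = sqrt (real n) * (\<Sum>i\<in>UNIV. th (snd rl) (map (block n i z \<pi>) [0..<N n i]) * Ch (permZ n z \<pi>) $ i $ fst rl)"
  by (simp add: Vn_def vecc_def Thetahat_def matrix_matrix_mult_def permZi_block)

text \<open>The common centring value drops out because the columns of the contrast matrix sum to zero.\<close>

lemma Vn_decomposition:
  assumes "\<forall>i. 0 < N n i"
  shows "Vn th Ch N n z \<pi> = (\<chi> rl. \<Sum>i\<in>UNIV. sqrt (real n / real (N n i)) *
     (block_score h n z \<pi> i (snd rl) + remainder (t (snd rl)) (h i (snd rl)) (snd rl) (N n i) (block n i z \<pi>)) * Ch (permZ n z \<pi>) $ i $ fst rl)"
proof -
  have "(\<Sum>i\<in>UNIV. sqrt (real n / real (N n i)) *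
     (block_score h n z \<pi> i l + remainder (t l) (h i l) l (N n i) (block n i z \<pi>)) * Ch (permZ n z \<pi>) $ i $ r) =
     Vn th Ch N n z \<pi> $ (r, l)" for r l
  proof -
    have "sqrt (real n / real (N n i)) * (block_score h n z \<pi> i l + remainder (t l) (h i l) l (N n i) (block n i z \<pi>)) =
      sqrt (real n) * (th l (map (block n i z \<pi>) [0..<N n i]) - t l)" for i
      using assms[rule_format, of i] by (simp add: block_score_block remainder_def real_sqrt_divide)
    then have "(\<Sum>i\<in>UNIV. sqrt (real n / real (N n i)) *
      (block_score h n z \<pi> i l + remainder (t l) (h i l) l (N n i) (block n i z \<pi>)) * Ch (permZ n z \<pi>) $ i $ r) =
      (\<Sum>i\<in>UNIV. sqrt (real n) * (th l (map (block n i z \<pi>) [0..<N n i]) - t l) * Ch (permZ n z \<pi>) $ i $ r)"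
      by (simp only:)
    also have "\<dots> = sqrt (real n) * (\<Sum>i\<in>UNIV. th l (map (block n i z \<pi>) [0..<N n i]) * Ch (permZ n z \<pi>) $ i $ r)
        - sqrt (real n) * t l * (\<Sum>i\<in>UNIV. Ch (permZ n z \<pi>) $ i $ r)"
      by (simp add: sum_distrib_left sum_subtractf[symmetric] algebra_simps)
    also have "(\<Sum>i\<in>UNIV. Ch (permZ n z \<pi>) $ i $ r) = 0"
      using Ch_contrast by (simp add: contrast_matrix_def)
    finally show ?thesis by (simp add: Vn_component)
  qed
  then show ?thesis by (simp add: vec_eq_iff)
qed

text \<open>Arbitrary position lists are allowed because later the list itself becomes a variable
  ranging over a countable type.\<close>

lemma Ch_map_measurable: "(\<lambda>z. Ch (map z xs)) \<in> borel_measurable (data_law N P n)"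
proof -
  have "(\<lambda>z. \<lambda>j\<in>{..<length xs}. z (xs ! j)) \<in> data_law N P n \<rightarrow>\<^sub>M PiM {..<length xs} (\<lambda>_. borel)"
  proof (rule measurable_restrict)
    fix j
    show "(\<lambda>z. z (xs ! j)) \<in> data_law N P n \<rightarrow>\<^sub>M borel"
    proof (cases "xs ! j < n")
      case True
      then have "(\<lambda>z. z (xs ! j)) \<in> PiM {..<n} (\<lambda>_. borel :: 'a measure) \<rightarrow>\<^sub>M borel"
        by (intro measurable_component_singleton) simp
      then show ?thesis by (simp add: measurable_cong_sets[OF sets_data_law refl])
    next
      case False
      \<comment> \<open>Outside the index range an extensional function has the constant value
        \<open>undefined\<close>.\<close>
      then have "z (xs ! j) = undefined" if "z \<in> space (data_law N P n)" for z
        using that by (auto simp: space_data_law PiE_def extensional_def)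
      then show ?thesis by (subst measurable_cong[where g="\<lambda>_. undefined"]) simp_all
    qed
  qed
  from measurable_compose[OF this Ch_meas]
  have "(\<lambda>z. Ch (map (\<lambda>j\<in>{..<length xs}. z (xs ! j)) [0..<length xs])) \<in> borel_measurable (data_law N P n)" .
  also have "(\<lambda>z. Ch (map (\<lambda>j\<in>{..<length xs}. z (xs ! j)) [0..<length xs])) = (\<lambda>z. Ch (map z xs))"
    by (intro ext arg_cong[where f=Ch]) (auto intro: nth_equalityI)
  finally show ?thesis .
qed

lemma permZ_map: "permZ n z \<pi> = map z (map \<pi> [0..<n])"
  by (simp add: permZ_def)

lemma Vn_measurable:
  assumes "\<pi> permutes {..<n}"
  shows "(\<lambda>z. Vn th Ch N n z \<pi>) \<in> borel_measurable (data_law N P n)"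
proof (rule borel_measurable_vecI)
  fix rl
  show "(\<lambda>z. Vn th Ch N n z \<pi> $ rl) \<in> borel_measurable (data_law N P n)"
    unfolding Vn_component permZ_map
    by (intro borel_measurable_times borel_measurable_const borel_measurable_sum borel_measurable_matrix_nth Ch_map_measurable
        measurable_compose[OF measurable_block[OF assms] th_meas])
qed

lemma block_score_measurable:
  assumes "\<pi> permutes {..<n}" and h: "\<And>i l. h i l \<in> borel_measurable borel"
  shows "(\<lambda>z. block_score h n z \<pi> i l) \<in> borel_measurable (data_law N P n)"
  unfolding block_score_block
  by (rule measurable_compose[OF measurable_block[OF assms(1)] sum_score_measurable[OF h]])

lemma block_stat_measurable:
  assumes "\<pi> permutes {..<n}" and h: "\<And>i l. h i l \<in> borel_measurable borel"
  shows "(\<lambda>z. block_stat h C n z \<pi>) \<in> borel_measurable (data_law N P n)"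
proof (rule borel_measurable_vecI)
  fix rl
  show "(\<lambda>z. block_stat h C n z \<pi> $ rl) \<in> borel_measurable (data_law N P n)"
    unfolding block_stat_def vec_lambda_beta
    by (intro borel_measurable_times borel_measurable_const borel_measurable_sum block_score_measurable assms)
qed

lemma sqrt_fraction_lim: "(\<lambda>n. sqrt (real n / real (N n i))) \<longlonglongrightarrow> sqrt (1 / p i)"
  by (intro tendsto_real_sqrt inverse_fraction_lim)

text \<open>A single centring \<open>t\<close> for all samples is the form in which the null
  hypothesis enters. The unpermuted blocks are i.i.d. samples whose sizes tend to infinity, so the
  expansions assumed for i.i.d. samples carry over by composition with \<open>N n i\<close>.\<close>

lemma sample_limit:
  fixes C :: "((real, 'm) vec, 'k) vec" and f :: "'k \<Rightarrow> 'd \<Rightarrow> 'a \<Rightarrow> real" and t :: "'d \<Rightarrow> real"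
  defines "S \<equiv> kron (transpose C) (mat 1 :: real^'d^'d) ** blockdiag (\<lambda>i. (1 / p i) *\<^sub>R covmat (P i) (f i))
              ** transpose (kron (transpose C) (mat 1 :: real^'d^'d))"
  assumes f_meas: "\<And>i l. f i l \<in> borel_measurable borel"
    and f_sq: "\<And>i l. integrable (P i) (\<lambda>x. (f i l x)\<^sup>2)"
    and f_mean: "\<And>i l. (\<integral>x. f i l x \<partial>P i) = 0"
    and f_lin: "\<And>i l. conv_in_prob (\<lambda>m. iid m (P i)) (\<lambda>m x. remainder (t l) (f i l) l m x) 0"
    and Ch_lim: "conv_in_prob (data_law N P) (\<lambda>n z. Ch (map z [0..<n])) C"
  shows "weak_conv (\<lambda>n. distr (data_law N P n) borel (\<lambda>z. Vn th Ch N n z id)) (mvnormal S)"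
proof -
  have scores: "centred_scores (P i) (f i)" for i
    by (intro centred_scores.intro centred_scores_axioms.intro P_prob f_sq f_mean)
      (simp add: measurable_cong_sets[OF P_sets refl] f_meas)
  interpret D: prob_seq "data_law N P" by (rule prob_seq.intro) (rule prob_space_data_law)
  have idp: "id permutes {..<n}" for n by (rule permutes_id)
  have cov: "covmat (P i) (f i) $ l $ l' = (\<integral>x. f i l x * f i l' x \<partial>P i)" for i l l'
    by (simp add: covmat_def f_mean)
  have Sq: "a \<bullet> (S *v a) = (\<Sum>i\<in>UNIV. \<Sum>l\<in>UNIV. \<Sum>l'\<in>UNIV. contrast_weight C a i l * contrast_weight C a i l' * (1 / p i * (\<integral>x. f i l x * f i l' x \<partial>P i)))" for a
    unfolding S_def kron_quadratic_form by (simp add: cov)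
  have Ssym: "transpose S = S"
    unfolding S_def by (rule kron_quadratic_form) (simp add: cov mult.commute)
  have Spsd: "0 \<le> a \<bullet> (S *v a)" for a
    unfolding Sq
  proof (rule sum_nonneg)
    fix i
    have "0 \<le> 1 / p i * (\<Sum>l\<in>UNIV. \<Sum>l'\<in>UNIV. contrast_weight C a i l * contrast_weight C a i l' * (\<integral>x. f i l x * f i l' x \<partial>P i))"
      using p_pos[of i] by (intro mult_nonneg_nonneg centred_scores.score_quadratic_nonneg[OF scores]) simp
    then show "0 \<le> (\<Sum>l\<in>UNIV. \<Sum>l'\<in>UNIV. contrast_weight C a i l * contrast_weight C a i l' * (1 / p i * (\<integral>x. f i l x * f i l' x \<partial>P i)))"
      by (simp add: sum_distrib_left sum_divide_distrib)
  qed
  have close: "(\<lambda>n. measure (data_law N P n) {z \<in> space (data_law N P n). norm (Vn th Ch N n z id - block_stat f C n z id) > e}) \<longlonglongrightarrow> 0"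
    if e: "e > 0" for e
    unfolding block_stat_def
  proof (rule D.contrast_linearisation[where T="\<lambda>n z i l. block_score f n z id i l" and W="\<lambda>n z. Ch (permZ n z id)"
        and R="\<lambda>n z i l. remainder (t l) (f i l) l (N n i) (block n i z id)" and \<omega>="\<lambda>i. sqrt (1 / p i)"])
    show "D.rv (\<lambda>n z. block_score f n z id i l)" for i l
      unfolding D.rv_def by (intro allI block_score_measurable idp f_meas)
    show "D.rv (\<lambda>n z. remainder (t l) (f i l) l (N n i) (block n i z id))" for i l
      unfolding D.rv_def by (intro allI measurable_compose[OF measurable_block[OF idp] remainder_measurable] f_meas)
    show "(\<lambda>z. Ch (permZ n z id)) \<in> borel_measurable (data_law N P n)" for n
      unfolding permZ_map by (rule Ch_map_measurable)
    show "conv_in_prob (data_law N P) (\<lambda>n z. Ch (permZ n z id)) C" using Ch_lim by (simp add: permZ_def)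
    show "(\<lambda>n. sqrt (real n / real (N n i))) \<longlonglongrightarrow> sqrt (1 / p i)" for i by (rule sqrt_fraction_lim)
    show "\<forall>\<^sub>F n in sequentially. \<forall>z\<in>space (data_law N P n). Vn th Ch N n z id = (\<chi> rl. \<Sum>i\<in>UNIV. sqrt (real n / real (N n i)) *
        (block_score f n z id i (snd rl) + remainder (t (snd rl)) (f i (snd rl)) (snd rl) (N n i) (block n i z id)) * Ch (permZ n z id) $ i $ fst rl)"
      using eventually_N_pos by eventually_elim (blast intro: Vn_decomposition)
    have event: "measure (data_law N P n) {z \<in> space (data_law N P n). G (block n i z id) > d} =
        measure (iid (N n i) (P i)) {x \<in> space (PiM {..<N n i} (\<lambda>_. borel)). G x > d}"
      if G: "G \<in> borel_measurable (PiM {..<N n i} (\<lambda>_. borel))" for G :: "(nat \<Rightarrow> 'a) \<Rightarrow> real" and d n i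
    proof -
      have "{x \<in> space (PiM {..<N n i} (\<lambda>_. borel)). G x > d} \<in> sets (PiM {..<N n i} (\<lambda>_. borel))" using G [measurable] by measurable
      note law = block_identity_law[OF this]
      have "{z \<in> space (data_law N P n). block n i z id \<in> {x \<in> space (PiM {..<N n i} (\<lambda>_. borel)). G x > d}} =
        {z \<in> space (data_law N P n). G (block n i z id) > d}"
        using measurable_space[OF measurable_block[OF idp]] by blast
      with law show ?thesis by (simp only:)
    qed
    show "vanishing (data_law N P) (\<lambda>n z. remainder (t l) (f i l) l (N n i) (block n i z id))" for i l
      unfolding vanishing_def
    proof (intro allI impI)
      fix d :: real assume d: "d > 0"
      have "(\<lambda>m. measure (iid m (P i)) {x \<in> space (PiM {..<m} (\<lambda>_. borel)). \<bar>remainder (t l) (f i l) l m x\<bar> > d}) \<longlonglongrightarrow> 0"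
        using f_lin[of i l] d by (simp add: conv_in_prob_def iid_def space_PiM)
      from filterlim_compose[OF this N_at_top[of i]]
      show "(\<lambda>n. measure (data_law N P n) {z \<in> space (data_law N P n). \<bar>remainder (t l) (f i l) l (N n i) (block n i z id)\<bar> > d}) \<longlonglongrightarrow> 0"
        by (subst event) (auto intro!: borel_measurable_abs remainder_measurable f_meas)
    qed
    show "stoch_bounded (data_law N P) (\<lambda>n z. block_score f n z id i l)" for i l
      unfolding stoch_bounded_def
    proof (intro allI impI)
      fix d :: real assume d: "d > 0"
      define v where "v = (\<integral>x. (f i l x)\<^sup>2 \<partial>P i)"
      have v0: "v \<ge> 0" by (simp add: v_def)
      obtain B where Bpos: "B > 0" and vB: "v / B\<^sup>2 < d" by (rule Chebyshev_radius[OF v0 d])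
      have "measure (data_law N P n) {z \<in> space (data_law N P n). \<bar>block_score f n z id i l\<bar> > B} < d" for n
      proof -
        have "measure (data_law N P n) {z \<in> space (data_law N P n). \<bar>block_score f n z id i l\<bar> > B} =
          measure (iid (N n i) (P i)) {x \<in> space (PiM {..<N n i} (\<lambda>_. borel)). \<bar>1 / sqrt (real (N n i)) * (\<Sum>j<N n i. f i l (x j))\<bar> > B}"
          unfolding block_score_block by (rule event) (intro borel_measurable_abs sum_score_measurable f_meas)
        also have "\<dots> \<le> v / B\<^sup>2"
          unfolding v_def by (rule iid_score_tail[OF P_prob P_sets f_meas f_sq f_mean Bpos])
        finally show ?thesis using vB by simp
      qed
      then show "\<exists>B>0. \<forall>\<^sub>F n in sequentially. measure (data_law N P n) {z \<in> space (data_law N P n). \<bar>block_score f n z id i l\<bar> > B} < d"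
        using Bpos by (intro exI[of _ B] conjI always_eventually allI)
    qed
  qed (rule e)
  show ?thesis
    unfolding weak_conv_def
  proof (intro allI impI)
    fix \<phi> :: "real^('m \<times> 'd) \<Rightarrow> real"
    assume \<phi>: "continuous_on UNIV \<phi> \<and> bounded (range \<phi>)"
    have "(\<lambda>n. \<integral>z. \<phi> (Vn th Ch N n z id) \<partial>data_law N P n) \<longlonglongrightarrow> (\<integral>x. \<phi> x \<partial>mvnormal S)"
    proof (rule slutsky_levy[where Y="\<lambda>n z. block_stat f C n z id"])
      show "(\<lambda>n. \<integral>z. iexp (a \<bullet> block_stat f C n z id) \<partial>data_law N P n) \<longlonglongrightarrow> mchar (mvnormal S) a" for a
        using sample_char_limit[OF scores, of a C] unfolding mchar_mvnormal[OF Ssym Spsd] Sq[symmetric] by simp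
      show "continuous_on UNIV \<phi>" "bounded (range \<phi>)" using \<phi> by auto
    qed (rule prob_space_data_law Vn_measurable[OF idp] block_stat_measurable[OF idp f_meas]
        prob_space_mvnormal[OF Ssym Spsd] sets_mvnormal[OF Ssym Spsd] close, assumption?)+
    moreover have \<phi>m: "\<phi> \<in> borel_measurable borel" using \<phi> by (blast intro: borel_measurable_continuous_onI)
    have "(\<integral>x. \<phi> x \<partial>distr (data_law N P n) borel (\<lambda>z. Vn th Ch N n z id)) = (\<integral>z. \<phi> (Vn th Ch N n z id) \<partial>data_law N P n)" for n
      by (rule integral_distr[OF Vn_measurable[OF idp] \<phi>m])
    ultimately show "(\<lambda>n. \<integral>x. \<phi> x \<partial>distr (data_law N P n) borel (\<lambda>z. Vn th Ch N n z id)) \<longlonglongrightarrow> (\<integral>x. \<phi> x \<partial>mvnormal S)"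
      by simp
  qed
qed

end

text \<open>The convergence of the permuted contrast matrix is assumed over a pmf on all functions,
  whereas the argument runs over the finite set of permutations. Both measures average the sections,
  so the probabilities agree.\<close>

lemma pair_pmf_of_set_measure:
  assumes D: "prob_space D" and A: "finite A" "A \<noteq> {}"
    and E: "{x \<in> space (D \<Otimes>\<^sub>M measure_pmf (pmf_of_set A)). P (fst x) (snd x)} \<in> sets (D \<Otimes>\<^sub>M measure_pmf (pmf_of_set A))"
  shows "measure (D \<Otimes>\<^sub>M measure_pmf (pmf_of_set A)) {x \<in> space (D \<Otimes>\<^sub>M measure_pmf (pmf_of_set A)). P (fst x) (snd x)} =
    (\<Sum>a\<in>A. measure D {z \<in> space D. P z a}) / real (card A)"
proof -
  interpret D: prob_space D by fact
  interpret U: prob_space "measure_pmf (pmf_of_set A)" by (rule measure_pmf.prob_space_axioms)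
  interpret DU: pair_prob_space D "measure_pmf (pmf_of_set A)" ..
  let ?M = "D \<Otimes>\<^sub>M measure_pmf (pmf_of_set A)"
  let ?E = "{x \<in> space ?M. P (fst x) (snd x)}"
  have i: "integrable ?M (indicat_real ?E)"
    using E by (intro DU.integrable_const_bound[where B=1]) (auto simp: indicator_def)
  have slice: "(\<integral>z. indicat_real ?E (z, a) \<partial>D) = measure D {z \<in> space D. P z a}" for a
  proof -
    have "(\<integral>z. indicat_real ?E (z, a) \<partial>D) = (\<integral>z. indicat_real {z \<in> space D. P z a} z \<partial>D)"
      by (intro Bochner_Integration.integral_cong refl) (auto simp: indicator_def space_pair_measure)
    then show ?thesis by (simp add: Int_absorb2)
  qed
  have "measure ?M ?E = (\<integral>x. indicat_real ?E x \<partial>?M)"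
    using E sets.sets_into_space[OF E] by (simp add: Int_absorb2)
  also have "\<dots> = (\<integral>a. (\<integral>z. indicat_real ?E (z, a) \<partial>D) \<partial>measure_pmf (pmf_of_set A))"
    using DU.integral_snd[of "\<lambda>z a. indicat_real ?E (z, a)"] i by simp
  also have "\<dots> = (\<Sum>a\<in>A. measure D {z \<in> space D. P z a}) / real (card A)"
    unfolding slice by (rule integral_pmf_of_set) (use A in auto)
  finally show ?thesis .
qed

text \<open>Given the data the two choices are independent, so a product of functions of one choice
  each integrates to the product of the conditional means. This turns joint limits of two permuted
  statistics into moments of the permutation distribution.\<close>

lemma double_uniform_integral:
  fixes u v :: "'a \<Rightarrow> 'z \<Rightarrow> 'b::{banach,second_countable_topology,real_normed_field}"
  assumes D: "prob_space D" and A: "finite A" "A \<noteq> {}"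
    and m: "\<And>a. a \<in> A \<Longrightarrow> u a \<in> borel_measurable D" "\<And>a. a \<in> A \<Longrightarrow> v a \<in> borel_measurable D"
    and B: "\<And>a z. norm (u a z) \<le> B" "\<And>a z. norm (v a z) \<le> B"
  shows "(\<integral>x. u (fst (snd x)) (fst x) * v (snd (snd x)) (fst x) \<partial>(D \<Otimes>\<^sub>M uniform_count_measure (A \<times> A))) =
    (\<integral>z. ((\<Sum>a\<in>A. u a z) / of_nat (card A)) * ((\<Sum>a\<in>A. v a z) / of_nat (card A)) \<partial>D)"
proof -
  interpret D: prob_space D by fact
  have AA: "finite (A \<times> A)" "A \<times> A \<noteq> {}" using A by auto
  have B2: "norm (u a z * v b z) \<le> B * B" for a b z
    unfolding norm_mult using B order_trans[OF norm_ge_zero B(1)] by (intro mult_mono) auto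
  have i: "integrable D (\<lambda>z. u a z * v b z)" if "a \<in> A" "b \<in> A" for a b
    by (rule D.integrable_const_bound[where B="B * B"]) (use B2 m that in \<open>auto intro: borel_measurable_times\<close>)
  have "(\<integral>x. u (fst (snd x)) (fst x) * v (snd (snd x)) (fst x) \<partial>(D \<Otimes>\<^sub>M uniform_count_measure (A \<times> A))) =
    (\<Sum>c\<in>A \<times> A. \<integral>z. u (fst c) z * v (snd c) z \<partial>D) /\<^sub>R real (card (A \<times> A))"
    by (subst uniform_product_integral[OF D AA, where B="B * B"]) (use B2 m in \<open>auto intro!: borel_measurable_times\<close>)
  also have "(\<Sum>c\<in>A \<times> A. \<integral>z. u (fst c) z * v (snd c) z \<partial>D) = (\<integral>z. (\<Sum>c\<in>A \<times> A. u (fst c) z * v (snd c) z) \<partial>D)"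
    by (rule Bochner_Integration.integral_sum[symmetric]) (use i in auto)
  also have "(\<lambda>z. \<Sum>c\<in>A \<times> A. u (fst c) z * v (snd c) z) = (\<lambda>z. (\<Sum>a\<in>A. u a z) * (\<Sum>a\<in>A. v a z))"
    by (simp add: sum_product sum.cartesian_product case_prod_unfold)
  also have "(\<integral>z. (\<Sum>a\<in>A. u a z) * (\<Sum>a\<in>A. v a z) \<partial>D) /\<^sub>R real (card (A \<times> A)) =
    (\<integral>z. ((\<Sum>a\<in>A. u a z) * (\<Sum>a\<in>A. v a z)) /\<^sub>R real (card (A \<times> A)) \<partial>D)"
    by simp
  also have "\<dots> = (\<integral>z. ((\<Sum>a\<in>A. u a z) / of_nat (card A)) * ((\<Sum>a\<in>A. v a z) / of_nat (card A)) \<partial>D)"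
    by (intro Bochner_Integration.integral_cong refl)
      (simp add: card_cartesian_product scaleR_conv_of_real divide_inverse of_real_inverse mult_ac)
  finally show ?thesis .
qed

text \<open>Each of the two choices has the law of a single one, which accounts for the factor
  2.\<close>

lemma double_uniform_union_bound:
  assumes D: "prob_space D" and A: "finite A" "A \<noteq> {}"
    and E: "\<And>a. a \<in> A \<Longrightarrow> {z \<in> space D. P z a} \<in> sets D"
    and F: "\<And>a b. a \<in> A \<Longrightarrow> b \<in> A \<Longrightarrow> {z \<in> space D. R z a b} \<in> sets D"
    and R: "\<And>z a b. R z a b \<Longrightarrow> P z a \<or> P z b"
  shows "measure (D \<Otimes>\<^sub>M uniform_count_measure (A \<times> A))
      {x \<in> space (D \<Otimes>\<^sub>M uniform_count_measure (A \<times> A)). R (fst x) (fst (snd x)) (snd (snd x))} \<le>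
    2 * measure (D \<Otimes>\<^sub>M uniform_count_measure A) {x \<in> space (D \<Otimes>\<^sub>M uniform_count_measure A). P (fst x) (snd x)}"
proof -
  interpret D: prob_space D by fact
  define m where "m a = measure D {z \<in> space D. P z a}" for a
  have AA: "finite (A \<times> A)" "A \<times> A \<noteq> {}" using A by auto
  have le: "measure D {z \<in> space D. R z a b} \<le> m a + m b" if "a \<in> A" "b \<in> A" for a b
  proof -
    have "measure D {z \<in> space D. R z a b} \<le> measure D ({z \<in> space D. P z a} \<union> {z \<in> space D. P z b})"
      using R E that by (intro D.finite_measure_mono) auto
    also have "\<dots> \<le> m a + m b" unfolding m_def using E that by (intro measure_Un_le)
    finally show ?thesis .
  qed
  have "measure (D \<Otimes>\<^sub>M uniform_count_measure (A \<times> A))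
      {x \<in> space (D \<Otimes>\<^sub>M uniform_count_measure (A \<times> A)). R (fst x) (fst (snd x)) (snd (snd x))} =
    (\<Sum>c\<in>A \<times> A. measure D {z \<in> space D. R z (fst c) (snd c)}) / real (card (A \<times> A))"
    by (rule uniform_product_measure(2)[OF D AA, where P="\<lambda>z c. R z (fst c) (snd c)"]) (use F in auto)
  also have "\<dots> \<le> (\<Sum>c\<in>A \<times> A. m (fst c) + m (snd c)) / real (card (A \<times> A))"
    by (intro divide_right_mono sum_mono le) auto
  also have "(\<Sum>c\<in>A \<times> A. m (fst c) + m (snd c)) = 2 * real (card A) * (\<Sum>a\<in>A. m a)"
    using sum.cartesian_product[of "\<lambda>a b. m a + m b" A A]
    by (simp add: case_prod_unfold sum.distrib sum_distrib_left[symmetric]) (simp add: mult_ac)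
  also have "2 * real (card A) * (\<Sum>a\<in>A. m a) / real (card (A \<times> A)) = 2 * ((\<Sum>a\<in>A. m a) / real (card A))"
    using A by (simp add: card_cartesian_product)
  also have "(\<Sum>a\<in>A. m a) / real (card A) =
    measure (D \<Otimes>\<^sub>M uniform_count_measure A) {x \<in> space (D \<Otimes>\<^sub>M uniform_count_measure A). P (fst x) (snd x)}"
    unfolding m_def by (rule uniform_product_measure(2)[OF D A E, symmetric])
  finally show ?thesis .
qed

lemma moments_imp_conv_in_prob:
  fixes X :: "nat \<Rightarrow> 'w \<Rightarrow> real"
  assumes M: "\<And>n. prob_space (M n)" and X: "\<And>n. X n \<in> borel_measurable (M n)" and B: "\<And>n x. \<bar>X n x\<bar> \<le> B"
    and m1: "(\<lambda>n. \<integral>x. X n x \<partial>M n) \<longlonglongrightarrow> c" and m2: "(\<lambda>n. \<integral>x. X n x * X n x \<partial>M n) \<longlonglongrightarrow> c * c"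
  shows "conv_in_prob M X c"
  unfolding conv_in_prob_def
proof (intro allI impI)
  fix e :: real assume e: "e > 0"
  have bound: "measure (M n) {x \<in> space (M n). dist (X n x) c > e} \<le>
      ((\<integral>x. X n x * X n x \<partial>M n) - 2 * c * (\<integral>x. X n x \<partial>M n) + c * c) / e\<^sup>2" for n
  proof -
    interpret prob_space "M n" by (rule M)
    note [measurable] = X[of n]
    have i1: "integrable (M n) (X n)" using B by (intro integrable_const_bound[where B=B]) auto
    have "\<bar>X n x * X n x\<bar> \<le> B * B" for x
      unfolding abs_mult using B[of n x] by (intro mult_mono) auto
    then have i2: "integrable (M n) (\<lambda>x. X n x * X n x)" by (intro integrable_const_bound[where B="B * B"]) auto
    have sq: "(X n x - c)\<^sup>2 = X n x * X n x - 2 * c * X n x + c * c" for x by (simp add: power2_eq_square algebra_simps)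
    have "measure (M n) {x \<in> space (M n). dist (X n x) c > e} \<le> measure (M n) {x \<in> space (M n). \<bar>X n x - c\<bar> \<ge> e}"
      by (rule finite_measure_mono) (auto simp: dist_real_def)
    also have "\<dots> \<le> (\<integral>x. (X n x - c)\<^sup>2 \<partial>M n) / e\<^sup>2"
      using i1 i2 by (intro second_moment_method e) (auto simp: sq)
    also have "(\<integral>x. (X n x - c)\<^sup>2 \<partial>M n) = (\<integral>x. X n x * X n x \<partial>M n) - 2 * c * (\<integral>x. X n x \<partial>M n) + c * c"
      unfolding sq using i1 i2 by (simp add: prob_space)
    finally show ?thesis .
  qed
  have "(\<lambda>n. ((\<integral>x. X n x * X n x \<partial>M n) - 2 * c * (\<integral>x. X n x \<partial>M n) + c * c) / e\<^sup>2) \<longlonglongrightarrow> (c * c - 2 * c * c + c * c) / e\<^sup>2"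
    using e by (intro tendsto_intros m1 m2) auto
  then have lim: "(\<lambda>n. ((\<integral>x. X n x * X n x \<partial>M n) - 2 * c * (\<integral>x. X n x \<partial>M n) + c * c) / e\<^sup>2) \<longlonglongrightarrow> 0" by simp
  show "(\<lambda>n. measure (M n) {x \<in> space (M n). dist (X n x) c > e}) \<longlonglongrightarrow> 0"
    by (rule tendsto_sandwich[OF _ _ tendsto_const lim]) (auto intro: always_eventually bound)
qed

context k_samples
begin

abbreviation perm_data :: "nat \<Rightarrow> ((nat \<Rightarrow> 'a) \<times> (nat \<Rightarrow> nat)) measure" where
  "perm_data n \<equiv> data_law N P n \<Otimes>\<^sub>M uniform_count_measure (Perms n)"

lemma prob_space_perm_data: "prob_space (perm_data n)"
proof -
  interpret D: prob_space "data_law N P n" by (rule prob_space_data_law)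
  interpret U: prob_space "uniform_count_measure (Perms n)" by (rule prob_space_uniform_count[OF finite_Perms])
  interpret DU: pair_prob_space "data_law N P n" "uniform_count_measure (Perms n)" ..
  show ?thesis by (rule DU.prob_space_axioms)
qed

text \<open>Contiguity in terms of tails. The constants are uniform in \<open>G\<close> and
  \<open>d\<close>, so the functional may change with \<open>n\<close>.\<close>

lemma permuted_tail:
  obtains K c where "0 \<le> K"
    "\<forall>\<^sub>F n in sequentially. \<forall>G\<in>borel_measurable (PiM {..<N n i} (\<lambda>_. borel)). \<forall>d::real.
      measure (perm_data n) {x \<in> space (perm_data n). G (block n i (fst x) (snd x)) > d} \<le>
        c / real n + K * measure (iid (N n i) (mixture p P)) {x \<in> space (PiM {..<N n i} (\<lambda>_. borel)). G x > d}"
proof -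
  obtain K c where K: "0 \<le> K" and ev: "\<forall>\<^sub>F n in sequentially. \<forall>A\<in>sets (PiM {..<N n i} (\<lambda>_. borel)).
      (\<Sum>\<pi> | \<pi> permutes {..<n}. measure (data_law N P n) {z \<in> space (data_law N P n). (\<lambda>j\<in>{..<N n i}. z (\<pi> (blk_start N n i + j))) \<in> A}) / fact n
        \<le> c / real n + K * measure (iid (N n i) (mixture p P)) A"
    using permuted_block_contiguity[of i] by blast
  show ?thesis
  proof (rule that[OF K])
    from ev show "\<forall>\<^sub>F n in sequentially. \<forall>G\<in>borel_measurable (PiM {..<N n i} (\<lambda>_. borel)). \<forall>d::real.
      measure (perm_data n) {x \<in> space (perm_data n). G (block n i (fst x) (snd x)) > d} \<le>
        c / real n + K * measure (iid (N n i) (mixture p P)) {x \<in> space (PiM {..<N n i} (\<lambda>_. borel)). G x > d}"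
    proof (eventually_elim, intro ballI allI)
      fix n and G :: "(nat \<Rightarrow> 'a) \<Rightarrow> real" and d :: real
      assume le: "\<forall>A\<in>sets (PiM {..<N n i} (\<lambda>_. borel)).
        (\<Sum>\<pi>\<in>Perms n. measure (data_law N P n) {z \<in> space (data_law N P n). (\<lambda>j\<in>{..<N n i}. z (\<pi> (blk_start N n i + j))) \<in> A}) / fact n
          \<le> c / real n + K * measure (iid (N n i) (mixture p P)) A"
        and G [measurable]: "G \<in> borel_measurable (PiM {..<N n i} (\<lambda>_. borel))"
      let ?A = "{x \<in> space (PiM {..<N n i} (\<lambda>_. borel :: 'a measure)). G x > d}"
      have A: "?A \<in> sets (PiM {..<N n i} (\<lambda>_. borel))" by measurable
      have eq: "{z \<in> space (data_law N P n). (\<lambda>j\<in>{..<N n i}. z (\<pi> (blk_start N n i + j))) \<in> ?A} =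
          {z \<in> space (data_law N P n). G (block n i z \<pi>) > d}" if "\<pi> \<in> Perms n" for \<pi>
        unfolding block_def[symmetric] using measurable_space[OF measurable_block, of \<pi>] that by blast
      have meas: "{z \<in> space (data_law N P n). G (block n i z \<pi>) > d} \<in> sets (data_law N P n)" if "\<pi> \<in> Perms n" for \<pi>
      proof -
        have [measurable]: "(\<lambda>z. G (block n i z \<pi>)) \<in> borel_measurable (data_law N P n)"
          using measurable_compose[OF measurable_block G] that by blast
        show ?thesis by measurable
      qed
      have "measure (perm_data n) {x \<in> space (perm_data n). G (block n i (fst x) (snd x)) > d} =
        (\<Sum>\<pi>\<in>Perms n. measure (data_law N P n) {z \<in> space (data_law N P n). G (block n i z \<pi>) > d}) / fact n"
        by (subst uniform_product_measure(2)[OF prob_space_data_law finite_Perms, where P="\<lambda>z \<pi>. G (block n i z \<pi>) > d"])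
          (use meas in simp_all)
      also have "\<dots> = (\<Sum>\<pi>\<in>Perms n. measure (data_law N P n) {z \<in> space (data_law N P n). (\<lambda>j\<in>{..<N n i}. z (\<pi> (blk_start N n i + j))) \<in> ?A}) / fact n"
        by (intro arg_cong2[where f="(/)"] refl sum.cong) (simp only: eq)
      also have "\<dots> \<le> c / real n + K * measure (iid (N n i) (mixture p P)) ?A" using le A by blast
      finally show "measure (perm_data n) {x \<in> space (perm_data n). G (block n i (fst x) (snd x)) > d} \<le>
        c / real n + K * measure (iid (N n i) (mixture p P)) ?A" .
    qed
  qed
qed

end

section \<open>The permuted statistic and its limit\<close>

context estimator
begin

text \<open>The permutation component carries the discrete sigma-algebra of an uncountable function
  type, where joint measurability does not follow from that of sections. Only the list of its first
  \<open>n\<close> values matters, and lists of naturals form a countable type.\<close>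

lemma permuted_contrast_measurable:
  "(\<lambda>x. Ch (permZ n (fst x) (snd x))) \<in> borel_measurable (data_law N P n \<Otimes>\<^sub>M measure_pmf (unif_perm n))"
proof -
  have "(\<lambda>(xs, z). Ch (map z xs)) \<in> borel_measurable (count_space UNIV \<Otimes>\<^sub>M data_law N P n)"
    by (rule measurable_pair_measure_countable1) (auto intro: Ch_map_measurable)
  note Ch = this
  have "(\<lambda>x. map (snd x) [0..<n]) \<in> data_law N P n \<Otimes>\<^sub>M measure_pmf (unif_perm n) \<rightarrow>\<^sub>M count_space UNIV"
    by (rule measurable_compose[OF measurable_snd]) simp
  from measurable_compose[OF measurable_Pair[OF this measurable_fst] Ch] show ?thesis
    by (simp add: permZ_map)
qed

text \<open>Contiguity is used twice: it transfers the o_P(1) remainder, and together with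
  Chebyshev's inequality under the mixture it bounds the block scores, whose means under the single
  \<open>P i\<close> need not vanish.\<close>

lemma permuted_linearisation:
  fixes C :: "((real, 'm) vec, 'k) vec" and g :: "'d \<Rightarrow> 'a \<Rightarrow> real" and t :: "'d \<Rightarrow> real"
  assumes g_meas: "\<And>l. g l \<in> borel_measurable borel"
    and g_sq: "\<And>l. integrable (mixture p P) (\<lambda>x. (g l x)\<^sup>2)"
    and g_mean: "\<And>l. (\<integral>x. g l x \<partial>mixture p P) = 0"
    and g_lin: "\<And>l. conv_in_prob (\<lambda>m. iid m (mixture p P)) (\<lambda>m x. remainder (t l) (g l) l m x) 0"
    and Ch_lim: "conv_in_prob (\<lambda>n. data_law N P n \<Otimes>\<^sub>M measure_pmf (unif_perm n)) (\<lambda>n (z, \<pi>). Ch (permZ n z \<pi>)) C"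
    and e: "e > 0"
  shows "(\<lambda>n. measure (perm_data n) {x \<in> space (perm_data n).
      norm (Vn th Ch N n (fst x) (snd x) - block_stat (\<lambda>_. g) C n (fst x) (snd x)) > e}) \<longlonglongrightarrow> 0"
proof -
  interpret D: prob_seq perm_data by (rule prob_seq.intro) (rule prob_space_perm_data)
  have rvI: "D.rv (\<lambda>n x. F n (fst x) (snd x))" if "\<And>n \<pi>. \<pi> permutes {..<n} \<Longrightarrow> (\<lambda>z. F n z \<pi>) \<in> borel_measurable (data_law N P n)" for F
    unfolding D.rv_def by (intro allI uniform_product_measurable finite_Perms) (use that in auto)
  have N0: "(\<lambda>n. c / real n) \<longlonglongrightarrow> 0" for c :: real by real_asymp
  show ?thesis
    unfolding block_stat_def
  proof (rule D.contrast_linearisation[where T="\<lambda>n x i l. block_score (\<lambda>_. g) n (fst x) (snd x) i l" and W="\<lambda>n x. Ch (permZ n (fst x) (snd x))"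
        and R="\<lambda>n x i l. remainder (t l) (g l) l (N n i) (block n i (fst x) (snd x))" and \<omega>="\<lambda>i. sqrt (1 / p i)"])
    show "D.rv (\<lambda>n x. block_score (\<lambda>_. g) n (fst x) (snd x) i l)" for i l
      by (intro rvI block_score_measurable g_meas)
    show "D.rv (\<lambda>n x. remainder (t l) (g l) l (N n i) (block n i (fst x) (snd x)))" for i l
      by (intro rvI measurable_compose[OF measurable_block remainder_measurable] g_meas)
    show "(\<lambda>x. Ch (permZ n (fst x) (snd x))) \<in> borel_measurable (perm_data n)" for n
      by (rule uniform_product_measurable[OF finite_Perms(1)]) (simp only: fst_conv snd_conv permZ_map Ch_map_measurable)
    show "conv_in_prob perm_data (\<lambda>n x. Ch (permZ n (fst x) (snd x))) C"
      unfolding conv_in_prob_def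
    proof (intro allI impI)
      fix d :: real assume d: "d > 0"
      have m1: "{z \<in> space (data_law N P n). dist (Ch (permZ n z \<pi>)) C > d} \<in> sets (data_law N P n)" for n \<pi>
      proof -
        have [measurable]: "(\<lambda>z. Ch (permZ n z \<pi>)) \<in> borel_measurable (data_law N P n)" unfolding permZ_map by (rule Ch_map_measurable)
        show ?thesis by measurable
      qed
      have m2: "{x \<in> space (data_law N P n \<Otimes>\<^sub>M measure_pmf (unif_perm n)). dist (Ch (permZ n (fst x) (snd x))) C > d} \<in> sets (data_law N P n \<Otimes>\<^sub>M measure_pmf (unif_perm n))" for n
      proof -
        note [measurable] = permuted_contrast_measurable[of n]
        show ?thesis by measurable
      qed
      have "measure (perm_data n) {x \<in> space (perm_data n). dist (Ch (permZ n (fst x) (snd x))) C > d} =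
         measure (data_law N P n \<Otimes>\<^sub>M measure_pmf (unif_perm n)) {x \<in> space (data_law N P n \<Otimes>\<^sub>M measure_pmf (unif_perm n)). dist (Ch (permZ n (fst x) (snd x))) C > d}" for n
        using uniform_product_measure(2)[OF prob_space_data_law finite_Perms, where P="\<lambda>z \<pi>. dist (Ch (permZ n z \<pi>)) C > d", OF m1]
          pair_pmf_of_set_measure[OF prob_space_data_law finite_Perms, where P="\<lambda>z \<pi>. dist (Ch (permZ n z \<pi>)) C > d", OF m2[unfolded unif_perm_def]]
        unfolding unif_perm_def by (simp only:)
      moreover have "(\<lambda>n. measure (data_law N P n \<Otimes>\<^sub>M measure_pmf (unif_perm n)) {x \<in> space (data_law N P n \<Otimes>\<^sub>M measure_pmf (unif_perm n)). dist (Ch (permZ n (fst x) (snd x))) C > d}) \<longlonglongrightarrow> 0"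
        using Ch_lim d by (simp add: conv_in_prob_def case_prod_unfold)
      ultimately show "(\<lambda>n. measure (perm_data n) {x \<in> space (perm_data n). dist (Ch (permZ n (fst x) (snd x))) C > d}) \<longlonglongrightarrow> 0"
        by (simp only:)
    qed
    show "(\<lambda>n. sqrt (real n / real (N n i))) \<longlonglongrightarrow> sqrt (1 / p i)" for i by (rule sqrt_fraction_lim)
    show "\<forall>\<^sub>F n in sequentially. \<forall>x\<in>space (perm_data n). Vn th Ch N n (fst x) (snd x) = (\<chi> rl. \<Sum>i\<in>UNIV. sqrt (real n / real (N n i)) *
        (block_score (\<lambda>_. g) n (fst x) (snd x) i (snd rl) + remainder (t (snd rl)) (g (snd rl)) (snd rl) (N n i) (block n i (fst x) (snd x))) * Ch (permZ n (fst x) (snd x)) $ i $ fst rl)"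
      using eventually_N_pos by eventually_elim (blast intro: Vn_decomposition)
    show "vanishing perm_data (\<lambda>n x. remainder (t l) (g l) l (N n i) (block n i (fst x) (snd x)))" for i l
      unfolding vanishing_def
    proof (intro allI impI)
      fix d :: real assume d: "d > 0"
      obtain K c where K: "0 \<le> K" and ev: "\<forall>\<^sub>F n in sequentially. \<forall>G\<in>borel_measurable (PiM {..<N n i} (\<lambda>_. borel)). \<forall>d::real.
        measure (perm_data n) {x \<in> space (perm_data n). G (block n i (fst x) (snd x)) > d} \<le>
          c / real n + K * measure (iid (N n i) (mixture p P)) {x \<in> space (PiM {..<N n i} (\<lambda>_. borel)). G x > d}"
        by (rule permuted_tail)
      have "(\<lambda>m. measure (iid m (mixture p P)) {x \<in> space (PiM {..<m} (\<lambda>_. borel)). \<bar>remainder (t l) (g l) l m x\<bar> > d}) \<longlonglongrightarrow> 0"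
        using g_lin[of l] d by (simp add: conv_in_prob_def iid_def space_PiM space_mixture)
      from filterlim_compose[OF this N_at_top[of i]]
      have "(\<lambda>n. c / real n + K * measure (iid (N n i) (mixture p P)) {x \<in> space (PiM {..<N n i} (\<lambda>_. borel)). \<bar>remainder (t l) (g l) l (N n i) x\<bar> > d}) \<longlonglongrightarrow> 0 + K * 0"
        by (intro tendsto_add tendsto_mult tendsto_const N0)
      then have lim: "(\<lambda>n. c / real n + K * measure (iid (N n i) (mixture p P)) {x \<in> space (PiM {..<N n i} (\<lambda>_. borel)). \<bar>remainder (t l) (g l) l (N n i) x\<bar> > d}) \<longlonglongrightarrow> 0"
        by simp
      show "(\<lambda>n. measure (perm_data n) {x \<in> space (perm_data n). \<bar>remainder (t l) (g l) l (N n i) (block n i (fst x) (snd x))\<bar> > d}) \<longlonglongrightarrow> 0"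
      proof (rule tendsto_sandwich[OF _ _ tendsto_const lim])
        show "\<forall>\<^sub>F n in sequentially. measure (perm_data n) {x \<in> space (perm_data n). \<bar>remainder (t l) (g l) l (N n i) (block n i (fst x) (snd x))\<bar> > d} \<le>
          c / real n + K * measure (iid (N n i) (mixture p P)) {x \<in> space (PiM {..<N n i} (\<lambda>_. borel)). \<bar>remainder (t l) (g l) l (N n i) x\<bar> > d}"
          using ev
        proof eventually_elim
          case (elim n)
          have "(\<lambda>x. \<bar>remainder (t l) (g l) l (N n i) x\<bar>) \<in> borel_measurable (PiM {..<N n i} (\<lambda>_. borel))"
            by (intro borel_measurable_abs remainder_measurable g_meas)
          from elim[rule_format, OF this, of d] show ?case .
        qed
      qed simp
    qed
    show "stoch_bounded perm_data (\<lambda>n x. block_score (\<lambda>_. g) n (fst x) (snd x) i l)" for i l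
      unfolding stoch_bounded_def
    proof (intro allI impI)
      fix d :: real assume d: "d > 0"
      obtain K c where K: "0 \<le> K" and ev: "\<forall>\<^sub>F n in sequentially. \<forall>G\<in>borel_measurable (PiM {..<N n i} (\<lambda>_. borel)). \<forall>d::real.
        measure (perm_data n) {x \<in> space (perm_data n). G (block n i (fst x) (snd x)) > d} \<le>
          c / real n + K * measure (iid (N n i) (mixture p P)) {x \<in> space (PiM {..<N n i} (\<lambda>_. borel)). G x > d}"
        by (rule permuted_tail)
      define v where "v = (\<integral>x. (g l x)\<^sup>2 \<partial>mixture p P)"
      have v0: "K * v \<ge> 0" using K by (simp add: v_def)
      \<comment> \<open>One half of \<open>d\<close> is for the Chebyshev term enlarged by
        \<open>K\<close>, the other for the exceptional term \<open>c / n\<close>.\<close>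
      obtain B where Bpos: "B > 0" and vB: "K * v / B\<^sup>2 < d / 2" by (rule Chebyshev_radius[OF v0, of "d / 2"]) (use d in auto)
      have "\<forall>\<^sub>F n in sequentially. c / real n < d / 2"
        by (rule order_tendstoD[OF N0]) (use d in simp)
      with ev have "\<forall>\<^sub>F n in sequentially. measure (perm_data n) {x \<in> space (perm_data n). \<bar>block_score (\<lambda>_. g) n (fst x) (snd x) i l\<bar> > B} < d"
      proof eventually_elim
        case (elim n)
        have "(\<lambda>x. \<bar>1 / sqrt (real (N n i)) * (\<Sum>j<N n i. g l (x j))\<bar>) \<in> borel_measurable (PiM {..<N n i} (\<lambda>_. borel))"
          by (intro borel_measurable_abs sum_score_measurable g_meas)
        from elim(1)[rule_format, OF this, of B]
        have "measure (perm_data n) {x \<in> space (perm_data n). \<bar>block_score (\<lambda>_. g) n (fst x) (snd x) i l\<bar> > B} \<le>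
          c / real n + K * measure (iid (N n i) (mixture p P)) {x \<in> space (PiM {..<N n i} (\<lambda>_. borel)). \<bar>1 / sqrt (real (N n i)) * (\<Sum>j<N n i. g l (x j))\<bar> > B}"
          unfolding block_score_block .
        also have "\<dots> \<le> c / real n + K * (v / B\<^sup>2)"
          unfolding v_def by (intro add_left_mono mult_left_mono K iid_score_tail[OF prob_space_mixture sets_mixture g_meas g_sq g_mean Bpos])
        also have "K * (v / B\<^sup>2) = K * v / B\<^sup>2" by simp
        finally show ?case using vB elim(2) by linarith
      qed
      then show "\<exists>B>0. \<forall>\<^sub>F n in sequentially. measure (perm_data n) {x \<in> space (perm_data n). \<bar>block_score (\<lambda>_. g) n (fst x) (snd x) i l\<bar> > B} < d"
        using Bpos by (intro exI[of _ B] conjI)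
    qed
  qed (rule e)
qed

text \<open>On \<open>M2\<close>, which carries the data and two independent permutations, joint
  convergence to \<open>Q \<Otimes>\<^sub>M Q\<close> concerns ordinary integrals, so
  \<open>slutsky_levy\<close> applies. The test functions \<open>\<phi> (fst x)\<close> and
  \<open>\<phi> (fst x) * \<phi> (snd x)\<close> then give the first two moments of the random
  integral of \<open>\<phi>\<close> over the permutation distribution.\<close>

lemma permutation_limit:
  fixes C :: "((real, 'm) vec, 'k) vec" and g :: "'d \<Rightarrow> 'a \<Rightarrow> real" and t :: "'d \<Rightarrow> real"
  defines "S \<equiv> kron (transpose C) (mat 1 :: real^'d^'d) ** blockdiag (\<lambda>i. (1 / p i) *\<^sub>R covmat (mixture p P) g)
              ** transpose (kron (transpose C) (mat 1 :: real^'d^'d))"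
  assumes g_meas: "\<And>l. g l \<in> borel_measurable borel"
    and g_sq: "\<And>l. integrable (mixture p P) (\<lambda>x. (g l x)\<^sup>2)"
    and g_mean: "\<And>l. (\<integral>x. g l x \<partial>mixture p P) = 0"
    and g_lin: "\<And>l. conv_in_prob (\<lambda>m. iid m (mixture p P)) (\<lambda>m x. remainder (t l) (g l) l m x) 0"
    and Ch_lim: "conv_in_prob (\<lambda>n. data_law N P n \<Otimes>\<^sub>M measure_pmf (unif_perm n)) (\<lambda>n (z, \<pi>). Ch (permZ n z \<pi>)) C"
    and C: "contrast_matrix C"
  shows "weak_conv_in_prob (data_law N P) (perm_dist th Ch N) (mvnormal S)"
proof -
  define \<sigma> where "\<sigma> l l' = (\<integral>x. g l x * g l' x \<partial>mixture p P)" for l l'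
  have scores: "centred_scores (mixture p P) g"
    by (intro centred_scores.intro centred_scores_axioms.intro prob_space_mixture g_sq g_mean)
      (simp add: measurable_cong_sets[OF sets_mixture refl] g_meas)
  have cov: "covmat (mixture p P) g $ l $ l' = \<sigma> l l'" for l l'
    by (simp add: covmat_def g_mean \<sigma>_def)
  have Sq: "a \<bullet> (S *v a) = limit_form \<sigma> C a" for a
    unfolding S_def kron_quadratic_form by (simp add: cov)
  have Ssym: "transpose S = S"
    unfolding S_def by (rule kron_quadratic_form) (simp add: cov \<sigma>_def mult.commute)
  have Spsd: "0 \<le> a \<bullet> (S *v a)" for a
    unfolding Sq
  proof (rule sum_nonneg)
    fix i
    have "0 \<le> 1 / p i * (\<Sum>l\<in>UNIV. \<Sum>l'\<in>UNIV. contrast_weight C a i l * contrast_weight C a i l' * (\<integral>x. g l x * g l' x \<partial>mixture p P))"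
      using p_pos[of i] by (intro mult_nonneg_nonneg centred_scores.score_quadratic_nonneg[OF scores]) simp
    then show "0 \<le> (\<Sum>l\<in>UNIV. \<Sum>l'\<in>UNIV. contrast_weight C a i l * contrast_weight C a i l' * (1 / p i * \<sigma> l l'))"
      by (simp add: sum_distrib_left sum_divide_distrib \<sigma>_def)
  qed
  define Q where "Q = mvnormal S"
  have Q: "prob_space Q" and sQ: "sets Q = sets borel"
    unfolding Q_def by (rule prob_space_mvnormal[OF Ssym Spsd], rule sets_mvnormal[OF Ssym Spsd])
  interpret Q: prob_space Q by (rule Q)
  interpret QQ: pair_prob_space Q Q ..
  have sQQ: "sets (Q \<Otimes>\<^sub>M Q) = sets borel"
    using sets_pair_measure_cong[OF sQ sQ] by (simp only: borel_prod)
  let ?V = "\<lambda>n z \<pi>. Vn th Ch N n z \<pi>" and ?S = "\<lambda>n z \<pi>. block_stat (\<lambda>_. g) C n z \<pi>"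
  define M2 where "M2 n = data_law N P n \<Otimes>\<^sub>M uniform_count_measure (Perms n \<times> Perms n)" for n
  have PP: "finite (Perms n \<times> Perms n)" "Perms n \<times> Perms n \<noteq> {}" for n using finite_Perms by blast+
  have M2: "prob_space (M2 n)" for n
  proof -
    interpret D: prob_space "data_law N P n" by (rule prob_space_data_law)
    interpret U: prob_space "uniform_count_measure (Perms n \<times> Perms n)" by (rule prob_space_uniform_count[OF PP])
    interpret DU: pair_prob_space "data_law N P n" "uniform_count_measure (Perms n \<times> Perms n)" ..
    show ?thesis unfolding M2_def by (rule DU.prob_space_axioms)
  qed
  have meas2: "(\<lambda>x. (F n (fst x) (fst (snd x)), F n (fst x) (snd (snd x)))) \<in> borel_measurable (M2 n)"
    if "\<And>\<pi>. \<pi> permutes {..<n} \<Longrightarrow> (\<lambda>z. F n z \<pi>) \<in> borel_measurable (data_law N P n)"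
    for F :: "nat \<Rightarrow> (nat \<Rightarrow> 'a) \<Rightarrow> (nat \<Rightarrow> nat) \<Rightarrow> real^('m \<times> 'd)" and n
    unfolding M2_def by (rule uniform_product_measurable[OF PP(1)]) (use that in \<open>auto intro!: borel_measurable_Pair\<close>)
  have close: "(\<lambda>n. measure (M2 n) {x \<in> space (M2 n). norm ((?V n (fst x) (fst (snd x)), ?V n (fst x) (snd (snd x)))
      - (?S n (fst x) (fst (snd x)), ?S n (fst x) (snd (snd x)))) > e}) \<longlonglongrightarrow> 0" if e: "e > 0" for e
  proof -
    have e2: "e / 2 > 0" using e by simp
    have lim: "(\<lambda>n. 2 * measure (perm_data n) {x \<in> space (perm_data n). norm (?V n (fst x) (snd x) - ?S n (fst x) (snd x)) > e / 2}) \<longlonglongrightarrow> 0"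
      using tendsto_mult[OF tendsto_const permuted_linearisation[OF g_meas g_sq g_mean g_lin Ch_lim e2], of 2] by simp
    have "measure (M2 n) {x \<in> space (M2 n). norm ((?V n (fst x) (fst (snd x)), ?V n (fst x) (snd (snd x)))
        - (?S n (fst x) (fst (snd x)), ?S n (fst x) (snd (snd x)))) > e} \<le>
      2 * measure (perm_data n) {x \<in> space (perm_data n). norm (?V n (fst x) (snd x) - ?S n (fst x) (snd x)) > e / 2}" for n
      unfolding M2_def
    proof (rule double_uniform_union_bound[OF prob_space_data_law finite_Perms,
          where R="\<lambda>z \<pi> \<rho>. norm ((?V n z \<pi>, ?V n z \<rho>) - (?S n z \<pi>, ?S n z \<rho>)) > e" and P="\<lambda>z \<pi>. norm (?V n z \<pi> - ?S n z \<pi>) > e / 2"])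
      have [measurable]: "(\<lambda>z. ?V n z \<pi> - ?S n z \<pi>) \<in> borel_measurable (data_law N P n)" if "\<pi> \<in> Perms n" for \<pi>
        using that by (intro borel_measurable_diff Vn_measurable block_stat_measurable g_meas) auto
      show "{z \<in> space (data_law N P n). norm (?V n z \<pi> - ?S n z \<pi>) > e / 2} \<in> sets (data_law N P n)" if [measurable]: "\<pi> \<in> Perms n" for \<pi>
        by measurable
      show "{z \<in> space (data_law N P n). norm ((?V n z \<pi>, ?V n z \<rho>) - (?S n z \<pi>, ?S n z \<rho>)) > e} \<in> sets (data_law N P n)"
        if [measurable]: "\<pi> \<in> Perms n" "\<rho> \<in> Perms n" for \<pi> \<rho>
        unfolding diff_Pair by measurable
      fix z \<pi> \<rho> assume "norm ((?V n z \<pi>, ?V n z \<rho>) - (?S n z \<pi>, ?S n z \<rho>)) > e"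
      then show "norm (?V n z \<pi> - ?S n z \<pi>) > e / 2 \<or> norm (?V n z \<rho> - ?S n z \<rho>) > e / 2"
        using norm_Pair_le[of "?V n z \<pi> - ?S n z \<pi>" "?V n z \<rho> - ?S n z \<rho>"] by (auto simp: diff_Pair)
    qed
    then show ?thesis
      by (intro tendsto_sandwich[OF _ _ tendsto_const lim] always_eventually allI) simp_all
  qed
  have char: "(\<lambda>n. \<integral>x. iexp (ab \<bullet> (?S n (fst x) (fst (snd x)), ?S n (fst x) (snd (snd x)))) \<partial>M2 n) \<longlonglongrightarrow> mchar (Q \<Otimes>\<^sub>M Q) ab" for ab
  proof -
    obtain a b where ab: "ab = (a, b)" by (cases ab)
    have "(\<integral>x. iexp (ab \<bullet> (?S n (fst x) (fst (snd x)), ?S n (fst x) (snd (snd x)))) \<partial>M2 n) =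
      (\<integral>z. perm_char g C a n z * perm_char g C b n z \<partial>data_law N P n)" for n
    proof -
      have "(\<integral>x. iexp (ab \<bullet> (?S n (fst x) (fst (snd x)), ?S n (fst x) (snd (snd x)))) \<partial>M2 n) =
        (\<integral>x. iexp (a \<bullet> ?S n (fst x) (fst (snd x))) * iexp (b \<bullet> ?S n (fst x) (snd (snd x))) \<partial>M2 n)"
        by (simp add: ab inner_prod_def distrib_left exp_add)
      also have "\<dots> = (\<integral>z. ((\<Sum>\<pi>\<in>Perms n. iexp (a \<bullet> ?S n z \<pi>)) / of_nat (card (Perms n))) * ((\<Sum>\<pi>\<in>Perms n. iexp (b \<bullet> ?S n z \<pi>)) / of_nat (card (Perms n))) \<partial>data_law N P n)"
        unfolding M2_def
      proof (rule double_uniform_integral[OF prob_space_data_law finite_Perms, where B=1])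
        have "(\<lambda>z. iexp (c \<bullet> ?S n z \<pi>)) \<in> borel_measurable (data_law N P n)" if "\<pi> \<in> Perms n" for c \<pi>
        proof -
          have [measurable]: "(\<lambda>z. ?S n z \<pi>) \<in> borel_measurable (data_law N P n)"
            using that by (intro block_stat_measurable g_meas) auto
          show ?thesis by measurable
        qed
        then show "(\<lambda>z. iexp (a \<bullet> ?S n z \<pi>)) \<in> borel_measurable (data_law N P n)" "(\<lambda>z. iexp (b \<bullet> ?S n z \<pi>)) \<in> borel_measurable (data_law N P n)"
          if "\<pi> \<in> Perms n" for \<pi> using that by blast+
      qed simp_all
      finally show ?thesis by (simp add: perm_char_def)
    qed
    moreover have "mchar (Q \<Otimes>\<^sub>M Q) ab = complex_of_real (exp (- (limit_form \<sigma> C a + limit_form \<sigma> C b) / 2))"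
      unfolding ab mchar_pair(1)[OF Q sQ] unfolding Q_def mchar_mvnormal[OF Ssym Spsd] Sq of_real_mult[symmetric] exp_add[symmetric]
      by (simp add: add_divide_distrib diff_divide_distrib)
    ultimately show ?thesis
      using permutation_char_limit[OF g_meas g_sq g_mean C, where a=a and b=b] by (simp add: \<sigma>_def)
  qed
  show ?thesis
    unfolding weak_conv_in_prob_def
  proof (intro allI impI)
    fix \<phi> :: "real^('m \<times> 'd) \<Rightarrow> real"
    assume "continuous_on UNIV \<phi> \<and> bounded (range \<phi>)"
    then have \<phi>: "continuous_on UNIV \<phi>" and "bounded (range \<phi>)" by auto
    then obtain B where B: "\<And>x. \<bar>\<phi> x\<bar> \<le> B" by (auto simp: bounded_iff)
    have B0: "B \<ge> 0" using B[of 0] by linarith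
    have \<phi>m [measurable]: "\<phi> \<in> borel_measurable borel" using \<phi> by (rule borel_measurable_continuous_onI)
    define G where "G n z = (\<Sum>\<pi>\<in>Perms n. \<phi> (?V n z \<pi>)) / fact n" for n z
    have joint: "(\<lambda>n. \<integral>x. F (?V n (fst x) (fst (snd x)), ?V n (fst x) (snd (snd x))) \<partial>M2 n) \<longlonglongrightarrow> (\<integral>x. F x \<partial>(Q \<Otimes>\<^sub>M Q))"
      if F: "continuous_on UNIV F" "bounded (range F)" for F :: "(real^('m \<times> 'd)) \<times> (real^('m \<times> 'd)) \<Rightarrow> real"
    proof (rule slutsky_levy[where M=M2 and Q="Q \<Otimes>\<^sub>M Q"
          and Y="\<lambda>n x. (?S n (fst x) (fst (snd x)), ?S n (fst x) (snd (snd x)))"])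
      show "(\<lambda>x. (?V n (fst x) (fst (snd x)), ?V n (fst x) (snd (snd x)))) \<in> borel_measurable (M2 n)" for n
        by (rule meas2) (rule Vn_measurable)
      show "(\<lambda>x. (?S n (fst x) (fst (snd x)), ?S n (fst x) (snd (snd x)))) \<in> borel_measurable (M2 n)" for n
        by (rule meas2) (rule block_stat_measurable[OF _ g_meas])
    qed (fact M2 QQ.prob_space_axioms sQQ F char | rule close, assumption)+
    \<comment> \<open>The bound \<open>B + 1\<close> covers both \<open>\<phi>\<close> and the
      constant function 1, which is inserted to obtain the first moment.\<close>
    have dbl: "(\<integral>x. u (?V n (fst x) (fst (snd x))) * v (?V n (fst x) (snd (snd x))) \<partial>M2 n) =
       (\<integral>z. ((\<Sum>\<pi>\<in>Perms n. u (?V n z \<pi>)) / fact n) * ((\<Sum>\<pi>\<in>Perms n. v (?V n z \<pi>)) / fact n) \<partial>data_law N P n)"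
      if [measurable]: "u \<in> borel_measurable borel" "v \<in> borel_measurable borel" and bd: "\<And>x. \<bar>u x\<bar> \<le> B + 1" "\<And>x. \<bar>v x\<bar> \<le> B + 1" for u v :: "real^('m \<times> 'd) \<Rightarrow> real" and n
      unfolding M2_def
      by (subst double_uniform_integral[OF prob_space_data_law finite_Perms, where B="B + 1" and u="\<lambda>\<pi> z. u (?V n z \<pi>)" and v="\<lambda>\<pi> z. v (?V n z \<pi>)"])
        (use bd in \<open>auto intro: measurable_compose[OF Vn_measurable]\<close>)
    have c1: "continuous_on UNIV (\<lambda>x :: (real^('m \<times> 'd)) \<times> (real^('m \<times> 'd)). \<phi> (fst x))"
      and c2: "continuous_on UNIV (\<lambda>x :: (real^('m \<times> 'd)) \<times> (real^('m \<times> 'd)). \<phi> (snd x))"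
      by (intro continuous_on_compose2[OF \<phi>] continuous_intros subset_UNIV)+
    have B1: "\<bar>\<phi> x\<bar> \<le> B + 1" "\<bar>1 :: real\<bar> \<le> B + 1" for x using B[of x] B0 by simp_all
    have one: "(\<Sum>\<pi>\<in>Perms n. (1 :: real)) / fact n = 1" for n by simp
    have "bounded (range (\<lambda>x :: (real^('m \<times> 'd)) \<times> (real^('m \<times> 'd)). \<phi> (fst x) * 1))"
      unfolding bounded_iff using B by auto
    note joint[OF continuous_on_mult[OF c1 continuous_on_const] this]
    also have "(\<integral>x. \<phi> (fst x) * 1 \<partial>(Q \<Otimes>\<^sub>M Q)) = (\<integral>x. \<phi> x \<partial>Q) * (\<integral>x. 1 \<partial>Q)"
      by (rule mchar_pair(2)[OF Q sQ \<phi>m borel_measurable_const B order_refl])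
    finally have m1: "(\<lambda>n. \<integral>z. G n z \<partial>data_law N P n) \<longlonglongrightarrow> (\<integral>x. \<phi> x \<partial>Q)"
      unfolding fst_conv dbl[OF \<phi>m borel_measurable_const B1] one by (simp add: G_def Q.prob_space)
    have "bounded (range (\<lambda>x. \<phi> (fst x) * \<phi> (snd x)))"
      unfolding bounded_iff by (rule exI[of _ "B * B"]) (use B B0 in \<open>auto simp: abs_mult intro!: mult_mono\<close>)
    note joint[OF continuous_on_mult[OF c1 c2] this]
    also have "(\<integral>x. \<phi> (fst x) * \<phi> (snd x) \<partial>(Q \<Otimes>\<^sub>M Q)) = (\<integral>x. \<phi> x \<partial>Q) * (\<integral>x. \<phi> x \<partial>Q)"
      by (rule mchar_pair(2)[OF Q sQ \<phi>m \<phi>m B B])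
    finally have m2: "(\<lambda>n. \<integral>z. G n z * G n z \<partial>data_law N P n) \<longlonglongrightarrow> (\<integral>x. \<phi> x \<partial>Q) * (\<integral>x. \<phi> x \<partial>Q)"
      unfolding fst_conv snd_conv dbl[OF \<phi>m \<phi>m B1(1) B1(1)] by (simp add: G_def)
    have "conv_in_prob (data_law N P) G (\<integral>x. \<phi> x \<partial>Q)"
    proof (rule moments_imp_conv_in_prob[OF prob_space_data_law _ _ m1 m2])
      show "G n \<in> borel_measurable (data_law N P n)" for n
        unfolding G_def by (intro borel_measurable_divide borel_measurable_sum borel_measurable_const measurable_compose[OF Vn_measurable \<phi>m]) auto
      fix n z
      have "\<bar>\<Sum>\<pi>\<in>Perms n. \<phi> (?V n z \<pi>)\<bar> \<le> (\<Sum>\<pi>\<in>Perms n. B)"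
        by (rule order_trans[OF sum_abs sum_mono[OF B]])
      then show "\<bar>G n z\<bar> \<le> B" by (simp add: G_def divide_le_eq mult.commute)
    qed
    moreover have "(\<integral>x. \<phi> x \<partial>perm_dist th Ch N n z) = G n z" for n z
      unfolding perm_dist_def unif_perm_def integral_map_pmf integral_pmf_of_set[OF finite_Perms(2,1)] by (simp add: G_def)
    ultimately show "conv_in_prob (data_law N P) (\<lambda>n z. \<integral>x. \<phi> x \<partial>perm_dist th Ch N n z) (\<integral>x. \<phi> x \<partial>mvnormal S)"
      by (simp add: Q_def)
  qed
qed

end

theorem theorem1:
  fixes P :: "'k::{finite,linorder} \<Rightarrow> (real^'p) measure"
    and N :: "nat \<Rightarrow> 'k \<Rightarrow> nat"
    and p :: "'k \<Rightarrow> real"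
    and th :: "'d::finite \<Rightarrow> (real^'p) list \<Rightarrow> real"
    and theta :: "'d \<Rightarrow> (real^'p) measure \<Rightarrow> real"
    and f :: "'k \<Rightarrow> 'd \<Rightarrow> real^'p \<Rightarrow> real"
    and fbar :: "'d \<Rightarrow> real^'p \<Rightarrow> real"
    and Ch :: "(real^'p) list \<Rightarrow> ((real, 'm::finite) vec, 'k) vec"
    and C Cbar :: "((real, 'm) vec, 'k) vec"
  assumes k2: "CARD('k) \<ge> 2"
    and P_prob: "\<And>i. prob_space (P i)"
    and P_sets: "\<And>i. sets (P i) = sets borel"
    \<comment> \<open>Condition (C1)\<close>
    and N_sum: "\<And>n. (\<Sum>i\<in>UNIV. N n i) = n"
    and N_lim: "\<And>i. (\<lambda>n. real (N n i) / real n) \<longlonglongrightarrow> p i"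
    and p_pos: "\<And>i. 0 < p i" and p_lt1: "\<And>i. p i < 1"
    and N_rate: "\<And>i. (\<lambda>n. real (N n i) / real n - p i) \<in> O(\<lambda>n. 1 / sqrt (real n))"
    \<comment> \<open>Condition (C2) for each P_i\<close>
    and f_meas: "\<And>i l. f i l \<in> borel_measurable borel"
    and f_sq: "\<And>i l. integrable (P i) (\<lambda>x. (f i l x)^2)"
    and f_mean: "\<And>i l. (\<integral>x. f i l x \<partial>P i) = 0"
    and f_lin: "\<And>i l. conv_in_prob (\<lambda>m. iid m (P i))
        (\<lambda>m x. sqrt (real m) * (th l (map x [0..<m]) - theta l (P i))
               - (1 / sqrt (real m)) * (\<Sum>j<m. f i l (x j))) 0"
    \<comment> \<open>Condition (C2) for the mixture Pbar\<close>
    and fbar_meas: "\<And>l. fbar l \<in> borel_measurable borel"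
    and fbar_sq: "\<And>l. integrable (mixture p P) (\<lambda>x. (fbar l x)^2)"
    and fbar_mean: "\<And>l. (\<integral>x. fbar l x \<partial>mixture p P) = 0"
    and fbar_lin: "\<And>l. conv_in_prob (\<lambda>m. iid m (mixture p P))
        (\<lambda>m x. sqrt (real m) * (th l (map x [0..<m]) - theta l (mixture p P))
               - (1 / sqrt (real m)) * (\<Sum>j<m. fbar l (x j))) 0"
    \<comment> \<open>measurability of the statistics\<close>
    and th_meas: "\<And>m l. (\<lambda>x. th l (map x [0..<m])) \<in> borel_measurable (PiM {..<m} (\<lambda>_. borel))"
    and Ch_meas: "\<And>m. (\<lambda>x. Ch (map x [0..<m])) \<in> borel_measurable (PiM {..<m} (\<lambda>_. borel))"
    \<comment> \<open>the contrast matrices\<close>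
    and Ch_contrast: "\<And>zs. contrast_matrix (Ch zs)"
    and C_contrast: "contrast_matrix C"
    and Cbar_contrast: "contrast_matrix Cbar"
    and Ch_lim: "conv_in_prob (data_law N P) (\<lambda>n z. Ch (map z [0..<n])) C"
    and ChPi_lim: "conv_in_prob (\<lambda>n. data_law N P n \<Otimes>\<^sub>M measure_pmf (unif_perm n))
        (\<lambda>n (z, \<pi>). Ch (permZ n z \<pi>)) Cbar"
    \<comment> \<open>the null hypothesis\<close>
    and H0: "\<And>l i i'. theta l (P i) = theta l (P i')"
  shows "weak_conv (\<lambda>n. distr (data_law N P n) borel (\<lambda>z. Vn th Ch N n z id))
           (mvnormal (kron (transpose C) (mat 1 :: real^'d^'d)
                      ** blockdiag (\<lambda>i. (1 / p i) *\<^sub>R covmat (P i) (f i))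
                      ** transpose (kron (transpose C) (mat 1 :: real^'d^'d))))
       \<and> weak_conv_in_prob (data_law N P) (perm_dist th Ch N)
           (mvnormal (kron (transpose Cbar) (mat 1 :: real^'d^'d)
                      ** blockdiag (\<lambda>i. (1 / p i) *\<^sub>R covmat (mixture p P) fbar)
                      ** transpose (kron (transpose Cbar) (mat 1 :: real^'d^'d))))"
proof -
  \<comment> \<open>That the limits \<open>p i\<close> add up to 1 is derived: the fractions
    \<open>N n i / n\<close> do so for every \<open>n > 0\<close>.\<close>
  have "(\<lambda>n. \<Sum>i\<in>UNIV. real (N n i) / real n) \<longlonglongrightarrow> (\<Sum>i\<in>UNIV. p i)"
    by (intro tendsto_sum N_lim)
  moreover have "(\<lambda>n. \<Sum>i\<in>UNIV. real (N n i) / real n) \<longlonglongrightarrow> 1"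
  proof (rule Lim_transform_eventually[OF tendsto_const])
    show "\<forall>\<^sub>F n in sequentially. 1 = (\<Sum>i\<in>UNIV. real (N n i) / real n)"
      using eventually_gt_at_top[of 0]
      by eventually_elim (simp add: sum_divide_distrib[symmetric] of_nat_sum[symmetric] N_sum del: of_nat_sum)
  qed
  ultimately have p_sum: "(\<Sum>i\<in>UNIV. p i) = 1" by (rule LIMSEQ_unique)
  interpret estimator p P N th Ch
    by (intro estimator.intro estimator_axioms.intro k_samples.intro k_samples_axioms.intro mixture_model.intro
        mixture_model_axioms.intro prob_vector.intro) (rule p_pos p_sum P_prob P_sets N_sum N_lim p_lt1 N_rate th_meas Ch_meas Ch_contrast)+
  \<comment> \<open>A reference sample; under the null its values of \<open>theta\<close> serve as
    the centring for all samples.\<close>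
  obtain i0 :: 'k where True by blast
  have null: "theta l (P i) = theta l (P i0)" for l i by (rule H0)
  show ?thesis
  proof
    show "weak_conv (\<lambda>n. distr (data_law N P n) borel (\<lambda>z. Vn th Ch N n z id))
           (mvnormal (kron (transpose C) (mat 1 :: real^'d^'d)
                      ** blockdiag (\<lambda>i. (1 / p i) *\<^sub>R covmat (P i) (f i))
                      ** transpose (kron (transpose C) (mat 1 :: real^'d^'d))))"
    proof (rule sample_limit[OF f_meas f_sq f_mean _ Ch_lim])
      show "conv_in_prob (\<lambda>m. iid m (P i)) (\<lambda>m x. remainder (theta l (P i0)) (f i l) l m x) 0" for i l
        using f_lin[where i=i and l=l] unfolding remainder_def null[of l i] .
    qed
    show "weak_conv_in_prob (data_law N P) (perm_dist th Ch N)
           (mvnormal (kron (transpose Cbar) (mat 1 :: real^'d^'d)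
                      ** blockdiag (\<lambda>i. (1 / p i) *\<^sub>R covmat (mixture p P) fbar)
                      ** transpose (kron (transpose Cbar) (mat 1 :: real^'d^'d))))"
    proof (rule permutation_limit[OF fbar_meas fbar_sq fbar_mean _ ChPi_lim Cbar_contrast])
      \<comment> \<open>Here the centring is the value of \<open>theta\<close> at the mixture, which
        may differ from the common value of the samples; it cancels all the same.\<close>
      show "conv_in_prob (\<lambda>m. iid m (mixture p P)) (\<lambda>m x. remainder (theta l (mixture p P)) (fbar l) l m x) 0" for l
        using fbar_lin[where l=l] unfolding remainder_def .
    qed
  qed
qed

end
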